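(* Let $\alpha<\beta$ be arbitrary real numbers. The equations $$\beta-\alpha=\frac{4\sigma^4x^3}{2-x},\qquad (x,\sigma)\in\mathcal E:\ 4\sigma^6x^4-2x+3=0\ \text{(elliptic curve)}$$ have a unique solution $(x,\sigma)=(x,\sigma_+)\in(\tfrac32,2)\times(-\tfrac12,0)$ (opening cusp) and a unique solution $(x,\sigma)=(x,\sigma_-)\in(\tfrac32,2)\times(0,\tfrac12)$ (closing cusp), with $\sigma_+=-\sigma_-$. Put $$T_\pm:=\frac{\alpha+\beta}2-\frac{2\sigma_\pm}{2-x},\qquad X:=\sigma_\pm^2(1-2x),\qquad \kappa:=\Big(\frac{2(x-1)}{|\sigma_\pm|x^2}\Big)^{1/4};$$ then $T_-<\frac{\alpha+\beta}2<T_+$. Let the starting and target parameters of the $m$ wanderers in the Airy process with $m$ wanderers $\mathcal{A}_m^{(\tilde a,\tilde b)}(\tau)$ grow with $m$ as $\tilde a=\alpha m^{1/3}$ and $\tilde b=\beta m^{1/3}$. Then $\mathcal{A}_m^{(\tilde a,\tilde b)}(\tau)$, properly rescaled as $m\to\infty$, converges to two (identical) Pearcey processes $\mathcal P(\theta)$ about two cusps, one opening cusp (at $T_+$, corresponding to $\sigma_+<0$) and one closing cusp (at $T_-$, corresponding to $\sigma_->0$), located at $$\tau\sim T_\pm m^{1/3},\qquad \xi\sim Xm^{2/3}.$$ To be precise, for any $\ell=1,2,\dots$, distinct reals $\theta_1,\dots,\theta_\ell$ and compact sets $E_1,\dots,E_\ell\subset\mathbb{R}$, use one of the two scalings (upper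 sign for the opening cusp, lower sign for the closing cusp) $$\tau_i=T_\pm m^{1/3}+\tfrac12\kappa^2\theta_im^{-1/6},\qquad \widetilde E_i=Xm^{2/3}-\kappa^2\sigma_\pm\theta_im^{1/6}-\kappa E_im^{-1/12}.$$ Then, for each of the two scalings, the limit of the gap probability of the sets $\widetilde E_1,\dots,\widetilde E_\ell$ at times $\tau_1,\dots,\tau_\ell$ is given by the same (matrix) Fredholm determinant: $$\lim_{m\to\infty}\mathbb{P}\Big(\bigcap_{k=1}^\ell\big\{\mathcal{A}_m^{(\alpha m^{1/3},\beta m^{1/3})}(\tau_k)\cap\widetilde E_k=\varnothing\big\}\Big)=\det\big(\mathbf 1-\chi_EK^{\mathcal P}\chi_E\big)_{L^2(\{\theta_1,\dots,\theta_\ell\}\times\mathbb{R})}=:\mathbb{P}\Big(\bigcap_{k=1}^\ell\{\mathcal P(\theta_k)\cap E_k=\varnothing\}\Big),$$ where $\chi_E(\theta_k,v)=\mathbf 1(v\in E_k)$ and $K^{\mathcal P}=K^{\mathcal P}(\theta_1,v_1;\theta_2,v_2)$ is the extended Pearcey kernel.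
   Context: Airy process with $m$ wanderers, for $\tilde a_1=\cdots=\tilde a_m=\tilde a<\tilde b=\tilde b_1=\cdots=\tilde b_m$: for distinct $\tau_1,\dots,\tau_\ell$ and compact $\widetilde E_1,\dots,\widetilde E_\ell\subset\mathbb R$, $$\mathbb{P}\Big(\bigcap_{k}\{\mathcal{A}_m^{(\tilde a,\tilde b)}(\tau_k)\cap\widetilde E_k=\varnothing\}\Big):=\det(\mathbf 1-\chi_{\widetilde E}K_m^{\tilde a,\tilde b}\chi_{\widetilde E})_{L^2(\{\tau_1,\dots,\tau_\ell\}\times\mathbb{R})},\quad \chi_{\widetilde E}(\tau_k,\xi)=\mathbf 1(\xi\in\widetilde E_k),$$ $$\begin{aligned}K_m^{\tilde a,\tilde b}(\tau_1,\xi_1;\tau_2,\xi_2)=&-\frac{\mathbf 1(\tau_2>\tau_1)}{\sqrt{4\pi(\tau_2-\tau_1)}}\,e^{-\frac{(\xi_2-\xi_1)^2}{4(\tau_2-\tau_1)}-\frac12(\tau_2-\tau_1)(\xi_2+\xi_1)+\frac1{12}(\tau_2-\tau_1)^3}\\&+\frac1{(2\pi i)^2}\int_{\Gamma_{\tilde a-\tau_2>}}d\omega\int_{\Gamma_{<\tilde b-\tau_1}}d\widetilde\omega\,\frac{e^{-\omega^3/3+\xi_2\omega}}{e^{-\widetilde\omega^3/3+\xi_1\widetilde\omega}}\,\frac{1}{(\omega+\tau_2)-(\widetilde\omega+\tau_1)}\left(\frac{\widetilde\omega-\tilde a+\tau_1}{\omega-\tilde a+\tau_2}\right)^m\left(\frac{\omega-\tilde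 b+\tau_2}{\widetilde\omega-\tilde b+\tau_1}\right)^m,\end{aligned}$$ where $\Gamma_{\tilde a-\tau_2>}$ goes from $e^{-2\pi i/3}\infty$ to $e^{2\pi i/3}\infty$ passing to the right of $\tilde a-\tau_2$, $\Gamma_{<\tilde b-\tau_1}$ goes from $e^{\pi i/3}\infty$ to $e^{-\pi i/3}\infty$ passing to the left of $\tilde b-\tau_1$, and the shifted contours $\Gamma_{\tilde a-\tau_2>}+\tau_2$, $\Gamma_{<\tilde b-\tau_1}+\tau_1$ do not intersect. (This process is the large-$n$ limit, near the edge, of $n$ nonintersecting Brownian bridges from $0$ to $0$ together with $m$ wanderers.) Extended Pearcey kernel: $$K^{\mathcal P}(\theta_1,v_1;\theta_2,v_2)=-\frac{\mathbf 1(\theta_2>\theta_1)}{\sqrt{2\pi(\theta_2-\theta_1)}}e^{-(v_2-v_1)^2/2(\theta_2-\theta_1)}+\frac1{(2\pi i)^2}\int_{-i\infty}^{i\infty}dz\int_{\Gamma_\times}d\tilde z\,\frac1{z-\tilde z}\,\frac{e^{-z^4/4+\theta_2z^2/2-v_2z}}{e^{-\tilde z^4/4+\theta_1\tilde z^2/2-v_1\tilde z}},$$ where $\Gamma_\times$ consists of the rays from $\pm e^{i\pi/4}\infty$ to $0$ and the rays from $0$ to $\pm e^{-i\pi/4}\infty$. The Pearcey process $\mathcal P$ is the process whose gap probabilities are the Fredholm determinants of $K^{\mathcal P}$ as displayed in the claim. The set $c-\lambda E$ is $\{c-\lambda v:v\in E\}$.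
   Formalization: At the closing cusp the scaling is used with each θ_i replaced by −θ_i: time reversal turns the closing cusp into an opening one, so the literal scaling has as its limit the Pearcey gap probability at times −θ_i, which differs in general from that at θ_i. *)

theory Defs
  imports "HOL-Analysis.Analysis" "Jordan_Normal_Form.Determinant"
begin

section \<open>Fredholm determinants and gap probabilities\<close>

text \<open>The determinant of \<open>1 - K\<close> on \<open>L\<^sup>2(M)\<close>, for an integral kernel \<open>K\<close>, as the Fredholm series
  \<open>\<Sum>n. (-1)\<^sup>n / n! * \<integral> det (K(x\<^sub>i, x\<^sub>j))\<^sub>i\<^sub>,\<^sub>j\<^sub><\<^sub>n dM\<^sup>n\<close>; the term for \<open>n = 0\<close> is \<open>1\<close>.\<close>

definition fredholm_det :: "'a measure \<Rightarrow> ('a \<Rightarrow> 'a \<Rightarrow> complex) \<Rightarrow> complex" where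
  "fredholm_det M K =
     (\<Sum>n. (- 1) ^ n / fact n *
        (\<integral>x. Determinant.det (Matrix.mat n n (\<lambda>(i, j). K (x i) (x j))) \<partial>(Pi\<^sub>M {..<n} (\<lambda>_. M))))"

text \<open>\<open>det (1 - \<chi>\<^sub>E K \<chi>\<^sub>E)\<close> on \<open>L\<^sup>2({\<tau>\<^sub>1, \<dots>, \<tau>\<^sub>l} \<times> \<real>)\<close>, where \<open>\<chi>\<^sub>E(\<tau>\<^sub>k, \<xi>) = 1(\<xi> \<in> E\<^sub>k)\<close>. The encoding of
  \<open>\<chi>\<^sub>E\<close> is meant for pairwise distinct \<open>\<tau>\<^sub>1, \<dots>, \<tau>\<^sub>l\<close>.\<close>

definition gap_det ::
  "(real \<times> real \<Rightarrow> real \<times> real \<Rightarrow> complex) \<Rightarrow> nat \<Rightarrow> (nat \<Rightarrow> real) \<Rightarrow> (nat \<Rightarrow> real set) \<Rightarrow> complex" where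
  "gap_det K l \<tau> E =
     (let X = indicator {(\<tau> k, \<xi>) | k \<xi>. k \<in> {1..l} \<and> \<xi> \<in> E k}
      in fredholm_det (count_space (\<tau> ` {1..l}) \<Otimes>\<^sub>M lborel) (\<lambda>p q. X p * K p q * X q))"

section \<open>Contours\<close>

text \<open>The integral of \<open>f\<close> along the ray from \<open>c\<close> to \<open>c + d\<infinity>\<close>.\<close>

definition ray_integral :: "complex \<Rightarrow> complex \<Rightarrow> (complex \<Rightarrow> complex) \<Rightarrow> complex" where
  "ray_integral c d f = (LBINT t:{0..}. f (c + of_real t * d) * d)"

text \<open>The integral along the two rays from \<open>d\<^sub>1\<infinity>\<close> to the vertex \<open>c\<close> and on to \<open>d\<^sub>2\<infinity>\<close>.\<close>

definition wedge_integral ::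
  "complex \<Rightarrow> complex \<Rightarrow> complex \<Rightarrow> (complex \<Rightarrow> complex) \<Rightarrow> complex" where
  "wedge_integral d1 c d2 f = ray_integral c d2 f - ray_integral c d1 f"

section \<open>The Airy process with wanderers\<close>

text \<open>The extended kernel of the Airy process with \<open>m\<close> wanderers, for \<open>a < b\<close>. The contours are the
  wedges whose shifts \<open>\<Gamma>\<^sub>w + \<tau>\<^sub>2\<close> and \<open>\<Gamma>\<^sub>w\<^sub>' + \<tau>\<^sub>1\<close> have the vertices \<open>p < q\<close> trisecting \<open>(a, b)\<close>: the first
  shifted wedge opens to the left of \<open>p > a\<close>, the second to the right of \<open>q < b\<close>, so they are disjoint.
  By Cauchy's theorem any other admissible pair of contours gives the same value.\<close>

definition airy_wanderers_kernel ::
  "nat \<Rightarrow> real \<Rightarrow> real \<Rightarrow> real \<times> real \<Rightarrow> real \<times> real \<Rightarrow> complex" where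
  "airy_wanderers_kernel m a b = (\<lambda>(\<tau>1, \<xi>1) (\<tau>2, \<xi>2).
     - (if \<tau>2 > \<tau>1
        then of_real (exp (- (\<xi>2 - \<xi>1)\<^sup>2 / (4 * (\<tau>2 - \<tau>1)) - (\<tau>2 - \<tau>1) * (\<xi>2 + \<xi>1) / 2
                + (\<tau>2 - \<tau>1) ^ 3 / 12) / sqrt (4 * pi * (\<tau>2 - \<tau>1)))
        else 0)
     + 1 / (2 * of_real pi * \<i>)\<^sup>2 *
       wedge_integral (cis (- 2 * pi / 3)) (of_real ((2 * a + b) / 3 - \<tau>2)) (cis (2 * pi / 3)) (\<lambda>w.
         wedge_integral (cis (pi / 3)) (of_real ((a + 2 * b) / 3 - \<tau>1)) (cis (- pi / 3)) (\<lambda>w'.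
           exp (- (w ^ 3) / 3 + of_real \<xi>2 * w) / exp (- (w' ^ 3) / 3 + of_real \<xi>1 * w')
           * (1 / ((w + of_real \<tau>2) - (w' + of_real \<tau>1)))
           * ((w' - of_real a + of_real \<tau>1) / (w - of_real a + of_real \<tau>2)) ^ m
           * ((w - of_real b + of_real \<tau>2) / (w' - of_real b + of_real \<tau>1)) ^ m)))"

text \<open>The probability that \<open>A\<^sub>m\<^sup>(\<^sup>a\<^sup>,\<^sup>b\<^sup>)(\<tau>\<^sub>k)\<close> avoids \<open>E\<^sub>k\<close> for all \<open>k \<in> {1..l}\<close>.\<close>

definition airy_wanderers_gap ::
  "nat \<Rightarrow> real \<Rightarrow> real \<Rightarrow> nat \<Rightarrow> (nat \<Rightarrow> real) \<Rightarrow> (nat \<Rightarrow> real set) \<Rightarrow> complex" where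
  "airy_wanderers_gap m a b = gap_det (airy_wanderers_kernel m a b)"

section \<open>The Pearcey process\<close>

text \<open>The contour \<open>\<Gamma>\<^sub>\<times>\<close> is the union of two wedges with vertex \<open>0\<close>, the right one traversed downwards
  and the left one upwards. The inner integral diverges for the single value \<open>z = 0\<close>, a null set for
  the outer one.\<close>

definition pearcey_kernel :: "real \<times> real \<Rightarrow> real \<times> real \<Rightarrow> complex" where
  "pearcey_kernel = (\<lambda>(\<theta>1, v1) (\<theta>2, v2).
     - (if \<theta>2 > \<theta>1
        then of_real (exp (- (v2 - v1)\<^sup>2 / (2 * (\<theta>2 - \<theta>1))) / sqrt (2 * pi * (\<theta>2 - \<theta>1)))
        else 0)
     + 1 / (2 * of_real pi * \<i>)\<^sup>2 *
       wedge_integral (- \<i>) 0 \<i> (\<lambda>z.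
         let f = (\<lambda>z'. 1 / (z - z')
                   * (exp (- (z ^ 4) / 4 + of_real \<theta>2 * z\<^sup>2 / 2 - of_real v2 * z)
                      / exp (- (z' ^ 4) / 4 + of_real \<theta>1 * z'\<^sup>2 / 2 - of_real v1 * z')))
         in wedge_integral (cis (pi / 4)) 0 (cis (- pi / 4)) f
            + wedge_integral (- cis (pi / 4)) 0 (- cis (- pi / 4)) f))"

text \<open>The probability that \<open>P(\<theta>\<^sub>k)\<close> avoids \<open>E\<^sub>k\<close> for all \<open>k \<in> {1..l}\<close>.\<close>

definition pearcey_gap :: "nat \<Rightarrow> (nat \<Rightarrow> real) \<Rightarrow> (nat \<Rightarrow> real set) \<Rightarrow> complex" where
  "pearcey_gap = gap_det pearcey_kernel"

section \<open>Location of the cusps and scaling\<close>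

definition elliptic_curve :: "(real \<times> real) set" where
  "elliptic_curve = {(x, \<sigma>). 4 * \<sigma> ^ 6 * x ^ 4 - 2 * x + 3 = 0}"

definition cusp_solution :: "real \<Rightarrow> real \<Rightarrow> real \<Rightarrow> real \<Rightarrow> bool" where
  "cusp_solution \<alpha> \<beta> x \<sigma> \<longleftrightarrow> \<beta> - \<alpha> = 4 * \<sigma> ^ 4 * x ^ 3 / (2 - x) \<and> (x, \<sigma>) \<in> elliptic_curve"

definition opening_cusp :: "real \<Rightarrow> real \<Rightarrow> real \<times> real \<Rightarrow> bool" where
  "opening_cusp \<alpha> \<beta> = (\<lambda>(x, \<sigma>). x \<in> {3 / 2<..<2} \<and> \<sigma> \<in> {- 1 / 2<..<0} \<and> cusp_solution \<alpha> \<beta> x \<sigma>)"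

definition closing_cusp :: "real \<Rightarrow> real \<Rightarrow> real \<times> real \<Rightarrow> bool" where
  "closing_cusp \<alpha> \<beta> = (\<lambda>(x, \<sigma>). x \<in> {3 / 2<..<2} \<and> \<sigma> \<in> {0<..<1 / 2} \<and> cusp_solution \<alpha> \<beta> x \<sigma>)"

definition cusp_T :: "real \<Rightarrow> real \<Rightarrow> real \<Rightarrow> real \<Rightarrow> real" where
  "cusp_T \<alpha> \<beta> x \<sigma> = (\<alpha> + \<beta>) / 2 - 2 * \<sigma> / (2 - x)"

definition cusp_X :: "real \<Rightarrow> real \<Rightarrow> real" where
  "cusp_X x \<sigma> = \<sigma>\<^sup>2 * (1 - 2 * x)"

definition cusp_\<kappa> :: "real \<Rightarrow> real \<Rightarrow> real" where
  "cusp_\<kappa> x \<sigma> = (2 * (x - 1) / (\<bar>\<sigma>\<bar> * x\<^sup>2)) powr (1 / 4)"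

definition cusp_time :: "real \<Rightarrow> real \<Rightarrow> real \<Rightarrow> real \<Rightarrow> nat \<Rightarrow> real \<Rightarrow> real" where
  "cusp_time \<alpha> \<beta> x \<sigma> m \<theta> =
     cusp_T \<alpha> \<beta> x \<sigma> * real m powr (1 / 3) + 1 / 2 * (cusp_\<kappa> x \<sigma>)\<^sup>2 * \<theta> * real m powr (- 1 / 6)"

definition cusp_set :: "real \<Rightarrow> real \<Rightarrow> nat \<Rightarrow> real \<Rightarrow> real set \<Rightarrow> real set" where
  "cusp_set x \<sigma> m \<theta> E =
     (\<lambda>v. cusp_X x \<sigma> * real m powr (2 / 3) - (cusp_\<kappa> x \<sigma>)\<^sup>2 * \<sigma> * \<theta> * real m powr (1 / 6)
           - cusp_\<kappa> x \<sigma> * real m powr (- 1 / 12) * v) ` E"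

text \<open>The gap probability of the rescaled process at the cusp \<open>(x, \<sigma>)\<close>. The Pearcey process opens its
  gap as time increases, so its time runs forwards through an opening cusp and backwards through a
  closing one: the limit of this gap probability is the Pearcey one with times \<open>\<theta>\<^sub>k\<close> at the opening
  cusp and with times \<open>-\<theta>\<^sub>k\<close> at the closing cusp. Indeed, substituting \<open>(w, w') \<mapsto> (-w', -w)\<close> in the
  double integral shows that the kernels with parameters \<open>(a, b)\<close> and \<open>(-b, -a)\<close> are related by
  transposition and \<open>\<tau> \<mapsto> -\<tau>\<close>. This exchanges \<open>T\<^sub>+\<close> with \<open>-T\<^sub>-\<close>, \<open>\<sigma>\<^sub>+\<close> with \<open>\<sigma>\<^sub>- = -\<sigma>\<^sub>+\<close>, and hence the
  scaling with \<open>\<theta>\<close> at one cusp with the scaling with \<open>-\<theta>\<close> at the other.\<close>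

definition cusp_gap ::
  "real \<Rightarrow> real \<Rightarrow> real \<Rightarrow> real \<Rightarrow> nat \<Rightarrow> (nat \<Rightarrow> real) \<Rightarrow> (nat \<Rightarrow> real set) \<Rightarrow> nat \<Rightarrow> complex" where
  "cusp_gap \<alpha> \<beta> x \<sigma> l \<theta> E m =
     airy_wanderers_gap m (\<alpha> * real m powr (1 / 3)) (\<beta> * real m powr (1 / 3)) l
       (\<lambda>k. cusp_time \<alpha> \<beta> x \<sigma> m (\<theta> k)) (\<lambda>k. cusp_set x \<sigma> m (\<theta> k) (E k))"

end

theory Submission
  imports Defs "Jordan_Normal_Form.Schur_Decomposition" "HOL-Complex_Analysis.Complex_Analysis"
begin

text \<open>
  With \<open>n = m powr (1/12)\<close> and \<open>w + \<tau> = u n\<^sup>4 + n z / \<kappa>\<close>, where \<open>u > \<beta>\<close> is the point at which three derivatives of the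
  phase function vanish, the integrand of the Airy kernel with \<open>m\<close> wanderers becomes \<open>exp (m g(\<mu> z))\<close>, with \<open>\<mu> = 1 / (\<kappa> n\<^sup>3)\<close>
  and \<open>g(s) = ln (1 + p s) - ln (1 + q s) - (p - q) s + (p\<^sup>2 - q\<^sup>2) s\<^sup>2 / 2 - s\<^sup>3 / 3\<close>, times the Pearcey factors in
  \<open>\<theta>\<close> and \<open>v\<close>. Here \<open>p = 1 / (u - \<beta>)\<close> and \<open>q = 1 / (u - \<alpha>)\<close>, and the elliptic curve together with the equation for
  \<open>\<beta> - \<alpha>\<close> expresses \<open>p\<^sup>3 - q\<^sup>3 = 1\<close>, so that \<open>g(s) = - (p\<^sup>4 - q\<^sup>4) s\<^sup>4 / 4 + O(s\<^sup>5)\<close>. Writing \<open>g\<close> as an integral over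
  \<open>[q, p]\<close> gives, uniformly in \<open>m\<close>, exponential decay along rays from the critical point, namely the imaginary axis for
  one variable and four rays for the other, and Cauchy's theorem moves the contours onto these rays.
  Dominated convergence then yields pointwise convergence of the conjugated kernels, Hadamard's bound makes the Fredholm
  series converge uniformly, and the determinants converge. The closing cusp reduces to the opening one through
  \<open>(w, w') \<mapsto> (- w', - w)\<close>, which transposes the kernel, reverses time, and replaces \<open>(\<alpha>, \<beta>)\<close> by \<open>(- \<beta>, - \<alpha>)\<close>.
\<close>

section \<open>A bound for determinants\<close>

text \<open>The limiting contours of the two variables meet at the critical point, where
  \<open>1 / (z - z')\<close> is singular, so Cauchy's theorem cannot be applied to both integrals
  at once. The power is therefore telescoped: with \<rho> the product of the two Moebius factors,
  \<rho> - 1 is divisible by z - z', so \<rho>^m / (z - z') is a finite sum of products of a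
  function of z and a function of z', plus \<open>1 / (z - z')\<close>. The products are deformed
  one variable at a time. In the remainder the poles of the wanderers are gone, the left half of the
  inner contour contributes nothing, and the singularity at the crossing is dominated by a multiple
  of (t t')^(-1/2), which is integrable. The left rays have directions -2 +- i, although those of
  the Pearcey contour are -1 +- i: on the latter the integrand of the representation of Re g over
  [q, p] changes sign far out. For the limiting integrand the rays are rotated back. The outer
  contour also needs a positive quadratic coefficient, that is, a critical point to the left of 0 in
  the variable w. At the opening cusp this follows from \<sigma> < 0; the closing cusp is reached by
  reflection.\<close>

lemma sum_list_diag_mat_eq:
  "sum_list (diag_mat M) = (\<Sum>i<dim_row M. M $$ (i, i))"
  by (simp add: diag_mat_def sum_list_distinct_conv_sum_set atLeast0LessThan)

lemma sum_diag_mult_commute: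
  fixes M N :: "complex mat"
  assumes "M \<in> carrier_mat n n" "N \<in> carrier_mat n n"
  shows "(\<Sum>i<n. (M * N) $$ (i, i)) = (\<Sum>i<n. (N * M) $$ (i, i))"
proof -
  have "(\<Sum>i<n. (M * N) $$ (i, i)) = (\<Sum>i<n. \<Sum>j<n. M $$ (i, j) * N $$ (j, i))"
    using assms by (auto simp: scalar_prod_def atLeast0LessThan intro!: sum.cong)
  also have "\<dots> = (\<Sum>j<n. \<Sum>i<n. N $$ (j, i) * M $$ (i, j))"
    by (subst sum.swap) (simp add: mult.commute)
  also have "\<dots> = (\<Sum>i<n. (N * M) $$ (i, i))"
    using assms by (auto simp: scalar_prod_def atLeast0LessThan intro!: sum.cong)
  finally show ?thesis .
qed

text \<open>Pairing A A^H v = e v with v gives e |v|^2 = |A^H v|^2, where A^H is the conjugate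
  transpose; \<open>u\<close> stands for A^H v.\<close>

lemma adjoint_eigenvalue_nonneg:
  fixes A :: "complex mat"
  assumes A: "A \<in> carrier_mat n n"
    and ev: "eigenvalue (A * transpose_mat (map_mat cnj A)) e"
  shows "Im e = 0 \<and> 0 \<le> Re e"
proof -
  define H where "H = A * transpose_mat (map_mat cnj A)"
  obtain v where v: "v \<in> carrier_vec n" "v \<noteq> 0\<^sub>v n" "H *\<^sub>v v = e \<cdot>\<^sub>v v"
    using ev A unfolding eigenvalue_def eigenvector_def H_def by auto
  define u where "u = (\<lambda>k. \<Sum>j<n. cnj (A $$ (j, k)) * vec_index v j)"
  have Hij: "H $$ (i, j) = (\<Sum>k<n. A $$ (i, k) * cnj (A $$ (j, k)))" if "i < n" "j < n" for i j
    using A that by (simp add: H_def scalar_prod_def atLeast0LessThan)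
  have H: "H \<in> carrier_mat n n" using A by (simp add: H_def)
  have Hv: "(\<Sum>k<n. A $$ (i, k) * u k) = e * vec_index v i" if "i < n" for i
  proof -
    have "e * vec_index v i = vec_index (H *\<^sub>v v) i"
      using v that by simp
    also have "\<dots> = (\<Sum>j<n. (\<Sum>k<n. A $$ (i, k) * cnj (A $$ (j, k))) * vec_index v j)"
      using H v(1) that by (auto simp: Hij[symmetric] scalar_prod_def atLeast0LessThan intro!: sum.cong)
    also have "\<dots> = (\<Sum>j<n. \<Sum>k<n. A $$ (i, k) * (cnj (A $$ (j, k)) * vec_index v j))"
      by (simp add: sum_distrib_right mult.assoc)
    also have "\<dots> = (\<Sum>k<n. A $$ (i, k) * u k)"
      unfolding u_def sum_distrib_left by (subst sum.swap) simp
    finally show ?thesis by simp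
  qed
  have "e * of_real (\<Sum>i<n. (cmod (vec_index v i))\<^sup>2) = (\<Sum>i<n. cnj (vec_index v i) * (e * vec_index v i))"
    unfolding of_real_sum sum_distrib_left
    by (intro sum.cong refl) (simp only: complex_norm_square mult_ac)
  also have "\<dots> = (\<Sum>i<n. cnj (vec_index v i) * (\<Sum>k<n. A $$ (i, k) * u k))"
    by (intro sum.cong) (auto simp: Hv)
  also have "\<dots> = (\<Sum>k<n. u k * (\<Sum>i<n. A $$ (i, k) * cnj (vec_index v i)))"
    unfolding sum_distrib_left by (subst sum.swap) (simp add: algebra_simps)
  also have "\<dots> = of_real (\<Sum>k<n. (cmod (u k))\<^sup>2)"
    unfolding of_real_sum
  proof (intro sum.cong refl)
    fix k
    have "(\<Sum>i<n. A $$ (i, k) * cnj (vec_index v i)) = cnj (u k)" by (simp add: u_def)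
    then show "u k * (\<Sum>i<n. A $$ (i, k) * cnj (vec_index v i)) = of_real ((cmod (u k))\<^sup>2)"
      by (simp only: complex_norm_square)
  qed
  finally have eq: "e * of_real (\<Sum>i<n. (cmod (vec_index v i))\<^sup>2) = of_real (\<Sum>k<n. (cmod (u k))\<^sup>2)" .
  define s where "s = (\<Sum>i<n. (cmod (vec_index v i))\<^sup>2)"
  have "\<exists>i<n. vec_index v i \<noteq> 0"
    using v(1,2) by (auto simp: Matrix.vec_eq_iff)
  then obtain i0 where i0: "i0 < n" "vec_index v i0 \<noteq> 0" by blast
  have "0 < (cmod (vec_index v i0))\<^sup>2" using i0 by simp
  also have "\<dots> \<le> s" unfolding s_def using i0 by (intro member_le_sum) auto
  finally have s: "0 < s" .
  have "e = of_real ((\<Sum>k<n. (cmod (u k))\<^sup>2) / s)"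
    using eq s unfolding s_def[symmetric] by (simp add: field_simps)
  then show ?thesis
    using s by (auto simp: sum_nonneg)
qed

text \<open>Hadamard's inequality for bounded entries. The eigenvalues of A A^H are nonnegative,
  their product is |det A|^2, and their sum, the trace, is the sum of all squared moduli of entries,
  at most n N with N = n B^2; AM-GM gives N^n. The Leibniz formula alone would give n! B^n, too much
  for the Fredholm series when B times the measure of the support is at least 1.\<close>

lemma norm_det_le:
  fixes A :: "complex mat"
  assumes A: "A \<in> carrier_mat n n" and B: "0 < B"
    and bd: "\<And>i j. i < n \<Longrightarrow> j < n \<Longrightarrow> cmod (A $$ (i, j)) \<le> B"
  shows "(cmod (Determinant.det A))\<^sup>2 \<le> (real n * B\<^sup>2) ^ n"
proof (cases "n = 0")
  case True
  then show ?thesis using A by (auto simp: Determinant.det_def)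
next
  case False
  define H where "H = A * transpose_mat (map_mat cnj A)"
  have H: "H \<in> carrier_mat n n" using A by (simp add: H_def)
  \<comment> \<open>A Schur form of H makes both determinant and trace readable from the list of
    eigenvalues.\<close>
  obtain es where es: "char_poly H = (\<Prod>e\<leftarrow>es. [:- e, 1:])" "length es = n"
    using char_poly_factorized[OF H] by auto
  obtain C P Q where "schur_decomposition H es = (C, P, Q)"
    by (cases "schur_decomposition H es") auto
  from schur_decomposition[OF H es(1) this]
  have sim: "similar_mat_wit H C P Q" and ut: "upper_triangular C" and dg: "diag_mat C = es"
    by auto
  note w = similar_mat_witD2[OF H sim]
  have "Determinant.det H = Determinant.det C"
    by (rule det_similar) (use sim in \<open>auto simp: similar_mat_def\<close>)
  then have detH: "Determinant.det H = prod_list es"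
    using det_upper_triangular[OF ut w(5)] dg by simp
  have "map_mat cnj A \<in> carrier_mat n n" using A by simp
  then have "Determinant.det (transpose_mat (map_mat cnj A)) = Determinant.det (map_mat cnj A)"
    by (rule Determinant.det_transpose)
  also have "\<dots> = cnj (Determinant.det A)"
    using A by (simp add: Determinant.det_def sign_def)
  finally have cjd: "Determinant.det (transpose_mat (map_mat cnj A)) = cnj (Determinant.det A)" .
  have detH': "Determinant.det H = of_real ((cmod (Determinant.det A))\<^sup>2)"
  proof -
    have "Determinant.det H = Determinant.det A * Determinant.det (transpose_mat (map_mat cnj A))"
      unfolding H_def using A by (intro Determinant.det_mult) auto
    then show ?thesis using cjd by (simp only: complex_norm_square)
  qed
  have "sum_list es = (\<Sum>i<n. C $$ (i, i))"
    using sum_list_diag_mat_eq[of C] dg w(5) by simp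
  also have "\<dots> = (\<Sum>i<n. H $$ (i, i))"
  proof -
    have "(\<Sum>i<n. H $$ (i, i)) = (\<Sum>i<n. (P * (C * Q)) $$ (i, i))"
      using w by (simp add: assoc_mult_mat[of _ n n])
    also have "\<dots> = (\<Sum>i<n. ((C * Q) * P) $$ (i, i))"
      using w by (intro sum_diag_mult_commute) auto
    also have "(C * Q) * P = C"
      using w by (simp add: assoc_mult_mat[of _ n n _ n _ n])
    finally show ?thesis by simp
  qed
  also have "\<dots> = of_real (\<Sum>i<n. \<Sum>k<n. (cmod (A $$ (i, k)))\<^sup>2)"
    unfolding of_real_sum
  proof (intro sum.cong refl)
    fix i assume "i \<in> {..<n}"
    then have "H $$ (i, i) = (\<Sum>k<n. A $$ (i, k) * cnj (A $$ (i, k)))"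
      using A by (simp add: H_def scalar_prod_def atLeast0LessThan)
    then show "H $$ (i, i) = (\<Sum>k<n. of_real ((cmod (A $$ (i, k)))\<^sup>2))"
      by (simp only: complex_norm_square)
  qed
  finally have tr: "sum_list es = of_real (\<Sum>i<n. \<Sum>k<n. (cmod (A $$ (i, k)))\<^sup>2)" .
  have trB: "(\<Sum>i<n. \<Sum>k<n. (cmod (A $$ (i, k)))\<^sup>2) \<le> real n * (real n * B\<^sup>2)"
  proof -
    have "(\<Sum>i<n. \<Sum>k<n. (cmod (A $$ (i, k)))\<^sup>2) \<le> (\<Sum>i<n. \<Sum>k<n. B\<^sup>2)"
      by (intro sum_mono power_mono bd) auto
    then show ?thesis by simp
  qed
  have nn: "Im e = 0 \<and> 0 \<le> Re e" if "e \<in> set es" for e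
  proof (rule adjoint_eigenvalue_nonneg[OF A])
    have "poly (char_poly H) e = 0"
      using that unfolding es(1) by (induction es) auto
    then show "eigenvalue (A * transpose_mat (map_mat cnj A)) e"
      using eigenvalue_root_char_poly[OF H] by (simp add: H_def)
  qed
  define N where "N = real n * B\<^sup>2"
  have N: "0 < N" using False B by (simp add: N_def)
  (* AM-GM in the form x <= exp (x - 1) *)
  have pr: "cmod (prod_list xs) \<le> N ^ length xs * exp (Re (sum_list xs) / N - real (length xs))"
    if "\<forall>e\<in>set xs. Im e = 0 \<and> 0 \<le> Re e" for xs
    using that
  proof (induction xs)
    case (Cons e xs)
    have "cmod e = Re e" using Cons.prems by (auto simp: cmod_eq_Re)
    also have "\<dots> \<le> N * exp (Re e / N - 1)"
      using exp_ge_add_one_self[of "Re e / N - 1"] N by (simp add: field_simps)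
    finally have "cmod (prod_list (e # xs)) \<le> (N * exp (Re e / N - 1)) *
        (N ^ length xs * exp (Re (sum_list xs) / N - real (length xs)))"
      using Cons N unfolding prod_list.Cons norm_mult by (intro mult_mono) auto
    also have "\<dots> = N ^ length (e # xs) * exp (Re (sum_list (e # xs)) / N - real (length (e # xs)))"
    proof -
      have "Re (sum_list (e # xs)) / N - real (length (e # xs))
          = (Re e / N - 1) + (Re (sum_list xs) / N - real (length xs))"
        by (simp add: add_divide_distrib)
      then show ?thesis by (simp only: exp_add) simp
    qed
    finally show ?case .
  qed simp
  have "(cmod (Determinant.det A))\<^sup>2 = cmod (prod_list es)"
    using detH detH' by (metis norm_of_real abs_of_nonneg zero_le_power2)
  also have "\<dots> \<le> N ^ n * exp (Re (sum_list es) / N - real n)"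
    using pr[of es] nn es(2) by auto
  also have "\<dots> \<le> N ^ n * exp 0"
  proof -
    have "Re (sum_list es) \<le> real n * N" using tr trB by (simp add: N_def)
    then have "Re (sum_list es) / N - real n \<le> 0" using N by (simp add: field_simps)
    then show ?thesis using N by (intro mult_left_mono) auto
  qed
  finally show ?thesis by (simp add: N_def)
qed

section \<open>Fredholm determinants\<close>

lemma det_mat_Leibniz:
  "Determinant.det (Matrix.mat n n (\<lambda>(i, j). K (x i) (x j))) =
     (\<Sum>p\<in>{p. p permutes {0..<n}}. signof p * (\<Prod>i=0..<n. K (x i) (x (p i))))"
  by (subst det_def'[of _ n]) (auto intro!: sum.cong prod.cong dest: permutes_in_image)

lemma permutes_nat_less: "p permutes {0..<n} \<Longrightarrow> i < n \<Longrightarrow> p i < (n::nat)"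
  using permutes_in_image[of p "{0..<n}" i] by auto

lemma measurable_det_kernel:
  fixes K :: "'a \<Rightarrow> 'a \<Rightarrow> complex"
  assumes K: "(\<lambda>z. K (fst z) (snd z)) \<in> borel_measurable (M \<Otimes>\<^sub>M M)"
  shows "(\<lambda>x. Determinant.det (Matrix.mat n n (\<lambda>(i, j). K (x i) (x j))))
    \<in> borel_measurable (Pi\<^sub>M {..<n} (\<lambda>_. M))"
proof -
  have "(\<lambda>x. K (x i) (x j)) \<in> borel_measurable (Pi\<^sub>M {..<n} (\<lambda>_. M))" if "i < n" "j < n" for i j
  proof -
    have "(\<lambda>x. (x i, x j)) \<in> Pi\<^sub>M {..<n} (\<lambda>_. M) \<rightarrow>\<^sub>M M \<Otimes>\<^sub>M M"
      using that by (intro measurable_Pair measurable_component_singleton) auto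
    from measurable_compose[OF this K] show ?thesis by simp
  qed
  then show ?thesis
    unfolding det_mat_Leibniz
    by (intro borel_measurable_sum borel_measurable_times borel_measurable_prod)
       (auto dest: permutes_nat_less)
qed

text \<open>Every term of the series is a determinant. This is needed because reversing time
  transposes the kernel of the wanderers.\<close>

lemma fredholm_det_transpose:
  "fredholm_det M (\<lambda>p q. K q p) = fredholm_det M K"
proof -
  have "Determinant.det (Matrix.mat n n (\<lambda>(i, j). K (x j) (x i)))
      = Determinant.det (Matrix.mat n n (\<lambda>(i, j). K (x i) (x j)))" for n and x :: "nat \<Rightarrow> 'a"
  proof -
    have "Matrix.mat n n (\<lambda>(i, j). K (x j) (x i))
        = transpose_mat (Matrix.mat n n (\<lambda>(i, j). K (x i) (x j)))"
      by (intro eq_matI) auto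
    then show ?thesis by (simp add: Determinant.det_transpose[of _ n])
  qed
  then show ?thesis unfolding fredholm_det_def by simp
qed

text \<open>Along a permutation the quotients of values of h multiply to 1. This discards the
  exponential prefactors of the rescaled kernel, which are unbounded in m.\<close>

lemma fredholm_det_conjugate:
  assumes h: "\<And>p. h p \<noteq> 0"
  shows "fredholm_det M (\<lambda>p q. h q / h p * K p q) = fredholm_det M K"
proof -
  have "(\<Prod>i=0..<n. h (x (p i)) / h (x i) * K (x i) (x (p i))) = (\<Prod>i=0..<n. K (x i) (x (p i)))"
    if "p permutes {0..<n}" for n p and x :: "nat \<Rightarrow> 'a"
  proof -
    have "(\<Prod>i=0..<n. h (x (p i))) = (\<Prod>i=0..<n. h (x i))"
      using prod.permute[OF that, of "\<lambda>i. h (x i)"] by (simp add: o_def)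
    moreover have "(\<Prod>i=0..<n. h (x i)) \<noteq> 0" using h by simp
    ultimately show ?thesis by (simp add: prod.distrib prod_dividef)
  qed
  then have "Determinant.det (Matrix.mat n n (\<lambda>(i, j). h (x j) / h (x i) * K (x i) (x j)))
      = Determinant.det (Matrix.mat n n (\<lambda>(i, j). K (x i) (x j)))" for n and x :: "nat \<Rightarrow> 'a"
    using det_mat_Leibniz[of n "\<lambda>p q. h q / h p * K p q" x] det_mat_Leibniz[of n K x]
    by simp
  then show ?thesis unfolding fredholm_det_def by simp
qed

text \<open>Hypothesis \<open>eq\<close> says that M is c times the image of N under f. The n-fold
  product of M is then c^n times the image of that of N, and c^n is absorbed by multiplying the n
  rows of the matrix by c.\<close>

lemma fredholm_det_change_of_variables:
  fixes f :: "'b \<Rightarrow> 'a" and K :: "'a \<Rightarrow> 'a \<Rightarrow> complex"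
  assumes M: "sigma_finite_measure M" and N: "sigma_finite_measure N" and c: "0 \<le> c"
    and f: "f \<in> N \<rightarrow>\<^sub>M M"
    and eq: "\<And>A. A \<in> sets M \<Longrightarrow> emeasure M A = ennreal c * emeasure N (f -` A \<inter> space N)"
    and K: "(\<lambda>z. K (fst z) (snd z)) \<in> borel_measurable (M \<Otimes>\<^sub>M M)"
  shows "fredholm_det M K = fredholm_det N (\<lambda>p q. of_real c * K (f p) (f q))"
proof -
  interpret PM: product_sigma_finite "\<lambda>_::nat. M" by (simp add: product_sigma_finite_def M)
  interpret PN: product_sigma_finite "\<lambda>_::nat. N" by (simp add: product_sigma_finite_def N)
  have "(\<integral>x. Determinant.det (Matrix.mat n n (\<lambda>(i, j). K (x i) (x j))) \<partial>(Pi\<^sub>M {..<n} (\<lambda>_. M)))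
      = (\<integral>x. Determinant.det (Matrix.mat n n (\<lambda>(i, j). of_real c * K (f (x i)) (f (x j))))
          \<partial>(Pi\<^sub>M {..<n} (\<lambda>_. N)))" for n
  proof -
    define F where "F = (\<lambda>x. \<lambda>i\<in>{..<n}. f (x i))"
    define D where "D = (\<lambda>x. Determinant.det (Matrix.mat n n (\<lambda>(i, j). K (x i) (x j))))"
    have D: "D \<in> borel_measurable (Pi\<^sub>M {..<n} (\<lambda>_. M))"
      unfolding D_def by (rule measurable_det_kernel[OF K])
    have F: "F \<in> Pi\<^sub>M {..<n} (\<lambda>_. N) \<rightarrow>\<^sub>M Pi\<^sub>M {..<n} (\<lambda>_. M)"
      unfolding F_def
      by (rule measurable_restrict, rule measurable_compose[OF _ f], rule measurable_component_singleton)
    have PiM: "distr (density (Pi\<^sub>M {..<n} (\<lambda>_. N)) (\<lambda>_. ennreal (c ^ n))) (Pi\<^sub>M {..<n} (\<lambda>_. M)) F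
        = Pi\<^sub>M {..<n} (\<lambda>_. M)"
    proof (rule PM.PiM_eqI)
      fix A :: "nat \<Rightarrow> 'a set" assume A: "\<And>i. i \<in> {..<n} \<Longrightarrow> A i \<in> sets M"
      have pre: "F -` Pi\<^sub>E {..<n} A \<inter> space (Pi\<^sub>M {..<n} (\<lambda>_. N))
          = Pi\<^sub>E {..<n} (\<lambda>i. f -` A i \<inter> space N)"
        by (auto simp: F_def space_PiM PiE_def Pi_def extensional_def)
      have sA: "Pi\<^sub>E {..<n} A \<in> sets (Pi\<^sub>M {..<n} (\<lambda>_. M))"
        using A by (intro sets_PiM_I_finite) auto
      have sB: "Pi\<^sub>E {..<n} (\<lambda>i. f -` A i \<inter> space N) \<in> sets (Pi\<^sub>M {..<n} (\<lambda>_. N))"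
        using A f by (intro sets_PiM_I_finite) auto
      have "emeasure (distr (density (Pi\<^sub>M {..<n} (\<lambda>_. N)) (\<lambda>_. ennreal (c ^ n))) (Pi\<^sub>M {..<n} (\<lambda>_. M)) F)
              (Pi\<^sub>E {..<n} A)
          = ennreal (c ^ n) * emeasure (Pi\<^sub>M {..<n} (\<lambda>_. N)) (Pi\<^sub>E {..<n} (\<lambda>i. f -` A i \<inter> space N))"
        using F sA sB by (subst emeasure_distr) (auto simp: pre emeasure_density_const)
      also have "\<dots> = ennreal (c ^ n) * (\<Prod>i<n. emeasure N (f -` A i \<inter> space N))"
        using A f by (subst PN.emeasure_PiM) auto
      also have "\<dots> = (\<Prod>i<n. ennreal c * emeasure N (f -` A i \<inter> space N))"
        using c by (simp add: prod.distrib ennreal_power)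
      also have "\<dots> = (\<Prod>i<n. emeasure M (A i))"
        by (intro prod.cong) (auto simp: eq A)
      finally show "emeasure (distr (density (Pi\<^sub>M {..<n} (\<lambda>_. N)) (\<lambda>_. ennreal (c ^ n)))
          (Pi\<^sub>M {..<n} (\<lambda>_. M)) F) (Pi\<^sub>E {..<n} A) = (\<Prod>i\<in>{..<n}. emeasure M (A i))" .
    qed auto
    have DF: "D (F x) = Determinant.det (Matrix.mat n n (\<lambda>(i, j). K (f (x i)) (f (x j))))" for x
      unfolding D_def by (rule arg_cong[where f = Determinant.det]) (auto simp: F_def)
    have cD: "of_real (c ^ n) * Determinant.det (Matrix.mat n n (\<lambda>(i, j). K (f (x i)) (f (x j))))
        = Determinant.det (Matrix.mat n n (\<lambda>(i, j). of_real c * K (f (x i)) (f (x j))))" for x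
    proof -
      have "Matrix.mat n n (\<lambda>(i, j). of_real c * K (f (x i)) (f (x j)))
          = of_real c \<cdot>\<^sub>m Matrix.mat n n (\<lambda>(i, j). K (f (x i)) (f (x j)))"
        by (intro eq_matI) auto
      then show ?thesis by simp
    qed
    have "(\<integral>x. D x \<partial>Pi\<^sub>M {..<n} (\<lambda>_. M))
        = (\<integral>x. D (F x) \<partial>density (Pi\<^sub>M {..<n} (\<lambda>_. N)) (\<lambda>_. ennreal (c ^ n)))"
      using F D by (subst PiM[symmetric], subst integral_distr) auto
    also have "\<dots> = (\<integral>x. c ^ n *\<^sub>R D (F x) \<partial>Pi\<^sub>M {..<n} (\<lambda>_. N))"
      using c measurable_compose[OF F D] by (subst integral_density) auto
    also have "\<dots> = (\<integral>x. Determinant.det (Matrix.mat n n (\<lambda>(i, j). of_real c * K (f (x i)) (f (x j))))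
          \<partial>(Pi\<^sub>M {..<n} (\<lambda>_. N)))"
      by (simp only: scaleR_conv_of_real DF cD)
    finally show ?thesis unfolding D_def .
  qed
  then show ?thesis unfolding fredholm_det_def by simp
qed

text \<open>The majorant left over when Hadamard's bound n^(n/2) is divided by n!. Consecutive terms
  have ratio y / sqrt(n + 1), at most 1/2 once n \<ge> 4 y^2.\<close>

lemma summable_power_over_sqrt_fact:
  assumes "0 \<le> (y::real)"
  shows "summable (\<lambda>n. y ^ n / sqrt (fact n))"
proof (rule summable_ratio_test[where c = "1/2" and N = "nat \<lceil>4 * y\<^sup>2\<rceil>"])
  fix n assume "nat \<lceil>4 * y\<^sup>2\<rceil> \<le> n"
  then have "(2 * y)\<^sup>2 \<le> real n + 1"
    by (simp add: power_mult_distrib)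
  then have "2 * y \<le> sqrt (real n + 1)" by (rule real_le_rsqrt)
  then have "y / sqrt (real n + 1) \<le> 1 / 2" by (simp add: field_simps)
  then have "(y ^ n / sqrt (fact n)) * (y / sqrt (real n + 1)) \<le> (y ^ n / sqrt (fact n)) * (1 / 2)"
    using assms by (intro mult_left_mono) auto
  moreover have "y ^ Suc n / sqrt (fact (Suc n)) = (y ^ n / sqrt (fact n)) * (y / sqrt (real n + 1))"
    by (simp only: fact_Suc power_Suc of_nat_Suc of_nat_mult real_sqrt_mult) (simp add: add.commute mult.commute)
  ultimately show "norm (y ^ Suc n / sqrt (fact (Suc n))) \<le> 1 / 2 * norm (y ^ n / sqrt (fact n))"
    using assms by (simp only: real_norm_def) simp
qed simp

text \<open>Two dominated convergences: termwise over the box S^n, where Hadamard's inequality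
  bounds the determinants, and then Tannery's theorem for the series. The kernels are bounded only
  for large m, so the sequence is shifted by \<open>m0\<close> and the shift is undone at the
  end.\<close>

lemma fredholm_det_tendsto:
  fixes K :: "nat \<Rightarrow> 'a \<Rightarrow> 'a \<Rightarrow> complex"
  assumes M: "sigma_finite_measure M" and S: "S \<in> sets M" "emeasure M S < \<infinity>"
    and meas: "\<And>m. (\<lambda>z. K m (fst z) (snd z)) \<in> borel_measurable (M \<Otimes>\<^sub>M M)"
      "(\<lambda>z. L (fst z) (snd z)) \<in> borel_measurable (M \<Otimes>\<^sub>M M)"
    and supp: "\<And>m p q. p \<notin> S \<or> q \<notin> S \<Longrightarrow> K m p q = 0" "\<And>p q. p \<notin> S \<or> q \<notin> S \<Longrightarrow> L p q = 0"
    and bd: "\<forall>\<^sub>F m in sequentially. \<forall>p\<in>S. \<forall>q\<in>S. cmod (K m p q) \<le> B"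
    and lim: "\<And>p q. p \<in> S \<Longrightarrow> q \<in> S \<Longrightarrow> (\<lambda>m. K m p q) \<longlonglongrightarrow> L p q"
  shows "(\<lambda>m. fredholm_det M (K m)) \<longlonglongrightarrow> fredholm_det M L"
proof -
  interpret PM: product_sigma_finite "\<lambda>_::nat. M" by (simp add: product_sigma_finite_def M)
  \<comment> \<open>The maximum with 1 secures the positivity that Hadamard's inequality asks
    for.\<close>
  define C where "C = max B 1"
  have C: "0 < C" by (simp add: C_def)
  define s where "s = measure M S"
  have s: "0 \<le> s" by (simp add: s_def)
  have eS: "emeasure M S = ennreal s" using S(2) by (simp add: s_def emeasure_eq_ennreal_measure)
  define D where "D = (\<lambda>(k :: 'a \<Rightarrow> 'a \<Rightarrow> complex) n x. Determinant.det (Matrix.mat n n (\<lambda>(i, j). k (x i) (x j))) :: complex)"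
  define w where "w = (\<lambda>n x. sqrt ((real n * C\<^sup>2) ^ n) * indicator (Pi\<^sub>E {..<n} (\<lambda>_. S)) x)"
  have box: "Pi\<^sub>E {..<n} (\<lambda>_. S) \<in> sets (Pi\<^sub>M {..<n} (\<lambda>_. M))" for n :: nat
    using S by (intro sets_PiM_I_finite) auto
  have ebox: "emeasure (Pi\<^sub>M {..<n} (\<lambda>_. M)) (Pi\<^sub>E {..<n} (\<lambda>_. S)) = ennreal (s ^ n)" for n
    using S s by (subst PM.emeasure_PiM) (auto simp: eS ennreal_power)
  have wint: "integrable (Pi\<^sub>M {..<n} (\<lambda>_. M)) (w n)" for n
    unfolding w_def using box ebox by (intro integrable_mult_right) (simp add: less_top[symmetric])
  have wval: "(\<integral>x. w n x \<partial>Pi\<^sub>M {..<n} (\<lambda>_. M)) = sqrt ((real n * C\<^sup>2) ^ n) * s ^ n" for n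
    unfolding w_def using box[of n] ebox[of n] s by (simp add: measure_def)
  have Dbd: "cmod (D k n x) \<le> w n x"
    if k: "\<And>p q. p \<notin> S \<or> q \<notin> S \<Longrightarrow> k p q = 0" "\<forall>p\<in>S. \<forall>q\<in>S. cmod (k p q) \<le> C"
      and x: "x \<in> space (Pi\<^sub>M {..<n} (\<lambda>_. M))" for k n x
  proof (cases "\<forall>i<n. x i \<in> S")
    case True
    have "x \<in> Pi\<^sub>E {..<n} (\<lambda>_. S)" using True x by (auto simp: space_PiM PiE_def)
    moreover have "(cmod (D k n x))\<^sup>2 \<le> (real n * C\<^sup>2) ^ n"
      unfolding D_def using True k(2) by (intro norm_det_le C) auto
    ultimately show ?thesis using real_le_rsqrt by (auto simp: w_def)
  next
    case False
    then obtain i where i: "i < n" "x i \<notin> S" by blast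
    \<comment> \<open>The row of a point outside S vanishes, and every Leibniz product contains an
      entry of that row.\<close>
    have "(\<Prod>j=0..<n. k (x j) (x (p j))) = 0" for p
    proof (rule prod_zero)
      show "\<exists>j\<in>{0..<n}. k (x j) (x (p j)) = 0"
        using i k(1) by (intro bexI[of _ i]) auto
    qed simp
    then have "D k n x = 0"
      unfolding D_def det_mat_Leibniz by (simp only: mult_zero_right sum.neutral_const)
    then show ?thesis by (simp add: w_def)
  qed
  have lim': "(\<lambda>m. K m p q) \<longlonglongrightarrow> L p q" for p q
    using lim[of p q] supp by (cases "p \<in> S \<and> q \<in> S") auto
  have Dlim: "(\<lambda>m. D (K m) n x) \<longlonglongrightarrow> D L n x" for n x
    unfolding D_def det_mat_Leibniz by (intro tendsto_intros lim')
  from bd obtain m0 where m0: "\<And>m. m \<ge> m0 \<Longrightarrow> \<forall>p\<in>S. \<forall>q\<in>S. cmod (K m p q) \<le> C"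
    unfolding eventually_sequentially C_def by (metis le_max_iff_disj)
  have Dmeas: "D (K m) n \<in> borel_measurable (Pi\<^sub>M {..<n} (\<lambda>_. M))"
      "D L n \<in> borel_measurable (Pi\<^sub>M {..<n} (\<lambda>_. M))" for m n
    unfolding D_def using measurable_det_kernel meas by blast+
  have Ilim: "(\<lambda>m. \<integral>x. D (K (m + m0)) n x \<partial>Pi\<^sub>M {..<n} (\<lambda>_. M)) \<longlonglongrightarrow> (\<integral>x. D L n x \<partial>Pi\<^sub>M {..<n} (\<lambda>_. M))" for n
  proof (rule integral_dominated_convergence[where w = "w n"])
    show "AE x in Pi\<^sub>M {..<n} (\<lambda>_. M). (\<lambda>m. D (K (m + m0)) n x) \<longlonglongrightarrow> D L n x"
      using LIMSEQ_ignore_initial_segment[OF Dlim] by simp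
    show "AE x in Pi\<^sub>M {..<n} (\<lambda>_. M). norm (D (K (m + m0)) n x) \<le> w n x" for m
      using Dbd[of "K (m + m0)"] supp m0[of "m + m0"] by (intro AE_I2) auto
  qed (use Dmeas wint in auto)
  have Ibd: "cmod (\<integral>x. D (K (m + m0)) n x \<partial>Pi\<^sub>M {..<n} (\<lambda>_. M)) \<le> sqrt ((real n * C\<^sup>2) ^ n) * s ^ n" for m n
  proof -
    have "cmod (\<integral>x. D (K (m + m0)) n x \<partial>Pi\<^sub>M {..<n} (\<lambda>_. M)) \<le> (\<integral>x. w n x \<partial>Pi\<^sub>M {..<n} (\<lambda>_. M))"
    proof (rule order_trans[OF integral_norm_bound])
      have le: "cmod (D (K (m + m0)) n x) \<le> w n x" if "x \<in> space (Pi\<^sub>M {..<n} (\<lambda>_. M))" for x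
        using Dbd[of "K (m + m0)"] supp m0[of "m + m0"] that by auto
      have "integrable (Pi\<^sub>M {..<n} (\<lambda>_. M)) (D (K (m + m0)) n)"
        by (rule Bochner_Integration.integrable_bound[OF wint Dmeas(1)])
           (auto intro!: AE_I2 order_trans[OF le abs_ge_self])
      then show "(\<integral>x. cmod (D (K (m + m0)) n x) \<partial>Pi\<^sub>M {..<n} (\<lambda>_. M)) \<le> (\<integral>x. w n x \<partial>Pi\<^sub>M {..<n} (\<lambda>_. M))"
        by (intro integral_mono integrable_norm wint le)
    qed
    then show ?thesis by (simp add: wval)
  qed
  define a where "a = (\<lambda>n m. (- 1) ^ n / fact n * (\<integral>x. D (K (m + m0)) n x \<partial>Pi\<^sub>M {..<n} (\<lambda>_. M)))"
  define b where "b = (\<lambda>n. (- 1) ^ n / fact n * (\<integral>x. D L n x \<partial>Pi\<^sub>M {..<n} (\<lambda>_. M)))"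
  define W where "W = (\<lambda>n. (exp (1/2) * C * s) ^ n / sqrt (fact n))"
  have W: "summable W"
    unfolding W_def using C s by (intro summable_power_over_sqrt_fact) auto
  have aW: "cmod (a n m) \<le> W n" for n m
  proof -
    \<comment> \<open>The n-th term of the exponential series at n; it follows that sqrt(n^n) / n!
      is at most e^(n/2) / sqrt(n!).\<close>
    have "real n ^ n / fact n \<le> exp (real n)"
      using exp_ge_one_plus_x_over_n_power_n sum_le_suminf[of "\<lambda>k. real n ^ k / fact k" "{n}"]
        summable_exp[of "real n"] by (simp add: exp_def field_simps)
    then have "real n ^ n \<le> exp (real n) * fact n" by (simp add: field_simps)
    then have "sqrt (real n ^ n) \<le> sqrt (exp (real n)) * sqrt (fact n)"
      by (metis real_sqrt_le_mono real_sqrt_mult)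
    also have "sqrt (exp (real n)) = exp (1/2) ^ n"
      by (rule real_sqrt_unique) (auto simp: exp_of_nat_mult[symmetric] power2_eq_square exp_add[symmetric])
    finally have sq: "sqrt (real n ^ n) \<le> exp (1/2) ^ n * sqrt (fact n)" .
    have "cmod (a n m) \<le> sqrt ((real n * C\<^sup>2) ^ n) * s ^ n / fact n"
      unfolding a_def using Ibd[of n m] by (simp add: norm_mult norm_divide norm_power divide_right_mono)
    also have "sqrt ((real n * C\<^sup>2) ^ n) = sqrt (real n ^ n) * C ^ n"
      using C by (simp add: power_mult_distrib real_sqrt_mult real_sqrt_power)
    also have "sqrt (real n ^ n) * C ^ n * s ^ n / fact n
        \<le> (exp (1/2) ^ n * sqrt (fact n)) * C ^ n * s ^ n / fact n"
      using sq C s by (intro divide_right_mono mult_right_mono) auto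
    also have "\<dots> = W n"
    proof -
      have "sqrt (fact n) / fact n = 1 / (sqrt (fact n) :: real)"
        by (simp add: field_simps)
      then show ?thesis by (simp add: W_def power_mult_distrib field_simps)
    qed
    finally show ?thesis .
  qed
  have "(\<lambda>m. a k m) \<longlonglongrightarrow> b k" for k
    unfolding a_def b_def by (intro tendsto_intros Ilim)
  from tannerys_theorem[where F = sequentially, OF this _ W] aW
  have "(\<lambda>m. suminf (\<lambda>n. a n m)) \<longlonglongrightarrow> suminf b"
    by (simp add: always_eventually)
  then have "(\<lambda>m. fredholm_det M (K (m + m0))) \<longlonglongrightarrow> fredholm_det M L"
    by (simp add: a_def b_def fredholm_det_def D_def)
  then show ?thesis by (rule LIMSEQ_offset)
qed

text \<open>Transports the gap determinants for all m to one fixed space, indices times the real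
  line, with the fixed sets \<open>E k\<close>; in the original coordinates the measure space and
  the sets move with m. The absolute value of c is the Jacobian.\<close>

lemma gap_det_affine:
  fixes K :: "real \<times> real \<Rightarrow> real \<times> real \<Rightarrow> complex"
  assumes inj: "inj_on \<tau> {1..l}" and c: "c \<noteq> 0" and E: "\<And>k. k \<in> {1..l} \<Longrightarrow> compact (E k)"
    and K: "(\<lambda>z. K (fst z) (snd z)) \<in> borel_measurable borel"
  shows "gap_det K l \<tau> (\<lambda>k. (\<lambda>v. d k + c * v) ` E k) =
    fredholm_det (count_space {1..l} \<Otimes>\<^sub>M lborel)
      (\<lambda>p q. indicator (Sigma {1..l} E) p * indicator (Sigma {1..l} E) q *
         (of_real \<bar>c\<bar> * K (\<tau> (fst p), d (fst p) + c * snd p) (\<tau> (fst q), d (fst q) + c * snd q)))"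
proof -
  define M where "M = count_space (\<tau> ` {1..l}) \<Otimes>\<^sub>M (lborel :: real measure)"
  define N where "N = count_space {1..l} \<Otimes>\<^sub>M (lborel :: real measure)"
  define f where "f = (\<lambda>p. (\<tau> (fst p), d (fst p) + c * snd p))"
  define Y where "Y = {(\<tau> k, \<xi>) | k \<xi>. k \<in> {1..l} \<and> \<xi> \<in> (\<lambda>v. d k + c * v) ` E k}"
  interpret M1: sigma_finite_measure "count_space (\<tau> ` {1..l})"
    by (intro sigma_finite_measure_count_space_finite) auto
  interpret N1: sigma_finite_measure "count_space {1..l}"
    by (intro sigma_finite_measure_count_space_finite) auto
  interpret PM: pair_sigma_finite "count_space (\<tau> ` {1..l})" "lborel :: real measure" ..
  interpret PN: pair_sigma_finite "count_space {1..l}" "lborel :: real measure" ..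
  have Yset: "Y \<in> sets M"
  proof -
    have "Y = (\<Union>k\<in>{1..l}. {\<tau> k} \<times> (\<lambda>v. d k + c * v) ` E k)"
      unfolding Y_def by blast
    also have "\<dots> \<in> sets M"
      unfolding M_def
    proof (intro sets.finite_UN pair_measureI)
      fix k assume k: "k \<in> {1..l}"
      have "compact ((\<lambda>v. d k + c * v) ` E k)"
        by (intro compact_continuous_image continuous_intros E k)
      then show "(\<lambda>v. d k + c * v) ` E k \<in> sets lborel" by (simp add: borel_compact)
    qed auto
    finally show ?thesis .
  qed
  have f: "f \<in> N \<rightarrow>\<^sub>M M"
    unfolding f_def N_def M_def
  proof (rule measurable_Pair)
    show "(\<lambda>p. \<tau> (fst p)) \<in> count_space {1..l} \<Otimes>\<^sub>M lborel \<rightarrow>\<^sub>M count_space (\<tau> ` {1..l})"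
      by (rule measurable_compose[OF measurable_fst]) auto
    have "(\<lambda>p. d (fst p)) \<in> borel_measurable (count_space {1..l} \<Otimes>\<^sub>M (lborel :: real measure))"
      by (rule measurable_compose[OF measurable_fst]) auto
    moreover have "(\<lambda>p. c * snd p) \<in> borel_measurable (count_space {1..l} \<Otimes>\<^sub>M (lborel :: real measure))"
      by measurable
    ultimately show "(\<lambda>p. d (fst p) + c * snd p) \<in> count_space {1..l} \<Otimes>\<^sub>M lborel \<rightarrow>\<^sub>M lborel"
      by simp
  qed
  have idm: "(\<lambda>p. p) \<in> M \<rightarrow>\<^sub>M (borel :: (real \<times> real) measure)"
  proof -
    have "(\<lambda>p. (fst p, snd p)) \<in> M \<rightarrow>\<^sub>M (borel \<Otimes>\<^sub>M borel :: (real \<times> real) measure)"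
      unfolding M_def
    proof (rule measurable_Pair)
      show "fst \<in> count_space (\<tau> ` {1..l}) \<Otimes>\<^sub>M (lborel :: real measure) \<rightarrow>\<^sub>M borel"
      proof -
        have "(\<lambda>t. t) \<in> count_space (\<tau> ` {1..l}) \<rightarrow>\<^sub>M (borel :: real measure)" by simp
        from measurable_compose[OF measurable_fst this] show ?thesis by simp
      qed
      show "snd \<in> count_space (\<tau> ` {1..l}) \<Otimes>\<^sub>M (lborel :: real measure) \<rightarrow>\<^sub>M borel"
        by measurable
    qed
    then show ?thesis by (simp add: borel_prod)
  qed
  have Km: "(\<lambda>z. K (fst z) (snd z)) \<in> borel_measurable (M \<Otimes>\<^sub>M M)"
  proof -
    have "(\<lambda>z. (fst z, snd z)) \<in> M \<Otimes>\<^sub>M M \<rightarrow>\<^sub>M (borel \<Otimes>\<^sub>M borel :: ((real \<times> real) \<times> (real \<times> real)) measure)"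
      by (intro measurable_Pair measurable_compose[OF measurable_fst idm] measurable_compose[OF measurable_snd idm])
    then show ?thesis using measurable_compose K by (fastforce simp: borel_prod)
  qed
  have "fredholm_det M (\<lambda>p q. indicator Y p * K p q * indicator Y q)
      = fredholm_det N (\<lambda>p q. of_real \<bar>c\<bar> * (indicator Y (f p) * K (f p) (f q) * indicator Y (f q)))"
  proof (rule fredholm_det_change_of_variables)
    show "sigma_finite_measure M" "sigma_finite_measure N"
      unfolding M_def N_def by (rule PM.sigma_finite_measure_axioms PN.sigma_finite_measure_axioms)+
    fix A assume A: "A \<in> sets M"
    have sec: "Pair (\<tau> k) -` A \<in> sets lborel" for k
      using A unfolding M_def by (rule sets_Pair1)
    have "emeasure M A = (\<Sum>t\<in>\<tau> ` {1..l}. \<integral>\<^sup>+\<xi>. indicator A (t, \<xi>) \<partial>lborel)"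
      using A unfolding M_def
      by (subst lborel.emeasure_pair_measure) (auto simp: nn_integral_count_space_finite)
    also have "\<dots> = (\<Sum>k\<in>{1..l}. \<integral>\<^sup>+\<xi>. indicator A (\<tau> k, \<xi>) \<partial>lborel)"
      by (subst sum.reindex[OF inj]) (simp add: o_def)
    also have "\<dots> = (\<Sum>k\<in>{1..l}. ennreal \<bar>c\<bar> * (\<integral>\<^sup>+v. indicator A (\<tau> k, d k + c * v) \<partial>lborel))"
    proof (intro sum.cong refl)
      fix k
      have "(\<lambda>\<xi>. indicator A (\<tau> k, \<xi>) :: ennreal) = indicator (Pair (\<tau> k) -` A)"
        by (auto simp: indicator_def)
      then have "(\<lambda>\<xi>. indicator A (\<tau> k, \<xi>) :: ennreal) \<in> borel_measurable borel"
        using sec[of k] by simp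
      then show "(\<integral>\<^sup>+\<xi>. indicator A (\<tau> k, \<xi>) \<partial>lborel) = ennreal \<bar>c\<bar> * (\<integral>\<^sup>+v. indicator A (\<tau> k, d k + c * v) \<partial>lborel)"
        by (rule nn_integral_real_affine) (use c in auto)
    qed
    also have "\<dots> = ennreal \<bar>c\<bar> * (\<Sum>k\<in>{1..l}. \<integral>\<^sup>+v. indicator (f -` A \<inter> space N) (k, v) \<partial>lborel)"
      unfolding sum_distrib_left
      by (intro sum.cong arg_cong2[where f = "(*)"] nn_integral_cong refl)
         (auto simp: f_def N_def space_pair_measure indicator_def)
    also have "\<dots> = ennreal \<bar>c\<bar> * emeasure N (f -` A \<inter> space N)"
      using measurable_sets[OF f A] unfolding N_def
      by (subst lborel.emeasure_pair_measure) (auto simp: nn_integral_count_space_finite)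
    finally show "emeasure M A = ennreal \<bar>c\<bar> * emeasure N (f -` A \<inter> space N)" .
  next
    show "(\<lambda>z. indicator Y (fst z) * K (fst z) (snd z) * indicator Y (snd z)) \<in> borel_measurable (M \<Otimes>\<^sub>M M)"
      using Yset by (intro borel_measurable_times Km borel_measurable_indicator' measurable_compose[OF measurable_fst]
         measurable_compose[OF measurable_snd] borel_measurable_indicator) auto
  qed (use f in auto)
  also have "\<dots> = fredholm_det N (\<lambda>p q. indicator (Sigma {1..l} E) p * indicator (Sigma {1..l} E) q *
         (of_real \<bar>c\<bar> * K (f p) (f q)))"
  proof -
    \<comment> \<open>Injectivity matters here: a time shared by two indices would carry the sets of
      both, and the indicator would not be that of \<open>Sigma {1..l} E\<close>.\<close>
    have ind: "indicator Y (f p) = (indicator (Sigma {1..l} E) p :: complex)" if "fst p \<in> {1..l}" for p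
    proof -
      have "f p \<in> Y \<longleftrightarrow> p \<in> Sigma {1..l} E"
      proof
        assume "f p \<in> Y"
        then obtain k v where kv: "k \<in> {1..l}" "v \<in> E k" "\<tau> (fst p) = \<tau> k" "d (fst p) + c * snd p = d k + c * v"
          by (auto simp: Y_def f_def)
        have "fst p = k" using inj_onD[OF inj kv(3) that kv(1)] .
        moreover from this have "snd p = v" using kv(4) c by simp
        ultimately show "p \<in> Sigma {1..l} E" using kv by (cases p) auto
      next
        assume "p \<in> Sigma {1..l} E"
        then show "f p \<in> Y" by (cases p) (auto simp: Y_def f_def)
      qed
      then show ?thesis by (simp add: indicator_def)
    qed
    have "(\<integral>x. Determinant.det (Matrix.mat n n (\<lambda>(i, j). of_real \<bar>c\<bar> * (indicator Y (f (x i)) * K (f (x i)) (f (x j)) * indicator Y (f (x j))))) \<partial>Pi\<^sub>M {..<n} (\<lambda>_. N))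
      = (\<integral>x. Determinant.det (Matrix.mat n n (\<lambda>(i, j). indicator (Sigma {1..l} E) (x i) * indicator (Sigma {1..l} E) (x j) *
         (of_real \<bar>c\<bar> * K (f (x i)) (f (x j))))) \<partial>Pi\<^sub>M {..<n} (\<lambda>_. N))" for n
    proof (intro Bochner_Integration.integral_cong refl arg_cong[where f = Determinant.det] eq_matI)
      fix x i j assume x: "x \<in> space (Pi\<^sub>M {..<n} (\<lambda>_. N))"
      assume ij: "i < dim_row (Matrix.mat n n (\<lambda>(i, j). indicator (Sigma {1..l} E) (x i) * indicator (Sigma {1..l} E) (x j) *
         (complex_of_real \<bar>c\<bar> * K (f (x i)) (f (x j)))))"
        "j < dim_col (Matrix.mat n n (\<lambda>(i, j). indicator (Sigma {1..l} E) (x i) * indicator (Sigma {1..l} E) (x j) *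
         (complex_of_real \<bar>c\<bar> * K (f (x i)) (f (x j)))))"
      have "fst (x k) \<in> {1..l}" if "k < n" for k
        using x that by (auto simp: space_PiM PiE_def Pi_def N_def space_pair_measure mem_Times_iff)
      then show "Matrix.mat n n (\<lambda>(i, j). of_real \<bar>c\<bar> * (indicator Y (f (x i)) * K (f (x i)) (f (x j)) * indicator Y (f (x j)))) $$ (i, j)
        = Matrix.mat n n (\<lambda>(i, j). indicator (Sigma {1..l} E) (x i) * indicator (Sigma {1..l} E) (x j) *
         (of_real \<bar>c\<bar> * K (f (x i)) (f (x j)))) $$ (i, j)"
        using ij by (simp add: ind mult_ac)
    qed auto
    then show ?thesis unfolding fredholm_det_def by simp
  qed
  finally show ?thesis
    unfolding gap_det_def Let_def Y_def[symmetric] M_def[symmetric] N_def[symmetric] f_def .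
qed

section \<open>Integrals along rays\<close>

definition ray_integrable :: "complex \<Rightarrow> complex \<Rightarrow> (complex \<Rightarrow> complex) \<Rightarrow> bool" where
  "ray_integrable c d f \<longleftrightarrow> set_integrable lborel {0..} (\<lambda>t. f (c + of_real t * d) * d)"

lemma ray_integral_add:
  "ray_integrable c d f \<Longrightarrow> ray_integrable c d g \<Longrightarrow>
    ray_integral c d (\<lambda>z. f z + g z) = ray_integral c d f + ray_integral c d g"
  by (simp add: ray_integral_def ray_integrable_def distrib_right set_integral_add)

lemma ray_integrable_add:
  "ray_integrable c d f \<Longrightarrow> ray_integrable c d g \<Longrightarrow> ray_integrable c d (\<lambda>z. f z + g z)"
  by (simp add: ray_integrable_def distrib_right set_integral_add)

lemma ray_integral_diff:
  "ray_integrable c d f \<Longrightarrow> ray_integrable c d g \<Longrightarrow>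
    ray_integral c d (\<lambda>z. f z - g z) = ray_integral c d f - ray_integral c d g"
  by (simp add: ray_integral_def ray_integrable_def left_diff_distrib set_integral_diff)

lemma ray_integrable_diff:
  "ray_integrable c d f \<Longrightarrow> ray_integrable c d g \<Longrightarrow> ray_integrable c d (\<lambda>z. f z - g z)"
  by (simp add: ray_integrable_def left_diff_distrib set_integral_diff)

lemma ray_integral_mult: "ray_integral c d (\<lambda>z. k * f z) = k * ray_integral c d f"
  by (simp add: ray_integral_def mult.assoc)

lemma ray_integrable_mult: "ray_integrable c d f \<Longrightarrow> ray_integrable c d (\<lambda>z. k * f z)"
  by (simp add: ray_integrable_def mult.assoc)

lemma ray_integrable_sum:
  "finite I \<Longrightarrow> (\<And>i. i \<in> I \<Longrightarrow> ray_integrable c d (f i)) \<Longrightarrow> ray_integrable c d (\<lambda>z. \<Sum>i\<in>I. f i z)"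
  by (induction I rule: finite_induct)
     (simp_all add: ray_integrable_add, simp add: ray_integrable_def set_integrable_def)

lemma ray_integral_sum:
  "finite I \<Longrightarrow> (\<And>i. i \<in> I \<Longrightarrow> ray_integrable c d (f i)) \<Longrightarrow>
    ray_integral c d (\<lambda>z. \<Sum>i\<in>I. f i z) = (\<Sum>i\<in>I. ray_integral c d (f i))"
  by (induction I rule: finite_induct)
     (simp_all add: ray_integral_add ray_integrable_sum, simp add: ray_integral_def)

text \<open>The vertex is a null set and nothing is asked there, since integrands may be singular at
  the common vertex of two contours.\<close>

lemma ray_integral_cong:
  assumes "\<And>t. 0 < t \<Longrightarrow> f (c + of_real t * d) = g (c + of_real t * d)"
  shows "ray_integral c d f = ray_integral c d g"
  unfolding ray_integral_def set_lebesgue_integral_def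
  by (rule integral_discrete_difference[of "{0}"]) (use assms in \<open>auto simp: indicator_def\<close>)

lemma ray_integral_scale:
  assumes "0 < k"
  shows "ray_integral (w + of_real k * c) d f = of_real k * ray_integral c d (\<lambda>z. f (w + of_real k * z))"
proof -
  have "ray_integral (w + of_real k * c) d f
      = \<bar>k\<bar> *\<^sub>R (LBINT t. indicator {0..} (0 + k * t) *\<^sub>R (f (w + of_real k * c + of_real (0 + k * t) * d) * d))"
    unfolding ray_integral_def set_lebesgue_integral_def
    by (rule lborel_integral_real_affine) (use assms in auto)
  also have "\<dots> = of_real k * ray_integral c d (\<lambda>z. f (w + of_real k * z))"
    using assms unfolding ray_integral_def set_lebesgue_integral_def
    by (auto simp: scaleR_conv_of_real indicator_def zero_le_mult_iff algebra_simps
        intro!: Bochner_Integration.integral_cong)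
  finally show ?thesis .
qed

text \<open>A ray does not depend on the length of its direction vector, so unit vectors on the
  diagonals can be replaced by vectors with rational coordinates.\<close>

lemma ray_integral_direction_scale:
  assumes "0 < k"
  shows "ray_integral c (of_real k * d) f = ray_integral c d f"
proof -
  have "ray_integral c d f
      = \<bar>k\<bar> *\<^sub>R (LBINT t. indicator {0..} (0 + k * t) *\<^sub>R (f (c + of_real (0 + k * t) * d) * d))"
    unfolding ray_integral_def set_lebesgue_integral_def
    by (rule lborel_integral_real_affine) (use assms in auto)
  also have "\<dots> = (LBINT t. \<bar>k\<bar> *\<^sub>R (indicator {0..} (0 + k * t) *\<^sub>R (f (c + of_real (0 + k * t) * d) * d)))"
    by (simp only: integral_scaleR_right)
  also have "\<dots> = ray_integral c (of_real k * d) f"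
    using assms unfolding ray_integral_def set_lebesgue_integral_def
    by (auto simp: scaleR_conv_of_real indicator_def zero_le_mult_iff algebra_simps
        intro!: Bochner_Integration.integral_cong)
  finally show ?thesis by simp
qed

text \<open>The Gamma integral. The case s = 1/2 dominates the singularity at the crossing of the
  contours, the case s = 1 is plain exponential decay.\<close>

lemma set_integrable_powr_exp:
  assumes "0 < (s::real)"
  shows "set_integrable lborel {0..} (\<lambda>t. t powr (s - 1) * exp (- t))"
  unfolding set_integrable_def
proof (rule integrableI_nonneg)
  have "(\<integral>\<^sup>+t. ennreal (indicator {0..} t *\<^sub>R (t powr (s - 1) * exp (- t))) \<partial>lborel) = Gamma s"
    unfolding Gamma_conv_nn_integral_real[OF assms] by (simp add: exp_minus field_simps)
  then show "(\<integral>\<^sup>+t. ennreal (indicator {0..} t *\<^sub>R (t powr (s - 1) * exp (- t))) \<partial>lborel) < \<infinity>"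
    by simp
qed auto

lemma set_integrable_exp_minus: "set_integrable lborel {0..} (\<lambda>t. C * exp (- t) :: real)"
proof -
  have "integrable lborel (\<lambda>t. indicator {0..} t *\<^sub>R (t powr (1 - 1) * exp (- t)) :: real)"
    using set_integrable_powr_exp[of 1] by (simp only: set_integrable_def)
  then have "integrable lborel (\<lambda>t. indicator {0..} t *\<^sub>R exp (- t) :: real)"
    \<comment> \<open>\<open>0 powr 0\<close> is 0, so the two integrands differ at t = 0.\<close>
    by (rule integrable_discrete_difference[of "{0}", THEN iffD1, rotated -1]) (auto simp: indicator_def)
  then show ?thesis unfolding set_integrable_def[symmetric] by (rule set_integrable_mult_right)
qed

lemma ray_integrableI:
  assumes cont: "continuous_on ((\<lambda>t. c + of_real t * d) ` {0..}) f"
    and bd: "\<And>t. 0 \<le> t \<Longrightarrow> cmod (f (c + of_real t * d)) \<le> C * exp (- t)"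
  shows "ray_integrable c d f"
  unfolding ray_integrable_def
proof (rule set_integrable_bound[OF set_integrable_exp_minus[of "C * cmod d"]])
  have "continuous_on {0..} (\<lambda>t. f (c + of_real t * d))"
    by (rule continuous_on_compose2[OF cont]) (auto intro!: continuous_intros)
  then have "continuous_on {0..} (\<lambda>t. f (c + of_real t * d) * d)"
    by (intro continuous_intros)
  then show "set_borel_measurable lborel {0..} (\<lambda>t. f (c + of_real t * d) * d)"
    unfolding set_borel_measurable_def
    by (simp add: borel_measurable_continuous_on_indicator)
  show "AE t\<in>{0..} in lborel. norm (f (c + of_real t * d) * d) \<le> norm (C * cmod d * exp (- t))"
  proof (intro AE_I2 impI)
    fix t :: real assume "t \<in> {0..}"
    then have "cmod (f (c + of_real t * d)) * cmod d \<le> C * exp (- t) * cmod d"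
      using bd[of t] by (intro mult_right_mono) auto
    then show "norm (f (c + of_real t * d) * d) \<le> norm (C * cmod d * exp (- t))"
      by (simp add: norm_mult mult_ac) 
  qed
qed

text \<open>Cauchy's theorem for two infinite rays. On the convex set S there is a primitive F, each
  ray integral is the limit of F along the ray minus the initial value, and the two limits agree:
  the segment joining the points of parameter R has length O(R), while f is at most C exp (- R) on
  it. This is why \<open>bd\<close> controls f on these segments and not only on the rays.\<close>

lemma ray_shift:
  assumes U: "open U" "f holomorphic_on U" and S: "convex S" "S \<subseteq> U"
    and ray: "\<And>t. 0 \<le> t \<Longrightarrow> c + of_real t * d \<in> S" "\<And>t. 0 \<le> t \<Longrightarrow> c' + of_real t * d' \<in> S"
    and bd: "\<And>R u. 0 \<le> R \<Longrightarrow> 0 \<le> u \<Longrightarrow> u \<le> 1 \<Longrightarrow>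
      cmod (f (of_real (1 - u) * (c + of_real R * d) + of_real u * (c' + of_real R * d'))) \<le> C * exp (- R)"
  shows "ray_integral c d f = contour_integral (linepath c c') f + ray_integral c' d' f"
    and "ray_integrable c d f" and "ray_integrable c' d' f"
proof -
  have contS: "continuous_on S f"
    using U S(2) holomorphic_on_imp_continuous_on continuous_on_subset by blast
  have int: "ray_integrable c d f" "ray_integrable c' d' f"
    using ray bd[of _ 0] bd[of _ 1]
    by (auto intro!: ray_integrableI[where C = C] continuous_on_subset[OF contS])
  then show "ray_integrable c d f" "ray_integrable c' d' f" .
  obtain F where F: "\<And>z. z \<in> S \<Longrightarrow> (F has_field_derivative f z) (at z within S)"
  proof (rule holomorphic_convex_primitive[of S "{}" f, THEN exE])
    show "\<And>x. x \<in> interior S - {} \<Longrightarrow> f field_differentiable at x"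
      using U S(2) interior_subset holomorphic_on_imp_differentiable_at by blast
  qed (use S contS in auto)
  have lim: "((\<lambda>R. F (c + of_real R * d)) \<longlongrightarrow> F c + ray_integral c d f) at_top"
    if ray: "\<And>t. 0 \<le> t \<Longrightarrow> c + of_real t * d \<in> S" and int: "ray_integrable c d f" for c d
  proof -
    have "set_lebesgue_integral lborel {0..R} (\<lambda>t. f (c + of_real t * d) * d) = F (c + of_real R * d) - F c"
      if "0 \<le> R" for R :: real
    proof -
      have "has_bochner_integral lborel (\<lambda>t. indicator {0..R} t *\<^sub>R (f (c + of_real t * d) * d))
          (F (c + of_real R * d) - F (c + of_real 0 * d))"
      proof (rule has_bochner_integral_FTC_Icc)
        fix t assume t: "0 \<le> t" "t \<le> R"
        have "((\<lambda>t. c + of_real t * d) has_vector_derivative d) (at t within {0..R})"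
          by (auto intro!: derivative_eq_intros)
        moreover have "(F has_field_derivative f (c + of_real t * d))
            (at (c + of_real t * d) within (\<lambda>t. c + of_real t * d) ` {0..R})"
          by (rule DERIV_subset[OF F]) (use ray t in auto)
        ultimately show "((\<lambda>t. F (c + of_real t * d)) has_vector_derivative f (c + of_real t * d) * d) (at t within {0..R})"
          using field_vector_diff_chain_within[of "\<lambda>t. c + of_real t * d" d t "{0..R}" F "f (c + of_real t * d)"]
          by (simp add: o_def mult.commute)
      next
        show "continuous_on {0..R} (\<lambda>t. f (c + of_real t * d) * d)"
          by (intro continuous_intros continuous_on_compose2[OF contS]) (use ray in auto)
      qed (use that in auto)
      then show ?thesis unfolding set_lebesgue_integral_def using has_bochner_integral_integral_eq by fastforce
    qed
    moreover have "((\<lambda>R. set_lebesgue_integral lborel {0..R} (\<lambda>t. f (c + of_real t * d) * d)) \<longlongrightarrow> ray_integral c d f) at_top"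
      unfolding ray_integral_def
      by (rule tendsto_set_lebesgue_integral_at_top) (use int in \<open>auto simp: ray_integrable_def\<close>)
    ultimately have "((\<lambda>R. F (c + of_real R * d) - F c) \<longlongrightarrow> ray_integral c d f) at_top"
      by (rule Lim_transform_eventually[rotated, rotated, OF _ eventually_mono[OF eventually_ge_at_top[of 0]], rotated]) auto
    from tendsto_add[OF tendsto_const[of "F c"] this] show ?thesis by simp
  qed
  have "((\<lambda>R. F (c' + of_real R * d') - F (c + of_real R * d)) \<longlongrightarrow> 0) at_top"
  proof (rule Lim_null_comparison)
    have C: "0 \<le> C" using bd[of 0 0] by (simp add: order_trans[OF norm_ge_zero])
    show "\<forall>\<^sub>F R in at_top. norm (F (c' + of_real R * d') - F (c + of_real R * d))
        \<le> C * exp (- R) * (cmod (c' - c) + R * cmod (d' - d))"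
    proof (rule eventually_mono[OF eventually_ge_at_top[of 0]])
      fix R :: real assume R: "0 \<le> R"
      let ?p = "c + of_real R * d" and ?q = "c' + of_real R * d'"
      have sub: "closed_segment ?p ?q \<subseteq> S"
        using S(1) ray R by (simp add: closed_segment_subset)
      have "norm (F ?q - F ?p) \<le> C * exp (- R) * norm (?q - ?p)"
      proof (rule field_differentiable_bound[of "closed_segment ?p ?q" F f])
        fix z assume z: "z \<in> closed_segment ?p ?q"
        then show "(F has_field_derivative f z) (at z within closed_segment ?p ?q)"
          using sub by (intro DERIV_subset[OF F]) auto
        from z obtain u where "0 \<le> u" "u \<le> 1" "z = (1 - u) *\<^sub>R ?p + u *\<^sub>R ?q"
          by (auto simp: in_segment)
        then show "norm (f z) \<le> C * exp (- R)"
          using bd[OF R, of u] by (simp add: scaleR_conv_of_real)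
      qed auto
      also have "?q - ?p = (c' - c) + of_real R * (d' - d)" by (simp add: algebra_simps)
      also have "C * exp (- R) * norm ((c' - c) + of_real R * (d' - d)) \<le> C * exp (- R) * (cmod (c' - c) + R * cmod (d' - d))"
        using C R by (intro mult_left_mono order_trans[OF norm_triangle_ineq]) (auto simp: norm_mult)
      finally show "norm (F ?q - F ?p) \<le> C * exp (- R) * (cmod (c' - c) + R * cmod (d' - d))" .
    qed
    have "((\<lambda>R. C * (exp (- R) * cmod (c' - c) + (R / exp R) * cmod (d' - d))) \<longlongrightarrow> C * (0 * cmod (c' - c) + 0 * cmod (d' - d))) at_top"
      using tendsto_power_div_exp_0[of 1]
      by (intro tendsto_intros exp_at_bot[THEN filterlim_compose] filterlim_uminus_at_bot_at_top) simp
    then show "((\<lambda>R. C * exp (- R) * (cmod (c' - c) + R * cmod (d' - d))) \<longlongrightarrow> 0) at_top"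
      by (simp add: exp_minus field_simps)
  qed
  moreover have "((\<lambda>R. F (c' + of_real R * d') - F (c + of_real R * d)) \<longlongrightarrow>
      (F c' + ray_integral c' d' f) - (F c + ray_integral c d f)) at_top"
    using ray int by (intro tendsto_diff lim) auto
  ultimately have "(F c' + ray_integral c' d' f) - (F c + ray_integral c d f) = 0"
    using tendsto_unique trivial_limit_at_top_linorder by blast
  then have "ray_integral c d f = (F c' - F c) + ray_integral c' d' f"
    by (simp add: algebra_simps)
  moreover have "contour_integral (linepath c c') f = F c' - F c"
  proof (rule contour_integral_unique)
    have "closed_segment c c' \<subseteq> S"
      using S(1) ray(1)[of 0] ray(2)[of 0] by (simp add: closed_segment_subset)
    then show "(f has_contour_integral F c' - F c) (linepath c c')"
      using contour_integral_primitive[of S F f "linepath c c'"] F by auto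
  qed
  ultimately show "ray_integral c d f = contour_integral (linepath c c') f + ray_integral c' d' f"
    by simp
qed

section \<open>Decay of exponentials of polynomials along families of rays\<close>

lemma quadratic_le_linear:
  fixes \<delta> M :: real
  assumes "0 < \<delta>"
  shows "\<exists>C. \<forall>R. M * R + M - \<delta> * R\<^sup>2 \<le> C - R"
proof (intro exI allI)
  fix R :: real
  have "0 \<le> (2 * \<delta> * R - (M + 1))\<^sup>2" by simp
  then show "M * R + M - \<delta> * R\<^sup>2 \<le> (M + (M + 1)\<^sup>2 / (4 * \<delta>)) - R"
    using assms by (simp add: field_simps power2_eq_square)
qed

text \<open>Up to R = 1 + A / \<delta> the additive constant is enough; beyond, R \<ge> 1 makes R^n
  at least R^3, and \<delta> R^3 is at least A R^2.\<close>

lemma power_ge_quadratic: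
  fixes \<delta> A R :: real
  assumes "0 < \<delta>" "0 \<le> A" "0 \<le> R" "2 < n"
  shows "A * R\<^sup>2 \<le> \<delta> * R ^ n + A * (1 + A / \<delta>)\<^sup>2"
proof (cases "R \<le> 1 + A / \<delta>")
  case True
  have "A * R\<^sup>2 \<le> A * (1 + A / \<delta>)\<^sup>2"
    using assms True by (intro mult_left_mono power_mono) auto
  moreover have "0 \<le> \<delta> * R ^ n" using assms by simp
  ultimately show ?thesis by simp
next
  case False
  moreover have "0 \<le> A / \<delta>" using assms by simp
  ultimately have R: "1 \<le> R" "A / \<delta> \<le> R" by linarith+
  have "A / \<delta> * R\<^sup>2 \<le> R * R\<^sup>2"
    using R by (intro mult_right_mono) auto
  also have "\<dots> = R ^ 3" by (simp add: power3_eq_cube power2_eq_square)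
  also have "\<dots> \<le> R ^ n" using R assms by (intro power_increasing) auto
  finally have "A * R\<^sup>2 \<le> \<delta> * R ^ n"
    using assms by (simp add: field_simps)
  moreover have "0 \<le> A * (1 + A / \<delta>)\<^sup>2" using assms by simp
  ultimately show ?thesis by simp
qed

lemma power_dominates_linear:
  fixes \<delta> M :: real
  assumes "0 < \<delta>" "0 \<le> M" "2 < n"
  shows "\<exists>C. \<forall>R\<ge>0. M * R\<^sup>2 + M * R + M - \<delta> * R ^ n \<le> C - R"
proof -
  obtain C where C: "\<And>R. M * R + M - 1 * R\<^sup>2 \<le> C - R" using quadratic_le_linear[of 1 M] by auto
  have "M * R\<^sup>2 + M * R + M - \<delta> * R ^ n \<le> C + (M + 1) * (1 + (M + 1) / \<delta>)\<^sup>2 - R" if "0 \<le> R" for R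
    using C[of R] power_ge_quadratic[of \<delta> "M + 1" R n] assms that by (simp add: algebra_simps)
  then show ?thesis by blast
qed

text \<open>A point of the segment at parameter R is k + R e, with k and e convex combinations of
  the vertices and of the directions. The coefficient of R^3 is at most -\<delta>, the rest is
  bounded by M (R^2 + R + 1), and cubic growth wins.\<close>

lemma cubic_decay:
  fixes c3 c2 c1 \<delta> :: real and c d c' d' :: complex
  assumes \<delta>: "0 < \<delta>"
    and lead: "\<And>u. 0 \<le> u \<Longrightarrow> u \<le> 1 \<Longrightarrow> c3 * Re ((of_real (1 - u) * d + of_real u * d') ^ 3) \<le> - \<delta>"
  shows "\<exists>C. \<forall>R u. 0 \<le> R \<longrightarrow> 0 \<le> u \<longrightarrow> u \<le> 1 \<longrightarrow>
    Re ((\<lambda>z. of_real c3 * z ^ 3 + of_real c2 * z\<^sup>2 + of_real c1 * z)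
      (of_real (1 - u) * (c + of_real R * d) + of_real u * (c' + of_real R * d'))) \<le> C - R"
proof -
  define K where "K = cmod c + cmod c'"
  define D where "D = cmod d + cmod d'"
  have KD: "0 \<le> K" "0 \<le> D" by (auto simp: K_def D_def)
  define M where "M = \<bar>c3\<bar> * (K ^ 3 + 3 * K\<^sup>2 * D + 3 * K * D\<^sup>2)
      + \<bar>c2\<bar> * (K\<^sup>2 + 2 * K * D + D\<^sup>2) + \<bar>c1\<bar> * (K + D)"
  have M: "0 \<le> M" using KD by (auto simp: M_def)
  obtain C where C: "\<And>R. 0 \<le> R \<Longrightarrow> M * R\<^sup>2 + M * R + M - \<delta> * R ^ 3 \<le> C - R"
    using power_dominates_linear[OF \<delta> M, of 3] by auto
  show ?thesis
  proof (intro exI allI impI)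
    fix R u :: real assume R: "0 \<le> R" and u: "0 \<le> u" "u \<le> 1"
    define k where "k = of_real (1 - u) * c + of_real u * c'"
    define e where "e = of_real (1 - u) * d + of_real u * d'"
    have nk: "cmod k \<le> K"
    proof -
      have "cmod k \<le> (1 - u) * cmod c + u * cmod c'"
        unfolding k_def using u by (intro order_trans[OF norm_triangle_ineq]) (auto simp: norm_mult simp del: of_real_diff)
      also have "\<dots> \<le> 1 * cmod c + 1 * cmod c'" using u by (intro add_mono mult_right_mono) auto
      finally show ?thesis by (simp add: K_def)
    qed
    have ne: "cmod e \<le> D"
    proof -
      have "cmod e \<le> (1 - u) * cmod d + u * cmod d'"
        unfolding e_def using u by (intro order_trans[OF norm_triangle_ineq]) (auto simp: norm_mult simp del: of_real_diff)
      also have "\<dots> \<le> 1 * cmod d + 1 * cmod d'" using u by (intro add_mono mult_right_mono) auto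
      finally show ?thesis by (simp add: D_def)
    qed
    define z where "z = of_real (1 - u) * (c + of_real R * d) + of_real u * (c' + of_real R * d')"
    have z: "z = k + of_real R * e" by (simp add: z_def k_def e_def algebra_simps)
    define w where "w = of_real c3 * (k ^ 3 + of_real 3 * k\<^sup>2 * e * of_real R + of_real 3 * k * e\<^sup>2 * of_real (R\<^sup>2))
      + of_real c2 * (k\<^sup>2 + of_real 2 * k * e * of_real R + e\<^sup>2 * of_real (R\<^sup>2)) + of_real c1 * (k + e * of_real R)"
    have "of_real c3 * z ^ 3 + of_real c2 * z\<^sup>2 + of_real c1 * z = of_real (R ^ 3) * (of_real c3 * e ^ 3) + w"
      unfolding z w_def by (simp add: power2_eq_square power3_eq_cube algebra_simps)
    then have "Re (of_real c3 * z ^ 3 + of_real c2 * z\<^sup>2 + of_real c1 * z) = R ^ 3 * (c3 * Re (e ^ 3)) + Re w"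
      by (simp del: of_real_power)
    also have "R ^ 3 * (c3 * Re (e ^ 3)) \<le> R ^ 3 * (- \<delta>)"
      using lead[OF u] R unfolding e_def by (intro mult_left_mono) auto
    also have "Re w \<le> M * (R\<^sup>2 + R + 1)"
    proof -
      have "Re w \<le> cmod w" by (rule complex_Re_le_cmod)
      also have "\<dots> \<le> \<bar>c3\<bar> * (cmod k ^ 3 + 3 * (cmod k)\<^sup>2 * cmod e * R + 3 * cmod k * (cmod e)\<^sup>2 * R\<^sup>2)
        + \<bar>c2\<bar> * ((cmod k)\<^sup>2 + 2 * cmod k * cmod e * R + (cmod e)\<^sup>2 * R\<^sup>2) + \<bar>c1\<bar> * (cmod k + cmod e * R)"
        unfolding w_def
        using R by (auto simp: norm_mult norm_power intro!: mult_left_mono norm_triangle_mono)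
      also have "\<dots> \<le> \<bar>c3\<bar> * (K ^ 3 + 3 * K\<^sup>2 * D * R + 3 * K * D\<^sup>2 * R\<^sup>2)
        + \<bar>c2\<bar> * (K\<^sup>2 + 2 * K * D * R + D\<^sup>2 * R\<^sup>2) + \<bar>c1\<bar> * (K + D * R)"
        using nk ne R KD by (intro add_mono mult_left_mono mult_right_mono mult_mono power_mono) auto
      also have "\<dots> \<le> \<bar>c3\<bar> * ((K ^ 3 + 3 * K\<^sup>2 * D + 3 * K * D\<^sup>2) * (R\<^sup>2 + R + 1))
        + \<bar>c2\<bar> * ((K\<^sup>2 + 2 * K * D + D\<^sup>2) * (R\<^sup>2 + R + 1)) + \<bar>c1\<bar> * ((K + D) * (R\<^sup>2 + R + 1))"
        using R KD by (intro add_mono mult_left_mono) (auto simp: algebra_simps intro!: add_nonneg_nonneg)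
      also have "\<dots> = M * (R\<^sup>2 + R + 1)" by (simp add: M_def algebra_simps)
      finally show ?thesis .
    qed
    finally show "Re ((\<lambda>z. of_real c3 * z ^ 3 + of_real c2 * z\<^sup>2 + of_real c1 * z)
      (of_real (1 - u) * (c + of_real R * d) + of_real u * (c' + of_real R * d'))) \<le> C - R"
      using C[OF R] unfolding z_def[symmetric] by (simp add: algebra_simps)
  qed
qed

text \<open>The variant for directions that reach the imaginary axis, where Re (e^3) = 0: the cubic
  coefficient is merely nonpositive, and the coefficient of R^2, which is the quantity in
  \<open>sub\<close>, must supply the decay.\<close>

lemma quadratic_decay:
  fixes c3 c2 c1 \<delta> :: real and c d c' d' :: complex
  assumes \<delta>: "0 < \<delta>"
    and lead: "\<And>u. 0 \<le> u \<Longrightarrow> u \<le> 1 \<Longrightarrow> c3 * Re ((of_real (1 - u) * d + of_real u * d') ^ 3) \<le> 0"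
    and sub: "\<And>u. 0 \<le> u \<Longrightarrow> u \<le> 1 \<Longrightarrow> Re ((of_real (1 - u) * d + of_real u * d')\<^sup>2 *
        (of_real (3 * c3) * (of_real (1 - u) * c + of_real u * c') + of_real c2)) \<le> - \<delta>"
  shows "\<exists>C. \<forall>R u. 0 \<le> R \<longrightarrow> 0 \<le> u \<longrightarrow> u \<le> 1 \<longrightarrow>
    Re ((\<lambda>z. of_real c3 * z ^ 3 + of_real c2 * z\<^sup>2 + of_real c1 * z)
      (of_real (1 - u) * (c + of_real R * d) + of_real u * (c' + of_real R * d'))) \<le> C - R"
proof -
  define K where "K = cmod c + cmod c'"
  define D where "D = cmod d + cmod d'"
  have KD: "0 \<le> K" "0 \<le> D" by (auto simp: K_def D_def)
  define M where "M = \<bar>c3\<bar> * (K ^ 3 + 3 * K\<^sup>2 * D)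
      + \<bar>c2\<bar> * (K\<^sup>2 + 2 * K * D) + \<bar>c1\<bar> * (K + D)"
  have M: "0 \<le> M" using KD by (auto simp: M_def)
  obtain C where C: "\<And>R. M * R + M - \<delta> * R\<^sup>2 \<le> C - R"
    using quadratic_le_linear[OF \<delta>] by auto
  show ?thesis
  proof (intro exI allI impI)
    fix R u :: real assume R: "0 \<le> R" and u: "0 \<le> u" "u \<le> 1"
    define k where "k = of_real (1 - u) * c + of_real u * c'"
    define e where "e = of_real (1 - u) * d + of_real u * d'"
    have nk: "cmod k \<le> K"
    proof -
      have "cmod k \<le> (1 - u) * cmod c + u * cmod c'"
        unfolding k_def using u by (intro order_trans[OF norm_triangle_ineq]) (auto simp: norm_mult simp del: of_real_diff)
      also have "\<dots> \<le> 1 * cmod c + 1 * cmod c'" using u by (intro add_mono mult_right_mono) auto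
      finally show ?thesis by (simp add: K_def)
    qed
    have ne: "cmod e \<le> D"
    proof -
      have "cmod e \<le> (1 - u) * cmod d + u * cmod d'"
        unfolding e_def using u by (intro order_trans[OF norm_triangle_ineq]) (auto simp: norm_mult simp del: of_real_diff)
      also have "\<dots> \<le> 1 * cmod d + 1 * cmod d'" using u by (intro add_mono mult_right_mono) auto
      finally show ?thesis by (simp add: D_def)
    qed
    define z where "z = of_real (1 - u) * (c + of_real R * d) + of_real u * (c' + of_real R * d')"
    have z: "z = k + of_real R * e" by (simp add: z_def k_def e_def algebra_simps)
    define w where "w = of_real c3 * (k ^ 3 + of_real 3 * k\<^sup>2 * e * of_real R)
      + of_real c2 * (k\<^sup>2 + of_real 2 * k * e * of_real R) + of_real c1 * (k + e * of_real R)"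
    have "of_real c3 * z ^ 3 + of_real c2 * z\<^sup>2 + of_real c1 * z
        = of_real (R ^ 3) * (of_real c3 * e ^ 3) + of_real (R\<^sup>2) * (e\<^sup>2 * (of_real (3 * c3) * k + of_real c2)) + w"
      unfolding z w_def by (simp add: power2_eq_square power3_eq_cube algebra_simps)
    then have "Re (of_real c3 * z ^ 3 + of_real c2 * z\<^sup>2 + of_real c1 * z)
        = R ^ 3 * (c3 * Re (e ^ 3)) + R\<^sup>2 * Re (e\<^sup>2 * (of_real (3 * c3) * k + of_real c2)) + Re w"
      by (simp del: of_real_power of_real_mult)
    also have "R ^ 3 * (c3 * Re (e ^ 3)) \<le> R ^ 3 * 0"
      using lead[OF u] R unfolding e_def by (intro mult_left_mono) auto
    also have "R\<^sup>2 * Re (e\<^sup>2 * (of_real (3 * c3) * k + of_real c2)) \<le> R\<^sup>2 * (- \<delta>)"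
      using sub[OF u] R unfolding e_def k_def by (intro mult_left_mono) auto
    also have "Re w \<le> M * (R + 1)"
    proof -
      have "Re w \<le> cmod w" by (rule complex_Re_le_cmod)
      also have "\<dots> \<le> \<bar>c3\<bar> * (cmod k ^ 3 + 3 * (cmod k)\<^sup>2 * cmod e * R)
        + \<bar>c2\<bar> * ((cmod k)\<^sup>2 + 2 * cmod k * cmod e * R) + \<bar>c1\<bar> * (cmod k + cmod e * R)"
        unfolding w_def
        using R by (auto simp: norm_mult norm_power intro!: mult_left_mono norm_triangle_mono)
      also have "\<dots> \<le> \<bar>c3\<bar> * (K ^ 3 + 3 * K\<^sup>2 * D * R)
        + \<bar>c2\<bar> * (K\<^sup>2 + 2 * K * D * R) + \<bar>c1\<bar> * (K + D * R)"
        using nk ne R KD by (intro add_mono mult_left_mono mult_right_mono mult_mono power_mono) auto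
      also have "\<dots> \<le> \<bar>c3\<bar> * ((K ^ 3 + 3 * K\<^sup>2 * D) * (R + 1))
        + \<bar>c2\<bar> * ((K\<^sup>2 + 2 * K * D) * (R + 1)) + \<bar>c1\<bar> * ((K + D) * (R + 1))"
        using R KD by (intro add_mono mult_left_mono) (auto simp: algebra_simps intro!: add_nonneg_nonneg)
      also have "\<dots> = M * (R + 1)" by (simp add: M_def algebra_simps)
      finally show ?thesis .
    qed
    finally show "Re ((\<lambda>z. of_real c3 * z ^ 3 + of_real c2 * z\<^sup>2 + of_real c1 * z)
      (of_real (1 - u) * (c + of_real R * d) + of_real u * (c' + of_real R * d'))) \<le> C - R"
      using C[of R] unfolding z_def[symmetric] by (simp add: algebra_simps)
  qed
qed

text \<open>Separates the integrand into an entire exponential, which gives the decay, and a factor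
  h that is bounded on S and may have poles outside it.\<close>

lemma ray_shift_exp:
  assumes hol: "open U" "h holomorphic_on U" "E holomorphic_on UNIV" and S: "convex S" "S \<subseteq> U"
    and H: "\<And>z. z \<in> S \<Longrightarrow> cmod (h z) \<le> H"
    and ray: "\<And>t. 0 \<le> t \<Longrightarrow> c + of_real t * d \<in> S" "\<And>t. 0 \<le> t \<Longrightarrow> c' + of_real t * d' \<in> S"
    and decay: "\<exists>C. \<forall>R u. 0 \<le> R \<longrightarrow> 0 \<le> u \<longrightarrow> u \<le> 1 \<longrightarrow>
      Re (E (of_real (1 - u) * (c + of_real R * d) + of_real u * (c' + of_real R * d'))) \<le> C - R"
  shows "ray_integral c d (\<lambda>z. exp (E z) * h z)
      = contour_integral (linepath c c') (\<lambda>z. exp (E z) * h z) + ray_integral c' d' (\<lambda>z. exp (E z) * h z)"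
    and "ray_integrable c d (\<lambda>z. exp (E z) * h z)" and "ray_integrable c' d' (\<lambda>z. exp (E z) * h z)"
proof -
  obtain C where C: "\<And>R u. 0 \<le> R \<Longrightarrow> 0 \<le> u \<Longrightarrow> u \<le> 1 \<Longrightarrow>
      Re (E (of_real (1 - u) * (c + of_real R * d) + of_real u * (c' + of_real R * d'))) \<le> C - R"
    using decay by blast
  have holo: "(\<lambda>z. exp (E z) * h z) holomorphic_on U"
    using hol by (intro holomorphic_intros) (auto intro: holomorphic_on_subset)
  have bd: "cmod (exp (E z) * h z) \<le> (exp C * H) * exp (- R)"
    if "0 \<le> R" "0 \<le> u" "u \<le> 1" "z = of_real (1 - u) * (c + of_real R * d) + of_real u * (c' + of_real R * d')" for R u z
  proof -
    have "z \<in> S"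
      using S(1) ray that convexD_alt[of S "c + of_real R * d" "c' + of_real R * d'" u]
      by (simp add: scaleR_conv_of_real)
    then have "cmod (exp (E z) * h z) \<le> exp (C - R) * H"
      unfolding norm_mult using C[OF that(1-3)] H that(4)
      by (intro mult_mono) (auto simp: norm_exp_eq_Re)
    then show ?thesis by (simp add: exp_diff exp_minus field_simps)
  qed
  note * = ray_shift[OF hol(1) holo S ray bd[OF _ _ _ refl]]
  show "ray_integral c d (\<lambda>z. exp (E z) * h z)
      = contour_integral (linepath c c') (\<lambda>z. exp (E z) * h z) + ray_integral c' d' (\<lambda>z. exp (E z) * h z)"
    "ray_integrable c d (\<lambda>z. exp (E z) * h z)" "ray_integrable c' d' (\<lambda>z. exp (E z) * h z)"
    using * by blast+
qed

text \<open>The majorant is a product and is asked for at positive parameters only, so that both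
  rays may start at a common singular point. The integrability of the inner integrals along the
  outer ray is recorded as well; it is what allows sums of integrals to be split.\<close>

lemma ray_fubini:
  fixes f :: "complex \<Rightarrow> complex \<Rightarrow> complex"
  assumes meas: "(\<lambda>x. f (fst x) (snd x)) \<in> borel_measurable borel"
    and AB: "set_integrable lborel {0..} A" "set_integrable lborel {0..} B"
    and bd: "\<And>t t'. 0 < t \<Longrightarrow> 0 < t' \<Longrightarrow> cmod (f (c + of_real t * d) (c' + of_real t' * d')) \<le> A t * B t'"
  shows "ray_integral c d (\<lambda>z. ray_integral c' d' (f z)) = ray_integral c' d' (\<lambda>z'. ray_integral c d (\<lambda>z. f z z'))"
    and "ray_integrable c d (\<lambda>z. ray_integral c' d' (f z))"
    and "ray_integrable c' d' (\<lambda>z'. ray_integral c d (\<lambda>z. f z z'))"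
proof -
  define g where "g = (\<lambda>(t, t'). indicator {0..} t *\<^sub>R (indicator {0..} t' *\<^sub>R (f (c + of_real t * d) (c' + of_real t' * d') * d' * d)))"
  define w where "w = (\<lambda>(t, t'). (indicator {0..} t *\<^sub>R A t) * (indicator {0..} t' *\<^sub>R B t') * (cmod d' * cmod d))"
  have A: "integrable lborel (\<lambda>t. indicator {0..} t *\<^sub>R A t)" and B: "integrable lborel (\<lambda>t. indicator {0..} t *\<^sub>R B t)"
    using AB by (simp_all add: set_integrable_def)
  note [measurable] = borel_measurable_integrable[OF A] borel_measurable_integrable[OF B]
  have "integrable (lborel \<Otimes>\<^sub>M lborel) w"
  proof (rule lborel_pair.Fubini_integrable)
    show "w \<in> borel_measurable (lborel \<Otimes>\<^sub>M lborel)" unfolding w_def by measurable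
    have "norm (w (t, t')) = norm (indicator {0..} t *\<^sub>R A t) * (norm (indicator {0..} t' *\<^sub>R B t') * (cmod d' * cmod d))" for t t'
      unfolding w_def by (simp add: norm_mult abs_mult mult.assoc)
    then have "(\<lambda>t. LBINT t'. norm (w (t, t')))
        = (\<lambda>t. norm (indicator {0..} t *\<^sub>R A t) * ((LBINT t'. norm (indicator {0..} t' *\<^sub>R B t')) * (cmod d' * cmod d)))"
      by (simp only: integral_mult_right_zero integral_mult_left_zero)
    then show "integrable lborel (\<lambda>t. LBINT t'. norm (w (t, t')))"
      using A by (simp only: integrable_mult_left integrable_norm)
    show "AE t in lborel. integrable lborel (\<lambda>t'. w (t, t'))"
      unfolding w_def using B by (auto intro!: AE_I2 integrable_mult_left integrable_mult_right)
  qed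
  moreover have gm: "g \<in> borel_measurable (lborel \<Otimes>\<^sub>M lborel)"
  proof -
    have "(\<lambda>x. (c + of_real (fst x) * d, c' + of_real (snd x) * d')) \<in> (lborel \<Otimes>\<^sub>M lborel) \<rightarrow>\<^sub>M (borel \<Otimes>\<^sub>M borel)"
      by measurable
    from measurable_compose[OF this, of "\<lambda>x. f (fst x) (snd x)" borel] meas
    have [measurable]: "(\<lambda>x. f (c + of_real (fst x) * d) (c' + of_real (snd x) * d')) \<in> borel_measurable (lborel \<Otimes>\<^sub>M lborel)"
      by (simp add: borel_prod)
    show ?thesis unfolding g_def split_beta by measurable
  qed
  moreover have "AE x in lborel \<Otimes>\<^sub>M lborel. norm (g x) \<le> norm (w x)"
  proof -
    have "AE x in lborel \<Otimes>\<^sub>M (lborel :: real measure). fst x \<noteq> (0::real) \<and> snd x \<noteq> 0"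
    proof (rule lborel_pair.AE_pair_measure)
      show "{x \<in> space (lborel \<Otimes>\<^sub>M (lborel :: real measure)). fst x \<noteq> (0::real) \<and> snd x \<noteq> 0}
          \<in> sets (lborel \<Otimes>\<^sub>M lborel)"
        by measurable
    qed (auto intro!: AE_lborel_singleton eventually_mono[OF AE_lborel_singleton[of 0]])
    then show ?thesis
    proof eventually_elim
      case (elim x)
      obtain t t' where x: "x = (t, t')" by (cases x)
      show ?case
      proof (cases "0 < t \<and> 0 < t'")
        case True
        then have "cmod (f (c + of_real t * d) (c' + of_real t' * d')) \<le> A t * B t'" using bd by simp
        then have "cmod (f (c + of_real t * d) (c' + of_real t' * d')) * (cmod d' * cmod d) \<le> \<bar>A t * B t'\<bar> * (cmod d' * cmod d)"
          by (intro mult_right_mono) auto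
        then show ?thesis using True by (simp add: x g_def w_def norm_mult abs_mult mult.assoc)
      qed (use elim x in \<open>auto simp: g_def w_def indicator_def not_less\<close>)
    qed
  qed
  ultimately have gi: "integrable (lborel \<Otimes>\<^sub>M lborel) g"
    by (rule Bochner_Integration.integrable_bound)
  have r1: "(LBINT t'. g (t, t')) = indicator {0..} t *\<^sub>R (ray_integral c' d' (f (c + of_real t * d)) * d)" for t
  proof -
    have "(\<lambda>t'. g (t, t')) = (\<lambda>t'. (indicator {0..} t' *\<^sub>R (f (c + of_real t * d) (c' + of_real t' * d') * d')) * (indicator {0..} t *\<^sub>R d))"
      by (auto simp: g_def scaleR_conv_of_real)
    then show ?thesis
      by (simp only: integral_mult_left_zero integral_scaleR_right ray_integral_def set_lebesgue_integral_def mult_scaleR_right)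
  qed
  have r2: "(LBINT t. g (t, t')) = indicator {0..} t' *\<^sub>R (ray_integral c d (\<lambda>z. f z (c' + of_real t' * d')) * d')" for t'
  proof -
    have "(\<lambda>t. g (t, t')) = (\<lambda>t. (indicator {0..} t *\<^sub>R (f (c + of_real t * d) (c' + of_real t' * d') * d)) * (indicator {0..} t' *\<^sub>R d'))"
      by (auto simp: g_def scaleR_conv_of_real)
    then show ?thesis
      by (simp only: integral_mult_left_zero integral_scaleR_right ray_integral_def set_lebesgue_integral_def mult_scaleR_right)
  qed
  show "ray_integral c d (\<lambda>z. ray_integral c' d' (f z)) = ray_integral c' d' (\<lambda>z'. ray_integral c d (\<lambda>z. f z z'))"
  proof -
    have "ray_integral c d (\<lambda>z. ray_integral c' d' (f z)) = (LBINT t. LBINT t'. g (t, t'))"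
      unfolding r1 ray_integral_def[of c d] set_lebesgue_integral_def ..
    also have "\<dots> = (LBINT t'. LBINT t. g (t, t'))"
      using lborel_pair.Fubini_integral[of "\<lambda>t t'. g (t, t')"] gi by simp
    also have "\<dots> = ray_integral c' d' (\<lambda>z'. ray_integral c d (\<lambda>z. f z z'))"
      unfolding r2 ray_integral_def[of c' d'] set_lebesgue_integral_def ..
    finally show ?thesis .
  qed
  show "ray_integrable c d (\<lambda>z. ray_integral c' d' (f z))"
    using lborel_pair.integrable_fst'[OF gi] unfolding r1 ray_integrable_def set_integrable_def .
  have "integrable (lborel \<Otimes>\<^sub>M lborel) (\<lambda>(x, y). g (y, x))"
    using gi by (simp add: lborel_pair.integrable_product_swap_iff)
  from lborel_pair.integrable_fst'[OF this]
  show "ray_integrable c' d' (\<lambda>z'. ray_integral c d (\<lambda>z. f z z'))"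
    unfolding ray_integrable_def set_integrable_def by (simp add: r2)
qed

section \<open>Deformation of the contours\<close>

definition half_plane :: "real \<Rightarrow> real \<Rightarrow> real \<Rightarrow> complex set" where
  "half_plane \<alpha> \<beta> \<gamma> = {z. \<alpha> * Re z + \<beta> * Im z \<le> \<gamma>}"

lemma mem_half_plane: "z \<in> half_plane \<alpha> \<beta> \<gamma> \<longleftrightarrow> \<alpha> * Re z + \<beta> * Im z \<le> \<gamma>"
  by (simp add: half_plane_def)

lemma half_plane_inner: "half_plane \<alpha> \<beta> \<gamma> = {z. inner (Complex \<alpha> \<beta>) z \<le> \<gamma>}"
  by (simp add: half_plane_def inner_complex_def)

lemma convex_half_plane: "convex (half_plane \<alpha> \<beta> \<gamma>)"
  by (simp add: half_plane_inner convex_halfspace_le)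

lemma closed_half_plane: "closed (half_plane \<alpha> \<beta> \<gamma>)"
  by (simp add: half_plane_inner closed_halfspace_le)

abbreviation cubic :: "real \<Rightarrow> real \<Rightarrow> real \<Rightarrow> complex \<Rightarrow> complex" where
  "cubic c3 c2 c1 \<equiv> (\<lambda>z. of_real c3 * z ^ 3 + of_real c2 * z\<^sup>2 + of_real c1 * z)"

lemma Re_complex_cube: "Re (z ^ 3) = Re z * ((Re z)\<^sup>2 - 3 * (Im z)\<^sup>2)"
  by (simp add: power3_eq_cube power2_eq_square algebra_simps)

text \<open>The directions run from e^(2 pi i s / 3) to i s. On the way (Re e)^2 \<le> 1/4 and (Im
  e)^2 \<ge> 3/4, so Re (e^2) \<le> -1/2, while the cubic part has the right sign but vanishes at
  the end. Hence the condition that the quadratic coefficient A be positive.\<close>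

lemma outer_decay:
  fixes A L :: real
  assumes par: "0 < \<zeta>" "0 < A" "P \<le> 0" and s: "\<bar>s\<bar> = 1"
  shows "\<exists>C. \<forall>R u. 0 \<le> R \<longrightarrow> 0 \<le> u \<longrightarrow> u \<le> 1 \<longrightarrow>
    Re (cubic (- \<zeta>) A L (of_real (1 - u) * (of_real P + of_real R * Complex (-1/2) (s * (sqrt 3 / 2)))
      + of_real u * (0 + of_real R * Complex 0 s))) \<le> C - R"
proof -
  have s2: "s * s = 1" using s by (auto simp: abs_if split: if_splits)
  have s2': "s * (s * x) = x" for x using s2 by (simp add: mult.assoc[symmetric])
  have sq3: "sqrt 3 > 1" by simp
  have lead: "(1 - u)\<^sup>2 / 4 \<le> 1/4 \<and> 3/4 \<le> ((1 - u) * (sqrt 3 / 2) + u)\<^sup>2" if "0 \<le> u" "u \<le> 1" for u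
  proof
    have "(1 - u)\<^sup>2 \<le> 1\<^sup>2" using that by (intro power_mono) auto
    then show "(1 - u)\<^sup>2 / 4 \<le> 1/4" by simp
    have "sqrt 3 \<le> 2" using real_sqrt_le_mono[of 3 4] by simp
    then have "u * (sqrt 3 / 2) \<le> u * 1" using that by (intro mult_left_mono) auto
    then have "sqrt 3 / 2 \<le> (1 - u) * (sqrt 3 / 2) + u"
      using left_diff_distrib[of 1 u "sqrt 3 / 2"] by linarith
    then have "(sqrt 3 / 2)\<^sup>2 \<le> ((1 - u) * (sqrt 3 / 2) + u)\<^sup>2" by (intro power_mono) auto
    then show "3/4 \<le> ((1 - u) * (sqrt 3 / 2) + u)\<^sup>2" by (simp add: power_divide)
  qed
  show ?thesis
  proof (rule quadratic_decay)
    show "0 < A / 2" using par by simp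
    fix u :: real assume u: "0 \<le> u" "u \<le> 1"
    define e where "e = of_real (1 - u) * Complex (-1/2) (s * (sqrt 3 / 2)) + of_real u * Complex 0 s"
    have ReIm: "Re e = - (1 - u) / 2" "Im e = s * ((1 - u) * (sqrt 3 / 2) + u)"
    proof -
      have "Re (of_real (1 - u) * Complex (-1/2) (s * h) + of_real u * Complex 0 s) = - (1 - u) / 2"
        "Im (of_real (1 - u) * Complex (-1/2) (s * h) + of_real u * Complex 0 s) = s * ((1 - u) * h + u)" for h
        by (simp_all add: algebra_simps)
      then show "Re e = - (1 - u) / 2" "Im e = s * ((1 - u) * (sqrt 3 / 2) + u)"
        unfolding e_def by blast+
    qed
    have sq: "(Re e)\<^sup>2 \<le> 1/4" "3/4 \<le> (Im e)\<^sup>2"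
      using lead[OF u] s2 unfolding ReIm
      by (simp_all add: power_mult_distrib power2_eq_square[of s] power_divide power2_commute[of 1])
    have "0 \<le> Re e * ((Re e)\<^sup>2 - 3 * (Im e)\<^sup>2)"
      using u sq by (intro mult_nonpos_nonpos) (auto simp: ReIm(1))
    then show "- \<zeta> * Re (e ^ 3) \<le> 0"
      using par by (simp add: Re_complex_cube mult_nonneg_nonneg)
    have "Re (e\<^sup>2 * (of_real (3 * - \<zeta>) * (of_real (1 - u) * of_real P + of_real u * 0) + of_real A))
        = ((Re e)\<^sup>2 - (Im e)\<^sup>2) * (3 * \<zeta> * (1 - u) * (- P) + A)"
      by (simp add: power2_eq_square algebra_simps)
    also have "\<dots> \<le> (- 1/2) * (3 * \<zeta> * (1 - u) * (- P) + A)"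
      using sq par u by (intro mult_right_mono add_nonneg_nonneg mult_nonneg_nonneg) auto
    also have "\<dots> \<le> - (A / 2)"
    proof -
      have "0 \<le> 3 * \<zeta> * (1 - u) * (- P)" using par u by (intro mult_nonneg_nonneg) auto
      then show ?thesis by simp
    qed
    finally show "Re (e\<^sup>2 * (of_real (3 * - \<zeta>) * (of_real (1 - u) * of_real P + of_real u * 0) + of_real A)) \<le> - (A / 2)" .
  qed
qed

text \<open>The half plane Re z + s Im z \<ge> P, cut at the imaginary axis, contains the ray at P
  and the half axis but no real point to the left of P, where the pole will be. The two segments
  from P to 0 cancel between s = 1 and s = -1.\<close>

lemma outer_wedge_shift:
  fixes A L :: real
  assumes par: "0 < \<zeta>" "0 < A" "P \<le> 0"
    and hol: "open U" "h holomorphic_on U"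
    and sub: "\<And>s. \<bar>s\<bar> = 1 \<Longrightarrow> half_plane 1 0 0 \<inter> half_plane (-1) (- s) (- P) \<subseteq> U"
    and bd: "\<And>s z. \<bar>s\<bar> = 1 \<Longrightarrow> z \<in> half_plane 1 0 0 \<inter> half_plane (-1) (- s) (- P) \<Longrightarrow> cmod (h z) \<le> H"
  defines "g \<equiv> \<lambda>z. exp (cubic (- \<zeta>) A L z) * h z"
  shows "wedge_integral (Complex (-1/2) (- (sqrt 3 / 2))) (of_real P) (Complex (-1/2) (sqrt 3 / 2)) g
      = wedge_integral (- \<i>) 0 \<i> g"
    and "\<bar>s\<bar> = 1 \<Longrightarrow> ray_integrable (of_real P) (Complex (-1/2) (s * (sqrt 3 / 2))) g"
    and "\<bar>s\<bar> = 1 \<Longrightarrow> ray_integrable 0 (Complex 0 s) g"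
proof -
  have *: "ray_integral (of_real P) (Complex (-1/2) (s * (sqrt 3 / 2))) g
        = contour_integral (linepath (of_real P) 0) g + ray_integral 0 (Complex 0 s) g \<and>
      ray_integrable (of_real P) (Complex (-1/2) (s * (sqrt 3 / 2))) g \<and> ray_integrable 0 (Complex 0 s) g"
    if s: "\<bar>s\<bar> = 1" for s
  proof -
    have s2: "s * s = 1" using s by (auto simp: abs_if split: if_splits)
    have s2': "s * (s * x) = x" for x using s2 by (simp add: mult.assoc[symmetric])
    have sq3: "sqrt 3 > 1" by simp
    note decay = outer_decay[OF par s, of L]
    have "of_real P + of_real t * Complex (-1/2) (s * (sqrt 3 / 2)) \<in> half_plane 1 0 0 \<inter> half_plane (-1) (- s) (- P)"
      if "0 \<le> t" for t
      using that par s2 sq3 mult_left_mono[of 1 "sqrt 3" t] by (auto simp: mem_half_plane s2' algebra_simps)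
    moreover have "0 + of_real t * Complex 0 s \<in> half_plane 1 0 0 \<inter> half_plane (-1) (- s) (- P)" if "0 \<le> t" for t
      using that par s2 by (auto simp: mem_half_plane s2' algebra_simps)
    moreover have "convex (half_plane 1 0 0 \<inter> half_plane (-1) (- s) (- P))"
      by (intro convex_Int convex_half_plane)
    moreover have "cubic (- \<zeta>) A L holomorphic_on UNIV" by (intro holomorphic_intros)
    ultimately show ?thesis
      using ray_shift_exp[of U h "cubic (- \<zeta>) A L" "half_plane 1 0 0 \<inter> half_plane (-1) (- s) (- P)" H "of_real P"
          "Complex (-1/2) (s * (sqrt 3 / 2))" 0 "Complex 0 s"] hol sub[OF s] bd[OF s] decay
      unfolding g_def by blast
  qed
  have i: "\<i> = Complex 0 1" "- \<i> = Complex 0 (-1)" by (auto simp: complex_eq_iff)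
  show "wedge_integral (Complex (-1/2) (- (sqrt 3 / 2))) (of_real P) (Complex (-1/2) (sqrt 3 / 2)) g
      = wedge_integral (- \<i>) 0 \<i> g"
    unfolding wedge_integral_def i(2) unfolding i(1) using *[of 1] *[of "-1"] by simp
  show "\<bar>s\<bar> = 1 \<Longrightarrow> ray_integrable (of_real P) (Complex (-1/2) (s * (sqrt 3 / 2))) g"
    "\<bar>s\<bar> = 1 \<Longrightarrow> ray_integrable 0 (Complex 0 s) g" using * by blast+
qed

text \<open>With X + i s Y for the combined direction, X \<le> Y and Y^2 \<ge> 3/4 give 3 Y^2 - X^2
  \<ge> 3/2, while X \<ge> 1/2.\<close>

lemma right_cube_bound:
  assumes "\<bar>s\<bar> = 1" "0 \<le> u" "u \<le> (1::real)"
  shows "Re ((of_real (1 - u) * Complex (1/2) (s * (sqrt 3 / 2)) + of_real u * Complex 1 s) ^ 3) \<le> - (3/4)"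
proof -
  have s2: "s * (s * x) = x" for x using assms(1) by (auto simp: abs_if split: if_splits)
  define X where "X = (1 + u) / 2"
  define Y where "Y = (1 - u) * (sqrt 3 / 2) + u"
  have "1 \<le> sqrt 3" by simp
  then have "(1 - u) * (1 / 2) \<le> (1 - u) * (sqrt 3 / 2)" using assms by (intro mult_left_mono) auto
  then have XY: "X \<le> Y" by (simp add: X_def Y_def field_simps)
  have "sqrt 3 \<le> 2" using real_sqrt_le_mono[of 3 4] by simp
  then have "u * (sqrt 3 / 2) \<le> u * 1" using assms by (intro mult_left_mono) auto
  then have "sqrt 3 / 2 \<le> Y"
    using left_diff_distrib[of 1 u "sqrt 3 / 2"] unfolding Y_def by linarith
  then have "(sqrt 3 / 2)\<^sup>2 \<le> Y\<^sup>2" by (intro power_mono) auto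
  then have Y2: "3/4 \<le> Y\<^sup>2" by (simp add: power_divide)
  have X: "1/2 \<le> X" using assms by (simp add: X_def)
  have "X\<^sup>2 \<le> Y\<^sup>2" using XY X by (intro power_mono) auto
  then have "3/2 \<le> 3 * Y\<^sup>2 - X\<^sup>2" using Y2 by simp
  then have "(1/2) * (3/2) \<le> X * (3 * Y\<^sup>2 - X\<^sup>2)" using X by (intro mult_mono) auto
  then have XY3: "X * (X\<^sup>2 - 3 * Y\<^sup>2) \<le> - (3/4)" by (simp add: right_diff_distrib)
  define e where "e = of_real (1 - u) * Complex (1/2) (s * (sqrt 3 / 2)) + of_real u * Complex 1 s"
  have "Re e = X" by (simp add: e_def X_def add_divide_distrib diff_divide_distrib)
  moreover have "Im e = s * Y"
  proof -
    have "(1 - u) * (s * h) + u * s = s * ((1 - u) * h + u)" for h by (simp add: algebra_simps)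
    from this[of "sqrt 3 / 2"] show ?thesis by (simp add: e_def Y_def)
  qed
  moreover have "s\<^sup>2 = 1" using s2[of 1] by (simp add: power2_eq_square)
  ultimately have "Re (e ^ 3) = X * (X\<^sup>2 - 3 * Y\<^sup>2)"
    by (simp add: Re_complex_cube power_mult_distrib)
  then show ?thesis using XY3 by (simp add: e_def)
qed

lemma left_cube_bound:
  assumes "\<bar>s\<bar> = 1" "0 \<le> u" "u \<le> (1::real)"
  shows "Re ((of_real (1 - u) * Complex (-2) s + of_real u * (-1)) ^ 3) \<le> - 1"
proof -
  have s2: "s * (s * x) = x" for x using assms(1) by (auto simp: abs_if split: if_splits)
  have "Re ((of_real (1 - u) * Complex (-2) s + of_real u * (-1)) ^ 3)
      = - ((2 - u) * ((2 - u)\<^sup>2 - 3 * (1 - u)\<^sup>2))"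
    unfolding Re_complex_cube by (simp add: power2_eq_square s2 algebra_simps)
  moreover have "1 \<le> (2 - u)\<^sup>2 - 3 * (1 - u)\<^sup>2"
  proof -
    have "0 \<le> 2 * u * (1 - u)" using assms by simp
    then show ?thesis by (simp add: power2_eq_square algebra_simps)
  qed
  then have "1 * 1 \<le> (2 - u) * ((2 - u)\<^sup>2 - 3 * (1 - u)\<^sup>2)" using assms by (intro mult_mono) auto
  ultimately show ?thesis by simp
qed

lemma right_decay:
  fixes A L :: real
  assumes par: "0 < \<zeta>" and s: "\<bar>s\<bar> = 1"
  shows "\<exists>C. \<forall>R u. 0 \<le> R \<longrightarrow> 0 \<le> u \<longrightarrow> u \<le> 1 \<longrightarrow>
      Re (cubic \<zeta> A L (of_real (1 - u) * (of_real Q + of_real R * Complex (1/2) (s * (sqrt 3 / 2)))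
        + of_real u * (0 + of_real R * Complex 1 s))) \<le> C - R"
proof (rule cubic_decay)
  show "0 < \<zeta> * (3/4)" using par by simp
  fix u :: real assume u: "0 \<le> u" "u \<le> 1"
  show "\<zeta> * Re ((of_real (1 - u) * Complex (1/2) (s * (sqrt 3 / 2)) + of_real u * Complex 1 s) ^ 3) \<le> - (\<zeta> * (3/4))"
    using mult_left_mono[OF right_cube_bound[OF s u], of \<zeta>] par by linarith
qed

text \<open>The case of a pole to the left of Q: the whole contour moves to 0 inside Re z \<ge> Q
  without meeting it, and no left wedge appears.\<close>

lemma right_wedge_shift:
  fixes A L :: real
  assumes par: "0 < \<zeta>" "Q \<le> 0"
    and hol: "open U" "h holomorphic_on U" and sub: "half_plane (-1) 0 (- Q) \<subseteq> U"
    and bd: "\<And>z. z \<in> half_plane (-1) 0 (- Q) \<Longrightarrow> cmod (h z) \<le> H"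
  defines "g \<equiv> \<lambda>z. exp (cubic \<zeta> A L z) * h z"
  shows "wedge_integral (Complex (1/2) (sqrt 3 / 2)) (of_real Q) (Complex (1/2) (- (sqrt 3 / 2))) g
      = wedge_integral (Complex 1 1) 0 (Complex 1 (-1)) g"
    and "\<bar>s\<bar> = 1 \<Longrightarrow> ray_integrable (of_real Q) (Complex (1/2) (s * (sqrt 3 / 2))) g"
    and "\<bar>s\<bar> = 1 \<Longrightarrow> ray_integrable 0 (Complex 1 s) g"
proof -
  have *: "ray_integral (of_real Q) (Complex (1/2) (s * (sqrt 3 / 2))) g
        = contour_integral (linepath (of_real Q) 0) g + ray_integral 0 (Complex 1 s) g \<and>
      ray_integrable (of_real Q) (Complex (1/2) (s * (sqrt 3 / 2))) g \<and> ray_integrable 0 (Complex 1 s) g"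
    if s: "\<bar>s\<bar> = 1" for s
  proof -
    note decay = right_decay[OF par(1) s, where A = A and L = L and Q = Q]
    have "of_real Q + of_real t * Complex (1/2) (s * (sqrt 3 / 2)) \<in> half_plane (-1) 0 (- Q)"
      "0 + of_real t * Complex 1 s \<in> half_plane (-1) 0 (- Q)" if "0 \<le> t" for t
      using that par by (auto simp: mem_half_plane)
    moreover have "cubic \<zeta> A L holomorphic_on UNIV" by (intro holomorphic_intros)
    ultimately show ?thesis
      using ray_shift_exp[of U h "cubic \<zeta> A L" "half_plane (-1) 0 (- Q)" H "of_real Q"
          "Complex (1/2) (s * (sqrt 3 / 2))" 0 "Complex 1 s"] hol sub bd decay convex_half_plane
      unfolding g_def by blast
  qed
  show "wedge_integral (Complex (1/2) (sqrt 3 / 2)) (of_real Q) (Complex (1/2) (- (sqrt 3 / 2))) g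
      = wedge_integral (Complex 1 1) 0 (Complex 1 (-1)) g"
    unfolding wedge_integral_def using *[of 1] *[of "-1"] by simp
  show "\<bar>s\<bar> = 1 \<Longrightarrow> ray_integrable (of_real Q) (Complex (1/2) (s * (sqrt 3 / 2))) g"
    "\<bar>s\<bar> = 1 \<Longrightarrow> ray_integrable 0 (Complex 1 s) g" using * by blast+
qed

text \<open>The inner exponential also decays in the direction -1, so each side of the left wedge
  folds onto the negative real axis, where the two cancel. For this h must have no pole in the
  sector.\<close>

lemma left_wedge_vanishes:
  fixes A L :: real
  assumes par: "0 < \<zeta>"
    and hol: "open U" "h holomorphic_on U" and sub: "half_plane 1 1 0 \<inter> half_plane 1 (-1) 0 \<subseteq> U"
    and bd: "\<And>z. z \<in> half_plane 1 1 0 \<inter> half_plane 1 (-1) 0 \<Longrightarrow> cmod (h z) \<le> H"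
  defines "g \<equiv> \<lambda>z. exp (cubic \<zeta> A L z) * h z"
  shows "wedge_integral (Complex (-2) (-1)) 0 (Complex (-2) 1) g = 0"
    and "\<bar>s\<bar> = 1 \<Longrightarrow> ray_integrable 0 (Complex (-2) s) g"
proof -
  have *: "ray_integral 0 (Complex (-2) s) g = contour_integral (linepath 0 0) g + ray_integral 0 (-1) g \<and>
      ray_integrable 0 (Complex (-2) s) g"
    if s: "\<bar>s\<bar> = 1" for s
  proof -
    have decay: "\<exists>C. \<forall>R u. 0 \<le> R \<longrightarrow> 0 \<le> u \<longrightarrow> u \<le> 1 \<longrightarrow>
      Re (cubic \<zeta> A L (of_real (1 - u) * (0 + of_real R * Complex (-2) s)
        + of_real u * (0 + of_real R * (-1)))) \<le> C - R"
    proof (rule cubic_decay[OF par])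
      fix u :: real assume u: "0 \<le> u" "u \<le> 1"
      show "\<zeta> * Re ((of_real (1 - u) * Complex (-2) s + of_real u * (-1)) ^ 3) \<le> - \<zeta>"
        using mult_left_mono[OF left_cube_bound[OF s u], of \<zeta>] par by linarith
    qed
    have "0 + of_real t * Complex (-2) s \<in> half_plane 1 1 0 \<inter> half_plane 1 (-1) 0"
      "0 + of_real t * (-1) \<in> half_plane 1 1 0 \<inter> half_plane 1 (-1) 0" if "0 \<le> t" for t
      using that s by (auto simp: mem_half_plane abs_if split: if_splits)
    moreover have "cubic \<zeta> A L holomorphic_on UNIV" by (intro holomorphic_intros)
    moreover have "convex (half_plane 1 1 0 \<inter> half_plane 1 (-1) 0)"
      by (intro convex_Int convex_half_plane)
    ultimately show ?thesis
      using ray_shift_exp[of U h "cubic \<zeta> A L" "half_plane 1 1 0 \<inter> half_plane 1 (-1) 0" H 0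
          "Complex (-2) s" 0 "-1"] hol sub bd decay
      unfolding g_def by blast
  qed
  show "wedge_integral (Complex (-2) (-1)) 0 (Complex (-2) 1) g = 0"
    unfolding wedge_integral_def using *[of 1] *[of "-1"] by simp
  show "\<bar>s\<bar> = 1 \<Longrightarrow> ray_integrable 0 (Complex (-2) s) g" using * by blast
qed

text \<open>The contour through \<open>Q\<close> to the left of the pole \<open>b\<close> is opened to the wedges to the right and to the
  left of \<open>0\<close>. In the upper and in the lower half plane, \<open>N\<close> is a point on the ray from \<open>0\<close> that lies
  above (below) \<open>Q\<close>.\<close>

lemma inner_wedge_split:
  fixes A L :: real
  assumes par: "0 < \<zeta>" "Q < 0"
    and hol: "open U" "h holomorphic_on U"
    and sub: "\<And>s. \<bar>s\<bar> = 1 \<Longrightarrow> half_plane 1 (- s) Q \<subseteq> U" "\<And>s. \<bar>s\<bar> = 1 \<Longrightarrow> half_plane (-1) (- 2 * s) 0 \<subseteq> U"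
    and bd: "\<And>s z. \<bar>s\<bar> = 1 \<Longrightarrow> z \<in> half_plane 1 (- s) Q \<Longrightarrow> cmod (h z) \<le> H"
      "\<And>s z. \<bar>s\<bar> = 1 \<Longrightarrow> z \<in> half_plane (-1) (- 2 * s) 0 \<Longrightarrow> cmod (h z) \<le> H"
  defines "g \<equiv> \<lambda>z. exp (cubic \<zeta> A L z) * h z"
  shows "wedge_integral (Complex (1/2) (sqrt 3 / 2)) (of_real Q) (Complex (1/2) (- (sqrt 3 / 2))) g
      = wedge_integral (Complex 1 1) 0 (Complex 1 (-1)) g + wedge_integral (Complex (-2) (-1)) 0 (Complex (-2) 1) g"
    and "\<bar>s\<bar> = 1 \<Longrightarrow> ray_integrable (of_real Q) (Complex (1/2) (s * (sqrt 3 / 2))) g"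
    and "\<bar>s\<bar> = 1 \<Longrightarrow> ray_integrable 0 (Complex 1 s) g"
    and "\<bar>s\<bar> = 1 \<Longrightarrow> ray_integrable 0 (Complex (-2) s) g"
proof -
  have *: "ray_integral (of_real Q) (Complex (1/2) (s * (sqrt 3 / 2))) g + ray_integral 0 (Complex (-2) s) g
        = ray_integral 0 (Complex 1 s) g + ray_integral (of_real Q) (-1) g \<and>
      ray_integrable (of_real Q) (Complex (1/2) (s * (sqrt 3 / 2))) g \<and> ray_integrable 0 (Complex 1 s) g \<and>
      ray_integrable 0 (Complex (-2) s) g"
    if s: "\<bar>s\<bar> = 1" for s
  proof -
    have s2: "s * s = 1" using s by (auto simp: abs_if split: if_splits)
    have s2': "s * (s * x) = x" for x using s2 by (simp add: mult.assoc[symmetric])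
    define N where "N = Complex Q (- (s * Q) / 2)"
    define q where "q = Complex (1/2) (s * (sqrt 3 / 2))"
    define l where "l = Complex (-2) s"
    have E: "cubic \<zeta> A L holomorphic_on UNIV" by (intro holomorphic_intros)
    have "1 \<le> sqrt 3" by simp
    have q3: "Re (q ^ 3) = - 1"
      by (simp add: q_def power3_eq_cube s2' algebra_simps)
    have l3: "Re (l ^ 3) = - 2"
      by (simp add: l_def power3_eq_cube s2' algebra_simps)
    have ray: "of_real Q + of_real t * q \<in> half_plane 1 (- s) Q" "N + of_real t * q \<in> half_plane 1 (- s) Q"
      "N + of_real t * l \<in> half_plane 1 (- s) Q" "of_real Q + of_real t * (-1) \<in> half_plane 1 (- s) Q"
      "N + of_real t * q \<in> half_plane (-1) (- 2 * s) 0" "0 + of_real t * Complex 1 s \<in> half_plane (-1) (- 2 * s) 0"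
      "0 + of_real t * l \<in> half_plane (-1) (- 2 * s) 0" "N + of_real t * l \<in> half_plane (-1) (- 2 * s) 0"
      if "0 \<le> t" for t
    proof -
      define k where "k = t * (sqrt 3 / 2)"
      have k: "t \<le> 2 * k" using mult_left_mono[OF \<open>1 \<le> sqrt 3\<close> that] by (simp add: k_def)
      have qt: "Re (of_real t * q) = t / 2" "Im (of_real t * q) = s * k"
        by (simp_all add: q_def k_def mult.left_commute)
      have lt: "Re (of_real t * l) = - 2 * t" "Im (of_real t * l) = s * t"
        by (simp_all add: l_def mult.commute)
      have NR: "Re N = Q" "Im N = - (s * Q) / 2" by (simp_all add: N_def)
      have "s = 1 \<or> s = - 1" using s by auto
      then show "of_real Q + of_real t * q \<in> half_plane 1 (- s) Q" "N + of_real t * q \<in> half_plane 1 (- s) Q"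
        "N + of_real t * l \<in> half_plane 1 (- s) Q" "of_real Q + of_real t * (-1) \<in> half_plane 1 (- s) Q"
        "N + of_real t * q \<in> half_plane (-1) (- 2 * s) 0" "0 + of_real t * Complex 1 s \<in> half_plane (-1) (- 2 * s) 0"
        "0 + of_real t * l \<in> half_plane (-1) (- 2 * s) 0" "N + of_real t * l \<in> half_plane (-1) (- 2 * s) 0"
        unfolding mem_half_plane plus_complex.simps qt lt NR using that par k by auto
    qed
    have conv: "of_real (1 - u) * d + of_real u * d = d" for u :: real and d :: complex
      by (simp add: left_diff_distrib)
    have lead: "\<zeta> * Re ((of_real (1 - u) * q + of_real u * q) ^ 3) \<le> - \<zeta>"
      "\<zeta> * Re ((of_real (1 - u) * l + of_real u * l) ^ 3) \<le> - \<zeta>" for u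
      using par unfolding conv q3 l3 by auto
    have lead': "\<zeta> * Re ((of_real (1 - u) * l + of_real u * (-1)) ^ 3) \<le> - \<zeta>"
      "\<zeta> * Re ((of_real (1 - u) * q + of_real u * Complex 1 s) ^ 3) \<le> - (\<zeta> * (3/4))"
      if "0 \<le> u" "u \<le> 1" for u
      using mult_left_mono[OF left_cube_bound[OF s that], of \<zeta>]
        mult_left_mono[OF right_cube_bound[OF s that], of \<zeta>] par unfolding l_def q_def by simp_all
    have 34: "0 < \<zeta> * (3/4)" using par by simp
    \<comment> \<open>The union of the two half planes is not convex, so every shift passes through
      N, which lies in both. The right-going rays move from Q over N to 0, the left-going ones from
      0 over N to Q. The segments cancel, and what remains at Q is the ray along the negative axis,
      the same for s = 1 and s = -1.\<close>
    have 1: "ray_integral (of_real Q) q g = contour_integral (linepath (of_real Q) N) g + ray_integral N q g"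
      "ray_integrable (of_real Q) q g" "ray_integrable N q g"
      using ray_shift_exp[of U h "cubic \<zeta> A L" "half_plane 1 (- s) Q" H "(of_real Q)" "q" "N" "q"]
        hol E convex_half_plane sub(1)[OF s] bd(1)[OF s] ray(1,2) cubic_decay[OF par(1) lead(1), where c = "(of_real Q)" and c' = "N", of A L]
      unfolding g_def by blast+
    have 2: "ray_integral N l g = contour_integral (linepath N (of_real Q)) g + ray_integral (of_real Q) (-1) g"
      "ray_integrable N l g" "ray_integrable (of_real Q) (-1) g"
      using ray_shift_exp[of U h "cubic \<zeta> A L" "half_plane 1 (- s) Q" H "N" "l" "(of_real Q)" "(-1)"]
        hol E convex_half_plane sub(1)[OF s] bd(1)[OF s] ray(3,4) cubic_decay[OF par(1) lead'(1), where c = "N" and c' = "(of_real Q)", of A L]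
      unfolding g_def by blast+
    have 3: "ray_integral N q g = contour_integral (linepath N 0) g + ray_integral 0 (Complex 1 s) g"
      "ray_integrable N q g" "ray_integrable 0 (Complex 1 s) g"
      using ray_shift_exp[of U h "cubic \<zeta> A L" "half_plane (-1) (- 2 * s) 0" H "N" "q" "0" "(Complex 1 s)"]
        hol E convex_half_plane sub(2)[OF s] bd(2)[OF s] ray(5,6) cubic_decay[OF 34 lead'(2), where c = "N" and c' = "0", of A L]
      unfolding g_def by blast+
    have 4: "ray_integral 0 l g = contour_integral (linepath 0 N) g + ray_integral N l g"
      "ray_integrable 0 l g" "ray_integrable N l g"
      using ray_shift_exp[of U h "cubic \<zeta> A L" "half_plane (-1) (- 2 * s) 0" H "0" "l" "N" "l"]
        hol E convex_half_plane sub(2)[OF s] bd(2)[OF s] ray(7,8) cubic_decay[OF par(1) lead(2), where c = "0" and c' = "N", of A L]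
      unfolding g_def by blast+
    have cont: "continuous_on U g"
      unfolding g_def using hol
      by (intro holomorphic_on_imp_continuous_on holomorphic_intros) (auto intro: holomorphic_on_subset)
    have QN: "closed_segment (of_real Q) N \<subseteq> U"
      using sub(1)[OF s] ray(1)[of 0] ray(2)[of 0] closed_segment_subset[OF _ _ convex_half_plane, of "of_real Q" 1 "-s" Q N] by auto
    have N0: "closed_segment N 0 \<subseteq> U"
      using sub(2)[OF s] ray(5)[of 0] ray(6)[of 0] closed_segment_subset[OF _ _ convex_half_plane, of N "- 1" "- 2 * s" 0 0] by auto
    have "contour_integral (linepath N (of_real Q)) g = - contour_integral (linepath (of_real Q) N) g"
      using contour_integral_reverse_linepath[OF continuous_on_subset[OF cont QN]] by simp
    moreover have "contour_integral (linepath 0 N) g = - contour_integral (linepath N 0) g"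
      using contour_integral_reverse_linepath[OF continuous_on_subset[OF cont N0]] by simp
    ultimately have "ray_integral (of_real Q) q g + ray_integral 0 l g
        = ray_integral 0 (Complex 1 s) g + ray_integral (of_real Q) (-1) g"
      unfolding 1(1) 3(1) 4(1) 2(1) by simp
    then show ?thesis using 1(2) 3(3) 4(2) unfolding q_def l_def by blast
  qed
  show "wedge_integral (Complex (1/2) (sqrt 3 / 2)) (of_real Q) (Complex (1/2) (- (sqrt 3 / 2))) g
      = wedge_integral (Complex 1 1) 0 (Complex 1 (-1)) g + wedge_integral (Complex (-2) (-1)) 0 (Complex (-2) 1) g"
    unfolding wedge_integral_def using *[of 1] *[of "-1"] by (simp add: algebra_simps)
  show "\<bar>s\<bar> = 1 \<Longrightarrow> ray_integrable (of_real Q) (Complex (1/2) (s * (sqrt 3 / 2))) g"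
    "\<bar>s\<bar> = 1 \<Longrightarrow> ray_integrable 0 (Complex 1 s) g"
    "\<bar>s\<bar> = 1 \<Longrightarrow> ray_integrable 0 (Complex (-2) s) g" using * by blast+
qed

lemma wedge_fubini:
  fixes f :: "complex \<Rightarrow> complex \<Rightarrow> complex"
  assumes meas: "(\<lambda>x. f (fst x) (snd x)) \<in> borel_measurable borel"
    and AB: "set_integrable lborel {0..} A" "set_integrable lborel {0..} B"
    and bd: "\<And>d d' t t'. d \<in> {d1, d2} \<Longrightarrow> d' \<in> {d1', d2'} \<Longrightarrow> 0 < t \<Longrightarrow> 0 < t' \<Longrightarrow>
      cmod (f (c + of_real t * d) (c' + of_real t' * d')) \<le> A t * B t'"
  shows "wedge_integral d1 c d2 (\<lambda>z. wedge_integral d1' c' d2' (f z))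
      = wedge_integral d1' c' d2' (\<lambda>z'. wedge_integral d1 c d2 (\<lambda>z. f z z'))"
    and "d \<in> {d1, d2} \<Longrightarrow> ray_integrable c d (\<lambda>z. wedge_integral d1' c' d2' (f z))"
proof -
  note F = ray_fubini[OF meas AB, of c _ c']
  have I1: "ray_integrable c d (\<lambda>z. ray_integral c' d' (f z))"
    and I2: "ray_integrable c' d' (\<lambda>z'. ray_integral c d (\<lambda>z. f z z'))"
    and E: "ray_integral c d (\<lambda>z. ray_integral c' d' (f z)) = ray_integral c' d' (\<lambda>z'. ray_integral c d (\<lambda>z. f z z'))"
    if "d \<in> {d1, d2}" "d' \<in> {d1', d2'}" for d d'
    using F[of d d'] bd[OF that] by blast+
  show "d \<in> {d1, d2} \<Longrightarrow> ray_integrable c d (\<lambda>z. wedge_integral d1' c' d2' (f z))"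
    unfolding wedge_integral_def by (intro ray_integrable_diff I1) auto
  have "wedge_integral d1 c d2 (\<lambda>z. wedge_integral d1' c' d2' (f z))
      = (ray_integral c d2 (\<lambda>z. ray_integral c' d2' (f z)) - ray_integral c d2 (\<lambda>z. ray_integral c' d1' (f z)))
        - (ray_integral c d1 (\<lambda>z. ray_integral c' d2' (f z)) - ray_integral c d1 (\<lambda>z. ray_integral c' d1' (f z)))"
    unfolding wedge_integral_def by (simp add: ray_integral_diff I1)
  also have "\<dots> = wedge_integral d1' c' d2' (\<lambda>z'. wedge_integral d1 c d2 (\<lambda>z. f z z'))"
    unfolding wedge_integral_def by (simp add: ray_integral_diff I2 E)
  finally show "wedge_integral d1 c d2 (\<lambda>z. wedge_integral d1' c' d2' (f z))
      = wedge_integral d1' c' d2' (\<lambda>z'. wedge_integral d1 c d2 (\<lambda>z. f z z'))" .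
qed

lemma wedge_integral_cong:
  assumes "\<And>d t. d \<in> {d1, d2} \<Longrightarrow> 0 < t \<Longrightarrow> f (c + of_real t * d) = g (c + of_real t * d)"
  shows "wedge_integral d1 c d2 f = wedge_integral d1 c d2 g"
  unfolding wedge_integral_def using assms by (intro arg_cong2[where f = "(-)"] ray_integral_cong) auto

lemma wedge_integral_mult: "wedge_integral d1 c d2 (\<lambda>z. k * f z) = k * wedge_integral d1 c d2 f"
  by (simp add: wedge_integral_def ray_integral_mult right_diff_distrib)

lemma wedge_integral_add:
  assumes "\<And>d. d \<in> {d1, d2} \<Longrightarrow> ray_integrable c d f" "\<And>d. d \<in> {d1, d2} \<Longrightarrow> ray_integrable c d g"
  shows "wedge_integral d1 c d2 (\<lambda>z. f z + g z) = wedge_integral d1 c d2 f + wedge_integral d1 c d2 g"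
  using assms by (simp add: wedge_integral_def ray_integral_add)

lemma wedge_integral_sum:
  assumes "finite I" "\<And>i d. i \<in> I \<Longrightarrow> d \<in> {d1, d2} \<Longrightarrow> ray_integrable c d (f i)"
  shows "wedge_integral d1 c d2 (\<lambda>z. \<Sum>i\<in>I. f i z) = (\<Sum>i\<in>I. wedge_integral d1 c d2 (f i))"
  using assms by (simp add: wedge_integral_def ray_integral_sum sum_subtractf)

section \<open>Decoupling the two variables\<close>

lemma inverse_bounded_on:
  assumes "closed S" "(w::complex) \<notin> S"
  shows "\<exists>H. \<forall>z\<in>S. cmod (1 / (z - w)) \<le> H"
proof -
  obtain d where d: "0 < d" "\<And>z. z \<in> S \<Longrightarrow> d \<le> dist w z"
    using separate_point_closed[OF assms] by blast
  have "cmod (1 / (z - w)) \<le> 1 / d" if "z \<in> S" for z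
    using d(2)[OF that] d(1) by (simp add: norm_divide dist_norm norm_minus_commute frac_le)
  then show ?thesis by blast
qed

text \<open>Normalised to 1 at the critical point 0. The constants a/b and b/a by which
  \<open>moebius a b z\<close> and \<open>moebius b a z'\<close> differ from the quotients in the
  Airy kernel cancel in their product.\<close>

definition moebius :: "complex \<Rightarrow> complex \<Rightarrow> complex \<Rightarrow> complex" where
  "moebius a b z = (1 - z / b) / (1 - z / a)"

text \<open>The map equals (a/b) (1 + (a - b) / (z - a)), so on S it is controlled by the distance
  of S from a.\<close>

lemma moebius_bounded_on:
  assumes "closed S" "a \<notin> S" and nz: "a \<noteq> 0" "b \<noteq> 0"
  shows "\<exists>H. \<forall>z\<in>S. cmod (moebius a b z ^ k / (1 - z / a)) \<le> H"
proof -
  obtain H where H: "\<And>z. z \<in> S \<Longrightarrow> cmod (1 / (z - a)) \<le> H"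
    using inverse_bounded_on[OF assms(1,2)] by blast
  have "cmod (moebius a b z ^ k / (1 - z / a)) \<le> (cmod (a / b) * (1 + cmod (a - b) * H)) ^ k * (cmod a * H)"
    if z: "z \<in> S" for z
  proof -
    have za: "z \<noteq> a" using z assms(2) by blast
    have inv: "1 / (1 - z / a) = - a * (1 / (z - a))" using za nz by (simp add: field_simps)
    have "moebius a b z = (a / b) * (1 + (a - b) * (1 / (z - a)))"
      using za nz by (simp add: moebius_def divide_simps) (simp add: algebra_simps)
    then have "cmod (moebius a b z) = cmod (a / b) * cmod (1 + (a - b) * (1 / (z - a)))"
      by (simp only: norm_mult)
    also have "\<dots> \<le> cmod (a / b) * (1 + cmod (a - b) * H)"
      by (intro mult_left_mono order_trans[OF norm_triangle_ineq] add_mono)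
         (use mult_left_mono[OF H[OF z], of "cmod (a - b)"] in \<open>auto simp: norm_mult norm_divide\<close>)
    finally have "cmod (moebius a b z) \<le> cmod (a / b) * (1 + cmod (a - b) * H)" .
    moreover have "cmod (1 / (1 - z / a)) \<le> cmod a * H"
      unfolding inv norm_mult using H[OF z] by (simp add: mult_left_mono)
    moreover have "0 \<le> H" using H[OF z] norm_ge_zero order_trans by blast
    ultimately have "cmod (moebius a b z) ^ k * cmod (1 / (1 - z / a))
        \<le> (cmod (a / b) * (1 + cmod (a - b) * H)) ^ k * (cmod a * H)"
      by (intro mult_mono power_mono) auto
    then show ?thesis by (simp add: norm_mult norm_power norm_divide)
  qed
  then show ?thesis by blast
qed

lemma moebius_holomorphic:
  "a \<noteq> 0 \<Longrightarrow> (\<lambda>z. moebius a b z ^ k / (1 - z / a)) holomorphic_on - {a}"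
  unfolding moebius_def by (intro holomorphic_intros) (auto simp: field_simps)

text \<open>Since \<rho> - 1 = (z - z') (1/a - 1/b) / ((1 - z/a) (1 - z'/b)), the geometric sum of
  the powers of \<rho> loses the pole at z = z'. In its summands z and z' are independent, and the
  term \<open>1 / (z - z')\<close> left over does not involve a and b.\<close>

lemma moebius_power_split:
  assumes "a \<noteq> 0" "b \<noteq> 0" "z \<noteq> a" "z' \<noteq> b" "z \<noteq> z'"
  shows "(moebius a b z * moebius b a z') ^ m / (z - z') =
    (1 / a - 1 / b) * (\<Sum>k<m. (moebius a b z ^ k / (1 - z / a)) * (moebius b a z' ^ k / (1 - z' / b))) + 1 / (z - z')"
proof -
  define \<rho> where "\<rho> = moebius a b z * moebius b a z'"
  have nz: "1 - z / a \<noteq> 0" "1 - z' / b \<noteq> 0" using assms by (auto simp: field_simps)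
  have "\<rho> - 1 = ((1 - z / b) * (1 - z' / a) - (1 - z / a) * (1 - z' / b)) / ((1 - z / a) * (1 - z' / b))"
  proof -
    have "A * B / (C * D) - 1 = (A * B - C * D) / (C * D)" if "C \<noteq> 0" "D \<noteq> 0" for A B C D :: complex
      using that by (simp add: field_simps)
    from this[OF nz] show ?thesis by (simp add: \<rho>_def moebius_def)
  qed
  also have "(1 - z / b) * (1 - z' / a) - (1 - z / a) * (1 - z' / b) = (z - z') * (1 / a - 1 / b)"
    by (simp add: algebra_simps diff_divide_distrib)
  finally have \<rho>1: "\<rho> - 1 = (z - z') * (1 / a - 1 / b) / ((1 - z / a) * (1 - z' / b))" .
  have "\<rho> ^ m = (\<rho> - 1) * (\<Sum>k<m. \<rho> ^ k) + 1"
    using power_diff_1_eq[of \<rho> m] by (simp add: algebra_simps)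
  then have "\<rho> ^ m / (z - z') = (\<rho> - 1) / (z - z') * (\<Sum>k<m. \<rho> ^ k) + 1 / (z - z')"
    by (simp add: add_divide_distrib)
  also have "(\<rho> - 1) / (z - z') = (1 / a - 1 / b) * (1 / ((1 - z / a) * (1 - z' / b)))"
    using assms(5) by (simp add: \<rho>1)
  also have "(1 / a - 1 / b) * (1 / ((1 - z / a) * (1 - z' / b))) * (\<Sum>k<m. \<rho> ^ k)
      = (1 / a - 1 / b) * (\<Sum>k<m. (moebius a b z ^ k / (1 - z / a)) * (moebius b a z' ^ k / (1 - z' / b)))"
    by (simp add: sum_distrib_left \<rho>_def power_mult_distrib mult.assoc)
  finally show ?thesis by (simp add: \<rho>_def)
qed

text \<open>The squared distance is at least t'^2 + (t - t')^2, because |x| \<ge> 1, and this is at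
  least t t' / 4. The resulting bound 2 / sqrt(t t') for 1 / |z - z'| is a product of functions
  integrable near 0, as Fubini and dominated convergence require.\<close>

lemma ray_separation:
  assumes "\<bar>s\<bar> = 1" "\<bar>s'\<bar> = 1" "1 \<le> \<bar>x\<bar>" "0 \<le> t" "0 \<le> (t'::real)"
  shows "sqrt (t * t') / 2 \<le> cmod (of_real t * Complex 0 s - of_real t' * Complex x s')"
proof (rule power2_le_imp_le)
  \<comment> \<open>Completing the square: t^2 - (9/4) t t' + 2 t'^2 = (t - (9/8) t')^2 + (2 -
    81/64) t'^2.\<close>
  have "t * t' / 4 \<le> (t - 9/8 * t')\<^sup>2 + (2 - 81/64) * t'\<^sup>2 + t * t' / 4"
    by simp
  also have "\<dots> = t'\<^sup>2 + (t - t')\<^sup>2" by (simp add: power2_eq_square algebra_simps)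
  also have "\<dots> \<le> (t' * x)\<^sup>2 + (t * s - t' * s')\<^sup>2"
  proof (rule add_mono)
    have "1 \<le> x\<^sup>2" using assms(3) by (metis abs_ge_zero abs_le_square_iff abs_one one_power2)
    then show "t'\<^sup>2 \<le> (t' * x)\<^sup>2" by (simp add: power_mult_distrib mult_le_cancel_left1)
    have "0 \<le> t * t'" using assms by simp
    then show "(t - t')\<^sup>2 \<le> (t * s - t' * s')\<^sup>2"
      using assms(1,2) by (auto simp: abs_if power2_eq_square algebra_simps split: if_splits)
  qed
  also have "\<dots> = (cmod (of_real t * Complex 0 s - of_real t' * Complex x s'))\<^sup>2"
    by (simp add: cmod_power2 algebra_simps)
  finally show "(sqrt (t * t') / 2)\<^sup>2 \<le> (cmod (of_real t * Complex 0 s - of_real t' * Complex x s'))\<^sup>2"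
    using assms by (simp add: power_divide)
qed simp

text \<open>The old wedges have their vertices P and Q in the gap between the poles a and b; the new
  ones all meet at 0, to the right of b. After \<open>moebius_power_split\<close> the products are
  moved factor by factor and collected in \<open>D\<close>. In the remainder \<open>g0\<close> the
  inner wedge becomes the right wedge at 0, its only pole z being left of Q; the outer wedge follows
  with the order of integration reversed; and the left wedge, which encloses no pole, may be added
  because it contributes 0.\<close>

theorem contour_deformation:
  fixes \<zeta> A1 A2 L1 L2 a b :: real and m :: nat
  assumes par: "0 < \<zeta>" "0 < A2" and ab: "a < b" "b < 0"
  defines "P \<equiv> (2 * a + b) / 3" and "Q \<equiv> (a + 2 * b) / 3"
  defines "f \<equiv> \<lambda>z z'. exp (cubic (- \<zeta>) A2 L2 z) * exp (cubic \<zeta> (- A1) (- L1) z')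
      * (moebius (of_real a) (of_real b) z * moebius (of_real b) (of_real a) z') ^ m / (z - z')"
  shows "wedge_integral (Complex (-1/2) (- (sqrt 3 / 2))) (of_real P) (Complex (-1/2) (sqrt 3 / 2)) (\<lambda>z.
      wedge_integral (Complex (1/2) (sqrt 3 / 2)) (of_real Q) (Complex (1/2) (- (sqrt 3 / 2))) (f z))
    = wedge_integral (- \<i>) 0 \<i> (\<lambda>z. wedge_integral (Complex 1 1) 0 (Complex 1 (-1)) (f z)
        + wedge_integral (Complex (-2) (-1)) 0 (Complex (-2) 1) (f z))"
proof -
  define e2 where "e2 = (\<lambda>z. exp (cubic (- \<zeta>) A2 L2 z))"
  define i1 where "i1 = (\<lambda>z. exp (cubic \<zeta> (- A1) (- L1) z))"
  define U where "U = (\<lambda>k z. moebius (of_real a) (of_real b) z ^ k / (1 - z / of_real a))"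
  define V where "V = (\<lambda>k z. moebius (of_real b) (of_real a) z ^ k / (1 - z / of_real b))"
  define c0 where "c0 = 1 / complex_of_real a - 1 / of_real b"
  define g0 where "g0 = (\<lambda>z z'. e2 z * i1 z' / (z - z'))"
  define WW where "WW = wedge_integral (Complex (-1/2) (- (sqrt 3 / 2))) (of_real P) (Complex (-1/2) (sqrt 3 / 2))"
  define WQ where "WQ = wedge_integral (Complex (1/2) (sqrt 3 / 2)) (of_real Q) (Complex (1/2) (- (sqrt 3 / 2)))"
  define WI where "WI = wedge_integral (- \<i>) 0 \<i>"
  define WR where "WR = wedge_integral (Complex 1 1) 0 (Complex 1 (-1))"
  define WL where "WL = wedge_integral (Complex (-2) (-1)) 0 (Complex (-2) 1)"
  \<comment> \<open>The inner integrals of the decoupled terms; by \<open>Vw\<close> they take the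
    same value on the contour at Q and on the two wedges at 0 together.\<close>
  define \<beta> where "\<beta> = (\<lambda>k. WQ (\<lambda>z. i1 z * V k z))"
  define D where "D = (\<lambda>z. c0 * (\<Sum>k<m. \<beta> k * (e2 z * U k z)))"
  have a0: "a < 0" using ab by simp
  have PQ: "a < P" "P < Q" "Q < b" "P < 0" "Q < 0" using ab by (auto simp: P_def Q_def)
  have i: "\<i> = Complex 0 1" "- \<i> = Complex 0 (-1)" by (auto simp: complex_eq_iff)
  have dirs: "{Complex (-1/2) (- (sqrt 3 / 2)), Complex (-1/2) (sqrt 3 / 2)} = (\<lambda>s. Complex (-1/2) (s * (sqrt 3 / 2))) ` {-1, 1}"
    "{Complex (1/2) (sqrt 3 / 2), Complex (1/2) (- (sqrt 3 / 2))} = (\<lambda>s. Complex (1/2) (s * (sqrt 3 / 2))) ` {-1, 1}"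
    "{- \<i>, \<i>} = (\<lambda>s. Complex 0 s) ` {-1, 1}" "{Complex 1 1, Complex 1 (-1)} = (\<lambda>s. Complex 1 s) ` {-1, 1}"
    "{Complex (-2) (-1), Complex (-2) 1} = (\<lambda>s. Complex (-2) s) ` {-1, 1}"
    by (auto simp: complex_eq_iff)
  have s1: "s \<in> {-1, 1} \<Longrightarrow> \<bar>s\<bar> = 1" for s :: real by auto
  have split: "f z z' = c0 * (\<Sum>k<m. (e2 z * U k z) * (i1 z' * V k z')) + g0 z z'"
    if "z \<noteq> of_real a" "z' \<noteq> of_real b" "z \<noteq> z'" for z z'
  proof -
    have "f z z' = e2 z * i1 z' * ((moebius (of_real a) (of_real b) z * moebius (of_real b) (of_real a) z') ^ m / (z - z'))"
      by (simp add: f_def e2_def i1_def)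
    also have "\<dots> = e2 z * i1 z' * (c0 * (\<Sum>k<m. U k z * V k z') + 1 / (z - z'))"
      unfolding c0_def U_def V_def by (subst moebius_power_split) (use that a0 ab in auto)
    also have "\<dots> = c0 * (\<Sum>k<m. (e2 z * U k z) * (i1 z' * V k z')) + g0 z z'"
      by (simp add: g0_def sum_distrib_left distrib_left mult_ac)
    finally show ?thesis .
  qed
  have Uw: "WW (\<lambda>z. e2 z * U k z) = WI (\<lambda>z. e2 z * U k z)"
    "\<bar>s\<bar> = 1 \<Longrightarrow> ray_integrable (of_real P) (Complex (-1/2) (s * (sqrt 3 / 2))) (\<lambda>z. e2 z * U k z)"
    "\<bar>s\<bar> = 1 \<Longrightarrow> ray_integrable 0 (Complex 0 s) (\<lambda>z. e2 z * U k z)" for k s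
  proof -
    define S where "S = (half_plane 1 0 0 \<inter> half_plane (-1) (- 1) (- P)) \<union> (half_plane 1 0 0 \<inter> half_plane (-1) (- (-1)) (- P))"
    have "closed S" unfolding S_def by (intro closed_Un closed_Int closed_half_plane)
    moreover have aS: "of_real a \<notin> S" using PQ by (auto simp: S_def mem_half_plane)
    ultimately obtain H where H: "\<And>z. z \<in> S \<Longrightarrow> cmod (U k z) \<le> H"
      using moebius_bounded_on[of S "of_real a" "of_real b" k] a0 ab unfolding U_def by auto
    have sub: "half_plane 1 0 0 \<inter> half_plane (-1) (- s) (- P) \<subseteq> S" if "\<bar>s\<bar> = 1" for s :: real
    proof -
      have "s = 1 \<or> s = -1" using that by auto
      then show ?thesis unfolding S_def by auto
    qed
    have hol: "U k holomorphic_on - {of_real a}" unfolding U_def using a0 by (intro moebius_holomorphic) auto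
    have op: "open (- {complex_of_real a})" by auto
    note * = outer_wedge_shift[OF par less_imp_le[OF PQ(4)] op hol]
    have s2: "\<And>s. \<bar>s\<bar> = 1 \<Longrightarrow> half_plane 1 0 0 \<inter> half_plane (-1) (- s) (- P) \<subseteq> - {of_real a}"
      using sub aS by blast
    have s3: "\<And>s z. \<bar>s\<bar> = 1 \<Longrightarrow> z \<in> half_plane 1 0 0 \<inter> half_plane (-1) (- s) (- P) \<Longrightarrow> cmod (U k z) \<le> H"
      using sub H by blast
    show "WW (\<lambda>z. e2 z * U k z) = WI (\<lambda>z. e2 z * U k z)"
      unfolding WW_def WI_def e2_def by (rule *(1)) (use s2 s3 in blast)+
    show "\<bar>s\<bar> = 1 \<Longrightarrow> ray_integrable (of_real P) (Complex (-1/2) (s * (sqrt 3 / 2))) (\<lambda>z. e2 z * U k z)"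
      unfolding e2_def by (rule *(2)) (use s2 s3 in blast)+
    show "\<bar>s\<bar> = 1 \<Longrightarrow> ray_integrable 0 (Complex 0 s) (\<lambda>z. e2 z * U k z)"
      unfolding e2_def by (rule *(3)) (use s2 s3 in blast)+
  qed
  have Vw: "\<beta> k = WR (\<lambda>z. i1 z * V k z) + WL (\<lambda>z. i1 z * V k z)"
    "\<bar>s\<bar> = 1 \<Longrightarrow> ray_integrable (of_real Q) (Complex (1/2) (s * (sqrt 3 / 2))) (\<lambda>z. i1 z * V k z)"
    "\<bar>s\<bar> = 1 \<Longrightarrow> ray_integrable 0 (Complex 1 s) (\<lambda>z. i1 z * V k z)"
    "\<bar>s\<bar> = 1 \<Longrightarrow> ray_integrable 0 (Complex (-2) s) (\<lambda>z. i1 z * V k z)" for k s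
  proof -
    define S where "S = (half_plane 1 (- 1) Q \<union> half_plane 1 (- (-1)) Q) \<union> (half_plane (-1) (- 2 * 1) 0 \<union> half_plane (-1) (- 2 * (-1)) 0)"
    have "closed S" unfolding S_def by (intro closed_Un closed_half_plane)
    moreover have bS: "of_real b \<notin> S" using PQ ab by (auto simp: S_def mem_half_plane)
    ultimately obtain H where H: "\<And>z. z \<in> S \<Longrightarrow> cmod (V k z) \<le> H"
      using moebius_bounded_on[of S "of_real b" "of_real a" k] a0 ab unfolding V_def by auto
    have sub: "half_plane 1 (- s) Q \<subseteq> S" "half_plane (-1) (- 2 * s) 0 \<subseteq> S" if "\<bar>s\<bar> = 1" for s :: real
    proof -
      have "s = 1 \<or> s = -1" using that by auto
      then show "half_plane 1 (- s) Q \<subseteq> S" "half_plane (-1) (- 2 * s) 0 \<subseteq> S" unfolding S_def by auto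
    qed
    have hol: "V k holomorphic_on - {of_real b}" unfolding V_def using ab by (intro moebius_holomorphic) auto
    have op: "open (- {complex_of_real b})" by auto
    note * = inner_wedge_split[OF par(1) PQ(5) op hol]
    have s2: "\<And>s. \<bar>s\<bar> = 1 \<Longrightarrow> half_plane 1 (- s) Q \<subseteq> - {of_real b}"
      "\<And>s. \<bar>s\<bar> = 1 \<Longrightarrow> half_plane (-1) (- 2 * s) 0 \<subseteq> - {of_real b}"
      using sub bS by blast+
    have s3: "\<And>s z. \<bar>s\<bar> = 1 \<Longrightarrow> z \<in> half_plane 1 (- s) Q \<Longrightarrow> cmod (V k z) \<le> H"
      "\<And>s z. \<bar>s\<bar> = 1 \<Longrightarrow> z \<in> half_plane (-1) (- 2 * s) 0 \<Longrightarrow> cmod (V k z) \<le> H"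
      using sub H by blast+
    show "\<beta> k = WR (\<lambda>z. i1 z * V k z) + WL (\<lambda>z. i1 z * V k z)"
      unfolding WR_def WL_def WQ_def \<beta>_def i1_def by (rule *(1)) (use s2 s3 in blast)+
    show "\<bar>s\<bar> = 1 \<Longrightarrow> ray_integrable (of_real Q) (Complex (1/2) (s * (sqrt 3 / 2))) (\<lambda>z. i1 z * V k z)"
      unfolding i1_def by (rule *(2)) (use s2 s3 in blast)+
    show "\<bar>s\<bar> = 1 \<Longrightarrow> ray_integrable 0 (Complex 1 s) (\<lambda>z. i1 z * V k z)"
      unfolding i1_def by (rule *(3)) (use s2 s3 in blast)+
    show "\<bar>s\<bar> = 1 \<Longrightarrow> ray_integrable 0 (Complex (-2) s) (\<lambda>z. i1 z * V k z)"
      unfolding i1_def by (rule *(4)) (use s2 s3 in blast)+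
  qed
  have Gq: "WQ (g0 z) = WR (g0 z)"
    "\<bar>s\<bar> = 1 \<Longrightarrow> ray_integrable (of_real Q) (Complex (1/2) (s * (sqrt 3 / 2))) (g0 z)"
    if z: "Re z \<le> P" for z s
  proof -
    have nin: "z \<notin> half_plane (-1) 0 (- Q)" using z PQ by (auto simp: mem_half_plane)
    obtain H where H: "\<And>w. w \<in> half_plane (-1) 0 (- Q) \<Longrightarrow> cmod (1 / (w - z)) \<le> H"
      using inverse_bounded_on[OF closed_half_plane nin] by blast
    have op: "open (- {z})" by auto
    have hol: "(\<lambda>w. 1 / (w - z)) holomorphic_on - {z}" by (intro holomorphic_intros) auto
    have sub: "half_plane (-1) 0 (- Q) \<subseteq> - {z}" using nin by blast
    note * = right_wedge_shift[OF par(1) less_imp_le[OF PQ(5)] op hol sub]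
    have g: "g0 z = (\<lambda>w. - e2 z * (i1 w * (1 / (w - z))))"
      by (auto simp: g0_def fun_eq_iff divide_simps) (simp add: algebra_simps)?
    show "WQ (g0 z) = WR (g0 z)"
      unfolding g WQ_def WR_def wedge_integral_mult i1_def
      by (rule arg_cong[where f = "\<lambda>x. - e2 z * x"], rule *(1)) (use H in blast)
    show "\<bar>s\<bar> = 1 \<Longrightarrow> ray_integrable (of_real Q) (Complex (1/2) (s * (sqrt 3 / 2))) (g0 z)"
      unfolding g i1_def by (rule ray_integrable_mult, rule *(2)) (use H in blast)+
  qed
  \<comment> \<open>An imaginary z other than 0 lies outside both closed sectors |Im w| \<le> |Re
    w|, so there is a positive distance to the pole.\<close>
  have Gr: "ray_integrable 0 (Complex 1 s) (g0 z)" "ray_integrable 0 (Complex (-2) s) (g0 z)" "WL (g0 z) = 0"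
    if z: "Re z = 0" "Im z \<noteq> 0" and s: "\<bar>s\<bar> = 1" for z s
  proof -
    have g: "g0 z = (\<lambda>w. - e2 z * (i1 w * (1 / (w - z))))"
      by (auto simp: g0_def fun_eq_iff divide_simps) (simp add: algebra_simps)?
    have op: "open (- {z})" by auto
    have hol: "(\<lambda>w. 1 / (w - z)) holomorphic_on - {z}" by (intro holomorphic_intros) auto
    define S where "S = half_plane 1 1 0 \<inter> half_plane 1 (-1) 0"
    have nin: "z \<notin> S" using z by (auto simp: S_def mem_half_plane)
    have "closed S" unfolding S_def by (intro closed_Int closed_half_plane)
    from inverse_bounded_on[OF this nin] obtain H where H: "\<And>w. w \<in> S \<Longrightarrow> cmod (1 / (w - z)) \<le> H" by blast
    have "S \<subseteq> - {z}" using nin by blast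
    note * = left_wedge_vanishes[OF par(1) op hol this[unfolded S_def]]
    have "WL (\<lambda>w. i1 w * (1 / (w - z))) = 0"
      unfolding WL_def i1_def by (rule *(1)) (use H in \<open>unfold S_def, blast\<close>)
    then show "WL (g0 z) = 0" unfolding g WL_def wedge_integral_mult by simp
    show "ray_integrable 0 (Complex (-2) s) (g0 z)"
      unfolding g i1_def by (rule ray_integrable_mult, rule *(2)) (use H s in \<open>unfold S_def, blast\<close>)+
    \<comment> \<open>The ray is shifted onto itself; what is wanted is the integrability that
      \<open>ray_shift_exp\<close> yields.\<close>
    have "ray_integrable 0 (Complex 1 s) (\<lambda>w. i1 w * (1 / (w - z)))"
    proof -
      define T where "T = half_plane (-1) s 0 \<inter> half_plane (-1) (- s) 0"
      have nin: "z \<notin> T" using z s by (auto simp: T_def mem_half_plane abs_if split: if_splits)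
      have "closed T" unfolding T_def by (intro closed_Int closed_half_plane)
      from inverse_bounded_on[OF this nin] obtain H where H: "\<And>w. w \<in> T \<Longrightarrow> cmod (1 / (w - z)) \<le> H" by blast
      have ray: "0 + of_real t * Complex 1 s \<in> T" if "0 \<le> t" for t
        using that s by (auto simp: T_def mem_half_plane abs_if split: if_splits)
      have sub: "T \<subseteq> - {z}" using nin by blast
      have conv: "convex T" unfolding T_def by (intro convex_Int convex_half_plane)
      have E: "cubic \<zeta> (- A1) (- L1) holomorphic_on UNIV" by (intro holomorphic_intros)
      have lead: "\<zeta> * Re ((of_real (1 - u) * Complex 1 s + of_real u * Complex 1 s) ^ 3) \<le> - \<zeta>" for u
      proof -
        have "of_real (1 - u) * Complex 1 s + of_real u * Complex 1 s = Complex 1 s" by (simp add: left_diff_distrib)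
        moreover have "Re (Complex 1 s ^ 3) = - 2"
          using s by (auto simp: Re_complex_cube abs_if split: if_splits)
        ultimately show ?thesis using par by simp
      qed
      show ?thesis
        using ray_shift_exp(2)[OF op hol E conv sub, of H 0 "Complex 1 s" 0 "Complex 1 s"] H ray
          cubic_decay[OF par(1) lead, where c = 0 and c' = 0 and ?c2.0 = "- A1" and ?c1.0 = "- L1"]
        unfolding i1_def by blast
    qed
    then show "ray_integrable 0 (Complex 1 s) (g0 z)"
      unfolding g by (rule ray_integrable_mult)
  qed
  have comb: "wedge_integral d1 c d2 (\<lambda>z'. c0 * (\<Sum>k<m. (e2 z * U k z) * (i1 z' * V k z')) + g0 z z')
      = c0 * (\<Sum>k<m. wedge_integral d1 c d2 (\<lambda>z. i1 z * V k z) * (e2 z * U k z)) + wedge_integral d1 c d2 (g0 z)"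
    if V: "\<And>d k. d \<in> {d1, d2} \<Longrightarrow> ray_integrable c d (\<lambda>z. i1 z * V k z)"
      and G: "\<And>d. d \<in> {d1, d2} \<Longrightarrow> ray_integrable c d (g0 z)" for d1 d2 c z
  proof -
    have int: "ray_integrable c d (\<lambda>z'. (e2 z * U k z) * (i1 z' * V k z'))" if "d \<in> {d1, d2}" for d k
      by (intro ray_integrable_mult V that)
    have "wedge_integral d1 c d2 (\<lambda>z'. c0 * (\<Sum>k<m. (e2 z * U k z) * (i1 z' * V k z')) + g0 z z')
        = wedge_integral d1 c d2 (\<lambda>z'. c0 * (\<Sum>k<m. (e2 z * U k z) * (i1 z' * V k z'))) + wedge_integral d1 c d2 (g0 z)"
      by (intro wedge_integral_add ray_integrable_mult ray_integrable_sum G V) auto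
    also have "wedge_integral d1 c d2 (\<lambda>z'. c0 * (\<Sum>k<m. (e2 z * U k z) * (i1 z' * V k z')))
        = c0 * (\<Sum>k<m. wedge_integral d1 c d2 (\<lambda>z'. (e2 z * U k z) * (i1 z' * V k z')))"
      unfolding wedge_integral_mult[of d1 c d2 c0]
      by (rule arg_cong[where f = "\<lambda>x. c0 * x"], rule wedge_integral_sum) (use int in auto)
    finally show ?thesis
      unfolding wedge_integral_mult by (simp only: mult.commute)
  qed
  have L: "WQ (f z) = D z + WR (g0 z)" if z: "z \<noteq> of_real a" "Re z \<le> P" for z
  proof -
    have "WQ (f z) = WQ (\<lambda>z'. c0 * (\<Sum>k<m. (e2 z * U k z) * (i1 z' * V k z')) + g0 z z')"
      unfolding WQ_def
    proof (rule wedge_integral_cong, rule split[OF z(1)])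
      fix d and t :: real assume d: "d \<in> {Complex (1/2) (sqrt 3 / 2), Complex (1/2) (- (sqrt 3 / 2))}" "0 < t"
      then show "of_real Q + of_real t * d \<noteq> of_real b" by (auto simp: complex_eq_iff)
      have "Q \<le> Re (of_real Q + of_real t * d)" using d by auto
      then show "z \<noteq> of_real Q + of_real t * d" using z PQ by auto
    qed
    also have "\<dots> = D z + WQ (g0 z)"
      unfolding WQ_def D_def \<beta>_def
      by (rule comb) (use Vw(2) Gq(2)[OF z(2)] s1 in \<open>unfold dirs, blast+\<close>)
    finally show ?thesis by (simp add: Gq(1)[OF z(2)])
  qed
  have R: "WR (f z) + WL (f z) = D z + WR (g0 z)" if z: "Re z = 0" "Im z \<noteq> 0" for z
  proof -
    have za: "z \<noteq> of_real a" using z by (auto simp: complex_eq_iff)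
    have "WR (f z) = WR (\<lambda>z'. c0 * (\<Sum>k<m. (e2 z * U k z) * (i1 z' * V k z')) + g0 z z')"
      unfolding WR_def
      by (rule wedge_integral_cong, rule split[OF za]) (use z ab in \<open>auto simp: complex_eq_iff\<close>)
    also have "\<dots> = c0 * (\<Sum>k<m. WR (\<lambda>z. i1 z * V k z) * (e2 z * U k z)) + WR (g0 z)"
      unfolding WR_def
      by (rule comb) (use Vw(3) Gr(1)[OF z] s1 in \<open>unfold dirs, blast+\<close>)
    finally have 1: "WR (f z) = c0 * (\<Sum>k<m. WR (\<lambda>z. i1 z * V k z) * (e2 z * U k z)) + WR (g0 z)" .
    have "WL (f z) = WL (\<lambda>z'. c0 * (\<Sum>k<m. (e2 z * U k z) * (i1 z' * V k z')) + g0 z z')"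
      unfolding WL_def
      by (rule wedge_integral_cong, rule split[OF za]) (use z ab in \<open>auto simp: complex_eq_iff\<close>)
    also have "\<dots> = c0 * (\<Sum>k<m. WL (\<lambda>z. i1 z * V k z) * (e2 z * U k z)) + WL (g0 z)"
      unfolding WL_def
      by (rule comb) (use Vw(4) Gr(2)[OF z] s1 in \<open>unfold dirs, blast+\<close>)
    finally have 2: "WL (f z) = c0 * (\<Sum>k<m. WL (\<lambda>z. i1 z * V k z) * (e2 z * U k z))"
      using Gr(3)[OF z, of 1] by simp
    show ?thesis unfolding 1 2 D_def Vw(1)
      by (simp add: distrib_right sum.distrib distrib_left)
  qed
  have Dint: "ray_integrable (of_real P) (Complex (-1/2) (s * (sqrt 3 / 2))) D" "ray_integrable 0 (Complex 0 s) D"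
    if "\<bar>s\<bar> = 1" for s
    unfolding D_def using Uw(2,3)[OF that] by (auto intro!: ray_integrable_mult ray_integrable_sum)
  have Uint: "ray_integrable (of_real P) d (\<lambda>z. \<beta> k * (e2 z * U k z))"
    if "d \<in> {Complex (-1/2) (- (sqrt 3 / 2)), Complex (-1/2) (sqrt 3 / 2)}" for d k
    by (rule ray_integrable_mult) (use Uw(2) s1 that in \<open>unfold dirs, blast\<close>)
  have Uint': "ray_integrable 0 d (\<lambda>z. \<beta> k * (e2 z * U k z))" if "d \<in> {- \<i>, \<i>}" for d k
    by (rule ray_integrable_mult) (use Uw(3) s1 that in \<open>unfold dirs, blast\<close>)
  have D: "WW D = WI D"
  proof -
    have "WW D = c0 * (\<Sum>k<m. \<beta> k * WW (\<lambda>z. e2 z * U k z))"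
      unfolding D_def WW_def wedge_integral_mult
      by (subst wedge_integral_sum) (rule finite_lessThan, erule Uint, simp only: wedge_integral_mult)
    also have "\<dots> = WI D"
      unfolding Uw(1) unfolding D_def WI_def wedge_integral_mult
      by (subst wedge_integral_sum) (rule finite_lessThan, erule Uint', simp only: wedge_integral_mult)
    finally show ?thesis .
  qed
  have e2m [measurable]: "e2 \<in> borel_measurable borel" and i1m [measurable]: "i1 \<in> borel_measurable borel"
    unfolding e2_def i1_def
    by (intro borel_measurable_continuous_onI continuous_intros)+
  have meas: "(\<lambda>x. g0 (fst x) (snd x)) \<in> borel_measurable borel"
    unfolding g0_def borel_prod[symmetric] by measurable
  have "\<exists>C. \<forall>s\<in>{-1,1::real}. \<forall>t\<ge>0. cmod (e2 (of_real P + of_real t * Complex (-1/2) (s * (sqrt 3 / 2)))) \<le> C * exp (- t)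
      \<and> cmod (e2 (of_real t * Complex 0 s)) \<le> C * exp (- t)"
  proof -
    obtain C where C: "\<And>s R u. s \<in> {-1, 1} \<Longrightarrow> 0 \<le> R \<Longrightarrow> 0 \<le> u \<Longrightarrow> u \<le> 1 \<Longrightarrow>
        Re (cubic (- \<zeta>) A2 L2 (of_real (1 - u) * (of_real P + of_real R * Complex (-1/2) (s * (sqrt 3 / 2)))
        + of_real u * (0 + of_real R * Complex 0 s))) \<le> C s - R"
      using outer_decay[OF par less_imp_le[OF PQ(4)] s1, where L = L2] by metis
    have "Re (cubic (- \<zeta>) A2 L2 (of_real P + of_real t * Complex (-1/2) (s * (sqrt 3 / 2)))) \<le> max (C 1) (C (-1)) - t"
      "Re (cubic (- \<zeta>) A2 L2 (of_real t * Complex 0 s)) \<le> max (C 1) (C (-1)) - t" if "s \<in> {-1, 1}" "0 \<le> t" for s t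
      using C[OF that, of 0] C[OF that, of 1] that(1) by auto
    then show ?thesis
      by (intro exI[of _ "exp (max (C 1) (C (-1)))"])
         (simp add: e2_def norm_exp_eq_Re exp_minus exp_diff[symmetric] divide_inverse[symmetric])
  qed
  then obtain Ce where Ce: "\<And>s t. s \<in> {-1, 1} \<Longrightarrow> 0 \<le> t \<Longrightarrow>
        cmod (e2 (of_real P + of_real t * Complex (-1/2) (s * (sqrt 3 / 2)))) \<le> Ce * exp (- t)"
      "\<And>s t. s \<in> {-1, 1} \<Longrightarrow> 0 \<le> t \<Longrightarrow> cmod (e2 (of_real t * Complex 0 s)) \<le> Ce * exp (- t)"
    by blast
  have "\<exists>C. \<forall>s\<in>{-1,1::real}. \<forall>t\<ge>0. cmod (i1 (of_real t * Complex 1 s)) \<le> C * exp (- t)"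
  proof -
    obtain C where C: "\<And>s R u. s \<in> {-1, 1} \<Longrightarrow> 0 \<le> R \<Longrightarrow> 0 \<le> u \<Longrightarrow> u \<le> 1 \<Longrightarrow>
        Re (cubic \<zeta> (- A1) (- L1) (of_real (1 - u) * (of_real Q + of_real R * Complex (1/2) (s * (sqrt 3 / 2)))
        + of_real u * (0 + of_real R * Complex 1 s))) \<le> C s - R"
      using right_decay[OF par(1) s1, where A = "- A1" and L = "- L1" and Q = Q] by metis
    have "Re (cubic \<zeta> (- A1) (- L1) (of_real t * Complex 1 s)) \<le> max (C 1) (C (-1)) - t" if "s \<in> {-1, 1}" "0 \<le> t" for s t
      using C[OF that, of 1] that(1) by auto
    then show ?thesis
      by (intro exI[of _ "exp (max (C 1) (C (-1)))"])
         (simp add: i1_def norm_exp_eq_Re exp_minus exp_diff[symmetric] divide_inverse[symmetric])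
  qed
  then obtain Ci where Ci: "\<And>s t. s \<in> {-1, 1} \<Longrightarrow> 0 \<le> t \<Longrightarrow> cmod (i1 (of_real t * Complex 1 s)) \<le> Ci * exp (- t)"
    by blast
  have pos: "0 \<le> Ce" "0 \<le> Ci"
    using Ce(2)[of 1 0] Ci[of 1 0] by (auto intro: order_trans[OF norm_ge_zero])
  have g0n: "cmod (g0 z z') = cmod (e2 z) * cmod (i1 z') / cmod (z - z')" for z z'
    by (simp add: g0_def norm_mult norm_divide)
  note F1 = wedge_fubini[OF meas set_integrable_exp_minus[of Ce] set_integrable_exp_minus[of "Ci / (- P)"],
      of "Complex (-1/2) (- (sqrt 3 / 2))" "Complex (-1/2) (sqrt 3 / 2)" "Complex 1 1" "Complex 1 (-1)" "of_real P" 0]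
  have F1b: "cmod (g0 (of_real P + of_real t * d) (0 + of_real t' * d')) \<le> Ce * exp (- t) * (Ci / (- P) * exp (- t'))"
    if d: "d \<in> {Complex (-1/2) (- (sqrt 3 / 2)), Complex (-1/2) (sqrt 3 / 2)}" "d' \<in> {Complex 1 1, Complex 1 (-1)}"
      and t: "0 < t" "0 < t'" for d d' t t'
  proof -
    obtain s s' where s: "s \<in> {-1, 1}" "d = Complex (-1/2) (s * (sqrt 3 / 2))" "s' \<in> {-1, 1}" "d' = Complex 1 s'"
      using d unfolding dirs by blast
    define z z' where "z = of_real P + of_real t * d" and "z' = 0 + of_real t' * d'"
    have "- P \<le> Re (z' - z)" using t s by (simp add: z_def z'_def)
    also have "\<dots> \<le> cmod (z - z')" using complex_Re_le_cmod[of "z' - z"] by (simp add: norm_minus_commute)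
    finally have sep: "- P \<le> cmod (z - z')" .
    have "cmod (e2 z) * cmod (i1 z') / cmod (z - z') \<le> (Ce * exp (- t)) * (Ci * exp (- t')) / (- P)"
      using Ce(1)[OF s(1), of t] Ci[OF s(3), of t'] sep PQ pos t s
      by (intro frac_le mult_mono) (auto simp: z_def z'_def)
    then show ?thesis by (simp add: g0n z_def z'_def)
  qed
  \<comment> \<open>Now both contours start at 0, so the factor t^(-1/2) is required; for the wedge
    at P the distance between the contours was at least -P.\<close>
  define h where "h = (\<lambda>K t. K * (t powr (1/2 - 1) * exp (- t)) :: real)"
  have hint: "set_integrable lborel {0..} (h K)" for K
    unfolding h_def by (intro set_integrable_mult_right set_integrable_powr_exp) simp
  note F2 = wedge_fubini[OF meas hint[of Ce] hint[of "2 * Ci"], of "- \<i>" "\<i>" "Complex 1 1" "Complex 1 (-1)" 0 0]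
  have F2b: "cmod (g0 (0 + of_real t * d) (0 + of_real t' * d')) \<le> h Ce t * h (2 * Ci) t'"
    if d: "d \<in> {- \<i>, \<i>}" "d' \<in> {Complex 1 1, Complex 1 (-1)}" and t: "0 < t" "0 < t'" for d d' t t'
  proof -
    obtain s s' where s: "s \<in> {-1, 1}" "d = Complex 0 s" "s' \<in> {-1, 1}" "d' = Complex 1 s'"
      using d unfolding dirs by blast
    have sep: "sqrt (t * t') / 2 \<le> cmod (of_real t * d - of_real t' * d')"
      unfolding s(2,4) by (rule ray_separation) (use t s1[OF s(1)] s1[OF s(3)] in auto)
    have "cmod (e2 (of_real t * d)) * cmod (i1 (of_real t' * d')) / cmod (of_real t * d - of_real t' * d')
        \<le> (Ce * exp (- t)) * (Ci * exp (- t')) / (sqrt (t * t') / 2)"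
      using Ce(2)[OF s(1), of t] Ci[OF s(3), of t'] sep pos t s
      by (intro frac_le mult_mono) auto
    also have "\<dots> = h Ce t * h (2 * Ci) t'"
      using t by (simp add: h_def real_sqrt_mult powr_half_sqrt powr_minus divide_simps)
    finally show ?thesis by (simp add: g0n)
  qed
  \<comment> \<open>With the order reversed, z' is fixed with positive real part, and the outer
    contour moves from P to the imaginary axis without meeting the pole z = z'.\<close>
  have H0: "WW (\<lambda>z. WR (g0 z)) = WI (\<lambda>z. WR (g0 z))"
  proof -
    have "WW (\<lambda>z. WR (g0 z)) = WR (\<lambda>z'. WW (\<lambda>z. g0 z z'))"
      unfolding WW_def WR_def using F1(1) F1b by blast
    also have "\<dots> = WR (\<lambda>z'. WI (\<lambda>z. g0 z z'))"
    proof (unfold WR_def, rule wedge_integral_cong)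
      fix d and t :: real assume d: "d \<in> {Complex 1 1, Complex 1 (-1)}" "0 < t"
      define z' where "z' = 0 + of_real t * d"
      have z': "0 < Re z'" using d by (auto simp: z'_def)
      have nin: "z' \<notin> half_plane 1 0 0" using z' by (auto simp: mem_half_plane)
      obtain H where H: "\<And>w. w \<in> half_plane 1 0 0 \<Longrightarrow> cmod (1 / (w - z')) \<le> H"
        using inverse_bounded_on[OF closed_half_plane nin] by blast
      have op: "open (- {z'})" by auto
      have hol: "(\<lambda>w. 1 / (w - z')) holomorphic_on - {z'}" by (intro holomorphic_intros) auto
      have "WW (\<lambda>z. e2 z * (1 / (z - z'))) = WI (\<lambda>z. e2 z * (1 / (z - z')))"
        unfolding WW_def WI_def e2_def
        by (rule outer_wedge_shift(1)[OF par less_imp_le[OF PQ(4)] op hol]) (use nin H in blast)+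
      moreover have "(\<lambda>z. g0 z z') = (\<lambda>z. i1 z' * (e2 z * (1 / (z - z'))))" by (auto simp: g0_def)
      ultimately show "WW (\<lambda>z. g0 z z') = WI (\<lambda>z. g0 z z')"
        unfolding WW_def WI_def by (simp only: wedge_integral_mult)
    qed
    also have "\<dots> = WI (\<lambda>z. WR (g0 z))"
      unfolding WI_def WR_def using F2(1) F2b by metis
    finally show ?thesis .
  qed
  have Hint: "ray_integrable (of_real P) d (\<lambda>z. WR (g0 z))"
    if "d \<in> {Complex (-1/2) (- (sqrt 3 / 2)), Complex (-1/2) (sqrt 3 / 2)}" for d
    unfolding WR_def using F1(2)[OF F1b] that by blast
  have Hint': "ray_integrable 0 d (\<lambda>z. WR (g0 z))" if "d \<in> {- \<i>, \<i>}" for d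
    unfolding WR_def using F2(2)[OF F2b] that by blast
  have "WW (\<lambda>z. WQ (f z)) = WW (\<lambda>z. D z + WR (g0 z))"
    unfolding WW_def by (rule wedge_integral_cong, rule L) (use PQ in \<open>auto simp: complex_eq_iff\<close>)
  also have "\<dots> = WW D + WW (\<lambda>z. WR (g0 z))"
    unfolding WW_def by (rule wedge_integral_add) (use Hint Dint(1) s1 in \<open>unfold dirs, blast+\<close>)
  also have "\<dots> = WI D + WI (\<lambda>z. WR (g0 z))" by (simp only: D H0)
  also have "\<dots> = WI (\<lambda>z. D z + WR (g0 z))"
    unfolding WI_def by (rule wedge_integral_add[symmetric]) (use Hint' Dint(2) s1 in \<open>unfold dirs, blast+\<close>)
  also have "\<dots> = WI (\<lambda>z. WR (f z) + WL (f z))"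
    unfolding WI_def by (rule wedge_integral_cong, rule R[symmetric]) auto
  finally show ?thesis unfolding WW_def WQ_def WI_def WR_def WL_def .
qed

section \<open>The saddle\<close>

text \<open>The derivative in \<rho> of ln (1 + \<rho> s) minus its cubic Taylor polynomial is -
  \<rho>^3 s^4 / (1 + \<rho> s). By \<open>bd\<close>, e times its real part is at least c \<rho>^3;
  the monotonicity of the difference on [q, p] takes the place of integrating this
  inequality.\<close>

lemma log_modulus_bound:
  fixes s :: complex and p q c e :: real
  assumes qp: "0 < q" "q \<le> p" and e: "\<bar>e\<bar> = 1"
    and nz: "\<And>\<rho>. q \<le> \<rho> \<Longrightarrow> \<rho> \<le> p \<Longrightarrow> 1 + of_real \<rho> * s \<noteq> 0"
    and bd: "\<And>\<rho>. q \<le> \<rho> \<Longrightarrow> \<rho> \<le> p \<Longrightarrow>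
      c * (cmod (1 + of_real \<rho> * s))\<^sup>2 \<le> e * Re (- (s ^ 4) * cnj (1 + of_real \<rho> * s))"
  shows "c * (p ^ 4 - q ^ 4) / 4 \<le> e * (ln (cmod (1 + of_real p * s)) - ln (cmod (1 + of_real q * s))
      - Re (of_real (p - q) * s - of_real (p\<^sup>2 - q\<^sup>2) * s\<^sup>2 / 2 + of_real (p ^ 3 - q ^ 3) * s ^ 3 / 3))"
proof -
  define x y where "x = Re s" and "y = Im s"
  define N where "N = (\<lambda>\<rho>. (1 + \<rho> * x)\<^sup>2 + (\<rho> * y)\<^sup>2)"
  have N: "(cmod (1 + of_real \<rho> * s))\<^sup>2 = N \<rho>" for \<rho>
    by (simp add: cmod_power2 N_def x_def y_def)
  have Npos: "0 < N \<rho>" if "q \<le> \<rho>" "\<rho> \<le> p" for \<rho>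
    using nz[OF that] unfolding N[symmetric] by simp
  define \<phi> where "\<phi> = (\<lambda>\<rho>. e * (ln (N \<rho>) / 2 - \<rho> * x + \<rho>\<^sup>2 * (x\<^sup>2 - y\<^sup>2) / 2 - \<rho> ^ 3 * (x ^ 3 - 3 * x * y\<^sup>2) / 3) - c * \<rho> ^ 4 / 4)"
  have "\<phi> q \<le> \<phi> p"
  proof (rule DERIV_nonneg_imp_nondecreasing[OF qp(2)])
    fix \<rho> assume \<rho>: "q \<le> \<rho>" "\<rho> \<le> p"
    define M where "M = (x + \<rho> * (x\<^sup>2 + y\<^sup>2)) / N \<rho> - x + \<rho> * (x\<^sup>2 - y\<^sup>2) - \<rho>\<^sup>2 * (x ^ 3 - 3 * x * y\<^sup>2)"
    have dN: "(N has_real_derivative 2 * (x + \<rho> * (x\<^sup>2 + y\<^sup>2))) (at \<rho>)"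
      unfolding N_def by (auto intro!: derivative_eq_intros simp: power2_eq_square algebra_simps)
    have "(\<phi> has_real_derivative e * M - c * \<rho> ^ 3) (at \<rho>)"
      unfolding \<phi>_def M_def
      by (rule derivative_eq_intros dN refl | use Npos[OF \<rho>] in \<open>simp add: field_simps power2_eq_square power3_eq_cube eval_nat_numeral; fail\<close>)+
    moreover have "0 \<le> e * M - c * \<rho> ^ 3"
    proof -
      have "N \<rho> * M = \<rho> ^ 3 * Re (- (s ^ 4) * cnj (1 + of_real \<rho> * s))"
      proof -
        have "N \<rho> * M = (x + \<rho> * (x\<^sup>2 + y\<^sup>2)) + N \<rho> * (- x + \<rho> * (x\<^sup>2 - y\<^sup>2) - \<rho>\<^sup>2 * (x ^ 3 - 3 * x * y\<^sup>2))"
          unfolding M_def using Npos[OF \<rho>] by (simp add: field_simps)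
        also have "\<dots> = \<rho> ^ 3 * (- ((x ^ 4 - 6 * x\<^sup>2 * y\<^sup>2 + y ^ 4) * (1 + \<rho> * x) + (4 * x ^ 3 * y - 4 * x * y ^ 3) * (\<rho> * y)))"
          unfolding N_def by (simp add: eval_nat_numeral algebra_simps)
        also have "- ((x ^ 4 - 6 * x\<^sup>2 * y\<^sup>2 + y ^ 4) * (1 + \<rho> * x) + (4 * x ^ 3 * y - 4 * x * y ^ 3) * (\<rho> * y))
            = Re (- (s ^ 4) * cnj (1 + of_real \<rho> * s))"
          unfolding x_def y_def by (simp add: eval_nat_numeral algebra_simps)
        finally show ?thesis .
      qed
      moreover have "N \<rho> * (e * M - c * \<rho> ^ 3) = e * (N \<rho> * M) - c * \<rho> ^ 3 * N \<rho>"
        by (simp add: right_diff_distrib mult_ac)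
      ultimately have "N \<rho> * (e * M - c * \<rho> ^ 3) = \<rho> ^ 3 * (e * Re (- (s ^ 4) * cnj (1 + of_real \<rho> * s)) - c * N \<rho>)"
        by (simp only: right_diff_distrib mult_ac)
      also have "\<dots> \<ge> 0"
        using bd[OF \<rho>] qp \<rho> unfolding N by (intro mult_nonneg_nonneg) auto
      finally show ?thesis using Npos[OF \<rho>] by (simp add: zero_le_mult_iff)
    qed
    ultimately show "\<exists>d. (\<phi> has_real_derivative d) (at \<rho>) \<and> 0 \<le> d" by blast
  qed
  have lnN: "ln (N \<rho>) / 2 = ln (cmod (1 + of_real \<rho> * s))" if "q \<le> \<rho>" "\<rho> \<le> p" for \<rho>
    using nz[OF that] unfolding N[symmetric] by (simp add: ln_realpow)
  have R: "Re (of_real (p - q) * s - of_real (p\<^sup>2 - q\<^sup>2) * s\<^sup>2 / 2 + of_real (p ^ 3 - q ^ 3) * s ^ 3 / 3)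
      = (p - q) * x - (p\<^sup>2 - q\<^sup>2) * (x\<^sup>2 - y\<^sup>2) / 2 + (p ^ 3 - q ^ 3) * (x ^ 3 - 3 * x * y\<^sup>2) / 3"
    unfolding x_def y_def by (simp add: power2_eq_square power3_eq_cube algebra_simps)
  show ?thesis
    using \<open>\<phi> q \<le> \<phi> p\<close> lnN[OF order_refl qp(2)] lnN[OF qp(2) order_refl] unfolding R \<phi>_def
    by (simp add: algebra_simps diff_divide_distrib add_divide_distrib)
qed

text \<open>The directions of the steepest descent contours, as multiples of unit vectors that keep the
  arithmetic rational: \<open>e = -1\<close> for the outer and \<open>e = 1\<close> for the inner integration.\<close>

definition steep_direction :: "real \<Rightarrow> complex \<Rightarrow> bool" where
  "steep_direction e d \<longleftrightarrow> (e = - 1 \<and> d \<in> {\<i>, - \<i>}) \<or>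
     (e = 1 \<and> d \<in> {Complex 1 1, Complex 1 (-1), Complex (-2) 1, Complex (-2) (-1)})"

text \<open>Every direction makes the right-hand side at least t^4: it is t^4 for +- i, 4 t^4 (1 +
  \<rho> t) for 1 +- i and t^4 (7 + 10 \<rho> t) for -2 +- i. For -1 +- i it would be 4 t^4 (1 -
  \<rho> t), negative for large t, which is why the left rays are flatter. The factor 3 is a common
  bound for |d|.\<close>

lemma steep_direction_bounds:
  assumes d: "steep_direction e d" and t: "0 \<le> t" and \<rho>: "0 < \<rho>" "\<rho> \<le> p"
  shows "1 + of_real \<rho> * (of_real t * d) \<noteq> 0"
    and "t ^ 4 / (1 + 3 * p * t)\<^sup>2 * (cmod (1 + of_real \<rho> * (of_real t * d)))\<^sup>2
      \<le> e * Re (- ((of_real t * d) ^ 4) * cnj (1 + of_real \<rho> * (of_real t * d)))"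
proof -
  have d3: "cmod d \<le> 3"
  proof (rule power2_le_imp_le)
    show "(cmod d)\<^sup>2 \<le> 3\<^sup>2" using d by (auto simp: steep_direction_def cmod_power2)
  qed simp
  show "1 + of_real \<rho> * (of_real t * d) \<noteq> 0"
  proof (cases "t = 0")
    case False
    then have "Im (1 + of_real \<rho> * (of_real t * d)) \<noteq> 0"
      using d \<rho> by (auto simp: steep_direction_def)
    then show ?thesis by (metis zero_complex.sel(2))
  qed simp
  have "cmod (1 + of_real \<rho> * (of_real t * d)) \<le> 1 + \<rho> * t * cmod d"
    using t \<rho> by (intro order_trans[OF norm_triangle_ineq]) (simp add: norm_mult)
  also have "\<dots> \<le> 1 + p * t * 3"
    using t \<rho> d3 by (intro add_left_mono mult_mono) auto
  finally have "(cmod (1 + of_real \<rho> * (of_real t * d)))\<^sup>2 \<le> (1 + 3 * p * t)\<^sup>2"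
    by (intro power_mono) (auto simp: mult_ac)
  then have "t ^ 4 / (1 + 3 * p * t)\<^sup>2 * (cmod (1 + of_real \<rho> * (of_real t * d)))\<^sup>2
      \<le> t ^ 4 / (1 + 3 * p * t)\<^sup>2 * (1 + 3 * p * t)\<^sup>2"
    using t by (intro mult_left_mono) auto
  also have "\<dots> \<le> t ^ 4"
    using t by simp
  also have "\<dots> \<le> e * Re (- ((of_real t * d) ^ 4) * cnj (1 + of_real \<rho> * (of_real t * d)))"
  proof -
    have "e * Re (- ((of_real t * d) ^ 4) * cnj (1 + of_real \<rho> * (of_real t * d)))
        = t ^ 4 * (e * Re (- (d ^ 4) * cnj (1 + of_real (\<rho> * t) * d)))"
    proof -
      have *: "- ((of_real t * d) ^ 4) * cnj (1 + of_real \<rho> * (of_real t * d))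
          = of_real (t ^ 4) * (- (d ^ 4) * cnj (1 + of_real (\<rho> * t) * d))"
        by (simp add: power_mult_distrib algebra_simps)
      have "Re (of_real r * w) = r * Re w" for r w by simp
      then show ?thesis unfolding * by (simp only: mult.left_commute[of e])
    qed
    moreover have "1 \<le> e * Re (- (d ^ 4) * cnj (1 + of_real (\<rho> * t) * d))"
      using d t \<rho> by (auto simp: steep_direction_def eval_nat_numeral)
    ultimately show ?thesis using mult_left_mono[of 1 "e * Re (- (d ^ 4) * cnj (1 + of_real (\<rho> * t) * d))" "t ^ 4"] t
      by (simp only: mult_1_right zero_le_power)
  qed
  finally show "t ^ 4 / (1 + 3 * p * t)\<^sup>2 * (cmod (1 + of_real \<rho> * (of_real t * d)))\<^sup>2
      \<le> e * Re (- ((of_real t * d) ^ 4) * cnj (1 + of_real \<rho> * (of_real t * d)))" .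
qed

text \<open>The integrand at the cusp without its time and space parameters, in the local variable at the
  critical point: \<open>exp (m g(\<mu> z))\<close> with \<open>g(s) = log ((1 + p s) / (1 + q s)) - (p - q) s + (p\<^sup>2 - q\<^sup>2) s\<^sup>2 / 2 - s\<^sup>3 / 3\<close>.\<close>

definition saddle :: "nat \<Rightarrow> real \<Rightarrow> real \<Rightarrow> real \<Rightarrow> complex \<Rightarrow> complex" where
  "saddle m p q \<mu> z = ((1 + of_real (p * \<mu>) * z) / (1 + of_real (q * \<mu>) * z)) ^ m *
     exp (- (of_nat m * (of_real ((p - q) * \<mu>) * z - of_real ((p\<^sup>2 - q\<^sup>2) * \<mu>\<^sup>2) * z\<^sup>2 / 2 + of_real (\<mu> ^ 3) * z ^ 3 / 3)))"

text \<open>With s = \<mu> t d this is m times \<open>log_modulus_bound\<close>. The condition p^3 -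
  q^3 = 1 identifies the cubic Taylor term with the s^3 / 3 of the Airy exponent, and m \<mu>^4 (p^4
  - q^4) = 1 makes the lower bound t^4 / 4 up to the damping denominator.\<close>

lemma saddle_bound:
  assumes d: "steep_direction e d" and t: "0 \<le> t" and pq: "0 < q" "q < p" "p ^ 3 - q ^ 3 = 1"
    and \<mu>: "0 < \<mu>" "real m * \<mu> ^ 4 * (p ^ 4 - q ^ 4) = 1"
  shows "saddle m p q \<mu> (of_real t * d) \<noteq> 0"
    and "t ^ 4 / (4 * (1 + 3 * p * \<mu> * t)\<^sup>2) \<le> e * ln (cmod (saddle m p q \<mu> (of_real t * d)))"
proof -
  define s where "s = of_real (\<mu> * t) * d"
  have \<mu>t: "0 \<le> \<mu> * t" using \<mu> t by simp
  note b = steep_direction_bounds[OF d \<mu>t, folded s_def]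
  have nz: "1 + of_real \<rho> * s \<noteq> 0" if "q \<le> \<rho>" "\<rho> \<le> p" for \<rho>
    using b(1)[of \<rho> p] that pq by auto
  have sad: "saddle m p q \<mu> (of_real t * d) = ((1 + of_real p * s) / (1 + of_real q * s)) ^ m *
     exp (- (of_nat m * (of_real (p - q) * s - of_real (p\<^sup>2 - q\<^sup>2) * s\<^sup>2 / 2 + s ^ 3 / 3)))"
    unfolding saddle_def s_def by (simp add: power_mult_distrib mult_ac)
  have nz': "1 + of_real p * s \<noteq> 0" "1 + of_real q * s \<noteq> 0" using nz[of p] nz[of q] pq by auto
  then show "saddle m p q \<mu> (of_real t * d) \<noteq> 0" unfolding sad by simp
  have e: "\<bar>e\<bar> = 1" using d by (auto simp: steep_direction_def)
  define B where "B = ln (cmod (1 + of_real p * s)) - ln (cmod (1 + of_real q * s))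
      - Re (of_real (p - q) * s - of_real (p\<^sup>2 - q\<^sup>2) * s\<^sup>2 / 2 + of_real (p ^ 3 - q ^ 3) * s ^ 3 / 3)"
  have "(\<mu> * t) ^ 4 / (1 + 3 * p * (\<mu> * t))\<^sup>2 * (p ^ 4 - q ^ 4) / 4 \<le> e * B"
    unfolding B_def by (rule log_modulus_bound) (use pq e nz b(2)[of _ p] in auto)
  then have ineq: "real m * ((\<mu> * t) ^ 4 / (1 + 3 * p * (\<mu> * t))\<^sup>2 * (p ^ 4 - q ^ 4) / 4) \<le> real m * (e * B)"
    by (intro mult_left_mono) auto
  have LX: "real m * ((\<mu> * t) ^ 4 / (1 + 3 * p * (\<mu> * t))\<^sup>2 * (p ^ 4 - q ^ 4) / 4)
      = (real m * \<mu> ^ 4 * (p ^ 4 - q ^ 4)) * (t ^ 4 / (4 * (1 + 3 * p * \<mu> * t)\<^sup>2))"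
    by (simp add: power_mult_distrib mult_ac)
  have lnS: "ln (cmod (saddle m p q \<mu> (of_real t * d))) = real m * B"
  proof -
    have "ln (cmod (saddle m p q \<mu> (of_real t * d)))
        = real m * (ln (cmod (1 + of_real p * s)) - ln (cmod (1 + of_real q * s)))
          + Re (- (of_nat m * (of_real (p - q) * s - of_real (p\<^sup>2 - q\<^sup>2) * s\<^sup>2 / 2 + s ^ 3 / 3)))"
      unfolding sad norm_mult norm_power norm_divide norm_exp_eq_Re using nz'
      by (subst ln_mult) (auto simp: ln_realpow ln_div)
    then show ?thesis unfolding B_def pq(3) by (simp add: algebra_simps)
  qed
  show "t ^ 4 / (4 * (1 + 3 * p * \<mu> * t)\<^sup>2) \<le> e * ln (cmod (saddle m p q \<mu> (of_real t * d)))"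
    using ineq unfolding LX lnS \<mu>(2) by (simp only: mult_1 mult.left_commute)
qed

text \<open>For \<nu> t \<le> 1 the quotient is at least t^4 / 16, which exceeds B t^2 up to a
  constant. For \<nu> t > 1 it grows only quadratically, but is at least t^2 / (16 \<nu>^2), and the
  last hypothesis makes this coefficient at least B. In the application \<nu> tends to 0, so every B
  is eventually admissible.\<close>

lemma quartic_dominates:
  fixes B t \<nu> :: real
  assumes "0 < B" "0 \<le> t" "0 \<le> \<nu>" "16 * B * \<nu>\<^sup>2 \<le> 1"
  shows "B * t\<^sup>2 - 4 * B\<^sup>2 \<le> t ^ 4 / (4 * (1 + \<nu> * t)\<^sup>2)"
proof -
  have pos: "0 < 4 * (1 + \<nu> * t)\<^sup>2"
  proof -
    have "0 < 1 + \<nu> * t" using assms by (simp add: add_pos_nonneg)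
    then show ?thesis by simp
  qed
  show ?thesis
proof (cases "\<nu> * t \<le> 1")
  case True
  have "(1 + \<nu> * t)\<^sup>2 \<le> 2\<^sup>2" using True assms by (intro power_mono) auto
  then have "t ^ 4 / 16 \<le> t ^ 4 / (4 * (1 + \<nu> * t)\<^sup>2)"
    using assms pos by (intro divide_left_mono) (auto intro!: mult_pos_pos)
  moreover have "B * t\<^sup>2 - 4 * B\<^sup>2 \<le> t ^ 4 / 16"
  proof -
    have "0 \<le> (t\<^sup>2 / 4 - 2 * B)\<^sup>2" by simp
    then show ?thesis by (simp add: power2_eq_square eval_nat_numeral algebra_simps)
  qed
  ultimately show ?thesis by simp
next
  case False
  then have "(1 + \<nu> * t)\<^sup>2 \<le> (2 * (\<nu> * t))\<^sup>2" using assms by (intro power_mono) auto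
  then have "4 * (1 + \<nu> * t)\<^sup>2 \<le> 16 * \<nu>\<^sup>2 * t\<^sup>2" by (simp add: power_mult_distrib)
  then have "B * t\<^sup>2 * (4 * (1 + \<nu> * t)\<^sup>2) \<le> B * t\<^sup>2 * (16 * \<nu>\<^sup>2 * t\<^sup>2)"
    using assms by (intro mult_left_mono) auto
  also have "\<dots> = (16 * B * \<nu>\<^sup>2) * t ^ 4" by (simp add: eval_nat_numeral)
  also have "\<dots> \<le> 1 * t ^ 4" using assms by (intro mult_right_mono) auto
  finally have "B * t\<^sup>2 \<le> t ^ 4 / (4 * (1 + \<nu> * t)\<^sup>2)"
    using pos by (simp only: pos_le_divide_eq mult_1)
  moreover have "0 \<le> 4 * B\<^sup>2" by simp
  ultimately show ?thesis by linarith
qed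
qed

text \<open>With |z| \<le> 3 t the quadratic term has coefficient 9/2, rounded up to 5, and the
  linear one 3; the extra 1 together with t \<le> t^2 + 1 leaves room for the term - t.\<close>

lemma exp_perturbation_bound:
  fixes z :: complex
  assumes "\<bar>\<theta>\<bar> \<le> \<Theta>" "\<bar>w\<bar> \<le> V" "cmod z \<le> 3 * t" "0 \<le> t"
  shows "\<bar>Re (of_real \<theta> * z\<^sup>2 / 2 - of_real w * z)\<bar> \<le> (5 * \<Theta> + 3 * V + 1) * (t\<^sup>2 + 1) - t"
proof -
  have pos: "0 \<le> \<Theta>" "0 \<le> V" using assms by auto
  have tt: "t \<le> t\<^sup>2 + 1"
  proof -
    have "0 \<le> (t - 1/2)\<^sup>2" by simp
    then show ?thesis by (simp add: power2_eq_square algebra_simps)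
  qed
  have "\<bar>Re (of_real \<theta> * z\<^sup>2 / 2 - of_real w * z)\<bar> \<le> cmod (of_real \<theta> * z\<^sup>2 / 2 - of_real w * z)"
    by (rule abs_Re_le_cmod)
  also have "\<dots> \<le> \<bar>\<theta>\<bar> * (cmod z)\<^sup>2 / 2 + \<bar>w\<bar> * cmod z"
    by (intro order_trans[OF norm_triangle_ineq4]) (simp add: norm_mult norm_divide norm_power)
  also have "\<dots> \<le> \<Theta> * (3 * t)\<^sup>2 / 2 + V * (3 * t)"
    using assms pos by (intro add_mono divide_right_mono mult_mono power_mono) auto
  also have "\<dots> \<le> (5 * \<Theta> + 3 * V + 1) * (t\<^sup>2 + 1) - t"
  proof -
    have "0 \<le> \<Theta> * t\<^sup>2" "V * t \<le> V * (t\<^sup>2 + 1)" using pos tt by (auto intro: mult_left_mono)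
    moreover have "\<Theta> * (3 * t)\<^sup>2 / 2 + V * (3 * t) = 9 / 2 * (\<Theta> * t\<^sup>2) + 3 * (V * t)"
      by (simp add: power_mult_distrib)
    moreover have "(5 * \<Theta> + 3 * V + 1) * (t\<^sup>2 + 1) - t
        = 5 * (\<Theta> * t\<^sup>2) + 5 * \<Theta> + 3 * (V * (t\<^sup>2 + 1)) + (t\<^sup>2 + 1) - t"
      by (simp add: algebra_simps)
    ultimately show ?thesis using tt pos by linarith
  qed
  finally show ?thesis .
qed

text \<open>The bound is uniform for \<theta> and w in bounded ranges. It is decay of F along the
  outer directions (e = -1) and of 1 / F along the inner ones (e = 1), the two ways in which F
  enters the integrand.\<close>

lemma saddle_perturbed_bound:
  assumes pq: "0 < q" "q < p" "p ^ 3 - q ^ 3 = 1"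
    and \<mu>: "\<And>m::nat. 0 < m \<Longrightarrow> 0 < \<mu> m" "\<And>m. 0 < m \<Longrightarrow> real m * \<mu> m ^ 4 * (p ^ 4 - q ^ 4) = 1" "\<mu> \<longlonglongrightarrow> 0"
  defines "F \<equiv> \<lambda>m \<theta> w z. saddle m p q (\<mu> m) z * exp (of_real \<theta> * z\<^sup>2 / 2 - of_real w * z)"
  shows "\<exists>C>0. \<forall>\<^sub>F m in sequentially. \<forall>\<theta> w e d t. \<bar>\<theta>\<bar> \<le> \<Theta> \<longrightarrow> \<bar>w\<bar> \<le> V \<longrightarrow> steep_direction e d \<longrightarrow> 0 \<le> t \<longrightarrow>
      F m \<theta> w (of_real t * d) \<noteq> 0 \<and> e * - ln (cmod (F m \<theta> w (of_real t * d))) \<le> C - t"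
proof -
  define B where "B = max 1 (5 * \<Theta> + 3 * V + 1)"
  have B: "0 < B" "5 * \<Theta> + 3 * V + 1 \<le> B" by (auto simp: B_def)
  have "(\<lambda>m. 16 * B * (3 * p * \<mu> m)\<^sup>2) \<longlonglongrightarrow> 16 * B * (3 * p * 0)\<^sup>2"
    by (intro tendsto_intros \<mu>(3))
  \<comment> \<open>The hypothesis of \<open>quartic_dominates\<close> for \<nu> = 3 p \<mu> m,
    valid for large m.\<close>
  then have ev: "\<forall>\<^sub>F m in sequentially. 16 * B * (3 * p * \<mu> m)\<^sup>2 < 1"
    by (intro order_tendstoD(2)[of _ 0]) auto
  have main: "F m \<theta> w (of_real t * d) \<noteq> 0 \<and> e * - ln (cmod (F m \<theta> w (of_real t * d))) \<le> (B + 4 * B\<^sup>2) - t"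
    if m: "16 * B * (3 * p * \<mu> m)\<^sup>2 < 1" "0 < m"
      and h: "\<bar>\<theta>\<bar> \<le> \<Theta>" "\<bar>w\<bar> \<le> V" "steep_direction e d" "0 \<le> t" for m \<theta> w e d t
  proof -
    define z where "z = of_real t * d"
    define S where "S = saddle m p q (\<mu> m) z"
    define r where "r = Re (of_real \<theta> * z\<^sup>2 / 2 - of_real w * z)"
    have d3: "cmod d \<le> 3"
    proof (rule power2_le_imp_le)
      show "(cmod d)\<^sup>2 \<le> 3\<^sup>2" using h(3) by (auto simp: steep_direction_def cmod_power2)
    qed simp
    then have "cmod z \<le> 3 * t" using mult_left_mono[OF d3 h(4)] h(4) by (simp add: z_def norm_mult mult_ac)
    then have "\<bar>r\<bar> \<le> (5 * \<Theta> + 3 * V + 1) * (t\<^sup>2 + 1) - t"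
      unfolding r_def using h by (intro exp_perturbation_bound) auto
    also have "\<dots> \<le> B * (t\<^sup>2 + 1) - t"
      using B by (intro diff_right_mono mult_right_mono) auto
    finally have r: "\<bar>r\<bar> \<le> B * t\<^sup>2 + B - t" by (simp add: algebra_simps)
    have \<nu>: "0 \<le> 3 * p * \<mu> m" using pq \<mu>(1)[OF m(2)] by simp
    have "B * t\<^sup>2 - 4 * B\<^sup>2 \<le> t ^ 4 / (4 * (1 + (3 * p * \<mu> m) * t)\<^sup>2)"
      by (rule quartic_dominates[OF B(1) h(4) \<nu> less_imp_le[OF m(1)]])
    also have "\<dots> \<le> e * ln (cmod S)"
      unfolding S_def z_def by (rule saddle_bound(2)[OF h(3,4) pq \<mu>(1,2)[OF m(2)]])
    finally have S: "B * t\<^sup>2 - 4 * B\<^sup>2 \<le> e * ln (cmod S)" .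
    have S0: "S \<noteq> 0" unfolding S_def z_def by (rule saddle_bound(1)[OF h(3,4) pq \<mu>(1,2)[OF m(2)]])
    have FS: "F m \<theta> w z = S * exp (of_real \<theta> * z\<^sup>2 / 2 - of_real w * z)" by (simp add: F_def S_def)
    have "ln (cmod (F m \<theta> w z)) = ln (cmod S) + r"
      unfolding FS norm_mult norm_exp_eq_Re using S0 by (subst ln_mult) (auto simp: r_def)
    moreover have "e = 1 \<or> e = - 1" using h(3) by (auto simp: steep_direction_def)
    ultimately have "e * - ln (cmod (F m \<theta> w z)) \<le> (B + 4 * B\<^sup>2) - t"
      using S r by auto
    moreover have "F m \<theta> w z \<noteq> 0" unfolding FS using S0 by simp
    ultimately show ?thesis unfolding z_def by blast
  qed
  have "0 < B + 4 * B\<^sup>2" using B by (simp add: add_pos_nonneg)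
  moreover have "\<forall>\<^sub>F m in sequentially. \<forall>\<theta> w e d t. \<bar>\<theta>\<bar> \<le> \<Theta> \<longrightarrow> \<bar>w\<bar> \<le> V \<longrightarrow> steep_direction e d \<longrightarrow> 0 \<le> t \<longrightarrow>
      F m \<theta> w (of_real t * d) \<noteq> 0 \<and> e * - ln (cmod (F m \<theta> w (of_real t * d))) \<le> (B + 4 * B\<^sup>2) - t"
    using ev eventually_gt_at_top[of 0] by eventually_elim (intro allI impI main)
  ultimately show ?thesis by (intro exI[of _ "B + 4 * B\<^sup>2"] conjI)
qed

section \<open>Pointwise limit of the saddle factor\<close>

lemma Ln_remainder_limit:
  "((\<lambda>x::complex. (Ln (1 + x) - x + x\<^sup>2 / 2 - x ^ 3 / 3) / x ^ 4) \<longlongrightarrow> - 1 / 4) (at 0)"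
proof -
  define a where "a = (\<lambda>n. (- 1) ^ Suc (n + 4) / of_nat (n + 4) :: complex)"
  have "((\<lambda>x. (Ln (1 + x) - x + x\<^sup>2 / 2 - x ^ 3 / 3) / x ^ 4) \<longlongrightarrow> a 0) (at 0)"
  proof (rule powser_limit_0_strong[of 1])
    fix x :: complex assume x: "x \<noteq> 0" "norm x < 1"
    have "(\<lambda>n. (- 1) ^ Suc n / of_nat n * x ^ n) sums Ln (1 + x)"
      by (rule Ln_series) (use x in auto)
    then have "(\<lambda>n. (- 1) ^ Suc (n + 4) / of_nat (n + 4) * x ^ (n + 4)) sums
        (Ln (1 + x) - (\<Sum>n<4. (- 1) ^ Suc n / of_nat n * x ^ n))"
      by (subst sums_iff_shift) simp
    moreover have "(\<Sum>n<4. (- 1) ^ Suc n / of_nat n * x ^ n) = x - x\<^sup>2 / 2 + x ^ 3 / 3"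
      by (simp add: eval_nat_numeral)
    moreover have "Ln (1 + x) - (x - x\<^sup>2 / 2 + x ^ 3 / 3) = Ln (1 + x) - x + x\<^sup>2 / 2 - x ^ 3 / 3"
      by simp
    ultimately have "(\<lambda>n. a n * x ^ (n + 4)) sums (Ln (1 + x) - x + x\<^sup>2 / 2 - x ^ 3 / 3)"
      unfolding a_def by (simp only:)
    then have "(\<lambda>n. a n * x ^ (n + 4) / x ^ 4) sums ((Ln (1 + x) - x + x\<^sup>2 / 2 - x ^ 3 / 3) / x ^ 4)"
      by (rule sums_divide)
    then show "(\<lambda>n. a n * x ^ n) sums ((Ln (1 + x) - x + x\<^sup>2 / 2 - x ^ 3 / 3) / x ^ 4)"
      using x by (simp add: power_add)
  qed simp
  then show ?thesis by (simp add: a_def)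
qed

text \<open>With x = p \<mu> z and y = q \<mu> z, the condition p^3 - q^3 = 1 turns the exponent
  into m (x^4 R x - y^4 R y), where R is the fourth-order remainder quotient of the logarithm and
  tends to -1/4. By the normalisation of \<mu>, m x^4 = p^4 z^4 / (p^4 - q^4), and likewise for
  y.\<close>

lemma saddle_tendsto:
  assumes pq: "0 < q" "q < p" "p ^ 3 - q ^ 3 = 1"
    and \<mu>: "\<And>m::nat. 0 < m \<Longrightarrow> 0 < \<mu> m" "\<And>m. 0 < m \<Longrightarrow> real m * \<mu> m ^ 4 * (p ^ 4 - q ^ 4) = 1" "\<mu> \<longlonglongrightarrow> 0"
  shows "(\<lambda>m. saddle m p q (\<mu> m) z) \<longlonglongrightarrow> exp (- (z ^ 4) / 4)"
proof (cases "z = 0")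
  case True
  then show ?thesis by (simp add: saddle_def)
next
  case False
  define R where "R = (\<lambda>x::complex. (Ln (1 + x) - x + x\<^sup>2 / 2 - x ^ 3 / 3) / x ^ 4)"
  have k: "p ^ 4 - q ^ 4 > 0" using pq by (simp add: power_strict_mono)
  define c where "c = complex_of_real (p ^ 4 - q ^ 4)"
  have c0: "c \<noteq> 0" using k unfolding c_def by (simp only: of_real_eq_0_iff)
  have lim0: "(\<lambda>m. of_real (\<rho> * \<mu> m) * z) \<longlonglongrightarrow> 0" for \<rho>
    using tendsto_mult[OF tendsto_of_real[OF tendsto_mult[OF tendsto_const \<mu>(3)]] tendsto_const[of z], of \<rho>] by simp
  have Rlim: "(\<lambda>m. R (of_real (\<rho> * \<mu> m) * z)) \<longlonglongrightarrow> - 1 / 4" if "0 < \<rho>" for \<rho>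
  proof (rule filterlim_compose[OF Ln_remainder_limit[folded R_def]])
    show "filterlim (\<lambda>m. of_real (\<rho> * \<mu> m) * z) (at 0) sequentially"
      unfolding filterlim_at
    proof
      show "\<forall>\<^sub>F m in sequentially. of_real (\<rho> * \<mu> m) * z \<in> UNIV \<and> of_real (\<rho> * \<mu> m) * z \<noteq> 0"
        using eventually_gt_at_top[of 0]
      proof eventually_elim
        case (elim m)
        have "\<rho> * \<mu> m \<noteq> 0" using that \<mu>(1)[OF elim] by simp
        then have "complex_of_real (\<rho> * \<mu> m) \<noteq> 0" by (simp only: of_real_eq_0_iff not_False_eq_True)
        then show ?case using False by (simp del: of_real_mult)
      qed
    qed (rule lim0)
  qed
  define E where "E = (\<lambda>m. (of_real (p ^ 4) * R (of_real (p * \<mu> m) * z) - of_real (q ^ 4) * R (of_real (q * \<mu> m) * z)) * z ^ 4 / of_real (p ^ 4 - q ^ 4))"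
  have "E \<longlonglongrightarrow> (of_real (p ^ 4) * (- 1 / 4) - of_real (q ^ 4) * (- 1 / 4)) * z ^ 4 / of_real (p ^ 4 - q ^ 4)"
    unfolding E_def
    by (intro tendsto_divide tendsto_mult tendsto_diff tendsto_const Rlim c0[unfolded c_def]) (use pq in simp_all)
  also have "(of_real (p ^ 4) * (- 1 / 4) - of_real (q ^ 4) * (- 1 / 4)) * z ^ 4 / of_real (p ^ 4 - q ^ 4) = - (z ^ 4) / 4"
  proof -
    have "complex_of_real (p ^ 4) * (- 1 / 4) - of_real (q ^ 4) * (- 1 / 4) = c * (- 1 / 4)"
      unfolding c_def by (simp only: of_real_diff left_diff_distrib)
    then show ?thesis using c0 unfolding c_def[symmetric] by simp
  qed
  finally have "(\<lambda>m. exp (E m)) \<longlonglongrightarrow> exp (- (z ^ 4) / 4)" by (rule tendsto_exp)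
  moreover have "\<forall>\<^sub>F m in sequentially. exp (E m) = saddle m p q (\<mu> m) z"
  proof -
    have small: "\<forall>\<^sub>F m in sequentially. cmod (of_real (\<rho> * \<mu> m) * z) < 1" for \<rho>
      using order_tendstoD(2)[OF tendsto_norm[OF lim0], of 1 \<rho>] by simp
    show ?thesis
      using eventually_gt_at_top[of 0] small[of p] small[of q]
    proof eventually_elim
      case (elim m)
      define x y where "x = of_real (p * \<mu> m) * z" and "y = of_real (q * \<mu> m) * z"
      have \<mu>m: "\<mu> m \<noteq> 0" using \<mu>(1)[of m] elim by simp
      have xy: "x \<noteq> 0" "y \<noteq> 0" using False pq \<mu>m by (auto simp: x_def y_def)
      have nz: "1 + x \<noteq> 0" "1 + y \<noteq> 0"
        using elim by (auto simp: x_def y_def add_eq_0_iff)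
      have "complex_of_real (real m * \<mu> m ^ 4 * (p ^ 4 - q ^ 4)) = 1"
        using \<mu>(2)[of m] elim(1) by (simp only: of_real_1)
      then have "of_nat m * of_real (\<mu> m ^ 4) * c = 1"
        unfolding c_def by (simp only: of_real_mult of_real_of_nat_eq)
      then have m4: "of_nat m * of_real (\<mu> m ^ 4) = 1 / c"
        using c0 by (simp only: eq_divide_eq) simp
      have xy4: "x ^ 4 = of_real (\<mu> m ^ 4) * of_real (p ^ 4) * z ^ 4" "y ^ 4 = of_real (\<mu> m ^ 4) * of_real (q ^ 4) * z ^ 4"
        by (simp_all add: x_def y_def power_mult_distrib)
      have alg: "M * (U * P * Z * r - U * Q * Z * r') = (M * U) * ((P * r - Q * r') * Z)" for M U P Q Z r r' :: complex
        by (simp add: algebra_simps)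
      have "of_nat m * (x ^ 4 * R x - y ^ 4 * R y)
          = 1 / c * ((of_real (p ^ 4) * R x - of_real (q ^ 4) * R y) * z ^ 4)"
        unfolding xy4 alg m4 ..
      then have "E m = of_nat m * (x ^ 4 * R x - y ^ 4 * R y)"
        unfolding E_def x_def[symmetric] y_def[symmetric] c_def[symmetric] by simp
      also have "x ^ 4 * R x = Ln (1 + x) - x + x\<^sup>2 / 2 - x ^ 3 / 3" using xy by (simp add: R_def)
      also have "y ^ 4 * R y = Ln (1 + y) - y + y\<^sup>2 / 2 - y ^ 3 / 3" using xy by (simp add: R_def)
      also have "of_nat m * ((Ln (1 + x) - x + x\<^sup>2 / 2 - x ^ 3 / 3) - (Ln (1 + y) - y + y\<^sup>2 / 2 - y ^ 3 / 3))
          = of_nat m * (Ln (1 + x) - Ln (1 + y)) + - (of_nat m * ((x - y) - (x\<^sup>2 - y\<^sup>2) / 2 + (x ^ 3 - y ^ 3) / 3))"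
      proof -
        have "M * ((a - x + x2 / 2 - x3 / 3) - (b - y + y2 / 2 - y3 / 3))
            = M * (a - b) + - (M * ((x - y) - (x2 - y2) / 2 + (x3 - y3) / 3))" for M a b x y x2 y2 x3 y3 :: complex
          by (simp add: algebra_simps diff_divide_distrib)
        then show ?thesis .
      qed
      finally have "exp (E m) = exp (Ln (1 + x) - Ln (1 + y)) ^ m * exp (- (of_nat m * ((x - y) - (x\<^sup>2 - y\<^sup>2) / 2 + (x ^ 3 - y ^ 3) / 3)))"
        by (simp only: exp_add exp_of_nat_mult)
      also have "exp (Ln (1 + x) - Ln (1 + y)) = (1 + x) / (1 + y)"
        using nz by (simp add: exp_diff)
      also have "(x - y) - (x\<^sup>2 - y\<^sup>2) / 2 + (x ^ 3 - y ^ 3) / 3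
          = of_real ((p - q) * \<mu> m) * z - of_real ((p\<^sup>2 - q\<^sup>2) * (\<mu> m)\<^sup>2) * z\<^sup>2 / 2 + of_real ((p ^ 3 - q ^ 3) * \<mu> m ^ 3) * z ^ 3 / 3"
      proof -
        have "(P * M * z - Q * M * z) - ((P * M * z)\<^sup>2 - (Q * M * z)\<^sup>2) / 2 + ((P * M * z) ^ 3 - (Q * M * z) ^ 3) / 3
          = (P - Q) * M * z - (P\<^sup>2 - Q\<^sup>2) * M\<^sup>2 * z\<^sup>2 / 2 + (P ^ 3 - Q ^ 3) * M ^ 3 * z ^ 3 / 3" for P Q M :: complex
          by (simp add: power_mult_distrib left_diff_distrib)
        from this[of "of_real p" "of_real (\<mu> m)" "of_real q"] show ?thesis
          unfolding x_def y_def by simp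
      qed
      finally show ?case unfolding saddle_def x_def[symmetric] y_def[symmetric] pq(3) mult_1 .
    qed
  qed
  ultimately show ?thesis by (rule Lim_transform_eventually)
qed

section \<open>Dominated convergence on pairs of rays\<close>

lemma ray_integral_open: "ray_integral c d f = (LBINT t:{0<..}. f (c + of_real t * d) * d)"
  unfolding ray_integral_def set_lebesgue_integral_def
  by (rule integral_discrete_difference[of "{0}"]) (auto simp: indicator_def)

lemma norm_ray_integral_le:
  assumes A: "set_integrable lborel {0..} A" and bd: "\<And>t. 0 < t \<Longrightarrow> cmod (f (c + of_real t * d)) \<le> A t"
  shows "cmod (ray_integral c d f) \<le> (LBINT t:{0..}. A t) * cmod d"
proof -
  have A': "set_integrable lborel {0<..} A"
    by (rule set_integrable_subset[OF A]) auto
  have "cmod (ray_integral c d f) \<le> (LBINT t. norm (indicator {0<..} t *\<^sub>R (f (c + of_real t * d) * d)))"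
    unfolding ray_integral_open set_lebesgue_integral_def by (rule integral_norm_bound)
  also have "\<dots> \<le> (LBINT t. (indicator {0<..} t *\<^sub>R A t) * cmod d)"
  proof (rule integral_mono')
    show "integrable lborel (\<lambda>t. (indicator {0<..} t *\<^sub>R A t) * cmod d)"
      using A' unfolding set_integrable_def by (rule integrable_mult_left)
    fix t :: real
    show "norm (indicator {0<..} t *\<^sub>R (f (c + of_real t * d) * d)) \<le> (indicator {0<..} t *\<^sub>R A t) * cmod d"
      using bd[of t] by (auto simp: indicator_def norm_mult intro: mult_right_mono)
    show "0 \<le> (indicator {0<..} t *\<^sub>R A t) * cmod d"
      using bd[of t] order_trans[OF norm_ge_zero, of "f (c + of_real t * d)" "A t"] by (auto simp: indicator_def)
  qed
  also have "\<dots> = (LBINT t:{0<..}. A t) * cmod d"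
    unfolding set_lebesgue_integral_def by simp
  also have "(LBINT t:{0<..}. A t) = (LBINT t:{0..}. A t)"
    unfolding set_lebesgue_integral_def by (rule integral_discrete_difference[of "{0}"]) (auto simp: indicator_def)
  finally show ?thesis .
qed

text \<open>Dominated convergence for the inner integral at each t > 0, then for the outer one:
  integrating B out of the product majorant leaves a multiple of A.\<close>

lemma ray_ray_dominated_convergence:
  fixes f :: "nat \<Rightarrow> complex \<Rightarrow> complex \<Rightarrow> complex"
  assumes meas: "\<And>m. (\<lambda>x. f m (fst x) (snd x)) \<in> borel_measurable borel" "(\<lambda>x. g (fst x) (snd x)) \<in> borel_measurable borel"
    and A: "set_integrable lborel {0..} A" and B: "set_integrable lborel {0..} B"
    and bd: "\<And>m t t'. 0 < t \<Longrightarrow> 0 < t' \<Longrightarrow> cmod (f m (c + of_real t * d) (c' + of_real t' * d')) \<le> A t * B t'"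
    and lim: "\<And>t t'. 0 < t \<Longrightarrow> 0 < t' \<Longrightarrow> (\<lambda>m. f m (c + of_real t * d) (c' + of_real t' * d')) \<longlonglongrightarrow> g (c + of_real t * d) (c' + of_real t' * d')"
  shows "(\<lambda>m. ray_integral c d (\<lambda>z. ray_integral c' d' (f m z))) \<longlonglongrightarrow> ray_integral c d (\<lambda>z. ray_integral c' d' (g z))"
proof -
  have bdg: "cmod (g (c + of_real t * d) (c' + of_real t' * d')) \<le> A t * B t'" if "0 < t" "0 < t'" for t t'
    by (rule tendsto_upperbound[OF tendsto_norm[OF lim[OF that]]]) (use bd[OF that] in auto)
  have A': "set_integrable lborel {0<..} A" and B': "set_integrable lborel {0<..} B"
    by (rule set_integrable_subset[OF A], simp, force, rule set_integrable_subset[OF B], simp, force)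
  have fm: "(\<lambda>t'. h z (c' + of_real t' * d') * d') \<in> borel_measurable borel"
    if h: "(\<lambda>x. h (fst x) (snd x)) \<in> borel_measurable borel" for h :: "complex \<Rightarrow> complex \<Rightarrow> complex" and z
  proof -
    have "(\<lambda>t'. (z, c' + of_real t' * d')) \<in> (borel :: real measure) \<rightarrow>\<^sub>M (borel \<Otimes>\<^sub>M borel)" by measurable
    from measurable_compose[OF this, of "\<lambda>x. h (fst x) (snd x)" borel] h
    have "(\<lambda>t'. h z (c' + of_real t' * d')) \<in> borel_measurable borel" by (simp add: borel_prod)
    then show ?thesis by measurable
  qed
  have inner: "(\<lambda>m. ray_integral c' d' (f m (c + of_real t * d))) \<longlonglongrightarrow> ray_integral c' d' (g (c + of_real t * d))"
    if t: "0 < t" for t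
    unfolding ray_integral_open set_lebesgue_integral_def
  proof (rule integral_dominated_convergence[where w = "\<lambda>t'. (A t * cmod d') * (indicator {0<..} t' *\<^sub>R B t')"])
    show "integrable lborel (\<lambda>t'. (A t * cmod d') * (indicator {0<..} t' *\<^sub>R B t'))"
      using B' unfolding set_integrable_def by (rule integrable_mult_right)
    show "AE t' in lborel. (\<lambda>m. indicator {0<..} t' *\<^sub>R (f m (c + of_real t * d) (c' + of_real t' * d') * d'))
        \<longlonglongrightarrow> indicator {0<..} t' *\<^sub>R (g (c + of_real t * d) (c' + of_real t' * d') * d')"
      using lim[OF t] by (intro AE_I2) (auto simp: indicator_def intro!: tendsto_mult)
    show "AE t' in lborel. norm (indicator {0<..} t' *\<^sub>R (f m (c + of_real t * d) (c' + of_real t' * d') * d'))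
        \<le> (A t * cmod d') * (indicator {0<..} t' *\<^sub>R B t')" for m
      using mult_right_mono[OF bd[OF t], of _ "cmod d'"] by (intro AE_I2) (auto simp: indicator_def norm_mult mult_ac)
  qed (use fm[OF meas(1)] fm[OF meas(2)] in \<open>auto intro!: borel_measurable_scaleR\<close>)
  define b where "b = (LBINT t:{0..}. B t) * cmod d'"
  have innerb: "cmod (ray_integral c' d' (f m (c + of_real t * d))) \<le> A t * b" if "0 < t" for m t
  proof -
    have "cmod (ray_integral c' d' (f m (c + of_real t * d))) \<le> (LBINT t':{0..}. A t * B t') * cmod d'"
      by (rule norm_ray_integral_le) (use bd[OF that] B in \<open>auto intro: set_integrable_mult_right\<close>)
    then show ?thesis by (simp add: b_def mult.assoc)
  qed
  have outm: "(\<lambda>t. indicator {0<..} t *\<^sub>R (ray_integral c' d' (h (c + of_real t * d)) * d)) \<in> borel_measurable lborel"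
    if h: "(\<lambda>x. h (fst x) (snd x)) \<in> borel_measurable borel"
      and hb: "\<And>t t'. 0 < t \<Longrightarrow> 0 < t' \<Longrightarrow> cmod (h (c + of_real t * d) (c' + of_real t' * d')) \<le> A t * B t'"
    for h :: "complex \<Rightarrow> complex \<Rightarrow> complex"
  proof -
    have "set_integrable lborel {0..} (\<lambda>t. ray_integral c' d' (h (c + of_real t * d)) * d)"
      using ray_fubini(2)[OF h A B, of c d c' d'] hb unfolding ray_integrable_def by blast
    then have "set_integrable lborel {0<..} (\<lambda>t. ray_integral c' d' (h (c + of_real t * d)) * d)"
      by (rule set_integrable_subset) auto
    then show ?thesis unfolding set_integrable_def by (rule borel_measurable_integrable)
  qed
  show ?thesis
    unfolding ray_integral_open[of c d] set_lebesgue_integral_def[of lborel "{0<..}"]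
  proof (rule integral_dominated_convergence[where w = "\<lambda>t. (indicator {0<..} t *\<^sub>R A t) * (b * cmod d)"])
    show "integrable lborel (\<lambda>t. (indicator {0<..} t *\<^sub>R A t) * (b * cmod d))"
      using A' unfolding set_integrable_def by (rule integrable_mult_left)
    show "AE t in lborel. (\<lambda>m. indicator {0<..} t *\<^sub>R (ray_integral c' d' (f m (c + of_real t * d)) * d))
        \<longlonglongrightarrow> indicator {0<..} t *\<^sub>R (ray_integral c' d' (g (c + of_real t * d)) * d)"
      using inner by (intro AE_I2) (auto simp: indicator_def intro!: tendsto_mult)
    show "AE t in lborel. norm (indicator {0<..} t *\<^sub>R (ray_integral c' d' (f m (c + of_real t * d)) * d))
        \<le> (indicator {0<..} t *\<^sub>R A t) * (b * cmod d)" for m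
      using mult_right_mono[OF innerb, of _ "cmod d"] by (intro AE_I2) (auto simp: indicator_def norm_mult mult_ac)
  qed (use outm[OF meas(1) bd] outm[OF meas(2) bdg] in blast)+
qed

section \<open>The double integral at the cusp\<close>

text \<open>The left wedge has the sides -2 +- i, on which the integrand before the limit decays
  uniformly in m. For the Pearcey integrand it can be replaced by the left half of the cross-shaped
  contour.\<close>

definition cusp_integral :: "(complex \<Rightarrow> complex) \<Rightarrow> (complex \<Rightarrow> complex) \<Rightarrow> complex" where
  "cusp_integral F1 F2 = wedge_integral (- \<i>) 0 \<i> (\<lambda>z.
     wedge_integral (Complex 1 1) 0 (Complex 1 (-1)) (\<lambda>z'. F2 z / F1 z' / (z - z'))
     + wedge_integral (Complex (-2) (-1)) 0 (Complex (-2) 1) (\<lambda>z'. F2 z / F1 z' / (z - z')))"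

definition pearcey_phase :: "real \<Rightarrow> real \<Rightarrow> complex \<Rightarrow> complex" where
  "pearcey_phase \<theta> v z = exp (- (z ^ 4) / 4 + of_real \<theta> * z\<^sup>2 / 2 - of_real v * z)"

lemma wedge_direction_scale:
  assumes "0 < k"
  shows "wedge_integral (of_real k * d1) c (of_real k * d2) f = wedge_integral d1 c d2 f"
  using assms by (simp add: wedge_integral_def ray_integral_direction_scale)

text \<open>For e = - (1 + u) + i s with s^2 = 1 one has Re (e^4) = ((1 + u)^2 - 3)^2 - 8, at most
  -4 because (1 + u)^2 lies in [1, 4]. So the integrand decays on the whole sector between the two
  left rays.\<close>

lemma quartic_decay_left:
  assumes "\<bar>s\<bar> = 1"
  shows "\<exists>C. \<forall>R u. 0 \<le> R \<longrightarrow> 0 \<le> u \<longrightarrow> u \<le> 1 \<longrightarrow>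
    Re ((\<lambda>z. z ^ 4 / 4 - of_real \<theta> * z\<^sup>2 / 2 + of_real v * z)
      (of_real (1 - u) * (0 + of_real R * Complex (-1) s) + of_real u * (0 + of_real R * Complex (-2) s))) \<le> C - R"
proof -
  define M where "M = 5 * \<bar>\<theta>\<bar> + 3 * \<bar>v\<bar>"
  have M: "0 \<le> M" by (simp add: M_def)
  obtain C where C: "\<And>R. 0 \<le> R \<Longrightarrow> M * R\<^sup>2 + M * R + M - 1 * R ^ 4 \<le> C - R"
    using power_dominates_linear[of 1 M 4] M by auto
  show ?thesis
  proof (intro exI allI impI)
    fix R u :: real assume R: "0 \<le> R" and u: "0 \<le> u" "u \<le> 1"
    define e where "e = Complex (- (1 + u)) s"
    define z where "z = of_real (1 - u) * (0 + of_real R * Complex (-1) s) + of_real u * (0 + of_real R * Complex (-2) s)"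
    have z: "z = of_real R * e" by (simp add: z_def e_def complex_eq_iff algebra_simps)
    have s2: "s\<^sup>2 = 1" "s ^ 4 = 1" using assms by (auto simp: abs_if split: if_splits)
    have "Re (e ^ 4) = (1 + u) ^ 4 - 6 * (1 + u)\<^sup>2 * s\<^sup>2 + s ^ 4"
      by (simp add: e_def eval_nat_numeral algebra_simps)
    also have "\<dots> = ((1 + u)\<^sup>2 - 3)\<^sup>2 - 8"
      by (simp add: s2) (simp add: eval_nat_numeral algebra_simps)
    also have "\<dots> \<le> - 4"
    proof -
      have "1\<^sup>2 \<le> (1 + u)\<^sup>2" "(1 + u)\<^sup>2 \<le> 2\<^sup>2" using u by (intro power_mono; simp)+
      then have "\<bar>(1 + u)\<^sup>2 - 3\<bar> \<le> 2" by (simp add: abs_le_iff)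
      then have "((1 + u)\<^sup>2 - 3)\<^sup>2 \<le> 2\<^sup>2" using abs_le_square_iff[of "(1 + u)\<^sup>2 - 3" 2] by simp
      then show ?thesis by simp
    qed
    finally have e4: "Re (e ^ 4) \<le> - 4" .
    have ne: "cmod e \<le> 3"
    proof (rule power2_le_imp_le)
      have "(1 + u)\<^sup>2 \<le> 2\<^sup>2" using u by (intro power_mono) auto
      then show "(cmod e)\<^sup>2 \<le> 3\<^sup>2" unfolding e_def cmod_power2 complex.sel power2_minus s2 by simp
    qed simp
    have nz: "cmod z \<le> 3 * R" using mult_left_mono[OF ne R] R by (simp add: z norm_mult mult_ac)
    have "Re (z ^ 4 / 4 - of_real \<theta> * z\<^sup>2 / 2 + of_real v * z)
        = R ^ 4 * Re (e ^ 4) / 4 + Re (- of_real \<theta> * z\<^sup>2 / 2 + of_real v * z)"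
    proof -
      have "z ^ 4 = of_real (R ^ 4) * e ^ 4" by (simp add: z power_mult_distrib)
      then have "Re (z ^ 4) = R ^ 4 * Re (e ^ 4)" by (simp del: of_real_power)
      then show ?thesis by simp
    qed
    also have "R ^ 4 * Re (e ^ 4) / 4 \<le> - (R ^ 4)"
      using mult_left_mono[OF e4, of "R ^ 4"] by simp
    also have "Re (- of_real \<theta> * z\<^sup>2 / 2 + of_real v * z) \<le> \<bar>\<theta>\<bar> * (cmod z)\<^sup>2 / 2 + \<bar>v\<bar> * cmod z"
      by (intro order_trans[OF complex_Re_le_cmod] order_trans[OF norm_triangle_ineq])
         (simp add: norm_mult norm_divide norm_power)
    also have "\<dots> \<le> \<bar>\<theta>\<bar> * (3 * R)\<^sup>2 / 2 + \<bar>v\<bar> * (3 * R)"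
      using nz by (intro add_mono divide_right_mono mult_left_mono power_mono) auto
    also have "\<dots> \<le> M * R\<^sup>2 + M * R + M"
    proof -
      have "0 \<le> \<bar>\<theta>\<bar> * R\<^sup>2" "0 \<le> \<bar>v\<bar> * R" "0 \<le> \<bar>\<theta>\<bar> * R" "0 \<le> \<bar>v\<bar> * R\<^sup>2" using R by auto
      moreover have "\<bar>\<theta>\<bar> * (3 * R)\<^sup>2 / 2 = 9 / 2 * (\<bar>\<theta>\<bar> * R\<^sup>2)" by (simp add: power_mult_distrib)
      moreover have "M * R\<^sup>2 = 5 * (\<bar>\<theta>\<bar> * R\<^sup>2) + 3 * (\<bar>v\<bar> * R\<^sup>2)" "M * R = 5 * (\<bar>\<theta>\<bar> * R) + 3 * (\<bar>v\<bar> * R)"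
        by (simp_all add: M_def algebra_simps)
      moreover have "\<bar>v\<bar> * (3 * R) = 3 * (\<bar>v\<bar> * R)" by simp
      ultimately show ?thesis using M by linarith
    qed
    finally show "Re ((\<lambda>z. z ^ 4 / 4 - of_real \<theta> * z\<^sup>2 / 2 + of_real v * z)
      (of_real (1 - u) * (0 + of_real R * Complex (-1) s) + of_real u * (0 + of_real R * Complex (-2) s))) \<le> C - R"
      unfolding z_def[symmetric] using C[OF R] by simp
  qed
qed

text \<open>The pole z is imaginary and nonzero, hence outside the closed sector |Im w| \<le> - Re w
  in which the ray turns.\<close>

lemma pearcey_left_rotation:
  assumes z: "Re z = 0" "Im z \<noteq> 0" and s: "\<bar>s\<bar> = 1"
  shows "ray_integral 0 (Complex (-1) s) (\<lambda>z'. k / pearcey_phase \<theta> v z' / (z - z'))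
    = ray_integral 0 (Complex (-2) s) (\<lambda>z'. k / pearcey_phase \<theta> v z' / (z - z'))"
proof -
  define S where "S = half_plane 1 1 0 \<inter> half_plane 1 (-1) 0"
  define E where "E = (\<lambda>z::complex. z ^ 4 / 4 - of_real \<theta> * z\<^sup>2 / 2 + of_real v * z)"
  have nin: "z \<notin> S" using z by (auto simp: S_def mem_half_plane)
  have "closed S" unfolding S_def by (intro closed_Int closed_half_plane)
  from inverse_bounded_on[OF this nin] obtain H where H: "\<And>w. w \<in> S \<Longrightarrow> cmod (1 / (w - z)) \<le> H" by blast
  have op: "open (- {z})" by auto
  have hol: "(\<lambda>w. 1 / (w - z)) holomorphic_on - {z}" by (intro holomorphic_intros) auto
  have E: "E holomorphic_on UNIV" unfolding E_def by (intro holomorphic_intros) auto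
  have conv: "convex S" unfolding S_def by (intro convex_Int convex_half_plane)
  have sub: "S \<subseteq> - {z}" using nin by blast
  have ray: "0 + of_real t * Complex (-1) s \<in> S" "0 + of_real t * Complex (-2) s \<in> S" if "0 \<le> t" for t
    using that s by (auto simp: S_def mem_half_plane abs_if split: if_splits)
  define g where "g = (\<lambda>w. exp (E w) * (1 / (w - z)))"
  have "ray_integral 0 (Complex (-1) s) g = contour_integral (linepath 0 0) g + ray_integral 0 (Complex (-2) s) g"
    unfolding g_def by (rule ray_shift_exp(1)[OF op hol E conv sub])
       (use H ray quartic_decay_left[OF s, of \<theta> v] in \<open>auto simp: E_def\<close>)
  then have "ray_integral 0 (Complex (-1) s) g = ray_integral 0 (Complex (-2) s) g" by simp
  moreover have "(\<lambda>z'. k / pearcey_phase \<theta> v z' / (z - z')) = (\<lambda>w. - k * g w)"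
    unfolding g_def
  proof
    fix w
    have "E w = - (- (w ^ 4) / 4 + of_real \<theta> * w\<^sup>2 / 2 - of_real v * w)" by (simp add: E_def)
    then have "1 / pearcey_phase \<theta> v w = exp (E w)"
      by (simp only: pearcey_phase_def exp_minus inverse_eq_divide)
    then have "k / pearcey_phase \<theta> v w = k * exp (E w)" by (simp add: divide_inverse)
    moreover have "1 / (z - w) = - (1 / (w - z))" by (metis minus_diff_eq minus_divide_right)
    ultimately show "k / pearcey_phase \<theta> v w / (z - w) = - k * (exp (E w) * (1 / (w - z)))"
      by (metis (no_types, lifting) divide_inverse mult.assoc mult_minus_left mult_minus_right inverse_eq_divide)
  qed
  ultimately show ?thesis by (simp only: ray_integral_mult)
qed

lemma pearcey_integral_eq:
  "wedge_integral (- \<i>) 0 \<i> (\<lambda>z.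
     let f = (\<lambda>z'. 1 / (z - z')
               * (exp (- (z ^ 4) / 4 + of_real \<theta>2 * z\<^sup>2 / 2 - of_real v2 * z)
                  / exp (- (z' ^ 4) / 4 + of_real \<theta>1 * z'\<^sup>2 / 2 - of_real v1 * z')))
     in wedge_integral (cis (pi / 4)) 0 (cis (- pi / 4)) f
        + wedge_integral (- cis (pi / 4)) 0 (- cis (- pi / 4)) f)
   = cusp_integral (pearcey_phase \<theta>1 v1) (pearcey_phase \<theta>2 v2)"
  unfolding cusp_integral_def Let_def
proof (rule wedge_integral_cong)
  fix d :: complex and t :: real assume d: "d \<in> {- \<i>, \<i>}" "0 < t"
  define z where "z = 0 + of_real t * d"
  define f where "f = (\<lambda>z'. pearcey_phase \<theta>2 v2 z / pearcey_phase \<theta>1 v1 z' / (z - z'))"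
  have z: "Re z = 0" "Im z \<noteq> 0" using d by (auto simp: z_def)
  have c: "cis (pi / 4) = of_real (sqrt 2 / 2) * Complex 1 1" "cis (- pi / 4) = of_real (sqrt 2 / 2) * Complex 1 (-1)"
    "- cis (pi / 4) = of_real (sqrt 2 / 2) * Complex (-1) (-1)" "- cis (- pi / 4) = of_real (sqrt 2 / 2) * Complex (-1) 1"
    by (auto simp: complex_eq_iff cos_45 sin_45)
  have k: "0 < sqrt 2 / (2::real)" by simp
  have "wedge_integral (cis (pi / 4)) 0 (cis (- pi / 4)) f = wedge_integral (Complex 1 1) 0 (Complex 1 (-1)) f"
    unfolding c(1,2) by (rule wedge_direction_scale[OF k])
  moreover have "wedge_integral (- cis (pi / 4)) 0 (- cis (- pi / 4)) f = wedge_integral (Complex (-1) (-1)) 0 (Complex (-1) 1) f"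
    unfolding c(3,4) by (rule wedge_direction_scale[OF k])
  moreover have "\<dots> = wedge_integral (Complex (-2) (-1)) 0 (Complex (-2) 1) f"
    unfolding wedge_integral_def f_def
    by (intro arg_cong2[where f = "(-)"] pearcey_left_rotation z) auto
  moreover have "(\<lambda>z'. 1 / (z - z')
               * (exp (- (z ^ 4) / 4 + of_real \<theta>2 * z\<^sup>2 / 2 - of_real v2 * z)
                  / exp (- (z' ^ 4) / 4 + of_real \<theta>1 * z'\<^sup>2 / 2 - of_real v1 * z'))) = f"
    by (simp add: f_def pearcey_phase_def fun_eq_iff)
  ultimately show "wedge_integral (cis (pi / 4)) 0 (cis (- pi / 4)) (\<lambda>z'. 1 / (z - z')
               * (exp (- (z ^ 4) / 4 + of_real \<theta>2 * z\<^sup>2 / 2 - of_real v2 * z)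
                  / exp (- (z' ^ 4) / 4 + of_real \<theta>1 * z'\<^sup>2 / 2 - of_real v1 * z')))
        + wedge_integral (- cis (pi / 4)) 0 (- cis (- pi / 4)) (\<lambda>z'. 1 / (z - z')
               * (exp (- (z ^ 4) / 4 + of_real \<theta>2 * z\<^sup>2 / 2 - of_real v2 * z)
                  / exp (- (z' ^ 4) / 4 + of_real \<theta>1 * z'\<^sup>2 / 2 - of_real v1 * z')))
      = wedge_integral (Complex 1 1) 0 (Complex 1 (- 1)) (\<lambda>z'. pearcey_phase \<theta>2 v2 z / pearcey_phase \<theta>1 v1 z' / (z - z'))
       + wedge_integral (Complex (- 2) (- 1)) 0 (Complex (- 2) 1) (\<lambda>z'. pearcey_phase \<theta>2 v2 z / pearcey_phase \<theta>1 v1 z' / (z - z'))"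
    unfolding f_def[symmetric] by simp
qed

text \<open>The majorant in one parameter; t^(-1/2) is its share of the singularity of
  \<open>1 / (z - z')\<close> at the crossing of the contours.\<close>

definition gamma_weight :: "real \<Rightarrow> real \<Rightarrow> real" where
  "gamma_weight K t = K * (t powr (1/2 - 1) * exp (- t))"

lemma gamma_weight_integrable: "set_integrable lborel {0..} (gamma_weight K)"
  unfolding gamma_weight_def by (intro set_integrable_mult_right set_integrable_powr_exp) simp

lemma steep_separation:
  assumes "steep_direction (-1) d" "steep_direction 1 d'" "0 \<le> t" "0 \<le> t'"
  shows "sqrt (t * t') / 2 \<le> cmod (of_real t * d - of_real t' * d')"
proof -
  have i: "\<i> = Complex 0 1" "- \<i> = Complex 0 (-1)" by (auto simp: complex_eq_iff)
  have "d = Complex 0 1 \<or> d = Complex 0 (-1)"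
    using assms(1) unfolding steep_direction_def i(2) unfolding i(1) by auto
  then obtain s where s: "\<bar>s\<bar> = 1" "d = Complex 0 s" by (metis abs_minus_cancel abs_one)
  have "d' \<in> {Complex 1 1, Complex 1 (-1), Complex (-2) 1, Complex (-2) (-1)}"
    using assms(2) by (simp add: steep_direction_def)
  then obtain x s' where x: "1 \<le> \<bar>x\<bar>" "\<bar>s'\<bar> = 1" "d' = Complex x s'" by fastforce
  show ?thesis unfolding s(2) x(3) by (rule ray_separation) (use assms s x in auto)
qed

lemma cusp_integrand_bound:
  assumes F2: "\<And>d t. steep_direction (-1) d \<Longrightarrow> 0 \<le> t \<Longrightarrow> cmod (F2 (of_real t * d)) \<le> K * exp (- t)"
    and F1: "\<And>d t. steep_direction 1 d \<Longrightarrow> 0 \<le> t \<Longrightarrow> cmod (1 / F1 (of_real t * d)) \<le> K * exp (- t)"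
    and d: "steep_direction (-1) d" "steep_direction 1 d'" and t: "0 < t" "0 < t'"
  shows "cmod (F2 (0 + of_real t * d) / F1 (0 + of_real t' * d') / ((0 + of_real t * d) - (0 + of_real t' * d')))
    \<le> gamma_weight K t * gamma_weight (2 * K) t'"
proof -
  have K: "0 \<le> K" using F2[OF d(1), of 0] by (auto intro: order_trans[OF norm_ge_zero])
  have "cmod (F2 (of_real t * d)) * cmod (1 / F1 (of_real t' * d')) / cmod (of_real t * d - of_real t' * d')
      \<le> (K * exp (- t)) * (K * exp (- t')) / (sqrt (t * t') / 2)"
    using F2[OF d(1), of t] F1[OF d(2), of t'] steep_separation[OF d, of t t'] t K
    by (intro frac_le mult_mono) auto
  also have "\<dots> = gamma_weight K t * gamma_weight (2 * K) t'"
    using t by (simp add: gamma_weight_def real_sqrt_mult powr_half_sqrt powr_minus divide_simps)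
  finally show ?thesis by (simp add: norm_mult norm_divide)
qed

lemma steep_dirs: "steep_direction (-1) \<i>" "steep_direction (-1) (- \<i>)" "steep_direction 1 (Complex 1 1)"
  "steep_direction 1 (Complex 1 (-1))" "steep_direction 1 (Complex (-2) 1)" "steep_direction 1 (Complex (-2) (-1))"
  by (auto simp: steep_direction_def)

text \<open>A reduction to eight pairs of rays, so that bounds and limits need be proved for one
  pair only. The splitting is legitimate because Fubini makes each inner integral integrable along
  the outer rays.\<close>

lemma cusp_integral_expand:
  fixes F1 F2 :: "complex \<Rightarrow> complex"
  assumes meas: "F1 \<in> borel_measurable borel" "F2 \<in> borel_measurable borel"
    and F2: "\<And>d t. steep_direction (-1) d \<Longrightarrow> 0 \<le> t \<Longrightarrow> cmod (F2 (of_real t * d)) \<le> K * exp (- t)"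
    and F1: "\<And>d t. steep_direction 1 d \<Longrightarrow> 0 \<le> t \<Longrightarrow> cmod (1 / F1 (of_real t * d)) \<le> K * exp (- t)"
  defines "J \<equiv> \<lambda>d d'. ray_integral 0 d (\<lambda>z. ray_integral 0 d' (\<lambda>z'. F2 z / F1 z' / (z - z')))"
  shows "cusp_integral F1 F2 = J \<i> (Complex 1 (-1)) - J \<i> (Complex 1 1) + J \<i> (Complex (-2) 1) - J \<i> (Complex (-2) (-1))
     - (J (- \<i>) (Complex 1 (-1)) - J (- \<i>) (Complex 1 1) + J (- \<i>) (Complex (-2) 1) - J (- \<i>) (Complex (-2) (-1)))"
proof -
  note [measurable] = meas
  have m: "(\<lambda>x. F2 (fst x) / F1 (snd x) / (fst x - snd x)) \<in> borel_measurable borel"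
    unfolding borel_prod[symmetric] by measurable
  define G where "G = (\<lambda>d' z. ray_integral 0 d' (\<lambda>z'. F2 z / F1 z' / (z - z')))"
  have Gz: "ray_integral 0 d' (\<lambda>z'. F2 z / F1 z' / (z - z')) = G d' z" for d' z by (simp add: G_def)
  have I: "ray_integrable 0 d (G d')"
    if "steep_direction (-1) d" "steep_direction 1 d'" for d d'
    unfolding G_def
    by (rule ray_fubini(2)[OF m gamma_weight_integrable gamma_weight_integrable])
       (rule cusp_integrand_bound[OF F2 F1 that])
  have "ray_integral 0 d (\<lambda>z.
     wedge_integral (Complex 1 1) 0 (Complex 1 (-1)) (\<lambda>z'. F2 z / F1 z' / (z - z'))
     + wedge_integral (Complex (-2) (-1)) 0 (Complex (-2) 1) (\<lambda>z'. F2 z / F1 z' / (z - z')))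
    = J d (Complex 1 (-1)) - J d (Complex 1 1) + J d (Complex (-2) 1) - J d (Complex (-2) (-1))"
    if d: "steep_direction (-1) d" for d
    unfolding wedge_integral_def J_def Gz
    by (simp add: ray_integral_add ray_integral_diff ray_integrable_add ray_integrable_diff I[OF d] steep_dirs)
  then show ?thesis
    unfolding cusp_integral_def wedge_integral_def[of "- \<i>"] by (simp add: steep_dirs)
qed

text \<open>There are eight pairs of rays, and 9 = 3 * 3 because all directions have modulus at most
  3. What counts is that the bound depends on K alone, which makes the rescaled kernels uniformly
  bounded.\<close>

lemma cusp_integral_bound:
  fixes F1 F2 :: "complex \<Rightarrow> complex"
  assumes meas: "F1 \<in> borel_measurable borel" "F2 \<in> borel_measurable borel"
    and F2: "\<And>d t. steep_direction (-1) d \<Longrightarrow> 0 \<le> t \<Longrightarrow> cmod (F2 (of_real t * d)) \<le> K * exp (- t)"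
    and F1: "\<And>d t. steep_direction 1 d \<Longrightarrow> 0 \<le> t \<Longrightarrow> cmod (1 / F1 (of_real t * d)) \<le> K * exp (- t)"
  shows "cmod (cusp_integral F1 F2) \<le> 8 * ((LBINT t:{0..}. gamma_weight K t) * (LBINT t:{0..}. gamma_weight (2 * K) t) * 9)"
proof -
  define J where "J = (\<lambda>d d'. ray_integral 0 d (\<lambda>z. ray_integral 0 d' (\<lambda>z'. F2 z / F1 z' / (z - z'))))"
  define b1 where "b1 = (LBINT t:{0..}. gamma_weight K t)"
  define b2 where "b2 = (LBINT t:{0..}. gamma_weight (2 * K) t)"
  have K: "0 \<le> K" using F2[OF steep_dirs(1), of 0] by (auto intro: order_trans[OF norm_ge_zero])
  have b0: "0 \<le> b1" "0 \<le> b2"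
    unfolding b1_def b2_def set_lebesgue_integral_def
    by (auto intro!: integral_nonneg_AE AE_I2 simp: gamma_weight_def K)
  have J: "cmod (J d d') \<le> b1 * b2 * 9" if d: "steep_direction (-1) d" "steep_direction 1 d'" for d d'
  proof -
    have d3: "cmod d \<le> 3" "cmod d' \<le> 3"
      by (rule power2_le_imp_le; use d in \<open>auto simp: steep_direction_def cmod_power2\<close>)+
    have in_: "cmod (ray_integral 0 d' (\<lambda>z'. F2 (0 + of_real t * d) / F1 z' / ((0 + of_real t * d) - z')))
        \<le> gamma_weight K t * (b2 * 3)" if t: "0 < t" for t
    proof -
      have "cmod (ray_integral 0 d' (\<lambda>z'. F2 (0 + of_real t * d) / F1 z' / ((0 + of_real t * d) - z')))
          \<le> (LBINT t':{0..}. gamma_weight K t * gamma_weight (2 * K) t') * cmod d'"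
        by (rule norm_ray_integral_le[OF set_integrable_mult_right[OF gamma_weight_integrable]])
           (rule cusp_integrand_bound[OF F2 F1 d t])
      also have "\<dots> = gamma_weight K t * b2 * cmod d'" by (simp add: b2_def)
      also have "\<dots> \<le> gamma_weight K t * b2 * 3"
        using d3 b0 K by (intro mult_left_mono) (auto simp: gamma_weight_def)
      finally show ?thesis by (simp add: mult.assoc)
    qed
    have "cmod (J d d') \<le> (LBINT t:{0..}. gamma_weight K t * (b2 * 3)) * cmod d"
      unfolding J_def
      by (rule norm_ray_integral_le[OF set_integrable_mult_left[OF gamma_weight_integrable]]) (rule in_)
    also have "\<dots> = b1 * b2 * 3 * cmod d" by (simp add: b1_def)
    also have "\<dots> \<le> b1 * b2 * 3 * 3" using d3 b0 by (intro mult_left_mono) auto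
    finally show ?thesis by simp
  qed
  have tri: "cmod (a1 - a2 + a3 - a4 - (a5 - a6 + a7 - a8)) \<le> 8 * B"
    if "cmod a1 \<le> B" "cmod a2 \<le> B" "cmod a3 \<le> B" "cmod a4 \<le> B" "cmod a5 \<le> B" "cmod a6 \<le> B" "cmod a7 \<le> B" "cmod a8 \<le> B"
    for a1 a2 a3 a4 a5 a6 a7 a8 B
  proof -
    have "cmod (a1 - a2 + a3 - a4) \<le> cmod a1 + cmod a2 + cmod a3 + cmod a4" for a1 a2 a3 a4 :: complex
      using norm_triangle_ineq4[of "a1 - a2 + a3" a4] norm_triangle_ineq[of "a1 - a2" a3] norm_triangle_ineq4[of a1 a2] by linarith
    from this[of a1 a2 a3 a4] this[of a5 a6 a7 a8] norm_triangle_ineq4[of "a1 - a2 + a3 - a4" "a5 - a6 + a7 - a8"] that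
    show ?thesis by linarith
  qed
  have "cusp_integral F1 F2 = J \<i> (Complex 1 (-1)) - J \<i> (Complex 1 1) + J \<i> (Complex (-2) 1) - J \<i> (Complex (-2) (-1))
     - (J (- \<i>) (Complex 1 (-1)) - J (- \<i>) (Complex 1 1) + J (- \<i>) (Complex (-2) 1) - J (- \<i>) (Complex (-2) (-1)))"
    unfolding J_def by (rule cusp_integral_expand[where K = K]) (use meas F1 F2 in auto)
  then show ?thesis
    unfolding b1_def[symmetric] b2_def[symmetric] by (simp only:) (rule tri; intro J steep_dirs)
qed

lemma cusp_integral_tendsto:
  fixes F1 F2 :: "nat \<Rightarrow> complex \<Rightarrow> complex"
  assumes meas: "\<And>m. F1 m \<in> borel_measurable borel" "\<And>m. F2 m \<in> borel_measurable borel"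
      "G1 \<in> borel_measurable borel" "G2 \<in> borel_measurable borel"
    and bd: "\<forall>\<^sub>F m in sequentially. (\<forall>d t. steep_direction (-1) d \<longrightarrow> 0 \<le> t \<longrightarrow> cmod (F2 m (of_real t * d)) \<le> K * exp (- t)) \<and>
      (\<forall>d t. steep_direction 1 d \<longrightarrow> 0 \<le> t \<longrightarrow> cmod (1 / F1 m (of_real t * d)) \<le> K * exp (- t))"
    and lim: "\<And>z. (\<lambda>m. F1 m z) \<longlonglongrightarrow> G1 z" "\<And>z. (\<lambda>m. F2 m z) \<longlonglongrightarrow> G2 z" and nz: "\<And>z. G1 z \<noteq> 0"
  shows "(\<lambda>m. cusp_integral (F1 m) (F2 m)) \<longlonglongrightarrow> cusp_integral G1 G2"
proof -
  obtain m0 where m0: "\<And>m d t. m0 \<le> m \<Longrightarrow> steep_direction (-1) d \<Longrightarrow> 0 \<le> t \<Longrightarrow> cmod (F2 m (of_real t * d)) \<le> K * exp (- t)"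
      "\<And>m d t. m0 \<le> m \<Longrightarrow> steep_direction 1 d \<Longrightarrow> 0 \<le> t \<Longrightarrow> cmod (1 / F1 m (of_real t * d)) \<le> K * exp (- t)"
    using bd unfolding eventually_sequentially by blast
  define f where "f = (\<lambda>m z z'. F2 (m + m0) z / F1 (m + m0) z' / (z - z'))"
  define g where "g = (\<lambda>z z'. G2 z / G1 z' / (z - z'))"
  note [measurable] = meas
  have fm: "(\<lambda>x. f m (fst x) (snd x)) \<in> borel_measurable borel" for m
    unfolding f_def borel_prod[symmetric] by measurable
  have gm: "(\<lambda>x. g (fst x) (snd x)) \<in> borel_measurable borel"
    unfolding g_def borel_prod[symmetric] by measurable
  \<comment> \<open>The exponential bounds pass to the limits, so that
    \<open>cusp_integral_expand\<close> applies to G1 and G2 too.\<close>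
  have G2: "cmod (G2 (of_real t * d)) \<le> K * exp (- t)" if "steep_direction (-1) d" "0 \<le> t" for d t
    by (rule tendsto_upperbound[OF tendsto_norm[OF LIMSEQ_ignore_initial_segment[OF lim(2), of m0]]])
       (use m0(1)[OF _ that] in auto)
  have G1: "cmod (1 / G1 (of_real t * d)) \<le> K * exp (- t)" if "steep_direction 1 d" "0 \<le> t" for d t
    by (rule tendsto_upperbound[OF tendsto_norm[OF tendsto_divide[OF tendsto_const LIMSEQ_ignore_initial_segment[OF lim(1), of m0] nz]]])
       (use m0(2)[OF _ that] in auto)
  have J: "(\<lambda>m. ray_integral 0 d (\<lambda>z. ray_integral 0 d' (f m z))) \<longlonglongrightarrow> ray_integral 0 d (\<lambda>z. ray_integral 0 d' (g z))"
    if d: "steep_direction (-1) d" "steep_direction 1 d'" for d d'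
  proof (rule ray_ray_dominated_convergence[OF fm gm gamma_weight_integrable[of K] gamma_weight_integrable[of "2 * K"]])
    show "cmod (f m (0 + of_real t * d) (0 + of_real t' * d')) \<le> gamma_weight K t * gamma_weight (2 * K) t'"
      if "0 < t" "0 < t'" for m t t'
      unfolding f_def by (rule cusp_integrand_bound[OF m0 d that]) auto
    fix t t' :: real assume t: "0 < t" "0 < t'"
    have "0 < sqrt (t * t') / 2" using t by simp
    then have "0 < cmod (of_real t * d - of_real t' * d')"
      using steep_separation[OF d, of t t'] t by (meson less_le_trans less_imp_le)
    then have "of_real t * d \<noteq> of_real t' * d'" by auto
    then show "(\<lambda>m. f m (0 + of_real t * d) (0 + of_real t' * d')) \<longlonglongrightarrow> g (0 + of_real t * d) (0 + of_real t' * d')"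
      unfolding f_def g_def
      by (intro tendsto_divide LIMSEQ_ignore_initial_segment[OF lim(1)] LIMSEQ_ignore_initial_segment[OF lim(2)] tendsto_const nz) auto
  qed
  have "(\<lambda>m. cusp_integral (F1 (m + m0)) (F2 (m + m0))) \<longlonglongrightarrow> cusp_integral G1 G2"
  proof -
    have e: "cusp_integral (F1 (m + m0)) (F2 (m + m0)) =
       ray_integral 0 \<i> (\<lambda>z. ray_integral 0 (Complex 1 (-1)) (f m z)) - ray_integral 0 \<i> (\<lambda>z. ray_integral 0 (Complex 1 1) (f m z))
       + ray_integral 0 \<i> (\<lambda>z. ray_integral 0 (Complex (-2) 1) (f m z)) - ray_integral 0 \<i> (\<lambda>z. ray_integral 0 (Complex (-2) (-1)) (f m z))
       - (ray_integral 0 (- \<i>) (\<lambda>z. ray_integral 0 (Complex 1 (-1)) (f m z)) - ray_integral 0 (- \<i>) (\<lambda>z. ray_integral 0 (Complex 1 1) (f m z))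
       + ray_integral 0 (- \<i>) (\<lambda>z. ray_integral 0 (Complex (-2) 1) (f m z)) - ray_integral 0 (- \<i>) (\<lambda>z. ray_integral 0 (Complex (-2) (-1)) (f m z)))" for m
      unfolding f_def by (rule cusp_integral_expand[where K = K]) (use m0 meas in auto)
    have e': "cusp_integral G1 G2 =
       ray_integral 0 \<i> (\<lambda>z. ray_integral 0 (Complex 1 (-1)) (g z)) - ray_integral 0 \<i> (\<lambda>z. ray_integral 0 (Complex 1 1) (g z))
       + ray_integral 0 \<i> (\<lambda>z. ray_integral 0 (Complex (-2) 1) (g z)) - ray_integral 0 \<i> (\<lambda>z. ray_integral 0 (Complex (-2) (-1)) (g z))
       - (ray_integral 0 (- \<i>) (\<lambda>z. ray_integral 0 (Complex 1 (-1)) (g z)) - ray_integral 0 (- \<i>) (\<lambda>z. ray_integral 0 (Complex 1 1) (g z))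
       + ray_integral 0 (- \<i>) (\<lambda>z. ray_integral 0 (Complex (-2) 1) (g z)) - ray_integral 0 (- \<i>) (\<lambda>z. ray_integral 0 (Complex (-2) (-1)) (g z)))"
      unfolding g_def by (rule cusp_integral_expand[where K = K]) (use G1 G2 meas in auto)
    show ?thesis
      unfolding e e' by (intro tendsto_diff tendsto_add J steep_dirs)
  qed
  then show ?thesis by (rule LIMSEQ_offset)
qed

section \<open>The kernel in local coordinates\<close>

lemma wedge_scale:
  assumes "0 < k"
  shows "wedge_integral d1 (w + of_real k * c) d2 f = of_real k * wedge_integral d1 c d2 (\<lambda>z. f (w + of_real k * z))"
  using assms by (simp add: wedge_integral_def ray_integral_scale right_diff_distrib)

lemma cis_directions:
  "cis (- 2 * pi / 3) = Complex (-1/2) (- (sqrt 3 / 2))" "cis (2 * pi / 3) = Complex (-1/2) (sqrt 3 / 2)"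
  "cis (pi / 3) = Complex (1/2) (sqrt 3 / 2)" "cis (- pi / 3) = Complex (1/2) (- (sqrt 3 / 2))"
  by (simp_all add: complex_eq_iff cos_120 sin_120 cos_60 sin_60)

lemma cubic_expansion:
  "exp (- ((of_real c + of_real k * z) ^ 3) / 3 + of_real \<xi> * (of_real c + of_real k * z))
    = of_real (exp (- (c ^ 3) / 3 + \<xi> * c)) * exp (cubic (- (k ^ 3 / 3)) (- (c * k\<^sup>2)) (k * (\<xi> - c\<^sup>2)) z)"
proof -
  have "- ((of_real c + of_real k * z) ^ 3) / 3 + of_real \<xi> * (of_real c + of_real k * z)
      = of_real (- (c ^ 3) / 3 + \<xi> * c) + cubic (- (k ^ 3 / 3)) (- (c * k\<^sup>2)) (k * (\<xi> - c\<^sup>2)) z"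
  proof -
    have "- ((C + K * z) ^ 3) / 3 + X * (C + K * z)
        = (- (C ^ 3) / 3 + X * C) + (- (K ^ 3 / 3) * z ^ 3 + - (C * K\<^sup>2) * z\<^sup>2 + K * (X - C\<^sup>2) * z)" for C K X :: complex
      by (simp add: power2_eq_square power3_eq_cube field_simps)
    from this[of "of_real c" "of_real k" "of_real \<xi>"] show ?thesis by simp
  qed
  then show ?thesis by (simp only: exp_add exp_of_real)
qed

text \<open>Holds for every B, and is used with B the critical point in the variable w + \<tau>.
  Written like this, the heat-kernel part of the Airy kernel has the same conjugating factor as the
  double integral: the quotient of the Airy exponentials evaluated at w + \<tau> = B.\<close>

lemma gaussian_exponent:
  fixes \<tau>1 \<tau>2 \<xi>1 \<xi>2 B :: real
  assumes "\<tau>1 \<noteq> \<tau>2"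
  shows "- (\<xi>2 - \<xi>1)\<^sup>2 / (4 * (\<tau>2 - \<tau>1)) - (\<tau>2 - \<tau>1) * (\<xi>2 + \<xi>1) / 2 + (\<tau>2 - \<tau>1) ^ 3 / 12
    = (- ((B - \<tau>2) ^ 3) / 3 + \<xi>2 * (B - \<tau>2)) - (- ((B - \<tau>1) ^ 3) / 3 + \<xi>1 * (B - \<tau>1))
      - ((\<xi>2 - (B - \<tau>2)\<^sup>2) - (\<xi>1 - (B - \<tau>1)\<^sup>2))\<^sup>2 / (4 * (\<tau>2 - \<tau>1))"
proof -
  define d where "d = \<tau>2 - \<tau>1"
  have d: "d \<noteq> 0" "\<tau>2 = \<tau>1 + d" using assms by (auto simp: d_def)
  define c where "c = B - \<tau>1"
  have c: "B - \<tau>1 = c" "B - \<tau>2 = c - d" by (auto simp: c_def d_def)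
  have "((\<xi>2 - (c - d)\<^sup>2) - (\<xi>1 - c\<^sup>2)) = (\<xi>2 - \<xi>1) + d * (2 * c - d)"
    by (simp add: power2_eq_square algebra_simps)
  then have "((\<xi>2 - (c - d)\<^sup>2) - (\<xi>1 - c\<^sup>2))\<^sup>2 / (4 * d)
      = (\<xi>2 - \<xi>1)\<^sup>2 / (4 * d) + (\<xi>2 - \<xi>1) * (2 * c - d) / 2 + d * (2 * c - d)\<^sup>2 / 4"
    using d(1) by (simp add: power2_eq_square field_simps)
  then show ?thesis
    unfolding c d_def[symmetric]
    by (simp add: power2_eq_square power3_eq_cube algebra_simps add_divide_distrib diff_divide_distrib)
qed

definition gaussian_term :: "real \<Rightarrow> real \<Rightarrow> real \<Rightarrow> real \<Rightarrow> real" where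
  "gaussian_term \<theta>1 w1 \<theta>2 w2 =
     (if \<theta>2 > \<theta>1 then exp (- (w2 - w1)\<^sup>2 / (2 * (\<theta>2 - \<theta>1))) / sqrt (2 * pi * (\<theta>2 - \<theta>1)) else 0)"

lemma pearcey_kernel_eq:
  "pearcey_kernel (\<theta>1, v1) (\<theta>2, v2) = - of_real (gaussian_term \<theta>1 v1 \<theta>2 v2)
     + 1 / (2 * of_real pi * \<i>)\<^sup>2 * cusp_integral (pearcey_phase \<theta>1 v1) (pearcey_phase \<theta>2 v2)"
  unfolding pearcey_kernel_def split pearcey_integral_eq gaussian_term_def by simp

definition local_phase :: "nat \<Rightarrow> real \<Rightarrow> real \<Rightarrow> real \<Rightarrow> real \<Rightarrow> real \<Rightarrow> complex \<Rightarrow> complex" where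
  "local_phase m p q \<mu> \<theta> w z = saddle m p q \<mu> z * exp (of_real \<theta> * z\<^sup>2 / 2 - of_real w * z)"

lemma moebius_inverse: "moebius b a z = inverse (moebius a b z)"
  by (simp add: moebius_def)

text \<open>With \<open>n = m\<^sup>1\<^sup>/\<^sup>1\<^sup>2\<close> all powers of \<open>m\<close> are integer powers of \<open>n\<close>. The local variable \<open>z\<close> at the critical point
  \<open>u\<close> is related to the variable \<open>w\<close> of the double integral by \<open>w + \<tau> = u n\<^sup>4 + n z / \<kappa>\<close>.\<close>

lemma airy_kernel_local:
  fixes n p q \<kappa> u :: real
  assumes n: "0 < n" "real m = n ^ 12" and pq: "0 < q" "q < p" "p ^ 3 - q ^ 3 = 1"
    and \<kappa>: "0 < \<kappa>" "\<kappa> ^ 4 = p ^ 4 - q ^ 4"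
  defines "\<sigma> \<equiv> - (p\<^sup>2 - q\<^sup>2) / 2"
  defines "\<tau> \<equiv> \<lambda>\<theta>. (u - \<sigma>) * n ^ 4 + \<kappa>\<^sup>2 * \<theta> / (2 * n\<^sup>2)"
  defines "\<xi> \<equiv> \<lambda>\<theta> v. (\<sigma>\<^sup>2 - (p - q)) * n ^ 8 - \<kappa>\<^sup>2 * \<sigma> * \<theta> * n\<^sup>2 - \<kappa> / n * v"
  defines "\<mu> \<equiv> 1 / (\<kappa> * n ^ 3)"
  defines "w \<equiv> \<lambda>\<theta> v. v + (\<kappa>\<^sup>2 * \<theta> / (2 * n\<^sup>2))\<^sup>2 * n / \<kappa>"
  defines "h \<equiv> \<lambda>\<theta> v. exp (- ((u * n ^ 4 - \<tau> \<theta>) ^ 3) / 3 + \<xi> \<theta> v * (u * n ^ 4 - \<tau> \<theta>))"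
  assumes large: "u * n ^ 4 < \<tau> \<theta>2"
  shows "of_real (\<kappa> / n) * airy_wanderers_kernel m ((u - 1 / q) * n ^ 4) ((u - 1 / p) * n ^ 4) (\<tau> \<theta>1, \<xi> \<theta>1 v1) (\<tau> \<theta>2, \<xi> \<theta>2 v2)
    = of_real (h \<theta>2 v2) / of_real (h \<theta>1 v1) * (- of_real (gaussian_term \<theta>1 (w \<theta>1 v1) \<theta>2 (w \<theta>2 v2))
     + 1 / (2 * of_real pi * \<i>)\<^sup>2 * cusp_integral (local_phase m p q \<mu> \<theta>1 (w \<theta>1 v1)) (local_phase m p q \<mu> \<theta>2 (w \<theta>2 v2)))"
proof -
  define B where "B = u * n ^ 4"
  define k where "k = n / \<kappa>"
  \<comment> \<open>The wanderers' parameters in the local variable: by \<open>ka\<close>, the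
    kernel's parameters are B + k a and B + k b.\<close>
  define a b where "a = - 1 / (q * \<mu>)" and "b = - 1 / (p * \<mu>)"
  have k: "0 < k" using n \<kappa> by (simp add: k_def)
  have \<mu>: "0 < \<mu>" using n \<kappa> by (simp add: \<mu>_def)
  have nz: "n \<noteq> 0" "\<kappa> \<noteq> 0" "p \<noteq> 0" "q \<noteq> 0" using n \<kappa> pq by auto
  have ab: "a < b" "b < 0"
    using pq \<mu> by (auto simp: a_def b_def field_simps)
  have ka: "(u - 1 / q) * n ^ 4 = B + k * a" "(u - 1 / p) * n ^ 4 = B + k * b"
    using nz by (auto simp: B_def k_def a_def b_def \<mu>_def field_simps eval_nat_numeral)
  \<comment> \<open>The critical point in the variable w. The numbers A, L and - \<zeta> are the
    quadratic, linear and cubic coefficients of the Airy exponent expanded there.\<close>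
  define c where "c = (\<lambda>\<theta>. B - \<tau> \<theta>)"
  define A where "A = (\<lambda>\<theta>. - (c \<theta> * k\<^sup>2))"
  define L where "L = (\<lambda>\<theta> v. k * (\<xi> \<theta> v - (c \<theta>)\<^sup>2))"
  define \<zeta> where "\<zeta> = k ^ 3 / 3"
  have \<zeta>: "0 < \<zeta>" using k by (simp add: \<zeta>_def)
  have c_eq: "c \<theta> = \<sigma> * n ^ 4 - \<kappa>\<^sup>2 * \<theta> / (2 * n\<^sup>2)" for \<theta>
    by (simp add: c_def B_def \<tau>_def algebra_simps)
  \<comment> \<open>The parts with the factor m are those subtracted in \<open>saddle\<close>; what
    remains is the Pearcey exponent \<theta> z^2 / 2 - w z. The square of c \<theta> turns v into
    \<open>w \<theta> v\<close>, a correction of order n^(-3).\<close>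
  have A_eq: "A \<theta> = real m * (p\<^sup>2 - q\<^sup>2) * \<mu>\<^sup>2 / 2 + \<theta> / 2" for \<theta>
    unfolding A_def c_eq n(2) \<mu>_def k_def \<sigma>_def using nz by (simp add: field_simps eval_nat_numeral)
  have L_eq: "L \<theta> v = - (real m * (p - q) * \<mu>) - w \<theta> v" for \<theta> v
    unfolding L_def c_eq n(2) \<mu>_def k_def \<xi>_def w_def using nz by (simp add: field_simps eval_nat_numeral)
  have \<zeta>_eq: "\<zeta> = real m * \<mu> ^ 3 / 3"
    unfolding \<zeta>_def n(2) \<mu>_def k_def using nz by (simp add: field_simps eval_nat_numeral)
  \<comment> \<open>By \<open>large\<close> the critical point c \<theta>2 is negative, which gives
    the positive quadratic coefficient that the outer contour needs.\<close>
  have A2: "0 < A \<theta>2"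
    unfolding A_def c_def using large k by (simp add: B_def mult_neg_pos)
  have phase: "exp (cubic (- \<zeta>) (A \<theta>) (L \<theta> v) z) * moebius (of_real a) (of_real b) z ^ m = local_phase m p q \<mu> \<theta> (w \<theta> v) z"
    for \<theta> v and z :: complex
  proof -
    have "moebius (of_real a) (of_real b) z = (1 + of_real (p * \<mu>) * z) / (1 + of_real (q * \<mu>) * z)"
      using nz \<mu> by (simp add: moebius_def a_def b_def field_simps)
    moreover have "cubic (- \<zeta>) (A \<theta>) (L \<theta> v) z
        = - (of_nat m * (of_real ((p - q) * \<mu>) * z - of_real ((p\<^sup>2 - q\<^sup>2) * \<mu>\<^sup>2) * z\<^sup>2 / 2 + of_real (\<mu> ^ 3) * z ^ 3 / 3))
          + (of_real \<theta> * z\<^sup>2 / 2 - of_real (w \<theta> v) * z)"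
      unfolding A_eq L_eq \<zeta>_eq by (simp add: field_simps)
    ultimately show ?thesis unfolding local_phase_def saddle_def by (simp only: exp_add mult_ac)
  qed
  define f where "f = (\<lambda>z z'. exp (cubic (- \<zeta>) (A \<theta>2) (L \<theta>2 v2) z) * exp (cubic \<zeta> (- A \<theta>1) (- L \<theta>1 v1) z')
      * (moebius (of_real a) (of_real b) z * moebius (of_real b) (of_real a) z') ^ m / (z - z'))"
  have f: "f z z' = local_phase m p q \<mu> \<theta>2 (w \<theta>2 v2) z / local_phase m p q \<mu> \<theta>1 (w \<theta>1 v1) z' / (z - z')" for z z' :: complex
  proof -
    have "cubic \<zeta> (- A \<theta>1) (- L \<theta>1 v1) z' = - cubic (- \<zeta>) (A \<theta>1) (L \<theta>1 v1) z'" by simp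
    then have "exp (cubic \<zeta> (- A \<theta>1) (- L \<theta>1 v1) z') = inverse (exp (cubic (- \<zeta>) (A \<theta>1) (L \<theta>1 v1) z'))"
      by (simp only: exp_minus)
    then show ?thesis
      unfolding f_def phase[symmetric] moebius_inverse[of "of_real b"]
      by (simp add: power_mult_distrib power_inverse divide_inverse mult_ac)
  qed
  define g where "g = (\<lambda>w w' :: complex. exp (- (w ^ 3) / 3 + of_real (\<xi> \<theta>2 v2) * w) / exp (- (w' ^ 3) / 3 + of_real (\<xi> \<theta>1 v1) * w')
           * (1 / ((w + of_real (\<tau> \<theta>2)) - (w' + of_real (\<tau> \<theta>1))))
           * ((w' - of_real ((u - 1 / q) * n ^ 4) + of_real (\<tau> \<theta>1)) / (w - of_real ((u - 1 / q) * n ^ 4) + of_real (\<tau> \<theta>2))) ^ m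
           * ((w - of_real ((u - 1 / p) * n ^ 4) + of_real (\<tau> \<theta>2)) / (w' - of_real ((u - 1 / p) * n ^ 4) + of_real (\<tau> \<theta>1))) ^ m)"
  have g: "g (of_real (c \<theta>2) + of_real k * z) (of_real (c \<theta>1) + of_real k * z')
      = of_real (h \<theta>2 v2) / of_real (h \<theta>1 v1) / of_real k * f z z'" for z z' :: complex
  proof -
    have hc: "h \<theta> v = exp (- (c \<theta> ^ 3) / 3 + \<xi> \<theta> v * c \<theta>)" for \<theta> v by (simp add: h_def c_def B_def)
    have e: "exp (- ((of_real (c \<theta>) + of_real k * z) ^ 3) / 3 + of_real (\<xi> \<theta> v) * (of_real (c \<theta>) + of_real k * z))
        = of_real (h \<theta> v) * exp (cubic (- \<zeta>) (A \<theta>) (L \<theta> v) z)" for \<theta> v and z :: complex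
      unfolding cubic_expansion hc A_def L_def \<zeta>_def ..
    have d: "(of_real (c \<theta>2) + of_real k * z + of_real (\<tau> \<theta>2)) - (of_real (c \<theta>1) + of_real k * z' + of_real (\<tau> \<theta>1)) = of_real k * (z - z')"
      by (simp add: c_def algebra_simps)
    have r: "of_real (c \<theta>) + of_real k * z - of_real (B + k * y) + of_real (\<tau> \<theta>) = of_real k * (z - of_real y)" for \<theta> y and z :: complex
      by (simp add: c_def algebra_simps)
    have k0: "complex_of_real k \<noteq> 0" using k by simp
    have mob: "((z' - of_real a) / (z - of_real a)) ^ m * ((z - of_real b) / (z' - of_real b)) ^ m
        = (moebius (of_real a) (of_real b) z * moebius (of_real b) (of_real a) z') ^ m"
    proof -
      have m1: "1 - y / of_real x = (of_real x - y) / of_real x" if "x \<noteq> 0" for x :: real and y :: complex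
        using that by (simp add: diff_divide_distrib)
      have "moebius (of_real a) (of_real b) z * moebius (of_real b) (of_real a) z'
          = (of_real b - z) / (of_real a - z) * ((of_real a - z') / (of_real b - z'))"
        unfolding moebius_def using ab by (simp add: m1)
      also have "\<dots> = ((z' - of_real a) / (z - of_real a)) * ((z - of_real b) / (z' - of_real b))"
        by (metis (no_types, lifting) minus_diff_eq minus_divide_divide mult.commute times_divide_times_eq)
      finally show ?thesis by (simp only: power_mult_distrib)
    qed
    have "g (of_real (c \<theta>2) + of_real k * z) (of_real (c \<theta>1) + of_real k * z')
        = (of_real (h \<theta>2 v2) * exp (cubic (- \<zeta>) (A \<theta>2) (L \<theta>2 v2) z)) / (of_real (h \<theta>1 v1) * exp (cubic (- \<zeta>) (A \<theta>1) (L \<theta>1 v1) z'))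
          * (1 / (of_real k * (z - z')))
          * ((of_real k * (z' - of_real a)) / (of_real k * (z - of_real a))) ^ m
          * ((of_real k * (z - of_real b)) / (of_real k * (z' - of_real b))) ^ m"
      unfolding g_def ka e d r ..
    also have "\<dots> = (of_real (h \<theta>2 v2) * exp (cubic (- \<zeta>) (A \<theta>2) (L \<theta>2 v2) z)) / (of_real (h \<theta>1 v1) * exp (cubic (- \<zeta>) (A \<theta>1) (L \<theta>1 v1) z'))
          * (1 / (of_real k * (z - z'))) * (((z' - of_real a) / (z - of_real a)) ^ m * ((z - of_real b) / (z' - of_real b)) ^ m)"
      using k0 by simp
    also have "\<dots> = of_real (h \<theta>2 v2) / of_real (h \<theta>1 v1) / of_real k * f z z'"
    proof -
      have "cubic \<zeta> (- A \<theta>1) (- L \<theta>1 v1) z' = - cubic (- \<zeta>) (A \<theta>1) (L \<theta>1 v1) z'" by simp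
      then have e1: "exp (cubic \<zeta> (- A \<theta>1) (- L \<theta>1 v1) z') = inverse (exp (cubic (- \<zeta>) (A \<theta>1) (L \<theta>1 v1) z'))"
        by (simp only: exp_minus)
      have alg: "(H2 * E2) / (H1 * E1) * (1 / (K * D)) * M = H2 / H1 / K * (E2 * inverse E1 * M / D)" for H1 H2 E1 E2 K D M :: complex
        by (simp add: divide_inverse mult_ac)
      show ?thesis unfolding mob f_def e1 by (rule alg)
    qed
    finally show ?thesis .
  qed
  define P Q where "P = (2 * a + b) / 3" and "Q = (a + 2 * b) / 3"
  have vert: "complex_of_real ((2 * ((u - 1 / q) * n ^ 4) + (u - 1 / p) * n ^ 4) / 3 - \<tau> \<theta>2) = of_real (c \<theta>2) + of_real k * of_real P"
    "complex_of_real (((u - 1 / q) * n ^ 4 + 2 * ((u - 1 / p) * n ^ 4)) / 3 - \<tau> \<theta>1) = of_real (c \<theta>1) + of_real k * of_real Q"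
    unfolding ka P_def Q_def c_def of_real_mult[symmetric] of_real_add[symmetric] by (rule arg_cong[where f = of_real], simp add: field_simps)+
  define I where "I = cusp_integral (local_phase m p q \<mu> \<theta>1 (w \<theta>1 v1)) (local_phase m p q \<mu> \<theta>2 (w \<theta>2 v2))"
  have int: "wedge_integral (cis (- 2 * pi / 3)) (of_real ((2 * ((u - 1 / q) * n ^ 4) + (u - 1 / p) * n ^ 4) / 3 - \<tau> \<theta>2)) (cis (2 * pi / 3)) (\<lambda>w.
         wedge_integral (cis (pi / 3)) (of_real (((u - 1 / q) * n ^ 4 + 2 * ((u - 1 / p) * n ^ 4)) / 3 - \<tau> \<theta>1)) (cis (- pi / 3)) (g w))
      = of_real (h \<theta>2 v2) / of_real (h \<theta>1 v1) * of_real k * I"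
  proof -
    have "wedge_integral (cis (- 2 * pi / 3)) (of_real ((2 * ((u - 1 / q) * n ^ 4) + (u - 1 / p) * n ^ 4) / 3 - \<tau> \<theta>2)) (cis (2 * pi / 3)) (\<lambda>w.
         wedge_integral (cis (pi / 3)) (of_real (((u - 1 / q) * n ^ 4 + 2 * ((u - 1 / p) * n ^ 4)) / 3 - \<tau> \<theta>1)) (cis (- pi / 3)) (g w))
      = of_real k * wedge_integral (Complex (-1/2) (- (sqrt 3 / 2))) (of_real P) (Complex (-1/2) (sqrt 3 / 2)) (\<lambda>z.
         of_real k * wedge_integral (Complex (1/2) (sqrt 3 / 2)) (of_real Q) (Complex (1/2) (- (sqrt 3 / 2))) (\<lambda>z'.
           of_real (h \<theta>2 v2) / of_real (h \<theta>1 v1) / of_real k * f z z'))"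
      unfolding vert cis_directions wedge_scale[OF k] g ..
    also have "\<dots> = of_real k * (of_real k * (of_real (h \<theta>2 v2) / of_real (h \<theta>1 v1) / of_real k *
       wedge_integral (Complex (-1/2) (- (sqrt 3 / 2))) (of_real P) (Complex (-1/2) (sqrt 3 / 2)) (\<lambda>z.
         wedge_integral (Complex (1/2) (sqrt 3 / 2)) (of_real Q) (Complex (1/2) (- (sqrt 3 / 2))) (f z))))"
      unfolding wedge_integral_mult ..
    also have "wedge_integral (Complex (-1/2) (- (sqrt 3 / 2))) (of_real P) (Complex (-1/2) (sqrt 3 / 2)) (\<lambda>z.
         wedge_integral (Complex (1/2) (sqrt 3 / 2)) (of_real Q) (Complex (1/2) (- (sqrt 3 / 2))) (f z)) = I"
      unfolding P_def Q_def f_def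
      by (subst contour_deformation[OF \<zeta> A2 ab]) (simp only: I_def cusp_integral_def f[unfolded f_def])
    finally show ?thesis using k by simp
  qed
  \<comment> \<open>The variances match because \<tau> \<theta>2 - \<tau> \<theta>1 = (\<theta>2 -
    \<theta>1) / (2 k^2), and the Jacobian \<kappa> / n = 1 / k corrects the prefactor.\<close>
  have gauss: "\<kappa> / n * (exp (- (\<xi> \<theta>2 v2 - \<xi> \<theta>1 v1)\<^sup>2 / (4 * (\<tau> \<theta>2 - \<tau> \<theta>1)) - (\<tau> \<theta>2 - \<tau> \<theta>1) * (\<xi> \<theta>2 v2 + \<xi> \<theta>1 v1) / 2
                + (\<tau> \<theta>2 - \<tau> \<theta>1) ^ 3 / 12) / sqrt (4 * pi * (\<tau> \<theta>2 - \<tau> \<theta>1)))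
     = h \<theta>2 v2 / h \<theta>1 v1 * gaussian_term \<theta>1 (w \<theta>1 v1) \<theta>2 (w \<theta>2 v2)" if "\<theta>1 < \<theta>2"
  proof -
    have \<tau>d: "\<tau> \<theta>2 - \<tau> \<theta>1 = (\<theta>2 - \<theta>1) / (2 * k\<^sup>2)"
      using nz by (simp add: \<tau>_def k_def field_simps power2_eq_square)
    have ne: "\<tau> \<theta>1 \<noteq> \<tau> \<theta>2" using \<tau>d that k by auto
    have "k * ((\<xi> \<theta>2 v2 - (B - \<tau> \<theta>2)\<^sup>2) - (\<xi> \<theta>1 v1 - (B - \<tau> \<theta>1)\<^sup>2)) = L \<theta>2 v2 - L \<theta>1 v1"
      by (simp add: L_def c_def right_diff_distrib)
    also have "\<dots> = - (w \<theta>2 v2 - w \<theta>1 v1)" unfolding L_eq by simp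
    finally have ld: "(\<xi> \<theta>2 v2 - (B - \<tau> \<theta>2)\<^sup>2) - (\<xi> \<theta>1 v1 - (B - \<tau> \<theta>1)\<^sup>2) = - (w \<theta>2 v2 - w \<theta>1 v1) / k"
      using k by (simp add: field_simps)
    have E: "((\<xi> \<theta>2 v2 - (B - \<tau> \<theta>2)\<^sup>2) - (\<xi> \<theta>1 v1 - (B - \<tau> \<theta>1)\<^sup>2))\<^sup>2 / (4 * (\<tau> \<theta>2 - \<tau> \<theta>1)) = (w \<theta>2 v2 - w \<theta>1 v1)\<^sup>2 / (2 * (\<theta>2 - \<theta>1))"
      unfolding ld \<tau>d using k that by (simp add: field_simps power2_eq_square)
    have split: "exp (H2 - H1 - Q / D) = exp H2 / exp H1 * exp (- Q / D)" for H1 H2 Q D :: real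
    proof -
      have "H2 - H1 - Q / D = H2 - H1 + - Q / D" by simp
      then show ?thesis by (simp only: exp_add exp_diff)
    qed
    have "exp (- (\<xi> \<theta>2 v2 - \<xi> \<theta>1 v1)\<^sup>2 / (4 * (\<tau> \<theta>2 - \<tau> \<theta>1)) - (\<tau> \<theta>2 - \<tau> \<theta>1) * (\<xi> \<theta>2 v2 + \<xi> \<theta>1 v1) / 2
                + (\<tau> \<theta>2 - \<tau> \<theta>1) ^ 3 / 12)
        = h \<theta>2 v2 / h \<theta>1 v1 * exp (- (w \<theta>2 v2 - w \<theta>1 v1)\<^sup>2 / (2 * (\<theta>2 - \<theta>1)))"
      unfolding gaussian_exponent[OF ne, of "\<xi> \<theta>2 v2" "\<xi> \<theta>1 v1" B] E h_def B_def[symmetric]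
      by (rule split)
    moreover have "sqrt (4 * pi * (\<tau> \<theta>2 - \<tau> \<theta>1)) = sqrt (2 * pi * (\<theta>2 - \<theta>1)) / k"
    proof -
      have "4 * pi * (\<tau> \<theta>2 - \<tau> \<theta>1) = 2 * pi * (\<theta>2 - \<theta>1) / k\<^sup>2"
        unfolding \<tau>d using k by (simp add: field_simps)
      then show ?thesis using k by (simp add: real_sqrt_divide)
    qed
    moreover have "\<kappa> / n = 1 / k" by (simp add: k_def)
    ultimately show ?thesis using that k by (simp add: gaussian_term_def)
  qed
  have \<tau>lt: "\<tau> \<theta>2 > \<tau> \<theta>1 \<longleftrightarrow> \<theta>2 > \<theta>1"
    using n \<kappa> by (simp add: \<tau>_def divide_less_cancel)
  have "airy_wanderers_kernel m ((u - 1 / q) * n ^ 4) ((u - 1 / p) * n ^ 4) (\<tau> \<theta>1, \<xi> \<theta>1 v1) (\<tau> \<theta>2, \<xi> \<theta>2 v2)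
    = - (if \<theta>2 > \<theta>1 then of_real (exp (- (\<xi> \<theta>2 v2 - \<xi> \<theta>1 v1)\<^sup>2 / (4 * (\<tau> \<theta>2 - \<tau> \<theta>1)) - (\<tau> \<theta>2 - \<tau> \<theta>1) * (\<xi> \<theta>2 v2 + \<xi> \<theta>1 v1) / 2
                + (\<tau> \<theta>2 - \<tau> \<theta>1) ^ 3 / 12) / sqrt (4 * pi * (\<tau> \<theta>2 - \<tau> \<theta>1))) else 0)
      + 1 / (2 * of_real pi * \<i>)\<^sup>2 * (of_real (h \<theta>2 v2) / of_real (h \<theta>1 v1) * of_real k * I)"
    unfolding airy_wanderers_kernel_def split int[unfolded g_def] \<tau>lt ..
  moreover have "of_real (\<kappa> / n) * (- (if \<theta>2 > \<theta>1 then complex_of_real (exp (- (\<xi> \<theta>2 v2 - \<xi> \<theta>1 v1)\<^sup>2 / (4 * (\<tau> \<theta>2 - \<tau> \<theta>1)) - (\<tau> \<theta>2 - \<tau> \<theta>1) * (\<xi> \<theta>2 v2 + \<xi> \<theta>1 v1) / 2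
                + (\<tau> \<theta>2 - \<tau> \<theta>1) ^ 3 / 12) / sqrt (4 * pi * (\<tau> \<theta>2 - \<tau> \<theta>1))) else 0))
      = of_real (h \<theta>2 v2) / of_real (h \<theta>1 v1) * (- of_real (gaussian_term \<theta>1 (w \<theta>1 v1) \<theta>2 (w \<theta>2 v2)))"
  proof (cases "\<theta>1 < \<theta>2")
    case True
    show ?thesis
      using arg_cong[OF gauss[OF True], of "\<lambda>x. - complex_of_real x"] True by (simp only: if_True of_real_mult of_real_divide mult_minus_right)
  next
    case False
    then show ?thesis by (simp add: gaussian_term_def)
  qed
  moreover have "of_real (\<kappa> / n) * (X * (H * of_real k * I)) = H * (X * I)" for X H :: complex
  proof -
    have "complex_of_real (\<kappa> / n) * of_real k = 1" using nz by (simp add: k_def)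
    moreover have "of_real (\<kappa> / n) * (X * (H * of_real k * I)) = (of_real (\<kappa> / n) * of_real k) * (H * (X * I))"
      by (simp only: mult_ac)
    ultimately show ?thesis by simp
  qed
  ultimately show ?thesis unfolding I_def[symmetric] by (simp only: distrib_left)
qed

section \<open>The equations of the cusps\<close>

text \<open>After cubing, \<sigma> enters only through \<sigma>^12 = (\<sigma>^6)^2, which the
  elliptic curve eliminates. The resulting equation determines x from \<beta> - \<alpha>
  alone.\<close>

lemma cusp_solution_cube:
  assumes x: "3 / 2 < x" "x < 2" and sol: "cusp_solution \<alpha> \<beta> x \<sigma>"
  shows "(\<beta> - \<alpha>) ^ 3 = 4 * x * (2 * x - 3)\<^sup>2 / (2 - x) ^ 3"
proof -
  have e: "4 * \<sigma> ^ 6 * x ^ 4 = 2 * x - 3" using sol by (simp add: cusp_solution_def elliptic_curve_def)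
  have "(\<beta> - \<alpha>) ^ 3 = (4 * \<sigma> ^ 4 * x ^ 3) ^ 3 / (2 - x) ^ 3"
    using sol by (simp add: cusp_solution_def power_divide)
  also have "(4 * \<sigma> ^ 4 * x ^ 3) ^ 3 = 4 * x * (4 * \<sigma> ^ 6 * x ^ 4)\<^sup>2"
    by (simp add: power_mult_distrib flip: power_mult power_add) (simp add: eval_nat_numeral)
  finally show ?thesis unfolding e .
qed

lemma cusp_function_strict_mono:
  fixes x y :: real
  assumes "3 / 2 < x" "x < y" "y < 2"
  shows "4 * x * (2 * x - 3)\<^sup>2 / (2 - x) ^ 3 < 4 * y * (2 * y - 3)\<^sup>2 / (2 - y) ^ 3"
proof -
  have "(2 * x - 3)\<^sup>2 < (2 * y - 3)\<^sup>2" using assms by (intro power_strict_mono) auto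
  moreover have "4 * x * (2 * x - 3)\<^sup>2 \<le> 4 * y * (2 * x - 3)\<^sup>2"
    using assms by (intro mult_right_mono) auto
  ultimately have "4 * x * (2 * x - 3)\<^sup>2 < 4 * y * (2 * y - 3)\<^sup>2"
    using assms mult_strict_left_mono[of "(2 * x - 3)\<^sup>2" "(2 * y - 3)\<^sup>2" "4 * y"] by linarith
  moreover have "(2 - y) ^ 3 \<le> (2 - x) ^ 3" using assms by (intro power_mono) auto
  ultimately show ?thesis using assms by (intro frac_less) auto
qed

lemma cusp_function_surj:
  fixes D :: real
  assumes "0 < D"
  shows "\<exists>x. 3 / 2 < x \<and> x < 2 \<and> 4 * x * (2 * x - 3)\<^sup>2 / (2 - x) ^ 3 = D"
proof -
  define \<psi> where "\<psi> = (\<lambda>x::real. 4 * x * (2 * x - 3)\<^sup>2 / (2 - x) ^ 3)"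
  \<comment> \<open>At x = 2 - e the function is at least 1 / e^3 = (4 + D)^3, which exceeds D; and
    e \<le> 1/4 keeps 2 - e above 3/2.\<close>
  define e where "e = 1 / (4 + D)"
  have e: "0 < e" "e \<le> 1 / 4" using assms by (auto simp: e_def field_simps)
  have "\<exists>x\<ge>3 / 2. x \<le> 2 - e \<and> \<psi> x = D"
  proof (rule IVT')
    show "\<psi> (3 / 2) \<le> D" using assms by (simp add: \<psi>_def)
    have "(1 / 2)\<^sup>2 \<le> (2 * (2 - e) - 3)\<^sup>2" using e by (intro power_mono) auto
    then have "4 * 1 * (1 / 2)\<^sup>2 \<le> 4 * (2 - e) * (2 * (2 - e) - 3)\<^sup>2"
      using e by (intro mult_mono) auto
    then have "1 / e ^ 3 \<le> \<psi> (2 - e)"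
      unfolding \<psi>_def using e by (simp add: divide_right_mono power2_eq_square)
    moreover have "D \<le> 1 / e ^ 3"
    proof -
      have "D \<le> (4 + D) ^ 1" by simp
      also have "\<dots> \<le> (4 + D) ^ 3" using assms by (intro power_increasing) auto
      finally show ?thesis by (simp add: e_def power_divide)
    qed
    ultimately show "D \<le> \<psi> (2 - e)" by simp
    show "3 / 2 \<le> 2 - e" using e by simp
    show "continuous_on {3 / 2..2 - e} \<psi>"
      unfolding \<psi>_def using e by (intro continuous_intros) auto
  qed
  then obtain x where x: "3 / 2 \<le> x" "x \<le> 2 - e" "\<psi> x = D" by blast
  moreover have "x \<noteq> 3 / 2"
  proof
    assume "x = 3 / 2"
    then have "\<psi> x = 0" by (simp add: \<psi>_def)
    then show False using x(3) assms by simp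
  qed
  ultimately show ?thesis using e by (intro exI[of _ x]) (auto simp: \<psi>_def)
qed

text \<open>x solves the equation free of \<sigma>, and \<sigma> is then read off the elliptic
  curve. The value E that this pair gives for \<beta> - \<alpha> is nonnegative with the right cube,
  hence correct.\<close>

lemma cusp_solution_exists:
  assumes "\<alpha> < \<beta>"
  shows "\<exists>x \<sigma>. 3 / 2 < x \<and> x < 2 \<and> 0 < \<sigma> \<and> \<sigma> < 1 / 2 \<and> cusp_solution \<alpha> \<beta> x \<sigma>"
proof -
  have D: "0 < \<beta> - \<alpha>" using assms by simp
  then obtain x where x: "3 / 2 < x" "x < 2" "4 * x * (2 * x - 3)\<^sup>2 / (2 - x) ^ 3 = (\<beta> - \<alpha>) ^ 3"
    using cusp_function_surj[of "(\<beta> - \<alpha>) ^ 3"] by auto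
  define \<sigma> where "\<sigma> = root 6 ((2 * x - 3) / (4 * x ^ 4))"
  have rad: "0 < (2 * x - 3) / (4 * x ^ 4)" using x by simp
  have \<sigma>: "0 < \<sigma>" "\<sigma> ^ 6 = (2 * x - 3) / (4 * x ^ 4)"
    using rad by (simp_all add: \<sigma>_def real_root_pow_pos)
  have e: "4 * \<sigma> ^ 6 * x ^ 4 = 2 * x - 3" using x by (simp add: \<sigma>(2))
  define E where "E = 4 * \<sigma> ^ 4 * x ^ 3 / (2 - x)"
  have E: "cusp_solution 0 E x \<sigma>" using e by (simp add: cusp_solution_def elliptic_curve_def E_def)
  have "E ^ 3 = (\<beta> - \<alpha>) ^ 3" using cusp_solution_cube[OF x(1,2) E] x(3) by simp
  moreover have "0 \<le> E" using x \<sigma> by (simp add: E_def)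
  ultimately have "E = \<beta> - \<alpha>" using D by (intro power_eq_imp_eq_base[of E 3]) auto
  then have "cusp_solution \<alpha> \<beta> x \<sigma>" using E by (simp add: cusp_solution_def)
  moreover have "\<sigma> < 1 / 2"
  proof (rule power_less_imp_less_base)
    \<comment> \<open>The product expands to x^4 - 32 x + 48, so its positivity says \<sigma>^6 <
      1/64.\<close>
    have "0 < (2 - x)\<^sup>2 * (x\<^sup>2 + 4 * x + 12)" using x by (intro mult_pos_pos) (auto intro!: add_pos_pos)
    then have "16 * (2 * x - 3) < x ^ 4" by (simp add: eval_nat_numeral algebra_simps)
    then show "\<sigma> ^ 6 < (1 / 2) ^ 6" using x by (simp add: \<sigma>(2) power_divide field_simps)
  qed simp
  ultimately show ?thesis using x \<sigma> by blast
qed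

lemma cusp_solution_unique:
  assumes x: "3 / 2 < x" "x < 2" and x': "3 / 2 < x'" "x' < 2"
    and sol: "cusp_solution \<alpha> \<beta> x \<sigma>" "cusp_solution \<alpha> \<beta> x' \<sigma>'"
  shows "x = x'" and "\<bar>\<sigma>\<bar> = \<bar>\<sigma>'\<bar>"
proof -
  have cube: "4 * x * (2 * x - 3)\<^sup>2 / (2 - x) ^ 3 = 4 * x' * (2 * x' - 3)\<^sup>2 / (2 - x') ^ 3"
    using cusp_solution_cube[OF x sol(1)] cusp_solution_cube[OF x' sol(2)] by (rule trans[OF sym])
  show xx: "x = x'"
  proof (rule linorder_cases[of x x'])
    assume "x < x'"
    then show ?thesis using cusp_function_strict_mono[OF x(1) _ x'(2)] unfolding cube by blast
  next
    assume "x' < x"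
    then show ?thesis using cusp_function_strict_mono[OF x'(1) _ x(2)] unfolding cube by blast
  qed
  have "4 * \<sigma> ^ 6 * x ^ 4 - 2 * x + 3 = 0"
    using sol(1) unfolding cusp_solution_def elliptic_curve_def mem_Collect_eq split by (rule conjunct2)
  moreover have "4 * \<sigma>' ^ 6 * x ^ 4 - 2 * x + 3 = 0"
    using sol(2) unfolding xx cusp_solution_def elliptic_curve_def mem_Collect_eq split by (rule conjunct2)
  ultimately have "\<sigma> ^ 6 * (4 * x ^ 4) = \<sigma>' ^ 6 * (4 * x ^ 4)" by (simp only: mult_ac)
  moreover have "4 * x ^ 4 \<noteq> 0" using x by simp
  ultimately have "\<sigma> ^ 6 = \<sigma>' ^ 6" by (rule mult_right_cancel[THEN iffD1, rotated])
  then have "\<bar>\<sigma>\<bar> ^ 6 = \<bar>\<sigma>'\<bar> ^ 6" by (simp only: power_even_abs even_numeral)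
  then show "\<bar>\<sigma>\<bar> = \<bar>\<sigma>'\<bar>" by (rule power_eq_imp_eq_base) simp_all
qed

text \<open>Both equations are even in \<sigma>; this is why the two cusps share x and have opposite
  \<sigma>.\<close>

lemma cusp_solution_minus: "cusp_solution \<alpha> \<beta> x (- \<sigma>) \<longleftrightarrow> cusp_solution \<alpha> \<beta> x \<sigma>"
  by (simp add: cusp_solution_def elliptic_curve_def)

lemma opening_cusp_minus: "opening_cusp \<alpha> \<beta> (x, \<sigma>) \<longleftrightarrow> closing_cusp \<alpha> \<beta> (x, - \<sigma>)"
  by (auto simp: opening_cusp_def closing_cusp_def cusp_solution_minus)

lemma closing_cusp_unique_existence:
  assumes "\<alpha> < \<beta>"
  shows "\<exists>!c. closing_cusp \<alpha> \<beta> c"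
proof -
  obtain x \<sigma> where xs: "3 / 2 < x" "x < 2" "0 < \<sigma>" "\<sigma> < 1 / 2" "cusp_solution \<alpha> \<beta> x \<sigma>"
    using cusp_solution_exists[OF assms] by blast
  show ?thesis
  proof (rule ex1I[of _ "(x, \<sigma>)"])
    show "closing_cusp \<alpha> \<beta> (x, \<sigma>)" using xs by (simp add: closing_cusp_def)
    fix c assume "closing_cusp \<alpha> \<beta> c"
    then obtain x' \<sigma>' where c: "c = (x', \<sigma>')" "3 / 2 < x'" "x' < 2" "0 < \<sigma>'" "cusp_solution \<alpha> \<beta> x' \<sigma>'"
      by (cases c) (auto simp: closing_cusp_def)
    show "c = (x, \<sigma>)"
      using cusp_solution_unique[OF c(2,3) xs(1,2) c(5) xs(5)] c xs by simp
  qed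
qed

lemma opening_cusp_unique_existence:
  assumes "\<alpha> < \<beta>"
  shows "\<exists>!c. opening_cusp \<alpha> \<beta> c"
proof -
  obtain c where c: "closing_cusp \<alpha> \<beta> c" "\<And>c'. closing_cusp \<alpha> \<beta> c' \<Longrightarrow> c' = c"
    using closing_cusp_unique_existence[OF assms] by blast
  show ?thesis
  proof (rule ex1I[of _ "(fst c, - snd c)"])
    show "opening_cusp \<alpha> \<beta> (fst c, - snd c)" using c(1) by (simp add: opening_cusp_minus)
    fix c' assume "opening_cusp \<alpha> \<beta> c'"
    then have "closing_cusp \<alpha> \<beta> (fst c', - snd c')" by (metis opening_cusp_minus prod.collapse)
    then have "(fst c', - snd c') = c" by (rule c(2))
    then show "c' = (fst c, - snd c)" by auto
  qed
qed

text \<open>Here \<open>p = 1 / (u - \<beta>)\<close> and \<open>q = 1 / (u - \<alpha>)\<close> for the critical point \<open>u > \<beta>\<close>.\<close>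

lemma opening_cusp_parameters:
  assumes op: "opening_cusp \<alpha> \<beta> (x, \<sigma>)"
  obtains p q u where "0 < q" "q < p" "p ^ 3 - q ^ 3 = 1" "\<sigma> = - (p\<^sup>2 - q\<^sup>2) / 2"
    "0 < cusp_\<kappa> x \<sigma>" "cusp_\<kappa> x \<sigma> ^ 4 = p ^ 4 - q ^ 4" "\<alpha> = u - 1 / q" "\<beta> = u - 1 / p"
    "cusp_T \<alpha> \<beta> x \<sigma> = u - \<sigma>" "cusp_X x \<sigma> = \<sigma>\<^sup>2 - (p - q)"
proof -
  have x: "3 / 2 < x" "x < 2" and \<sigma>: "\<sigma> < 0" and D: "\<beta> - \<alpha> = 4 * \<sigma> ^ 4 * x ^ 3 / (2 - x)"
    and e: "4 * \<sigma> ^ 6 * x ^ 4 = 2 * x - 3"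
    using op by (auto simp: opening_cusp_def cusp_solution_def elliptic_curve_def)
  define r where "r = - \<sigma>"
  have r: "0 < r" using \<sigma> by (simp add: r_def)
  have e': "4 * r ^ 6 * x ^ 4 = 2 * x - 3" using e by (simp add: r_def)
  \<comment> \<open>These will be p + q and p - q. They are forced by the wanted identities \<sigma>
    = - (p^2 - q^2) / 2 and X = \<sigma>^2 - (p - q).\<close>
  define s d where "s = 1 / (x * r)" and "d = 2 * x * r\<^sup>2"
  have pos: "0 < s" "0 < d" using x r by (auto simp: s_def d_def)
  have sd: "s * d = 2 * r" using x r by (simp add: s_def d_def power2_eq_square)
  \<comment> \<open>The equation of the elliptic curve in the variables s and d.\<close>
  have d2: "d\<^sup>2 = (2 * x - 3) * s\<^sup>2"
  proof -
    have "d\<^sup>2 * (x * r)\<^sup>2 = 4 * r ^ 6 * x ^ 4" by (simp add: d_def eval_nat_numeral)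
    then show ?thesis unfolding e' using x r by (simp add: s_def power_divide field_simps)
  qed
  have "d\<^sup>2 < 1 * s\<^sup>2" unfolding d2 using x pos by (intro mult_strict_right_mono) auto
  then have ds: "d < s" using pos by (intro power_less_imp_less_base[of d 2 s]) auto
  define p q where "p = (s + d) / 2" and "q = (s - d) / 2"
  have pq: "p + q = s" "p - q = d" by (auto simp: p_def q_def field_simps)
  have q0: "0 < q" and qp: "q < p" using ds pos by (auto simp: p_def q_def)
  have ppq: "p * q = (2 - x) * s\<^sup>2 / 2"
  proof -
    have "4 * (p * q) = s\<^sup>2 - d\<^sup>2" unfolding p_def q_def by (simp add: power2_eq_square field_simps)
    then show ?thesis unfolding d2 by (simp add: algebra_simps)
  qed
  have p3: "p ^ 3 - q ^ 3 = 1"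
  proof -
    have "4 * (p ^ 3 - q ^ 3) = d * (3 * s\<^sup>2 + d\<^sup>2)"
      unfolding p_def q_def by (simp add: power2_eq_square power3_eq_cube field_simps)
    also have "\<dots> = (s * d) * s * (2 * x)" unfolding d2 by (simp add: power2_eq_square algebra_simps)
    also have "\<dots> = 4" unfolding sd using x r by (simp add: s_def)
    finally show ?thesis by simp
  qed
  have p2: "p\<^sup>2 - q\<^sup>2 = 2 * r"
  proof -
    have "p\<^sup>2 - q\<^sup>2 = (p + q) * (p - q)" by (simp add: power2_eq_square algebra_simps)
    then show ?thesis unfolding pq sd .
  qed
  have p4: "p ^ 4 - q ^ 4 = 2 * (x - 1) / (r * x\<^sup>2)"
  proof -
    have "2 * (p ^ 4 - q ^ 4) = (p\<^sup>2 - q\<^sup>2) * ((p + q)\<^sup>2 + (p - q)\<^sup>2)"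
      by (simp add: eval_nat_numeral algebra_simps)
    also have "\<dots> = 2 * r * ((2 * x - 2) * s\<^sup>2)" unfolding p2 pq d2 by (simp add: algebra_simps)
    also have "\<dots> = 2 * (2 * (x - 1) / (r * x\<^sup>2))"
      using x r by (simp add: s_def power2_eq_square field_simps)
    finally show ?thesis by (rule mult_left_cancel[THEN iffD1, rotated]) simp
  qed
  have k0: "0 < 2 * (x - 1) / (\<bar>\<sigma>\<bar> * x\<^sup>2)" using x \<sigma> by (intro divide_pos_pos mult_pos_pos) auto
  have k: "0 < cusp_\<kappa> x \<sigma>" "cusp_\<kappa> x \<sigma> ^ 4 = p ^ 4 - q ^ 4"
  proof -
    show "0 < cusp_\<kappa> x \<sigma>" unfolding cusp_\<kappa>_def powr_gt_zero using k0 by (rule less_imp_neq[THEN not_sym])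
    have pw: "(y powr (1 / 4)) ^ 4 = y" if "0 < y" for y :: real using that by (simp add: powr_power)
    have "cusp_\<kappa> x \<sigma> ^ 4 = 2 * (x - 1) / (\<bar>\<sigma>\<bar> * x\<^sup>2)"
      unfolding cusp_\<kappa>_def by (rule pw[OF k0])
    then show "cusp_\<kappa> x \<sigma> ^ 4 = p ^ 4 - q ^ 4" unfolding p4 using \<sigma> by (simp add: r_def)
  qed
  define u where "u = \<alpha> + 1 / q"
  have inv: "1 / q - 1 / p = \<beta> - \<alpha>" "1 / q + 1 / p = 2 * r * x / (2 - x)"
  proof -
    have nz: "p \<noteq> 0" "q \<noteq> 0" "x \<noteq> 0" "r \<noteq> 0" "2 - x \<noteq> 0" using q0 qp x r by auto
    have "1 / q - 1 / p = d / (p * q)" using nz pq(2) by (simp add: field_simps)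
    also have "\<dots> = 4 * r ^ 4 * x ^ 3 / (2 - x)"
      unfolding ppq using nz by (simp add: s_def d_def field_simps eval_nat_numeral)
    finally show "1 / q - 1 / p = \<beta> - \<alpha>" unfolding D by (simp add: r_def)
    have "1 / q + 1 / p = s / (p * q)" using nz pq(1) by (simp add: field_simps)
    also have "\<dots> = 2 * r * x / (2 - x)"
      unfolding ppq using nz by (simp add: s_def field_simps power2_eq_square)
    finally show "1 / q + 1 / p = 2 * r * x / (2 - x)" .
  qed
  show thesis
  proof (rule that[of q p u])
    show "\<sigma> = - (p\<^sup>2 - q\<^sup>2) / 2" unfolding p2 by (simp add: r_def)
    show "\<alpha> = u - 1 / q" "\<beta> = u - 1 / p" using inv(1) by (auto simp: u_def)
    show "cusp_X x \<sigma> = \<sigma>\<^sup>2 - (p - q)" unfolding pq d_def cusp_X_def by (simp add: r_def algebra_simps)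
    show "cusp_T \<alpha> \<beta> x \<sigma> = u - \<sigma>"
    proof -
      have "1 / q + 1 / p = 2 * \<sigma> - 2 * (2 * \<sigma> / (2 - x))"
        unfolding inv(2) r_def using x by (simp add: field_simps)
      moreover have "(a + b) / 2 - y = a + s - r" if "s + t = 2 * r - 2 * y" "s - t = b - a" for a b s t r y :: real
      proof -
        have "b = a + s - t" "y = r - (s + t) / 2" using that by (auto simp: field_simps)
        then show ?thesis by (simp add: field_simps)
      qed
      ultimately show ?thesis using inv(1) unfolding cusp_T_def u_def by blast
    qed
  qed (use q0 qp p3 k in auto)
qed

section \<open>Measurability and time reversal\<close>

text \<open>The Bochner integral is measurable in a parameter even where the integrand is not
  integrable, so the divergence of the inner Pearcey integral at z = 0 does no harm.\<close>

lemma measurable_ray_integral: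
  fixes f :: "'a \<Rightarrow> complex \<Rightarrow> complex"
  assumes c [measurable]: "c \<in> borel_measurable M"
    and f: "(\<lambda>z. f (fst z) (snd z)) \<in> borel_measurable (M \<Otimes>\<^sub>M borel)"
  shows "(\<lambda>x. ray_integral (c x) d (f x)) \<in> borel_measurable M"
proof -
  have "(\<lambda>z. (fst z, c (fst z) + of_real (snd z) * d)) \<in> M \<Otimes>\<^sub>M lborel \<rightarrow>\<^sub>M M \<Otimes>\<^sub>M borel"
    by measurable
  from measurable_compose[OF this f]
  have "(\<lambda>z. f (fst z) (c (fst z) + of_real (snd z) * d)) \<in> borel_measurable (M \<Otimes>\<^sub>M lborel)"
    by simp
  then have "(\<lambda>(x, t). indicator {0..} t *\<^sub>R (f x (c x + of_real t * d) * d)) \<in> borel_measurable (M \<Otimes>\<^sub>M lborel)"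
    unfolding split_beta by measurable
  then show ?thesis
    unfolding ray_integral_def set_lebesgue_integral_def by (rule lborel.borel_measurable_lebesgue_integral)
qed

lemma measurable_wedge_integral:
  fixes f :: "'a \<Rightarrow> complex \<Rightarrow> complex"
  assumes "c \<in> borel_measurable M" "(\<lambda>z. f (fst z) (snd z)) \<in> borel_measurable (M \<Otimes>\<^sub>M borel)"
  shows "(\<lambda>x. wedge_integral d1 (c x) d2 (f x)) \<in> borel_measurable M"
  unfolding wedge_integral_def by (intro borel_measurable_diff measurable_ray_integral assms)

lemma measurable_airy_wanderers_kernel:
  assumes [measurable]: "\<tau>1 \<in> borel_measurable M" "\<xi>1 \<in> borel_measurable M"
    "\<tau>2 \<in> borel_measurable M" "\<xi>2 \<in> borel_measurable M"
  shows "(\<lambda>x. airy_wanderers_kernel m a b (\<tau>1 x, \<xi>1 x) (\<tau>2 x, \<xi>2 x)) \<in> borel_measurable M"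
  unfolding airy_wanderers_kernel_def split
  by (intro borel_measurable_add borel_measurable_uminus borel_measurable_times borel_measurable_const
        measurable_wedge_integral) measurable

lemma measurable_pearcey_kernel:
  assumes [measurable]: "\<theta>1 \<in> borel_measurable M" "v1 \<in> borel_measurable M"
    "\<theta>2 \<in> borel_measurable M" "v2 \<in> borel_measurable M"
  shows "(\<lambda>x. pearcey_kernel (\<theta>1 x, v1 x) (\<theta>2 x, v2 x)) \<in> borel_measurable M"
  unfolding pearcey_kernel_def split Let_def
  by (intro borel_measurable_add borel_measurable_uminus borel_measurable_times borel_measurable_const
        measurable_wedge_integral) measurable

lemma measurable_airy_wanderers_kernel_pair:
  "(\<lambda>z. airy_wanderers_kernel m a b (fst z) (snd z)) \<in> borel_measurable borel"
proof -
  have "(\<lambda>z. airy_wanderers_kernel m a b (fst (fst z), snd (fst z)) (fst (snd z), snd (snd z))) \<in> borel_measurable borel"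
    by (rule measurable_airy_wanderers_kernel) (auto intro!: borel_measurable_continuous_onI continuous_intros)
  then show ?thesis by simp
qed

lemma measurable_pearcey_kernel_pair:
  "(\<lambda>z. pearcey_kernel (fst z) (snd z)) \<in> borel_measurable borel"
proof -
  have "(\<lambda>z. pearcey_kernel (fst (fst z), snd (fst z)) (fst (snd z), snd (snd z))) \<in> borel_measurable borel"
    by (rule measurable_pearcey_kernel) (auto intro!: borel_measurable_continuous_onI continuous_intros)
  then show ?thesis by simp
qed

section \<open>Reflection of the wanderers' kernel\<close>

lemma wedge_reflect: "wedge_integral (- d1) (- c) (- d2) f = - wedge_integral d1 c d2 (\<lambda>z. f (- z))"
proof -
  have "ray_integral (- c) (- d) f = - ray_integral c d (\<lambda>z. f (- z))" for d
    unfolding ray_integral_def set_lebesgue_integral_def by simp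
  then show ?thesis by (simp add: wedge_integral_def)
qed

lemma wedge_integral_minus: "wedge_integral d1 c d2 (\<lambda>z. - f z) = - wedge_integral d1 c d2 f"
  using wedge_integral_mult[of d1 c d2 "-1" f] by simp

text \<open>\<open>cubic_decay\<close> for the constant family of rays, where only the direction d
  decides.\<close>

lemma cubic_ray_decay:
  fixes s x :: real
  assumes "s * Re (d ^ 3) < 0"
  shows "\<exists>C. \<forall>t\<ge>0. cmod (exp (of_real s * (c + of_real t * d) ^ 3 + of_real x * (c + of_real t * d))) \<le> exp C * exp (- t)"
proof -
  have "\<exists>C. \<forall>R u. 0 \<le> R \<longrightarrow> 0 \<le> u \<longrightarrow> u \<le> 1 \<longrightarrow>
    Re ((\<lambda>z. of_real s * z ^ 3 + of_real 0 * z\<^sup>2 + of_real x * z)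
      (of_real (1 - u) * (c + of_real R * d) + of_real u * (c + of_real R * d))) \<le> C - R"
  proof (rule cubic_decay[of "- (s * Re (d ^ 3))"])
    show "s * Re ((of_real (1 - u) * d + of_real u * d) ^ 3) \<le> - (- (s * Re (d ^ 3)))" for u
      by (simp add: flip: distrib_right of_real_add)
  qed (use assms in simp)
  then obtain C where C: "\<forall>R u. 0 \<le> R \<longrightarrow> 0 \<le> u \<longrightarrow> u \<le> 1 \<longrightarrow>
    Re ((\<lambda>z. of_real s * z ^ 3 + of_real 0 * z\<^sup>2 + of_real x * z)
      (of_real (1 - u) * (c + of_real R * d) + of_real u * (c + of_real R * d))) \<le> C - R" by blast
  have "Re (of_real s * (c + of_real t * d) ^ 3 + of_real x * (c + of_real t * d)) \<le> C - t" if "0 \<le> t" for t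
    using C[rule_format, of t 0] that by simp
  then show ?thesis
    by (intro exI[of _ C] allI impI) (simp only: norm_exp_eq_Re exp_add[symmetric] exp_le_cancel_iff, simp)
qed

lemma cubic_wedge_decay:
  fixes s x :: real
  assumes "s * Re (d1 ^ 3) < 0" "s * Re (d2 ^ 3) < 0"
  obtains H where "0 \<le> H" "\<And>d t. d \<in> {d1, d2} \<Longrightarrow> 0 \<le> t \<Longrightarrow>
    cmod (exp (of_real s * (c + of_real t * d) ^ 3 + of_real x * (c + of_real t * d))) \<le> H * exp (- t)"
proof -
  obtain C1 where C1: "\<And>t. 0 \<le> t \<Longrightarrow> cmod (exp (of_real s * (c + of_real t * d1) ^ 3 + of_real x * (c + of_real t * d1))) \<le> exp C1 * exp (- t)"
    using cubic_ray_decay[OF assms(1)] by blast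
  obtain C2 where C2: "\<And>t. 0 \<le> t \<Longrightarrow> cmod (exp (of_real s * (c + of_real t * d2) ^ 3 + of_real x * (c + of_real t * d2))) \<le> exp C2 * exp (- t)"
    using cubic_ray_decay[OF assms(2)] by blast
  show thesis
  proof (rule that[of "exp C1 + exp C2"])
    fix d t assume "d \<in> {d1, d2}" and t: "0 \<le> (t::real)"
    moreover have "exp C1 * exp (- t) \<le> (exp C1 + exp C2) * exp (- t)" "exp C2 * exp (- t) \<le> (exp C1 + exp C2) * exp (- t)"
      by (intro mult_right_mono; simp)+
    ultimately show "cmod (exp (of_real s * (c + of_real t * d) ^ 3 + of_real x * (c + of_real t * d))) \<le> (exp C1 + exp C2) * exp (- t)"
      using C1[OF t] C2[OF t] by (elim insertE emptyE) (simp_all only:)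
  qed simp
qed

text \<open>The ray starts at distance \<delta> from 0 and, being inclined by 60 degrees to the real
  axis, keeps distance at least \<delta> / 2. Hence the quotient is at most 1 + 3 \<delta> /
  (\<delta> / 2) = 7.\<close>

lemma wanderer_ratio_bound:
  fixes y d e :: complex and \<delta> t :: real
  assumes \<delta>: "0 < \<delta>" and t: "0 \<le> t" and d: "cmod d = 1" "\<bar>Re d\<bar> = 1 / 2" and e: "cmod e = 3 * \<delta>"
    and y: "y = of_real \<delta> + of_real t * d \<or> y = - of_real \<delta> + of_real t * d"
  shows "cmod ((y + e) / y) \<le> 7"
proof -
  have "(Re d)\<^sup>2 = (1 / 2)\<^sup>2" using power2_abs[of "Re d"] unfolding d(2) by (rule sym)
  then have im: "(Im d)\<^sup>2 = 3 / 4"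
    using cmod_power2[of d] unfolding d(1) by (simp add: power_divide)
  define r where "r = t * Re d"
  have "(\<delta> / 2)\<^sup>2 \<le> (\<delta> - t / 2)\<^sup>2 + t\<^sup>2 * (3 / 4)"
  proof -
    have "0 \<le> (\<delta> / 2 - t)\<^sup>2 + \<delta>\<^sup>2 / 2" by simp
    also have "\<dots> = (\<delta> - t / 2)\<^sup>2 + t\<^sup>2 * (3 / 4) - (\<delta> / 2)\<^sup>2" by (simp add: power2_eq_square field_simps)
    finally show ?thesis by simp
  qed
  also have "\<dots> \<le> (cmod y)\<^sup>2"
  proof -
    have "(cmod y)\<^sup>2 = (\<delta> + r)\<^sup>2 + t\<^sup>2 * (3 / 4) \<or> (cmod y)\<^sup>2 = (\<delta> - r)\<^sup>2 + t\<^sup>2 * (3 / 4)"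
      using y
    proof (elim disjE)
      assume "y = of_real \<delta> + of_real t * d"
      then have "(cmod y)\<^sup>2 = (\<delta> + r)\<^sup>2 + t\<^sup>2 * (3 / 4)"
        using im by (simp add: r_def cmod_power2 power_mult_distrib)
      then show ?thesis by (rule disjI1)
    next
      assume "y = - of_real \<delta> + of_real t * d"
      then have "(cmod y)\<^sup>2 = (r - \<delta>)\<^sup>2 + t\<^sup>2 * (3 / 4)"
        using im by (simp add: r_def cmod_power2 power_mult_distrib)
      then show ?thesis unfolding power2_commute[of r \<delta>] by (rule disjI2)
    qed
    moreover have "r = t * (1 / 2) \<or> r = t * (- 1 / 2)"
    proof -
      have "Re d = 1 / 2 \<or> Re d = - 1 / 2" using d(2) by linarith
      then show ?thesis unfolding r_def by (elim disjE) simp_all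
    qed
    moreover have "(\<delta> - t / 2)\<^sup>2 \<le> (\<delta> + t / 2)\<^sup>2" using \<delta> t by (simp add: power2_eq_square algebra_simps)
    ultimately show ?thesis by auto
  qed
  finally have low: "\<delta> / 2 \<le> cmod y" by (rule power2_le_imp_le) simp
  then have "cmod (y + e) \<le> 7 * cmod y" using norm_triangle_ineq[of y e] e by linarith
  moreover have "0 < cmod y" using low \<delta> by linarith
  ultimately show ?thesis unfolding norm_divide by (subst pos_divide_le_eq)
qed

text \<open>The substitution exchanges the roles of the two integrals, so Fubini is needed. It
  applies because the shifted wedges have distance at least \<delta> = (b - a) / 3 and the rational
  factors are bounded by 7 along them. The vertices trisect (a, b), a configuration that the
  reflection preserves.\<close>

lemma airy_wanderers_kernel_reflection:
  assumes ab: "a < b"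
  shows "airy_wanderers_kernel m (- b) (- a) (- \<tau>2, \<xi>2) (- \<tau>1, \<xi>1) = airy_wanderers_kernel m a b (\<tau>1, \<xi>1) (\<tau>2, \<xi>2)"
proof -
  define c2 c1 :: complex where "c2 = of_real ((2 * a + b) / 3 - \<tau>2)" and "c1 = of_real ((a + 2 * b) / 3 - \<tau>1)"
  define D1 D2 E1 E2 where "D1 = cis (- 2 * pi / 3)" and "D2 = cis (2 * pi / 3)" and "E1 = cis (pi / 3)" and "E2 = cis (- pi / 3)"
  note D = D1_def[unfolded cis_directions] D2_def[unfolded cis_directions] E1_def[unfolded cis_directions] E2_def[unfolded cis_directions]
  have DE: "D1 = - E1" "D2 = - E2" "E1 = - D1" "E2 = - D2"
    unfolding D by (simp_all add: complex_eq_iff)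
  define G where "G = (\<lambda>w w' :: complex. exp (- (w ^ 3) / 3 + of_real \<xi>2 * w) / exp (- (w' ^ 3) / 3 + of_real \<xi>1 * w')
           * (1 / ((w + of_real \<tau>2) - (w' + of_real \<tau>1)))
           * ((w' - of_real a + of_real \<tau>1) / (w - of_real a + of_real \<tau>2)) ^ m
           * ((w - of_real b + of_real \<tau>2) / (w' - of_real b + of_real \<tau>1)) ^ m)"
  define G' where "G' = (\<lambda>w w' :: complex. exp (- (w ^ 3) / 3 + of_real \<xi>1 * w) / exp (- (w' ^ 3) / 3 + of_real \<xi>2 * w')
           * (1 / ((w + of_real (- \<tau>1)) - (w' + of_real (- \<tau>2))))
           * ((w' - of_real (- b) + of_real (- \<tau>2)) / (w - of_real (- b) + of_real (- \<tau>1))) ^ m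
           * ((w - of_real (- a) + of_real (- \<tau>1)) / (w' - of_real (- a) + of_real (- \<tau>2))) ^ m)"
  have G': "G' (- w') (- w) = G w w'" for w w'
  proof -
    have quot: "exp (- ((- w') ^ 3) / 3 + of_real \<xi>1 * - w') / exp (- ((- w) ^ 3) / 3 + of_real \<xi>2 * - w)
        = exp (- (w ^ 3) / 3 + of_real \<xi>2 * w) / exp (- (w' ^ 3) / 3 + of_real \<xi>1 * w')"
      by (simp add: algebra_simps flip: exp_diff)
    have neg: "(- x) / (- y) = x / y" for x y :: complex by simp
    have lin: "- w - of_real (- y) + of_real (- x) = - (w - of_real y + of_real x)" for w :: complex and x y :: real
      by simp
    have sep: "(- w' + of_real (- \<tau>1)) - (- w + of_real (- \<tau>2)) = (w + of_real \<tau>2) - (w' + complex_of_real \<tau>1)"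
      by simp
    have alg: "X * s * A ^ m * B ^ m = X * s * B ^ m * A ^ m" for X s A B :: complex
      by (simp only: mult.assoc mult.commute[of "A ^ m"])
    show ?thesis unfolding G'_def G_def quot lin neg sep by (rule alg)
  qed
  define \<delta> where "\<delta> = (b - a) / 3"
  have \<delta>: "0 < \<delta>" using ab by (simp add: \<delta>_def)
  have dirs: "cmod d = 1" "Re d = - 1 / 2" "d ^ 3 = 1" if "d \<in> {D1, D2}" for d
  proof -
    show "cmod d = 1" using that unfolding D1_def D2_def by (elim insertE emptyE) (simp_all only: norm_cis)
    show "Re d = - 1 / 2" using that unfolding D by auto
    have "Complex (-1/2) (- (sqrt 3 / 2)) ^ 3 = 1" "Complex (-1/2) (sqrt 3 / 2) ^ 3 = 1"
      by (simp_all add: complex_eq_iff power3_eq_cube)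
    then show "d ^ 3 = 1" using that unfolding D by (elim insertE emptyE) (simp_all only:)
  qed
  have dirs': "cmod d = 1" "Re d = 1 / 2" "d ^ 3 = - 1" if "d \<in> {E1, E2}" for d
    using dirs[of "- d"] that unfolding DE(3,4) by (auto simp: minus_equation_iff)
  obtain H where H0: "0 \<le> H" and H: "\<And>d t. d \<in> {D1, D2} \<Longrightarrow> 0 \<le> t \<Longrightarrow>
      cmod (exp (of_real (- 1 / 3) * (c2 + of_real t * d) ^ 3 + of_real \<xi>2 * (c2 + of_real t * d))) \<le> H * exp (- t)"
    by (rule cubic_wedge_decay[of "- 1 / 3" D1 D2 c2 \<xi>2]) (simp_all add: dirs)
  obtain H' where H0': "0 \<le> H'" and H': "\<And>d t. d \<in> {E1, E2} \<Longrightarrow> 0 \<le> t \<Longrightarrow>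
      cmod (exp (of_real (1 / 3) * (c1 + of_real t * d) ^ 3 + of_real (- \<xi>1) * (c1 + of_real t * d))) \<le> H' * exp (- t)"
    by (rule cubic_wedge_decay[of "1 / 3" E1 E2 c1 "- \<xi>1"]) (simp_all add: dirs')
  have fub: "wedge_integral D1 c2 D2 (\<lambda>w. wedge_integral E1 c1 E2 (G w))
      = wedge_integral E1 c1 E2 (\<lambda>w'. wedge_integral D1 c2 D2 (\<lambda>w. G w w'))"
  proof (rule wedge_fubini(1)[where A = "\<lambda>t. H * exp (- t)" and B = "\<lambda>t. H' / \<delta> * 7 ^ m * 7 ^ m * exp (- t)"])
    show "(\<lambda>x. G (fst x) (snd x)) \<in> borel_measurable borel"
      unfolding G_def borel_prod[symmetric] by measurable
    show "set_integrable lborel {0..} (\<lambda>t. H * exp (- t))" "set_integrable lborel {0..} (\<lambda>t. H' / \<delta> * 7 ^ m * 7 ^ m * exp (- t))"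
      by (intro set_integrable_exp_minus)+
    fix d d' :: complex and t t' :: real
    assume d: "d \<in> {D1, D2}" and d': "d' \<in> {E1, E2}" and t: "0 < t" "0 < t'"
    define w w' where "w = c2 + of_real t * d" and "w' = c1 + of_real t' * d'"
    have e2: "cmod (exp (- (w ^ 3) / 3 + of_real \<xi>2 * w)) \<le> H * exp (- t)"
    proof -
      have "of_real (- 1 / 3) * w ^ 3 + of_real \<xi>2 * w = - (w ^ 3) / 3 + of_real \<xi>2 * w" by simp
      then show ?thesis using H[OF d less_imp_le[OF t(1)]] unfolding w_def by (simp only:)
    qed
    have e1: "cmod (1 / exp (- (w' ^ 3) / 3 + of_real \<xi>1 * w')) \<le> H' * exp (- t')"
    proof -
      have "of_real (1 / 3) * w' ^ 3 + of_real (- \<xi>1) * w' = - (- (w' ^ 3) / 3 + of_real \<xi>1 * w')" by simp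
      then have "exp (of_real (1 / 3) * w' ^ 3 + of_real (- \<xi>1) * w') = 1 / exp (- (w' ^ 3) / 3 + of_real \<xi>1 * w')"
        by (simp only: exp_minus inverse_eq_divide)
      then show ?thesis using H'[OF d' less_imp_le[OF t(2)]] unfolding w'_def by (simp only:)
    qed
    have sep: "cmod (1 / ((w + of_real \<tau>2) - (w' + of_real \<tau>1))) \<le> 1 / \<delta>"
    proof -
      have "Re ((w + of_real \<tau>2) - (w' + of_real \<tau>1)) = - \<delta> - t / 2 - t' / 2"
      proof -
        have "Re ((w + of_real \<tau>2) - (w' + of_real \<tau>1)) = ((2 * a + b) / 3 + t * Re d) - ((a + 2 * b) / 3 + t' * Re d')"
          by (simp add: w_def w'_def c1_def c2_def)
        also have "\<dots> = - \<delta> - t / 2 - t' / 2"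
          unfolding dirs(2)[OF d] dirs'(2)[OF d'] \<delta>_def by (simp add: field_simps)
        finally show ?thesis .
      qed
      then have "\<delta> \<le> cmod ((w + of_real \<tau>2) - (w' + of_real \<tau>1))"
        using abs_Re_le_cmod[of "(w + of_real \<tau>2) - (w' + of_real \<tau>1)"] t \<delta> by linarith
      then show ?thesis using \<delta> by (simp add: norm_divide frac_le)
    qed
    have ra: "cmod ((w - of_real b + of_real \<tau>2) / (w - of_real a + of_real \<tau>2)) \<le> 7"
    proof -
      have y: "w - of_real a + of_real \<tau>2 = of_real \<delta> + of_real t * d"
        by (simp add: w_def c2_def \<delta>_def field_simps)
      have e: "w - of_real b + of_real \<tau>2 = (w - of_real a + of_real \<tau>2) + of_real (- 3 * \<delta>)"
        by (simp add: \<delta>_def field_simps)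
      have n: "cmod (of_real (- 3 * \<delta>)) = 3 * \<delta>" using \<delta> by (simp only: norm_of_real)
      show ?thesis
        unfolding e by (rule wanderer_ratio_bound[OF \<delta> less_imp_le[OF t(1)] dirs(1)[OF d] _ n disjI1[OF y]])
          (use dirs(2)[OF d] in simp)
    qed
    have rb: "cmod ((w' - of_real a + of_real \<tau>1) / (w' - of_real b + of_real \<tau>1)) \<le> 7"
    proof -
      have y: "w' - of_real b + of_real \<tau>1 = - of_real \<delta> + of_real t' * d'"
        by (simp add: w'_def c1_def \<delta>_def field_simps)
      have e: "w' - of_real a + of_real \<tau>1 = (w' - of_real b + of_real \<tau>1) + of_real (3 * \<delta>)"
        by (simp add: \<delta>_def field_simps)
      have n: "cmod (of_real (3 * \<delta>)) = 3 * \<delta>" using \<delta> by (simp only: norm_of_real)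
      show ?thesis
        unfolding e by (rule wanderer_ratio_bound[OF \<delta> less_imp_le[OF t(2)] dirs'(1)[OF d'] _ n disjI2[OF y]])
          (use dirs'(2)[OF d'] in simp)
    qed
    have "G w w' = exp (- (w ^ 3) / 3 + of_real \<xi>2 * w) * (1 / exp (- (w' ^ 3) / 3 + of_real \<xi>1 * w')
        * (1 / ((w + of_real \<tau>2) - (w' + of_real \<tau>1)))
        * ((w - of_real b + of_real \<tau>2) / (w - of_real a + of_real \<tau>2)) ^ m
        * ((w' - of_real a + of_real \<tau>1) / (w' - of_real b + of_real \<tau>1)) ^ m)"
    proof -
      have alg: "e / e' * s * (p / q) ^ m * (r / u) ^ m = e * (1 / e' * s * (r / q) ^ m * (p / u) ^ m)" for e e' s p q r u :: complex
        by (simp add: power_divide)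
      show ?thesis unfolding G_def by (rule alg)
    qed
    then have "cmod (G w w') = cmod (exp (- (w ^ 3) / 3 + of_real \<xi>2 * w)) * (cmod (1 / exp (- (w' ^ 3) / 3 + of_real \<xi>1 * w'))
        * cmod (1 / ((w + of_real \<tau>2) - (w' + of_real \<tau>1)))
        * cmod ((w - of_real b + of_real \<tau>2) / (w - of_real a + of_real \<tau>2)) ^ m
        * cmod ((w' - of_real a + of_real \<tau>1) / (w' - of_real b + of_real \<tau>1)) ^ m)"
      by (simp only: norm_mult norm_power)
    also have "\<dots> \<le> (H * exp (- t)) * ((H' * exp (- t')) * (1 / \<delta>) * 7 ^ m * 7 ^ m)"
      using \<delta> H0 H0' by (intro mult_mono e1 e2 sep power_mono ra rb mult_nonneg_nonneg zero_le_power norm_ge_zero) simp_all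
    also have "\<dots> = H * exp (- t) * (H' / \<delta> * 7 ^ m * 7 ^ m * exp (- t'))" by simp
    finally show "cmod (G (c2 + of_real t * d) (c1 + of_real t' * d')) \<le> H * exp (- t) * (H' / \<delta> * 7 ^ m * 7 ^ m * exp (- t'))"
      unfolding w_def w'_def .
  qed
  have "wedge_integral D1 (- c1) D2 (\<lambda>w. wedge_integral E1 (- c2) E2 (G' w))
      = wedge_integral D1 c2 D2 (\<lambda>w. wedge_integral E1 c1 E2 (G w))"
  proof -
    have "wedge_integral D1 (- c1) D2 (\<lambda>w. wedge_integral E1 (- c2) E2 (G' w))
        = wedge_integral (- E1) (- c1) (- E2) (\<lambda>w. wedge_integral (- D1) (- c2) (- D2) (G' w))"
      by (simp only: DE(3,4) minus_minus)
    also have "\<dots> = wedge_integral E1 c1 E2 (\<lambda>w'. wedge_integral D1 c2 D2 (\<lambda>w. G w w'))"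
      unfolding wedge_reflect wedge_integral_minus minus_minus G' ..
    finally show ?thesis unfolding fub .
  qed
  moreover have "- c1 = of_real ((2 * - b + - a) / 3 - - \<tau>1)" "- c2 = of_real ((- b + 2 * - a) / 3 - - \<tau>2)"
    unfolding c1_def c2_def of_real_minus[symmetric] by (rule arg_cong[where f = of_real], simp add: field_simps)+
  ultimately have int: "wedge_integral D1 (of_real ((2 * - b + - a) / 3 - - \<tau>1)) D2 (\<lambda>w.
      wedge_integral E1 (of_real ((- b + 2 * - a) / 3 - - \<tau>2)) E2 (G' w))
      = wedge_integral D1 c2 D2 (\<lambda>w. wedge_integral E1 c1 E2 (G w))" by simp
  have gauss: "(if - \<tau>1 > - \<tau>2
        then of_real (exp (- (\<xi>1 - \<xi>2)\<^sup>2 / (4 * (- \<tau>1 - - \<tau>2)) - (- \<tau>1 - - \<tau>2) * (\<xi>1 + \<xi>2) / 2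
                + (- \<tau>1 - - \<tau>2) ^ 3 / 12) / sqrt (4 * pi * (- \<tau>1 - - \<tau>2)))
        else 0) = (if \<tau>2 > \<tau>1
        then complex_of_real (exp (- (\<xi>2 - \<xi>1)\<^sup>2 / (4 * (\<tau>2 - \<tau>1)) - (\<tau>2 - \<tau>1) * (\<xi>2 + \<xi>1) / 2
                + (\<tau>2 - \<tau>1) ^ 3 / 12) / sqrt (4 * pi * (\<tau>2 - \<tau>1)))
        else 0)"
  proof -
    have "- \<tau>1 - - \<tau>2 = \<tau>2 - \<tau>1" "- \<tau>1 > - \<tau>2 \<longleftrightarrow> \<tau>2 > \<tau>1" by auto
    then show ?thesis by (simp only: power2_commute[of \<xi>1 \<xi>2] add.commute[of \<xi>1 \<xi>2])
  qed
  show ?thesis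
    unfolding airy_wanderers_kernel_def split gauss
    unfolding D1_def[symmetric] D2_def[symmetric] E1_def[symmetric] E2_def[symmetric] c1_def[symmetric] c2_def[symmetric]
    unfolding int[unfolded G_def G'_def] ..
qed

section \<open>Convergence\<close>

definition local_kernel :: "nat \<Rightarrow> real \<Rightarrow> real \<Rightarrow> real \<Rightarrow> real \<Rightarrow> real \<Rightarrow> real \<Rightarrow> real \<Rightarrow> complex" where
  "local_kernel m p q \<mu> \<theta>1 w1 \<theta>2 w2 = - of_real (gaussian_term \<theta>1 w1 \<theta>2 w2)
     + 1 / (2 * of_real pi * \<i>)\<^sup>2 * cusp_integral (local_phase m p q \<mu> \<theta>1 w1) (local_phase m p q \<mu> \<theta>2 w2)"

lemma measurable_local_phase: "local_phase m p q \<mu> \<theta> w \<in> borel_measurable borel"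
  unfolding local_phase_def saddle_def by measurable

lemma local_phase_bounds:
  assumes "0 < q" "q < p" "p ^ 3 - q ^ 3 = 1"
    and "\<And>m::nat. 0 < m \<Longrightarrow> 0 < \<mu> m" "\<And>m. 0 < m \<Longrightarrow> real m * \<mu> m ^ 4 * (p ^ 4 - q ^ 4) = 1" "\<mu> \<longlonglongrightarrow> 0"
  shows "\<exists>K>0. \<forall>\<^sub>F m in sequentially. \<forall>\<theta> w d t. \<bar>\<theta>\<bar> \<le> \<Theta> \<longrightarrow> \<bar>w\<bar> \<le> V \<longrightarrow> 0 \<le> t \<longrightarrow>
      (steep_direction (-1) d \<longrightarrow> cmod (local_phase m p q (\<mu> m) \<theta> w (of_real t * d)) \<le> K * exp (- t)) \<and>
      (steep_direction 1 d \<longrightarrow> cmod (1 / local_phase m p q (\<mu> m) \<theta> w (of_real t * d)) \<le> K * exp (- t))"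
proof -
  obtain C where C: "\<forall>\<^sub>F m in sequentially. \<forall>\<theta> w e d t. \<bar>\<theta>\<bar> \<le> \<Theta> \<longrightarrow> \<bar>w\<bar> \<le> V \<longrightarrow> steep_direction e d \<longrightarrow> 0 \<le> t \<longrightarrow>
      local_phase m p q (\<mu> m) \<theta> w (of_real t * d) \<noteq> 0 \<and> e * - ln (cmod (local_phase m p q (\<mu> m) \<theta> w (of_real t * d))) \<le> C - t"
    using saddle_perturbed_bound[of q p \<mu> \<Theta> V] assms unfolding local_phase_def by blast
  show ?thesis
  proof (intro exI[of _ "exp C"] conjI eventually_mono[OF C] allI impI)
    fix m and \<theta> w t :: real and d :: complex
    assume m: "\<forall>\<theta> w e d t. \<bar>\<theta>\<bar> \<le> \<Theta> \<longrightarrow> \<bar>w\<bar> \<le> V \<longrightarrow> steep_direction e d \<longrightarrow> 0 \<le> t \<longrightarrow>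
      local_phase m p q (\<mu> m) \<theta> w (of_real t * d) \<noteq> 0 \<and> e * - ln (cmod (local_phase m p q (\<mu> m) \<theta> w (of_real t * d))) \<le> C - t"
      and h: "\<bar>\<theta>\<bar> \<le> \<Theta>" "\<bar>w\<bar> \<le> V" "0 \<le> t"
    define F where "F = local_phase m p q (\<mu> m) \<theta> w (of_real t * d)"
    have F: "F \<noteq> 0" "e * - ln (cmod F) \<le> C - t" if "steep_direction e d" for e
      using m h that unfolding F_def by blast+
    have E: "exp (C - t) = exp C * exp (- t)" by (simp flip: exp_add)
    show "cmod (local_phase m p q (\<mu> m) \<theta> w (of_real t * d)) \<le> exp C * exp (- t)" if "steep_direction (-1) d"
    proof -
      have "exp (ln (cmod F)) \<le> exp (C - t)" using F(2)[OF that] by simp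
      then show ?thesis using F(1)[OF that] unfolding F_def[symmetric] E by simp
    qed
    show "cmod (1 / local_phase m p q (\<mu> m) \<theta> w (of_real t * d)) \<le> exp C * exp (- t)" if "steep_direction 1 d"
    proof -
      have "exp (- ln (cmod F)) \<le> exp (C - t)" using F(2)[OF that] by simp
      then show ?thesis using F(1)[OF that] unfolding F_def[symmetric] E by (simp add: exp_minus norm_divide norm_inverse divide_inverse)
    qed
  qed simp
qed

text \<open>The times come from a finite set, so the prefactors take finitely many values, and the
  exponential is at most 1 when \<theta>1 < \<theta>2.\<close>

lemma gaussian_term_bounded:
  assumes "finite T"
  shows "\<exists>G. \<forall>\<theta>1\<in>T. \<forall>\<theta>2\<in>T. \<forall>w1 w2. \<bar>gaussian_term \<theta>1 w1 \<theta>2 w2\<bar> \<le> G"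
proof -
  define g where "g = (\<lambda>s. \<bar>1 / sqrt (2 * pi * (snd s - fst s))\<bar> :: real)"
  have "\<bar>gaussian_term \<theta>1 w1 \<theta>2 w2\<bar> \<le> sum g (T \<times> T)" if T: "\<theta>1 \<in> T" "\<theta>2 \<in> T" for \<theta>1 \<theta>2 w1 w2
  proof -
    have "\<bar>gaussian_term \<theta>1 w1 \<theta>2 w2\<bar> \<le> g (\<theta>1, \<theta>2)"
    proof (cases "\<theta>1 < \<theta>2")
      case True
      have "exp (- (w2 - w1)\<^sup>2 / (2 * (\<theta>2 - \<theta>1))) \<le> 1" using True by (simp add: divide_nonneg_pos)
      then have "exp (- (w2 - w1)\<^sup>2 / (2 * (\<theta>2 - \<theta>1))) / sqrt (2 * pi * (\<theta>2 - \<theta>1)) \<le> 1 / sqrt (2 * pi * (\<theta>2 - \<theta>1))"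
        using True by (intro divide_right_mono) auto
      then show ?thesis using True by (simp add: gaussian_term_def g_def)
    qed (simp add: gaussian_term_def g_def)
    also have "\<dots> \<le> sum g (T \<times> T)" using T assms by (intro member_le_sum) (auto simp: g_def)
    finally show ?thesis .
  qed
  then show ?thesis by blast
qed

text \<open>The bound holds for all space variables in [-V, V] at once, the uniformity that
  \<open>fredholm_det_tendsto\<close> needs.\<close>

lemma local_kernel_bounded:
  assumes "finite T"
    and "0 < q" "q < p" "p ^ 3 - q ^ 3 = 1"
    and "\<And>m::nat. 0 < m \<Longrightarrow> 0 < \<mu> m" "\<And>m. 0 < m \<Longrightarrow> real m * \<mu> m ^ 4 * (p ^ 4 - q ^ 4) = 1" "\<mu> \<longlonglongrightarrow> 0"
  shows "\<exists>B. \<forall>\<^sub>F m in sequentially. \<forall>\<theta>1\<in>T. \<forall>\<theta>2\<in>T. \<forall>w1 w2. \<bar>w1\<bar> \<le> V \<longrightarrow> \<bar>w2\<bar> \<le> V \<longrightarrow>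
    cmod (local_kernel m p q (\<mu> m) \<theta>1 w1 \<theta>2 w2) \<le> B"
proof -
  obtain G where G: "\<And>\<theta>1 \<theta>2 w1 w2. \<theta>1 \<in> T \<Longrightarrow> \<theta>2 \<in> T \<Longrightarrow> \<bar>gaussian_term \<theta>1 w1 \<theta>2 w2\<bar> \<le> G"
    using gaussian_term_bounded[OF assms(1)] by blast
  define \<Theta> where "\<Theta> = (\<Sum>\<theta>\<in>T. \<bar>\<theta>\<bar>)"
  have \<Theta>: "\<bar>\<theta>\<bar> \<le> \<Theta>" if "\<theta> \<in> T" for \<theta>
    unfolding \<Theta>_def using that assms(1) by (intro member_le_sum) auto
  obtain K where K: "\<forall>\<^sub>F m in sequentially. \<forall>\<theta> w d t. \<bar>\<theta>\<bar> \<le> \<Theta> \<longrightarrow> \<bar>w\<bar> \<le> V \<longrightarrow> 0 \<le> t \<longrightarrow>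
      (steep_direction (-1) d \<longrightarrow> cmod (local_phase m p q (\<mu> m) \<theta> w (of_real t * d)) \<le> K * exp (- t)) \<and>
      (steep_direction 1 d \<longrightarrow> cmod (1 / local_phase m p q (\<mu> m) \<theta> w (of_real t * d)) \<le> K * exp (- t))"
    using local_phase_bounds[of q p \<mu> \<Theta> V] assms(2-) by blast
  define I where "I = 8 * ((LBINT t:{0..}. gamma_weight K t) * (LBINT t:{0..}. gamma_weight (2 * K) t) * 9)"
  define B where "B = G + cmod (1 / (2 * of_real pi * \<i>)\<^sup>2) * I"
  show ?thesis
  proof (intro exI[of _ B] eventually_mono[OF K] ballI allI impI)
    fix m \<theta>1 \<theta>2 w1 w2
    assume m: "\<forall>\<theta> w d t. \<bar>\<theta>\<bar> \<le> \<Theta> \<longrightarrow> \<bar>w\<bar> \<le> V \<longrightarrow> 0 \<le> t \<longrightarrow>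
      (steep_direction (-1) d \<longrightarrow> cmod (local_phase m p q (\<mu> m) \<theta> w (of_real t * d)) \<le> K * exp (- t)) \<and>
      (steep_direction 1 d \<longrightarrow> cmod (1 / local_phase m p q (\<mu> m) \<theta> w (of_real t * d)) \<le> K * exp (- t))"
      and h: "\<theta>1 \<in> T" "\<theta>2 \<in> T" "\<bar>w1\<bar> \<le> V" "\<bar>w2\<bar> \<le> V"
    have I: "cmod (cusp_integral (local_phase m p q (\<mu> m) \<theta>1 w1) (local_phase m p q (\<mu> m) \<theta>2 w2)) \<le> I"
      unfolding I_def
    proof (rule cusp_integral_bound[OF measurable_local_phase measurable_local_phase])
      show "cmod (local_phase m p q (\<mu> m) \<theta>2 w2 (of_real t * d)) \<le> K * exp (- t)"
        if "steep_direction (-1) d" "0 \<le> t" for d t using m \<Theta>[OF h(2)] h(4) that by blast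
      show "cmod (1 / local_phase m p q (\<mu> m) \<theta>1 w1 (of_real t * d)) \<le> K * exp (- t)"
        if "steep_direction 1 d" "0 \<le> t" for d t using m \<Theta>[OF h(1)] h(3) that by blast
    qed
    have "cmod (local_kernel m p q (\<mu> m) \<theta>1 w1 \<theta>2 w2) \<le> cmod (- of_real (gaussian_term \<theta>1 w1 \<theta>2 w2))
        + cmod (1 / (2 * of_real pi * \<i>)\<^sup>2) * cmod (cusp_integral (local_phase m p q (\<mu> m) \<theta>1 w1) (local_phase m p q (\<mu> m) \<theta>2 w2))"
      unfolding local_kernel_def norm_mult[symmetric] by (rule norm_triangle_ineq)
    also have "\<dots> \<le> G + cmod (1 / (2 * of_real pi * \<i>)\<^sup>2) * I"
      using G[OF h(1,2), of w1 w2] by (intro add_mono mult_left_mono I norm_ge_zero) (simp only: norm_minus_cancel norm_of_real)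
    finally show "cmod (local_kernel m p q (\<mu> m) \<theta>1 w1 \<theta>2 w2) \<le> B" unfolding B_def .
  qed
qed

lemma gaussian_term_tendsto:
  assumes "W1 \<longlonglongrightarrow> v1" "W2 \<longlonglongrightarrow> v2"
  shows "(\<lambda>m. gaussian_term \<theta>1 (W1 m) \<theta>2 (W2 m)) \<longlonglongrightarrow> gaussian_term \<theta>1 v1 \<theta>2 v2"
  unfolding gaussian_term_def by (cases "\<theta>1 < \<theta>2") (auto intro!: tendsto_intros assms)

lemma local_kernel_tendsto:
  assumes pq: "0 < q" "q < p" "p ^ 3 - q ^ 3 = 1"
    and \<mu>: "\<And>m::nat. 0 < m \<Longrightarrow> 0 < \<mu> m" "\<And>m. 0 < m \<Longrightarrow> real m * \<mu> m ^ 4 * (p ^ 4 - q ^ 4) = 1" "\<mu> \<longlonglongrightarrow> 0"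
    and W: "W1 \<longlonglongrightarrow> v1" "W2 \<longlonglongrightarrow> v2"
  shows "(\<lambda>m. local_kernel m p q (\<mu> m) \<theta>1 (W1 m) \<theta>2 (W2 m)) \<longlonglongrightarrow> pearcey_kernel (\<theta>1, v1) (\<theta>2, v2)"
proof -
  define \<Theta> where "\<Theta> = max \<bar>\<theta>1\<bar> \<bar>\<theta>2\<bar>"
  \<comment> \<open>The margin 1 lets the sequences W1 and W2 eventually lie in the range of the
    uniform bounds.\<close>
  define V where "V = max \<bar>v1\<bar> \<bar>v2\<bar> + 1"
  obtain K where K: "\<forall>\<^sub>F m in sequentially. \<forall>\<theta> w d t. \<bar>\<theta>\<bar> \<le> \<Theta> \<longrightarrow> \<bar>w\<bar> \<le> V \<longrightarrow> 0 \<le> t \<longrightarrow>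
      (steep_direction (-1) d \<longrightarrow> cmod (local_phase m p q (\<mu> m) \<theta> w (of_real t * d)) \<le> K * exp (- t)) \<and>
      (steep_direction 1 d \<longrightarrow> cmod (1 / local_phase m p q (\<mu> m) \<theta> w (of_real t * d)) \<le> K * exp (- t))"
    using local_phase_bounds[of q p \<mu> \<Theta> V] pq \<mu> by blast
  have phase: "(\<lambda>m. local_phase m p q (\<mu> m) \<theta> (W m) z) \<longlonglongrightarrow> pearcey_phase \<theta> v z"
    if "W \<longlonglongrightarrow> v" for \<theta> W v z
  proof -
    have "(\<lambda>m. saddle m p q (\<mu> m) z * exp (of_real \<theta> * z\<^sup>2 / 2 - of_real (W m) * z))
        \<longlonglongrightarrow> exp (- (z ^ 4) / 4) * exp (of_real \<theta> * z\<^sup>2 / 2 - of_real v * z)"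
      by (intro tendsto_intros that saddle_tendsto[OF pq \<mu>])
    moreover have "exp (- (z ^ 4) / 4) * exp (of_real \<theta> * z\<^sup>2 / 2 - of_real v * z) = pearcey_phase \<theta> v z"
      unfolding pearcey_phase_def exp_add[symmetric] by (simp only: add_diff_eq)
    ultimately show ?thesis unfolding local_phase_def by simp
  qed
  have "\<forall>\<^sub>F m in sequentially. \<bar>W1 m\<bar> < V" "\<forall>\<^sub>F m in sequentially. \<bar>W2 m\<bar> < V"
    by (rule order_tendstoD(2)[OF tendsto_rabs[OF W(1)]], simp add: V_def)
       (rule order_tendstoD(2)[OF tendsto_rabs[OF W(2)]], simp add: V_def)
  with K have bd: "\<forall>\<^sub>F m in sequentially. (\<forall>d t. steep_direction (-1) d \<longrightarrow> 0 \<le> t \<longrightarrow> cmod (local_phase m p q (\<mu> m) \<theta>2 (W2 m) (of_real t * d)) \<le> K * exp (- t)) \<and>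
      (\<forall>d t. steep_direction 1 d \<longrightarrow> 0 \<le> t \<longrightarrow> cmod (1 / local_phase m p q (\<mu> m) \<theta>1 (W1 m) (of_real t * d)) \<le> K * exp (- t))"
  proof eventually_elim
    case (elim m)
    have "\<bar>\<theta>1\<bar> \<le> \<Theta>" "\<bar>\<theta>2\<bar> \<le> \<Theta>" by (auto simp: \<Theta>_def)
    then show ?case using elim less_imp_le by blast
  qed
  have "(\<lambda>m. cusp_integral (local_phase m p q (\<mu> m) \<theta>1 (W1 m)) (local_phase m p q (\<mu> m) \<theta>2 (W2 m)))
      \<longlonglongrightarrow> cusp_integral (pearcey_phase \<theta>1 v1) (pearcey_phase \<theta>2 v2)"
  proof (rule cusp_integral_tendsto[OF measurable_local_phase measurable_local_phase _ _ bd])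
    have "pearcey_phase \<theta> v \<in> borel_measurable borel" for \<theta> v
      unfolding pearcey_phase_def by measurable
    then show "pearcey_phase \<theta>1 v1 \<in> borel_measurable borel" "pearcey_phase \<theta>2 v2 \<in> borel_measurable borel" by blast+
  qed (use phase W in \<open>auto simp: pearcey_phase_def\<close>)
  then show ?thesis
    unfolding local_kernel_def pearcey_kernel_eq
    by (intro tendsto_intros gaussian_term_tendsto W)
qed

text \<open>On the fixed space of indices and positions the rescaled kernel is conjugate to
  \<open>local_kernel\<close> for large m; this kernel converges pointwise and is eventually bounded
  on the compact support, so \<open>fredholm_det_tendsto\<close> applies.\<close>

lemma opening_cusp_limit:
  assumes op: "opening_cusp \<alpha> \<beta> (x, \<sigma>)" and inj: "inj_on \<theta> {1..l}"
    and E: "\<And>k. k \<in> {1..l} \<Longrightarrow> compact (E k)"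
  shows "cusp_gap \<alpha> \<beta> x \<sigma> l \<theta> E \<longlonglongrightarrow> pearcey_gap l \<theta> E"
proof -
  define \<kappa> where "\<kappa> = cusp_\<kappa> x \<sigma>"
  obtain p q u where pq: "0 < q" "q < p" "p ^ 3 - q ^ 3 = 1" and \<sigma>: "\<sigma> = - (p\<^sup>2 - q\<^sup>2) / 2"
    and \<kappa>: "0 < \<kappa>" "\<kappa> ^ 4 = p ^ 4 - q ^ 4" and \<alpha>\<beta>: "\<alpha> = u - 1 / q" "\<beta> = u - 1 / p"
    and TX: "cusp_T \<alpha> \<beta> x \<sigma> = u - \<sigma>" "cusp_X x \<sigma> = \<sigma>\<^sup>2 - (p - q)"
    unfolding \<kappa>_def by (rule opening_cusp_parameters[OF op])
  have \<sigma>0: "\<sigma> < 0" using op by (simp add: opening_cusp_def)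
  define n where "n = (\<lambda>m::nat. real m powr (1 / 12))"
  have n0: "0 < n m" if "0 < m" for m using that by (simp add: n_def)
  have npow: "n m ^ k = real m powr (real k / 12)" if "0 < m" for m k
    using that by (simp add: n_def powr_powr flip: powr_realpow)
  have n12: "real m = n m ^ 12" if "0 < m" for m using that by (simp add: npow)
  have n_large: "\<forall>\<^sub>F m in sequentially. A < n m" for A
  proof -
    have "\<forall>\<^sub>F m in sequentially. max A 0 ^ 12 < real m"
      using filterlim_real_sequentially by (simp add: filterlim_at_top_dense)
    then show ?thesis using eventually_gt_at_top[of 0]
    proof eventually_elim
      case (elim m)
      have "max A 0 < n m"
      proof (rule ccontr)
        assume "\<not> max A 0 < n m"
        then have "n m ^ 12 \<le> max A 0 ^ 12" using n0[OF elim(2)] by (intro power_mono) auto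
        then show False using elim(1) n12[OF elim(2)] by simp
      qed
      then show ?case by simp
    qed
  qed
  define \<mu> where "\<mu> = (\<lambda>m. 1 / (\<kappa> * n m ^ 3))"
  have \<mu>0: "0 < \<mu> m" if "0 < m" for m using n0[OF that] \<kappa> by (simp add: \<mu>_def)
  have \<mu>4: "real m * \<mu> m ^ 4 * (p ^ 4 - q ^ 4) = 1" if "0 < m" for m
    unfolding \<kappa>(2)[symmetric] \<mu>_def n12[OF that] using n0[OF that] \<kappa>(1)
    by (simp add: power_divide power_mult_distrib flip: power_mult)
  have \<mu>lim: "\<mu> \<longlonglongrightarrow> 0"
  proof -
    have "filterlim n at_top sequentially" unfolding filterlim_at_top_dense using n_large by blast
    then have "filterlim (\<lambda>m. \<kappa> * n m ^ 3) at_top sequentially"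
      using \<kappa>(1) by (intro filterlim_tendsto_pos_mult_at_top[OF tendsto_const] filterlim_pow_at_top) auto
    then show ?thesis
      unfolding \<mu>_def using tendsto_inverse_0_at_top by (simp add: divide_inverse del: inverse_mult_distrib)
  qed
  define \<tau> where "\<tau> = (\<lambda>m t. (u - \<sigma>) * n m ^ 4 + \<kappa>\<^sup>2 * t / (2 * (n m)\<^sup>2))"
  define \<xi> where "\<xi> = (\<lambda>m t v. (\<sigma>\<^sup>2 - (p - q)) * n m ^ 8 - \<kappa>\<^sup>2 * \<sigma> * t * (n m)\<^sup>2 - \<kappa> / n m * v)"
  define w where "w = (\<lambda>m t v. v + (\<kappa>\<^sup>2 * t / (2 * (n m)\<^sup>2))\<^sup>2 * n m / \<kappa>)"
  define h where "h = (\<lambda>m t v. exp (- ((u * n m ^ 4 - \<tau> m t) ^ 3) / 3 + \<xi> m t v * (u * n m ^ 4 - \<tau> m t)))"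
  define K where "K = (\<lambda>m::nat. airy_wanderers_kernel m (\<alpha> * n m ^ 4) (\<beta> * n m ^ 4))"
  have local: "of_real (\<kappa> / n m) * K m (\<tau> m t1, \<xi> m t1 v1) (\<tau> m t2, \<xi> m t2 v2)
      = of_real (h m t2 v2) / of_real (h m t1 v1) * local_kernel m p q (\<mu> m) t1 (w m t1 v1) t2 (w m t2 v2)"
    if m: "0 < m" and large: "u * n m ^ 4 < \<tau> m t2" for m t1 v1 t2 v2
    unfolding K_def \<alpha>\<beta> local_kernel_def h_def w_def \<mu>_def \<xi>_def \<tau>_def \<sigma>
    by (rule airy_kernel_local[OF n0[OF m] n12[OF m] pq \<kappa> large[unfolded \<tau>_def \<sigma>]])
  define N where "N = count_space {1..l} \<Otimes>\<^sub>M (lborel :: real measure)"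
  define S where "S = Sigma {1..l} E"
  \<comment> \<open>The reciprocal of the prefactor in \<open>airy_kernel_local\<close>; conjugation
    with it leaves \<open>local_kernel\<close>.\<close>
  define H where "H = (\<lambda>m y. inverse (complex_of_real (h m (\<theta> (fst y)) (snd y))))"
  define A where "A = (\<lambda>m y y'. H m y' / H m y * (indicator S y * indicator S y' *
      (of_real (\<kappa> / n m) * K m (\<tau> m (\<theta> (fst y)), \<xi> m (\<theta> (fst y)) (snd y)) (\<tau> m (\<theta> (fst y')), \<xi> m (\<theta> (fst y')) (snd y')))))"
  define L where "L = (\<lambda>y y'. indicator S y * indicator S y' * pearcey_kernel (\<theta> (fst y), snd y) (\<theta> (fst y'), snd y'))"
  have gap: "cusp_gap \<alpha> \<beta> x \<sigma> l \<theta> E m = fredholm_det N (A m)" if m: "0 < m" for m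
  proof -
    note nm = n0[OF m]
    define d where "d = (\<lambda>k. (\<sigma>\<^sup>2 - (p - q)) * n m ^ 8 - \<kappa>\<^sup>2 * \<sigma> * \<theta> k * (n m)\<^sup>2)"
    have powers: "real m powr (1 / 3) = n m ^ 4" "real m powr (2 / 3) = n m ^ 8" "real m powr (1 / 6) = (n m)\<^sup>2"
      using npow[OF m, of 4] npow[OF m, of 8] npow[OF m, of 2] by simp_all
    have inv: "real m powr (- 1 / 6) = 1 / (n m)\<^sup>2" "real m powr (- 1 / 12) = 1 / n m"
      using powers(3) powr_minus_divide[of "real m" "1 / 6"] powr_minus_divide[of "real m" "1 / 12"] by (simp_all add: n_def)
    have time: "cusp_time \<alpha> \<beta> x \<sigma> m (\<theta> k) = \<tau> m (\<theta> k)" for k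
      unfolding cusp_time_def TX powers inv \<tau>_def \<kappa>_def[symmetric] by simp
    have set: "cusp_set x \<sigma> m (\<theta> k) (E k) = (\<lambda>v. d k + - (\<kappa> / n m) * v) ` E k" for k
      unfolding cusp_set_def TX powers inv d_def \<kappa>_def[symmetric] by simp
    have \<tau>inj: "inj_on (\<lambda>k. \<tau> m (\<theta> k)) {1..l}"
    proof (rule inj_onI)
      fix j k assume jk: "j \<in> {1..l}" "k \<in> {1..l}" and "\<tau> m (\<theta> j) = \<tau> m (\<theta> k)"
      then have "\<theta> j = \<theta> k" using nm \<kappa>(1) by (simp add: \<tau>_def)
      then show "j = k" by (rule inj_onD[OF inj _ jk])
    qed
    have Km: "airy_wanderers_kernel m (\<alpha> * n m ^ 4) (\<beta> * n m ^ 4) = K m" by (simp add: K_def)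
    have c: "- (\<kappa> / n m) \<noteq> 0" using nm \<kappa>(1) by simp
    have Kmeas: "(\<lambda>z. K m (fst z) (snd z)) \<in> borel_measurable borel"
      unfolding K_def by (rule measurable_airy_wanderers_kernel_pair)
    have \<xi>: "d k + - (\<kappa> / n m) * v = \<xi> m (\<theta> k) v" for k v by (simp add: d_def \<xi>_def)
    have "\<bar>- (\<kappa> / n m)\<bar> = \<kappa> / n m" using nm \<kappa>(1) by simp
    note affine = gap_det_affine[where d = d, OF \<tau>inj c E Kmeas, unfolded \<xi> this]
    have "cusp_gap \<alpha> \<beta> x \<sigma> l \<theta> E m = fredholm_det N (\<lambda>y y'. indicator S y * indicator S y' *
      (of_real (\<kappa> / n m) * K m (\<tau> m (\<theta> (fst y)), \<xi> m (\<theta> (fst y)) (snd y)) (\<tau> m (\<theta> (fst y')), \<xi> m (\<theta> (fst y')) (snd y'))))"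
      unfolding cusp_gap_def airy_wanderers_gap_def powers(1) time set Km N_def S_def \<xi>
      by (rule affine)
    also have "\<dots> = fredholm_det N (A m)"
      unfolding A_def by (rule fredholm_det_conjugate[symmetric]) (simp add: H_def h_def)
    finally show ?thesis .
  qed
  have pearcey: "pearcey_gap l \<theta> E = fredholm_det N L"
  proof -
    from gap_det_affine[where d = "\<lambda>_. 0" and c = 1, OF inj _ E measurable_pearcey_kernel_pair]
    show ?thesis unfolding pearcey_gap_def N_def L_def S_def by simp
  qed
  obtain V0 where V0: "\<And>k v. k \<in> {1..l} \<Longrightarrow> v \<in> E k \<Longrightarrow> \<bar>v\<bar> \<le> V0"
  proof -
    have "bounded (\<Union>k\<in>{1..l}. E k)" using E by (intro bounded_UN) (simp_all add: compact_imp_bounded)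
    then obtain V0 where "\<forall>v\<in>(\<Union>k\<in>{1..l}. E k). norm v \<le> V0" unfolding bounded_iff by blast
    then show thesis using that[of V0] by auto
  qed
  have "(\<lambda>m. fredholm_det N (A m)) \<longlonglongrightarrow> fredholm_det N L"
  proof -
    interpret C: sigma_finite_measure "count_space {1..l}"
      by (intro sigma_finite_measure_count_space_finite) auto
    interpret PN: pair_sigma_finite "count_space {1..l}" "lborel :: real measure" ..
    have sf: "sigma_finite_measure N" unfolding N_def by (rule PN.sigma_finite_measure_axioms)
    have S: "S \<in> sets N"
    proof -
      have "S = (\<Union>k\<in>{1..l}. {k} \<times> E k)" unfolding S_def by auto
      also have "\<dots> \<in> sets N"
        unfolding N_def using E compact_imp_closed by (intro sets.finite_UN pair_measureI) (auto intro!: borel_closed)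
      finally show ?thesis .
    qed
    have Sfin: "emeasure N S < \<infinity>"
    proof -
      have "emeasure N S \<le> emeasure N ({1..l} \<times> {- V0..V0})"
        using V0 by (intro emeasure_mono) (auto simp: S_def N_def abs_le_iff minus_le_iff)
      also have "\<dots> = emeasure (count_space {1..l}) {1..l} * emeasure lborel {- V0..V0}"
        unfolding N_def by (intro lborel.emeasure_pair_measure_Times) auto
      also have "\<dots> < \<infinity>" by (simp add: ennreal_mult_less_top emeasure_count_space emeasure_lborel_Icc_eq of_nat_less_top)
      finally show ?thesis .
    qed
    have [measurable]: "S \<in> sets (count_space {1..l} \<Otimes>\<^sub>M lborel)" using S unfolding N_def .
    have [measurable]: "\<theta> \<in> borel_measurable (count_space {1..l})" by simp
    have meas1: "(\<lambda>z. A m (fst z) (snd z)) \<in> borel_measurable (N \<Otimes>\<^sub>M N)" for m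
    proof -
      have [measurable]: "(\<lambda>z. K m (\<tau> m (\<theta> (fst (fst z))), \<xi> m (\<theta> (fst (fst z))) (snd (fst z)))
          (\<tau> m (\<theta> (fst (snd z))), \<xi> m (\<theta> (fst (snd z))) (snd (snd z)))) \<in> borel_measurable (N \<Otimes>\<^sub>M N)"
        unfolding K_def N_def \<tau>_def \<xi>_def by (rule measurable_airy_wanderers_kernel) measurable
      have [measurable]: "H m \<in> borel_measurable N"
        unfolding H_def h_def N_def \<tau>_def \<xi>_def by measurable
      have [measurable]: "S \<in> sets N" by (rule S)
      show ?thesis unfolding A_def by measurable
    qed
    have meas2: "(\<lambda>z. L (fst z) (snd z)) \<in> borel_measurable (N \<Otimes>\<^sub>M N)"
    proof -
      have [measurable]: "(\<lambda>z. pearcey_kernel (\<theta> (fst (fst z)), snd (fst z)) (\<theta> (fst (snd z)), snd (snd z))) \<in> borel_measurable (N \<Otimes>\<^sub>M N)"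
        unfolding N_def by (rule measurable_pearcey_kernel) measurable
      have [measurable]: "S \<in> sets N" by (rule S)
      show ?thesis unfolding L_def by measurable
    qed
    \<comment> \<open>\<tau> - u n^4 equals - \<sigma> n^4 up to a term of order n^(-2), hence is
      eventually positive because \<sigma> < 0 at the opening cusp. Finitely many times allow one
      threshold for all of them.\<close>
    have large: "\<forall>\<^sub>F m in sequentially. 0 < m \<and> (\<forall>k\<in>{1..l}. u * n m ^ 4 < \<tau> m (\<theta> k))"
    proof -
      have "\<forall>\<^sub>F m in sequentially. u * n m ^ 4 < \<tau> m t" for t
        using n_large[of 1] n_large[of "\<kappa>\<^sup>2 * \<bar>t\<bar> / (- 2 * \<sigma>)"]
      proof eventually_elim
        case (elim m)
        have "n m ^ 1 \<le> n m ^ 6" using elim(1) by (intro power_increasing) auto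
        then have "\<kappa>\<^sup>2 * \<bar>t\<bar> / (- 2 * \<sigma>) < n m ^ 6" using elim(2) by simp
        then have "\<kappa>\<^sup>2 * \<bar>t\<bar> < n m ^ 6 * (- 2 * \<sigma>)"
          by (rule pos_divide_less_eq[THEN iffD1, rotated]) (use \<sigma>0 in simp)
        moreover have "- (\<kappa>\<^sup>2 * t) \<le> \<kappa>\<^sup>2 * \<bar>t\<bar>"
          by (metis abs_ge_minus_self mult_left_mono mult_minus_right zero_le_power2)
        ultimately have lt: "- (\<kappa>\<^sup>2 * t) < n m ^ 6 * (- 2 * \<sigma>)" by (rule le_less_trans[rotated])
        have "n m ^ 6 * (- 2 * \<sigma>) = - \<sigma> * n m ^ 4 * (2 * (n m)\<^sup>2)" by (simp add: eval_nat_numeral)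
        then have num: "0 < - \<sigma> * n m ^ 4 * (2 * (n m)\<^sup>2) + \<kappa>\<^sup>2 * t" using lt by linarith
        have den: "0 < 2 * (n m)\<^sup>2" using elim(1) by simp
        have "0 < (- \<sigma> * n m ^ 4 * (2 * (n m)\<^sup>2) + \<kappa>\<^sup>2 * t) / (2 * (n m)\<^sup>2)"
          by (rule divide_pos_pos[OF num den])
        also have "\<dots> = - \<sigma> * n m ^ 4 + \<kappa>\<^sup>2 * t / (2 * (n m)\<^sup>2)"
        proof -
          have "(A * D + B) / D = A + B / D" if "0 < D" for A B D :: real
            using that by (simp add: add_divide_distrib)
          then show ?thesis using den .
        qed
        finally show ?case unfolding \<tau>_def by (simp add: algebra_simps)
      qed
      then have "\<forall>\<^sub>F m in sequentially. \<forall>k\<in>{1..l}. u * n m ^ 4 < \<tau> m (\<theta> k)"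
        by (intro eventually_ball_finite) auto
      then show ?thesis using eventually_gt_at_top[of 0] by eventually_elim simp
    qed
    have A_local: "A m y y' = local_kernel m p q (\<mu> m) (\<theta> (fst y)) (w m (\<theta> (fst y)) (snd y)) (\<theta> (fst y')) (w m (\<theta> (fst y')) (snd y'))"
      if m: "0 < m \<and> (\<forall>k\<in>{1..l}. u * n m ^ 4 < \<tau> m (\<theta> k))" and y: "y \<in> S" "y' \<in> S" for m y y'
    proof -
      have "fst y' \<in> {1..l}" using y by (auto simp: S_def)
      then have "u * n m ^ 4 < \<tau> m (\<theta> (fst y'))" using m by blast
      moreover have "h m t v \<noteq> 0" for t v by (simp add: h_def)
      ultimately show ?thesis
        unfolding A_def using m y by (simp only: local) (simp add: H_def)
    qed
    \<comment> \<open>The shift of v is a fixed multiple of \<mu> m: it vanishes in the limit and is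
      bounded once \<mu> m < 1.\<close>
    have w_eq: "w m t v = v + \<kappa> ^ 4 * t\<^sup>2 / 4 * \<mu> m" if "0 < m" for m t v
      using n0[OF that] \<kappa>(1) by (simp add: w_def \<mu>_def field_simps eval_nat_numeral)
    have w_lim: "(\<lambda>m. w m t v) \<longlonglongrightarrow> v" for t v
    proof -
      have "(\<lambda>m. v + \<kappa> ^ 4 * t\<^sup>2 / 4 * \<mu> m) \<longlonglongrightarrow> v + \<kappa> ^ 4 * t\<^sup>2 / 4 * 0"
        by (intro tendsto_intros \<mu>lim)
      moreover have "\<forall>\<^sub>F m in sequentially. v + \<kappa> ^ 4 * t\<^sup>2 / 4 * \<mu> m = w m t v"
        using eventually_gt_at_top[of 0] by eventually_elim (simp add: w_eq)
      ultimately show ?thesis using Lim_transform_eventually by fastforce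
    qed
    define V where "V = V0 + \<kappa> ^ 4 * (\<Sum>k\<in>{1..l}. (\<theta> k)\<^sup>2) / 4"
    have w_bd: "\<bar>w m (\<theta> (fst y)) (snd y)\<bar> \<le> V" if "0 < m" "\<mu> m < 1" "y \<in> S" for m y
    proof -
      have k: "fst y \<in> {1..l}" "snd y \<in> E (fst y)" using that(3) by (auto simp: S_def)
      have "(\<theta> (fst y))\<^sup>2 \<le> (\<Sum>k\<in>{1..l}. (\<theta> k)\<^sup>2)" using k(1) by (intro member_le_sum) auto
      then have "\<kappa> ^ 4 * (\<theta> (fst y))\<^sup>2 / 4 * \<mu> m \<le> \<kappa> ^ 4 * (\<Sum>k\<in>{1..l}. (\<theta> k)\<^sup>2) / 4 * 1"
        using that \<mu>0[OF that(1)] \<kappa>(1) by (intro mult_mono divide_right_mono mult_left_mono) (auto intro!: mult_nonneg_nonneg sum_nonneg)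
      moreover have "0 \<le> \<kappa> ^ 4 * (\<theta> (fst y))\<^sup>2 / 4 * \<mu> m" using \<mu>0[OF that(1)] \<kappa>(1) by simp
      ultimately show ?thesis using V0[OF k] unfolding w_eq[OF that(1)] V_def by linarith
    qed
    obtain B where B: "\<forall>\<^sub>F m in sequentially. \<forall>t1\<in>\<theta> ` {1..l}. \<forall>t2\<in>\<theta> ` {1..l}. \<forall>w1 w2. \<bar>w1\<bar> \<le> V \<longrightarrow> \<bar>w2\<bar> \<le> V \<longrightarrow>
        cmod (local_kernel m p q (\<mu> m) t1 w1 t2 w2) \<le> B"
      using local_kernel_bounded[of "\<theta> ` {1..l}" q p \<mu> V] pq \<mu>0 \<mu>4 \<mu>lim by blast
    have "\<forall>\<^sub>F m in sequentially. \<mu> m < 1" using \<mu>lim by (rule order_tendstoD(2)) simp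
    with large B have bd: "\<forall>\<^sub>F m in sequentially. \<forall>y\<in>S. \<forall>y'\<in>S. cmod (A m y y') \<le> B"
    proof eventually_elim
      case (elim m)
      show ?case
      proof (intro ballI)
        fix y y' assume y: "y \<in> S" "y' \<in> S"
        have m: "0 < m" using elim(1) by blast
        have "\<theta> (fst y) \<in> \<theta> ` {1..l}" "\<theta> (fst y') \<in> \<theta> ` {1..l}" using y by (auto simp: S_def)
        then show "cmod (A m y y') \<le> B"
          unfolding A_local[OF elim(1) y] using elim(2) w_bd[OF m elim(3) y(1)] w_bd[OF m elim(3) y(2)] by blast
      qed
    qed
    show ?thesis
    proof (rule fredholm_det_tendsto[OF sf S Sfin meas1 meas2 _ _ bd])
      show "A m y y' = 0" if "y \<notin> S \<or> y' \<notin> S" for m y y' using that by (auto simp: A_def)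
      show "L y y' = 0" if "y \<notin> S \<or> y' \<notin> S" for y y' using that by (auto simp: L_def)
      fix y y' assume y: "y \<in> S" "y' \<in> S"
      have "(\<lambda>m. local_kernel m p q (\<mu> m) (\<theta> (fst y)) (w m (\<theta> (fst y)) (snd y)) (\<theta> (fst y')) (w m (\<theta> (fst y')) (snd y')))
          \<longlonglongrightarrow> pearcey_kernel (\<theta> (fst y), snd y) (\<theta> (fst y'), snd y')"
        by (rule local_kernel_tendsto[OF pq \<mu>0 \<mu>4 \<mu>lim w_lim w_lim])
      moreover have "\<forall>\<^sub>F m in sequentially. local_kernel m p q (\<mu> m) (\<theta> (fst y)) (w m (\<theta> (fst y)) (snd y)) (\<theta> (fst y')) (w m (\<theta> (fst y')) (snd y')) = A m y y'"
        using large by eventually_elim (simp add: A_local y)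
      ultimately have "(\<lambda>m. A m y y') \<longlonglongrightarrow> pearcey_kernel (\<theta> (fst y), snd y) (\<theta> (fst y'), snd y')"
        by (rule Lim_transform_eventually)
      then show "(\<lambda>m. A m y y') \<longlonglongrightarrow> L y y'" using y by (simp add: L_def)
    qed
  qed
  moreover have "\<forall>\<^sub>F m in sequentially. fredholm_det N (A m) = cusp_gap \<alpha> \<beta> x \<sigma> l \<theta> E m"
    using eventually_gt_at_top[of 0] by eventually_elim (simp add: gap)
  ultimately show ?thesis unfolding pearcey by (rule Lim_transform_eventually)
qed

text \<open>Passing from (\<alpha>, \<beta>, \<sigma>) to (-\<beta>, -\<alpha>, -\<sigma>) negates T
  and keeps X and \<kappa>. The sets depend on \<sigma> \<theta>, which is kept when \<theta>
  changes sign too, so they agree while the times are opposite; the kernels are then transposes of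
  each other.\<close>

lemma cusp_gap_reflection:
  assumes \<alpha>\<beta>: "\<alpha> < \<beta>" and m: "0 < m" and \<kappa>: "0 < cusp_\<kappa> x \<sigma>" and inj: "inj_on \<theta> {1..l}"
    and E: "\<And>k. k \<in> {1..l} \<Longrightarrow> compact (E k)"
  shows "cusp_gap \<alpha> \<beta> x \<sigma> l (\<lambda>k. - \<theta> k) E m = cusp_gap (- \<beta>) (- \<alpha>) x (- \<sigma>) l \<theta> E m"
proof -
  define r where "r = real m powr (1 / 3)"
  have r: "0 < r" using m by (simp add: r_def)
  define d where "d = (\<lambda>k. cusp_X x \<sigma> * real m powr (2 / 3) + (cusp_\<kappa> x \<sigma>)\<^sup>2 * \<sigma> * \<theta> k * real m powr (1 / 6))"
  define c where "c = - (cusp_\<kappa> x \<sigma> * real m powr (- 1 / 12))"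
  have c: "c \<noteq> 0" using \<kappa> m by (simp add: c_def)
  have T: "cusp_T (- \<beta>) (- \<alpha>) x (- \<sigma>) = - cusp_T \<alpha> \<beta> x \<sigma>"
  proof -
    have "(- \<beta> + - \<alpha>) / 2 = - ((\<alpha> + \<beta>) / 2)" "2 * - \<sigma> / (2 - x) = - (2 * \<sigma> / (2 - x))"
      by (simp_all add: field_simps)
    then show ?thesis unfolding cusp_T_def by linarith
  qed
  have X: "cusp_X x (- \<sigma>) = cusp_X x \<sigma>" and \<kappa>': "cusp_\<kappa> x (- \<sigma>) = cusp_\<kappa> x \<sigma>"
    by (simp_all add: cusp_X_def cusp_\<kappa>_def)
  define \<tau> where "\<tau> = (\<lambda>k. cusp_time \<alpha> \<beta> x \<sigma> m (- \<theta> k))"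
  have time: "cusp_time (- \<beta>) (- \<alpha>) x (- \<sigma>) m (\<theta> k) = - \<tau> k" for k
    unfolding \<tau>_def cusp_time_def T \<kappa>' by simp
  have set: "cusp_set x \<sigma> m (- \<theta> k) (E k) = (\<lambda>v. d k + c * v) ` E k"
    "cusp_set x (- \<sigma>) m (\<theta> k) (E k) = (\<lambda>v. d k + c * v) ` E k" for k
    unfolding cusp_set_def X \<kappa>' d_def c_def by simp_all
  have \<tau>eq: "\<tau> j = \<tau> k \<Longrightarrow> \<theta> j = \<theta> k" for j k
    using \<kappa> m by (simp add: \<tau>_def cusp_time_def)
  have \<tau>1: "inj_on \<tau> {1..l}"
  proof (rule inj_onI)
    fix j k assume jk: "j \<in> {1..l}" "k \<in> {1..l}" and "\<tau> j = \<tau> k"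
    then show "j = k" by (intro inj_onD[OF inj _ jk] \<tau>eq)
  qed
  then have \<tau>2: "inj_on (\<lambda>k. - \<tau> k) {1..l}" unfolding inj_on_def neg_equal_iff_equal .
  define N where "N = count_space {1..l} \<Otimes>\<^sub>M (lborel :: real measure)"
  define F where "F = (\<lambda>y y'. indicator (Sigma {1..l} E) y * indicator (Sigma {1..l} E) y' *
      (of_real \<bar>c\<bar> * airy_wanderers_kernel m (\<alpha> * r) (\<beta> * r) (\<tau> (fst y), d (fst y) + c * snd y) (\<tau> (fst y'), d (fst y') + c * snd y')))"
  have "cusp_gap (- \<beta>) (- \<alpha>) x (- \<sigma>) l \<theta> E m = fredholm_det N (\<lambda>y y'. indicator (Sigma {1..l} E) y * indicator (Sigma {1..l} E) y' *
      (of_real \<bar>c\<bar> * airy_wanderers_kernel m (- \<beta> * r) (- \<alpha> * r) (- \<tau> (fst y), d (fst y) + c * snd y) (- \<tau> (fst y'), d (fst y') + c * snd y')))"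
    unfolding cusp_gap_def airy_wanderers_gap_def time set r_def[symmetric] N_def
    by (rule gap_det_affine[OF \<tau>2 c E measurable_airy_wanderers_kernel_pair])
  also have "\<dots> = fredholm_det N (\<lambda>y y'. F y' y)"
  proof -
    have "airy_wanderers_kernel m (- \<beta> * r) (- \<alpha> * r) (- t, v) (- t', v') = airy_wanderers_kernel m (\<alpha> * r) (\<beta> * r) (t', v') (t, v)" for t t' v v'
      using airy_wanderers_kernel_reflection[of "\<alpha> * r" "\<beta> * r" m t v t' v'] \<alpha>\<beta> r by simp
    then have "indicator (Sigma {1..l} E) y * indicator (Sigma {1..l} E) y' *
        (of_real \<bar>c\<bar> * airy_wanderers_kernel m (- \<beta> * r) (- \<alpha> * r) (- \<tau> (fst y), d (fst y) + c * snd y) (- \<tau> (fst y'), d (fst y') + c * snd y')) = F y' y" for y y'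
      unfolding F_def by (simp only: mult.commute[of "indicator (Sigma {1..l} E) y'"])
    then show ?thesis by (simp only:)
  qed
  also have "\<dots> = fredholm_det N F" by (rule fredholm_det_transpose)
  also have "\<dots> = cusp_gap \<alpha> \<beta> x \<sigma> l (\<lambda>k. - \<theta> k) E m"
    unfolding cusp_gap_def airy_wanderers_gap_def set r_def[symmetric] N_def F_def \<tau>_def[symmetric]
    by (rule gap_det_affine[OF \<tau>1 c E measurable_airy_wanderers_kernel_pair, symmetric])
  finally show ?thesis ..
qed

lemma closing_cusp_limit:
  assumes cl: "closing_cusp \<alpha> \<beta> (x, \<sigma>)" and \<alpha>\<beta>: "\<alpha> < \<beta>" and inj: "inj_on \<theta> {1..l}"
    and E: "\<And>k. k \<in> {1..l} \<Longrightarrow> compact (E k)"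
  shows "cusp_gap \<alpha> \<beta> x \<sigma> l (\<lambda>k. - \<theta> k) E \<longlonglongrightarrow> pearcey_gap l \<theta> E"
proof -
  \<comment> \<open>The equations involve \<alpha> and \<beta> only through \<beta> - \<alpha>,
    which the reflection keeps.\<close>
  have op: "opening_cusp (- \<beta>) (- \<alpha>) (x, - \<sigma>)"
    using cl by (simp add: opening_cusp_minus closing_cusp_def cusp_solution_def)
  have "0 < cusp_\<kappa> x (- \<sigma>)" by (rule opening_cusp_parameters[OF op])
  then have \<kappa>: "0 < cusp_\<kappa> x \<sigma>" by (simp add: cusp_\<kappa>_def)
  have "cusp_gap (- \<beta>) (- \<alpha>) x (- \<sigma>) l \<theta> E \<longlonglongrightarrow> pearcey_gap l \<theta> E"
    by (rule opening_cusp_limit[OF op inj E])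
  moreover have "\<forall>\<^sub>F m in sequentially. cusp_gap (- \<beta>) (- \<alpha>) x (- \<sigma>) l \<theta> E m = cusp_gap \<alpha> \<beta> x \<sigma> l (\<lambda>k. - \<theta> k) E m"
    using eventually_gt_at_top[of 0] by eventually_elim (rule cusp_gap_reflection[OF \<alpha>\<beta> _ \<kappa> inj E, symmetric])
  ultimately show ?thesis by (rule Lim_transform_eventually)
qed

theorem theorem1p5:
  fixes \<alpha> \<beta> :: real
  assumes "\<alpha> < \<beta>"
  shows "(\<exists>!c. opening_cusp \<alpha> \<beta> c) \<and> (\<exists>!c. closing_cusp \<alpha> \<beta> c) \<and>
    (\<forall>x \<sigma>p x' \<sigma>m. opening_cusp \<alpha> \<beta> (x, \<sigma>p) \<and> closing_cusp \<alpha> \<beta> (x', \<sigma>m) \<longrightarrow>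
       x = x' \<and> \<sigma>p = - \<sigma>m \<and>
       cusp_T \<alpha> \<beta> x \<sigma>m < (\<alpha> + \<beta>) / 2 \<and> (\<alpha> + \<beta>) / 2 < cusp_T \<alpha> \<beta> x \<sigma>p \<and>
       (\<forall>(l::nat) (\<theta> :: nat \<Rightarrow> real) (E :: nat \<Rightarrow> real set).
          1 \<le> l \<and> inj_on \<theta> {1..l} \<and> (\<forall>k\<in>{1..l}. compact (E k)) \<longrightarrow>
          cusp_gap \<alpha> \<beta> x \<sigma>p l \<theta> E \<longlonglongrightarrow> pearcey_gap l \<theta> E \<and>
          cusp_gap \<alpha> \<beta> x \<sigma>m l (\<lambda>k. - \<theta> k) E \<longlonglongrightarrow> pearcey_gap l \<theta> E))"
proof (intro conjI opening_cusp_unique_existence closing_cusp_unique_existence assms allI impI; (elim conjE)?)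
  fix x \<sigma>p x' \<sigma>m
  assume op: "opening_cusp \<alpha> \<beta> (x, \<sigma>p)" and cl: "closing_cusp \<alpha> \<beta> (x', \<sigma>m)"
  have "closing_cusp \<alpha> \<beta> (x, - \<sigma>p)" using op by (simp add: opening_cusp_minus)
  then have "(x, - \<sigma>p) = (x', \<sigma>m)" using cl closing_cusp_unique_existence[OF assms] by blast
  then show xx: "x = x'" and "\<sigma>p = - \<sigma>m" by auto
  have "x < 2" "\<sigma>p < 0" "0 < \<sigma>m" using op cl by (auto simp: opening_cusp_def closing_cusp_def)
  then have "0 < 2 * \<sigma>m / (2 - x)" "2 * \<sigma>p / (2 - x) < 0"
    by (simp_all add: divide_pos_pos divide_neg_pos)
  moreover have "c - t < c" if "0 < t" for c t :: real using that by simp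
  moreover have "c < c - t" if "t < 0" for c t :: real using that by simp
  ultimately show "cusp_T \<alpha> \<beta> x \<sigma>m < (\<alpha> + \<beta>) / 2" "(\<alpha> + \<beta>) / 2 < cusp_T \<alpha> \<beta> x \<sigma>p"
    unfolding cusp_T_def by blast+
  fix l and \<theta> :: "nat \<Rightarrow> real" and E :: "nat \<Rightarrow> real set"
  assume lE: "inj_on \<theta> {1..l}" "\<forall>k\<in>{1..l}. compact (E k)"
  show "cusp_gap \<alpha> \<beta> x \<sigma>p l \<theta> E \<longlonglongrightarrow> pearcey_gap l \<theta> E"
    using lE by (intro opening_cusp_limit[OF op]) auto
  show "cusp_gap \<alpha> \<beta> x \<sigma>m l (\<lambda>k. - \<theta> k) E \<longlonglongrightarrow> pearcey_gap l \<theta> E"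
    using lE cl unfolding xx by (intro closing_cusp_limit assms) auto
qed

end
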